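(* Let $X$ be a compact Kähler manifold, let $D=\sum_{i=1}^r D_i$ be a smooth divisor in $X$ (each $D_i$ is a smooth hypersurface and $D_i\cap D_j=\emptyset$ for $i\neq j$), and let $L$ be a holomorphic line bundle over $X$ with $L^N=\mathcal{O}_X(D)$ for some integer $N\ge1$. Let $d=\partial+\bar\partial$ be the integrable logarithmic connection along $D$ on $L^{-1}$ induced by $L^N=\mathcal{O}_X(D)$, extended to $L^{-1}$-valued logarithmic forms. If $\alpha\in A^{0,0}(X,\Omega^p_X(\log D)\otimes L^{-1})$ satisfies $\bar\partial\partial\alpha=0$, then $\partial\alpha=0$.
   Context: $\Omega^p_X(\log D)$ is the locally free sheaf of holomorphic $p$-forms with logarithmic poles along $D$; in local coordinates in which $D=\{z^1=0\}$ it is generated over $\Omega_X^\bullet$ by $dz^1/z^1$, and $\Omega_X^p(\log D)=\wedge^p\Omega_X^1(\log D)$. $A^{0,q}(X,\mathcal{F})$ denotes the space of smooth $(0,q)$-forms on $X$ with values in the holomorphic vector bundle (locally free sheaf) $\mathcal{F}$; in particular $A^{0,0}(X,\mathcal F)$ is the space of smooth sections. The connection on $L^{-1}$: let $\sigma$ be the canonical meromorphic section of $\mathcal{O}_X(-D)=(L^{-1})^N$ (divisor $-D$). Locally choose a holomorphic frame $e^*$ of $L^{-1}$ with $(e^* )^N=z^1\sigma$, where $z^1$ is a local defining function of $D$ ($z^1$ replaced by $1$ away from $D$). Put $\partial e^*=\frac1N\,\frac{dz^1}{z^1}\otimes e^*$ (which is $0$ away from $D$) and $\bar\partial e^*=0$.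 This is well defined. On forms set $\partial(\omega\otimes e^* )=\partial\omega\otimes e^*+(-1)^{\deg\omega}\omega\wedge\partial e^*$ and $\bar\partial(\omega\otimes e^* )=\bar\partial\omega\otimes e^*$, which gives $\partial:A^{0,q}(X,\Omega^p_X(\log D)\otimes L^{-1})\to A^{0,q}(X,\Omega^{p+1}_X(\log D)\otimes L^{-1})$ and $\bar\partial:A^{0,q}(X,\Omega^p_X(\log D)\otimes L^{-1})\to A^{0,q+1}(X,\Omega^{p}_X(\log D)\otimes L^{-1})$, with $d=\partial+\bar\partial$ and $d^2=0$. *)

theory Defs
  imports "HOL-Analysis.Analysis"
begin

section \<open>Smooth and holomorphic functions of several variables\<close>

primrec Ck_on ::
  "nat \<Rightarrow> ('v::real_normed_vector \<Rightarrow> 'w::real_normed_vector) \<Rightarrow> 'v set \<Rightarrow> bool" where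
  "Ck_on 0 f S \<longleftrightarrow> continuous_on S f"
| "Ck_on (Suc k) f S \<longleftrightarrow>
     (\<forall>x\<in>S. f differentiable (at x)) \<and> (\<forall>v. Ck_on k (\<lambda>x. frechet_derivative f (at x) v) S)"

text \<open>Only used for open sets.\<close>

definition smooth_on ::
  "('v::real_normed_vector \<Rightarrow> 'w::real_normed_vector) \<Rightarrow> 'v set \<Rightarrow> bool" where
  "smooth_on f S \<longleftrightarrow> (\<forall>k. Ck_on k f S)"

definition holo_on :: "(complex ^ 'n \<Rightarrow> complex) \<Rightarrow> (complex ^ 'n) set \<Rightarrow> bool" where
  "holo_on f S \<longleftrightarrow>
     (\<forall>z\<in>S. \<exists>f'. (f has_derivative f') (at z) \<and> (\<forall>c v. f' (c *s v) = c * f' v))"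


section \<open>Complex manifolds\<close>

text \<open>A chart is a pair \<open>(U, \<phi>)\<close>; the values of \<open>\<phi>\<close> outside \<open>U\<close> are irrelevant. The index of
  a coordinate is an element of the finite type \<open>'n\<close>, whose cardinality is the complex dimension.\<close>

type_synonym ('a, 'n) chart = "'a set \<times> ('a \<Rightarrow> complex ^ 'n)"

definition is_chart :: "'a topology \<Rightarrow> ('a, 'n::finite) chart \<Rightarrow> bool" where
  "is_chart X = (\<lambda>(U, \<phi>). openin X U \<and> open (\<phi> ` U) \<and>
     homeomorphic_map (subtopology X U) (top_of_set (\<phi> ` U)) \<phi>)"

definition transition ::
  "('a, 'n::finite) chart \<Rightarrow> ('a, 'n) chart \<Rightarrow> complex ^ 'n \<Rightarrow> complex ^ 'n" where
  "transition = (\<lambda>(U, \<phi>) (V, \<psi>). \<psi> \<circ> inv_into U \<phi>)"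

definition compatible :: "('a, 'n::finite) chart \<Rightarrow> ('a, 'n) chart \<Rightarrow> bool" where
  "compatible c c' \<longleftrightarrow>
     (\<forall>k. holo_on (\<lambda>z. transition c c' z $ k) (snd c ` (fst c \<inter> fst c'))) \<and>
     (\<forall>k. holo_on (\<lambda>z. transition c' c z $ k) (snd c' ` (fst c \<inter> fst c')))"

text \<open>\<open>A\<close> is a maximal holomorphic atlas on the Hausdorff space \<open>X\<close>. (Second countability is
  automatic for the compact spaces considered below.)\<close>

definition complex_manifold :: "'a topology \<Rightarrow> ('a, 'n::finite) chart set \<Rightarrow> bool" where
  "complex_manifold X A \<longleftrightarrow>
     Hausdorff_space X \<and>
     (\<forall>c\<in>A. is_chart X c) \<and>
     topspace X = (\<Union>c\<in>A. fst c) \<and>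
     (\<forall>c\<in>A. \<forall>c'\<in>A. compatible c c') \<and>
     (\<forall>c. is_chart X c \<and> (\<forall>c'\<in>A. compatible c c') \<longrightarrow> c \<in> A)"

definition in_chart :: "('a, 'n::finite) chart \<Rightarrow> ('a \<Rightarrow> 'b) \<Rightarrow> complex ^ 'n \<Rightarrow> 'b" where
  "in_chart = (\<lambda>(U, \<phi>) f. f \<circ> inv_into U \<phi>)"

definition holo_fun_on ::
  "('a, 'n::finite) chart set \<Rightarrow> 'a set \<Rightarrow> ('a \<Rightarrow> complex) \<Rightarrow> bool" where
  "holo_fun_on A W f \<longleftrightarrow> (\<forall>c\<in>A. holo_on (in_chart c f) (snd c ` (fst c \<inter> W)))"


section \<open>Holomorphic line bundles\<close>

text \<open>A line bundle is given by an open cover \<open>cover i\<close>, \<open>i \<in> idx\<close>, with a frame on each \<open>cover i\<close>, and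
  by its transition functions: a section with component \<open>s i\<close> in the \<open>i\<close>-th frame satisfies
  \<open>s i = cocycle i j * s j\<close> on \<open>cover i \<inter> cover j\<close>.\<close>

record ('a, 'i) line_bundle =
  idx :: "'i set"
  cover :: "'i \<Rightarrow> 'a set"
  cocycle :: "'i \<Rightarrow> 'i \<Rightarrow> 'a \<Rightarrow> complex"

definition holomorphic_line_bundle ::
  "'a topology \<Rightarrow> ('a, 'n::finite) chart set \<Rightarrow> ('a, 'i) line_bundle \<Rightarrow> bool" where
  "holomorphic_line_bundle X A L \<longleftrightarrow>
     (\<forall>i\<in>idx L. openin X (cover L i)) \<and>
     topspace X = (\<Union>i\<in>idx L. cover L i) \<and>
     (\<forall>i\<in>idx L. \<forall>j\<in>idx L. holo_fun_on A (cover L i \<inter> cover L j) (cocycle L i j) \<and>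
        (\<forall>x\<in>cover L i \<inter> cover L j. cocycle L i j x \<noteq> 0)) \<and>
     (\<forall>i\<in>idx L. \<forall>x\<in>cover L i. cocycle L i i x = 1) \<and>
     (\<forall>i\<in>idx L. \<forall>j\<in>idx L. \<forall>k\<in>idx L. \<forall>x\<in>cover L i \<inter> cover L j \<inter> cover L k.
        cocycle L i j x * cocycle L j k x = cocycle L i k x)"

definition trivial_bundle :: "'a topology \<Rightarrow> ('a, unit) line_bundle" where
  "trivial_bundle X = \<lparr>idx = UNIV, cover = (\<lambda>_. topspace X), cocycle = (\<lambda>_ _ _. 1)\<rparr>"

definition dual_bundle :: "('a, 'i) line_bundle \<Rightarrow> ('a, 'i) line_bundle" where
  "dual_bundle L = L\<lparr>cocycle := \<lambda>i j x. inverse (cocycle L i j x)\<rparr>"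

definition tensor_power :: "('a, 'i) line_bundle \<Rightarrow> nat \<Rightarrow> ('a, 'i) line_bundle" where
  "tensor_power L N = L\<lparr>cocycle := \<lambda>i j x. cocycle L i j x ^ N\<rparr>"

text \<open>The component of the image of the \<open>i\<close>-th frame of \<open>L\<close> in the \<open>j\<close>-th frame of \<open>M\<close> is \<open>\<iota> j i\<close>.\<close>

definition line_bundle_iso ::
  "('a, 'n::finite) chart set \<Rightarrow> ('a, 'i) line_bundle \<Rightarrow> ('a, 'j) line_bundle \<Rightarrow>
   ('j \<Rightarrow> 'i \<Rightarrow> 'a \<Rightarrow> complex) \<Rightarrow> bool" where
  "line_bundle_iso A L M \<iota> \<longleftrightarrow>
     (\<forall>i\<in>idx L. \<forall>j\<in>idx M. holo_fun_on A (cover L i \<inter> cover M j) (\<iota> j i) \<and>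
        (\<forall>x\<in>cover L i \<inter> cover M j. \<iota> j i x \<noteq> 0)) \<and>
     (\<forall>i\<in>idx L. \<forall>i'\<in>idx L. \<forall>j\<in>idx M. \<forall>j'\<in>idx M.
        \<forall>x\<in>cover L i \<inter> cover L i' \<inter> cover M j \<inter> cover M j'.
          \<iota> j i x * cocycle L i i' x = cocycle M j j' x * \<iota> j' i' x)"


section \<open>Smooth divisors\<close>

definition smooth_hypersurface ::
  "'a topology \<Rightarrow> ('a, 'n::finite) chart set \<Rightarrow> 'a set \<Rightarrow> bool" where
  "smooth_hypersurface X A Z \<longleftrightarrow> closedin X Z \<and>
     (\<forall>x\<in>Z. \<exists>(U, \<phi>)\<in>A. \<exists>k. x \<in> U \<and> Z \<inter> U = {y\<in>U. \<phi> y $ k = 0})"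

text \<open>For a smooth (reduced) divisor with support \<open>D\<close>: \<open>f\<close> is holomorphic on \<open>U\<close> with divisor
  \<open>D \<inter> U\<close>; the nonvanishing of \<open>df\<close> along \<open>D\<close> says that the multiplicity is one.\<close>

definition defining_function ::
  "'a topology \<Rightarrow> ('a, 'n::finite) chart set \<Rightarrow> 'a set \<Rightarrow> 'a set \<Rightarrow> ('a \<Rightarrow> complex) \<Rightarrow> bool" where
  "defining_function X A D U f \<longleftrightarrow>
     openin X U \<and> holo_fun_on A U f \<and> D \<inter> U = {x\<in>U. f x = 0} \<and>
     (\<forall>c\<in>A. \<forall>x\<in>D \<inter> U \<inter> fst c. \<exists>v. frechet_derivative (in_chart c f) (at (snd c x)) v \<noteq> 0)"

text \<open>\<open>O\<^sub>X(D)\<close>: the frame belonging to a local defining function \<open>f\<close> is the meromorphic function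
  \<open>1/f\<close>, so that the transition functions are the holomorphic extensions of \<open>f/h\<close> across \<open>D\<close>. The
  canonical section (the function 1, with divisor \<open>D\<close>) has component \<open>f\<close> in this frame.\<close>

definition divisor_bundle ::
  "'a topology \<Rightarrow> ('a, 'n::finite) chart set \<Rightarrow> 'a set \<Rightarrow>
   ('a, 'a set \<times> ('a \<Rightarrow> complex)) line_bundle" where
  "divisor_bundle X A D =
     \<lparr>idx = {(U, f). defining_function X A D U f},
      cover = fst,
      cocycle = (\<lambda>(U, f) (V, h) x. if x \<notin> D then f x / h x
                 else Lim (atin_within X x (- D)) (\<lambda>y. f y / h y))\<rparr>"


section \<open>Differential forms with logarithmic poles and values in a line bundle\<close>

text \<open>A \<open>(p,q)\<close>-form is evaluated on a list of \<open>p\<close> vectors (complex linear in each of them) and a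
  list of \<open>q\<close> vectors (conjugate linear in each of them): a (0,1)-vector is represented by its
  complex conjugate. Vectors are given by their components in a chart.\<close>

type_synonym ('a, 'n) local_form = "'a \<Rightarrow> (complex ^ 'n) list \<Rightarrow> (complex ^ 'n) list \<Rightarrow> complex"

text \<open>A form with values in a line bundle is a family of local forms, one for each chart and
  each frame of the line bundle.\<close>

type_synonym ('a, 'n, 'i) form = "('a, 'n) chart \<Rightarrow> 'i \<Rightarrow> ('a, 'n) local_form"

definition wedge_covectors :: "('v \<Rightarrow> complex) list \<Rightarrow> 'v list \<Rightarrow> complex" where
  "wedge_covectors \<eta>s vs =
     (\<Sum>\<sigma> | \<sigma> permutes {..<length \<eta>s}.
        of_int (sign \<sigma>) * (\<Prod>a<length \<eta>s. (\<eta>s ! a) (vs ! \<sigma> a)))"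

text \<open>Coordinates adapted to \<open>D\<close>: either \<open>D\<close> does not meet the chart, or it is the zero set of one
  coordinate.\<close>

definition adapted :: "'a set \<Rightarrow> ('a, 'n::finite) chart \<Rightarrow> 'n option \<Rightarrow> bool" where
  "adapted D = (\<lambda>(U, \<phi>) K. case K of
       None \<Rightarrow> D \<inter> U = {}
     | Some k \<Rightarrow> D \<inter> U = {x\<in>U. \<phi> x $ k = 0})"

text \<open>The local frame of \<open>\<Omega>\<^sup>1(log D)\<close> at the point with coordinates \<open>z\<close>: \<open>dz\<^sup>k/z\<^sup>k\<close> for \<open>K = Some k\<close>,
  and \<open>dz\<^sup>j\<close> for the other coordinates.\<close>

definition log_coframe :: "'n option \<Rightarrow> complex ^ 'n \<Rightarrow> 'n \<Rightarrow> complex ^ 'n \<Rightarrow> complex" where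
  "log_coframe K z j v = (if K = Some j then v $ j / z $ j else v $ j)"

definition conj_coframe :: "'n \<Rightarrow> complex ^ 'n \<Rightarrow> complex" where
  "conj_coframe j w = cnj (w $ j)"

text \<open>\<open>A\<^sup>0\<^sup>,\<^sup>q(X, \<Omega>\<^sup>p(log D) \<otimes> E)\<close>. A section is described by its restriction to the dense open set
  \<open>X - D\<close>, which determines it (values of \<open>\<alpha>\<close> on \<open>D\<close>, where the frame \<open>log_coframe\<close> does not make
  sense pointwise, are irrelevant). Being a smooth section on all of \<open>X\<close> means that the coefficients
  in the local frames of \<open>\<Omega>\<^sup>p(log D)\<close> extend smoothly across \<open>D\<close>. The first clause is the
  transformation law under a change of chart and of frame of \<open>E\<close>.\<close>

definition log_form ::
  "('a, 'n::finite) chart set \<Rightarrow> 'a set \<Rightarrow> ('a, 'i) line_bundle \<Rightarrow> nat \<Rightarrow> nat \<Rightarrow>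
   ('a, 'n, 'i) form \<Rightarrow> bool" where
  "log_form A D E p q \<alpha> \<longleftrightarrow>
     (\<forall>c\<in>A. \<forall>c'\<in>A. \<forall>i\<in>idx E. \<forall>j\<in>idx E.
        \<forall>x\<in>(fst c \<inter> fst c' \<inter> cover E i \<inter> cover E j) - D.
        \<forall>vs ws. length vs = p \<and> length ws = q \<longrightarrow>
          (let T = frechet_derivative (transition c c') (at (snd c x)) in
           \<alpha> c i x vs ws = cocycle E i j x * \<alpha> c' j x (map T vs) (map T ws))) \<and>
     (\<forall>c\<in>A. \<forall>K. adapted D c K \<longrightarrow> (\<forall>i\<in>idx E.
        \<exists>f. (\<forall>I J. smooth_on (f I J) (snd c ` (fst c \<inter> cover E i))) \<and>
          (\<forall>x\<in>(fst c \<inter> cover E i) - D. \<forall>vs ws. length vs = p \<and> length ws = q \<longrightarrow>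
             \<alpha> c i x vs ws =
               (\<Sum>I | length I = p. \<Sum>J | length J = q.
                  f I J (snd c x) *
                  wedge_covectors (map (log_coframe K (snd c x)) I) vs *
                  wedge_covectors (map conj_coframe J) ws))))"

definition form_zero ::
  "('a, 'n::finite) chart set \<Rightarrow> 'a set \<Rightarrow> ('a, 'i) line_bundle \<Rightarrow> nat \<Rightarrow> nat \<Rightarrow>
   ('a, 'n, 'i) form \<Rightarrow> bool" where
  "form_zero A D E p q \<alpha> \<longleftrightarrow>
     (\<forall>c\<in>A. \<forall>i\<in>idx E. \<forall>x\<in>(fst c \<inter> cover E i) - D.
        \<forall>vs ws. length vs = p \<and> length ws = q \<longrightarrow> \<alpha> c i x vs ws = 0)"

text \<open>The derivatives of a function along the (1,0)-vector with components \<open>v\<close> and along the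
  (0,1)-vector conjugate to it: the complex linear and the conjugate linear part of the real
  differential.\<close>

definition dir_del :: "('a, 'n::finite) chart \<Rightarrow> ('a \<Rightarrow> complex) \<Rightarrow> 'a \<Rightarrow> complex ^ 'n \<Rightarrow> complex" where
  "dir_del c f x v =
     (let Df = frechet_derivative (in_chart c f) (at (snd c x)) in (Df v - \<i> * Df (\<i> *s v)) / 2)"

definition dir_delbar :: "('a, 'n::finite) chart \<Rightarrow> ('a \<Rightarrow> complex) \<Rightarrow> 'a \<Rightarrow> complex ^ 'n \<Rightarrow> complex" where
  "dir_delbar c f x v =
     (let Df = frechet_derivative (in_chart c f) (at (snd c x)) in (Df v + \<i> * Df (\<i> *s v)) / 2)"

definition remove_nth :: "nat \<Rightarrow> 'b list \<Rightarrow> 'b list" where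
  "remove_nth a vs = take a vs @ drop (Suc a) vs"

text \<open>The operators \<open>\<partial>\<close> and \<open>\<partial>\<close>-bar on scalar forms. In the latter the sign \<open>(-1)\<^sup>p\<close> comes from
  moving \<open>dz\<close>-bar past the \<open>p\<close> holomorphic factors.\<close>

definition del_form :: "('a, 'n::finite) chart \<Rightarrow> ('a, 'n) local_form \<Rightarrow> ('a, 'n) local_form" where
  "del_form c \<omega> x vs ws =
     (\<Sum>a<length vs. (- 1) ^ a * dir_del c (\<lambda>y. \<omega> y (remove_nth a vs) ws) x (vs ! a))"

definition delbar_form :: "('a, 'n::finite) chart \<Rightarrow> ('a, 'n) local_form \<Rightarrow> ('a, 'n) local_form" where
  "delbar_form c \<omega> x vs ws =
     (- 1) ^ length vs *
     (\<Sum>b<length ws. (- 1) ^ b * dir_delbar c (\<lambda>y. \<omega> y vs (remove_nth b ws)) x (ws ! b))"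

text \<open>\<open>\<omega> \<and> \<eta>\<close> for a \<open>(p,q)\<close>-form \<open>\<omega>\<close> and a (1,0)-form \<open>\<eta>\<close>, evaluated on \<open>p + 1\<close> and \<open>q\<close> vectors: \<open>\<eta>\<close>
  has to be moved past the \<open>q\<close> antiholomorphic factors and past \<open>p - a\<close> holomorphic ones.\<close>

definition wedge_10 ::
  "('a, 'n) local_form \<Rightarrow> ('a \<Rightarrow> complex ^ 'n \<Rightarrow> complex) \<Rightarrow> ('a, 'n) local_form" where
  "wedge_10 \<omega> \<eta> x vs ws =
     (\<Sum>a<length vs. (- 1) ^ (length ws + (length vs - Suc a)) *
        \<omega> x (remove_nth a vs) ws * \<eta> x (vs ! a))"


section \<open>The logarithmic connection on the dual of a root of the divisor bundle\<close>

text \<open>Let \<open>\<iota>\<close> be an isomorphism from \<open>L\<^sup>N\<close> to \<open>O\<^sub>X(D)\<close>, \<open>e\<^sup>*\<close> the \<open>i\<close>-th frame of the dual of \<open>L\<close>, and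
  \<open>\<sigma>\<close> the canonical meromorphic section of \<open>O\<^sub>X(-D)\<close>, which has component \<open>1/f\<close> in the frame
  belonging to \<open>(V, f)\<close>. The dual of \<open>\<iota>\<close> identifies \<open>(e\<^sup>*)\<^sup>N\<close> with the local section of \<open>O\<^sub>X(-D)\<close>
  with component \<open>1/\<iota> (V, f) i\<close>, so \<open>(e\<^sup>*)\<^sup>N = z \<sigma>\<close> with \<open>z = f/\<iota> (V, f) i\<close>, a local defining
  function of \<open>D\<close> that does not depend on the choice of \<open>(V, f)\<close>.\<close>

definition frame_equation ::
  "'a topology \<Rightarrow> ('a, 'n::finite) chart set \<Rightarrow> 'a set \<Rightarrow>
   ('a set \<times> ('a \<Rightarrow> complex) \<Rightarrow> 'i \<Rightarrow> 'a \<Rightarrow> complex) \<Rightarrow> 'i \<Rightarrow> 'a \<Rightarrow> complex" where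
  "frame_equation X A D \<iota> i x =
     (let j = (SOME j. j \<in> idx (divisor_bundle X A D) \<and> x \<in> cover (divisor_bundle X A D) j)
      in snd j x / \<iota> j i x)"

text \<open>\<open>\<partial>e\<^sup>* = (1/N) (dz/z) \<otimes> e\<^sup>*\<close> with \<open>z\<close> as above\<close>

definition connection_form ::
  "'a topology \<Rightarrow> ('a, 'n::finite) chart set \<Rightarrow> 'a set \<Rightarrow> nat \<Rightarrow>
   ('a set \<times> ('a \<Rightarrow> complex) \<Rightarrow> 'i \<Rightarrow> 'a \<Rightarrow> complex) \<Rightarrow>
   ('a, 'n) chart \<Rightarrow> 'i \<Rightarrow> 'a \<Rightarrow> complex ^ 'n \<Rightarrow> complex" where
  "connection_form X A D N \<iota> c i x v =
     1 / of_nat N * (dir_del c (frame_equation X A D \<iota> i) x v / frame_equation X A D \<iota> i x)"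

text \<open>\<open>\<partial>(\<omega> \<otimes> e\<^sup>*) = \<partial>\<omega> \<otimes> e\<^sup>* + (-1)\<^bsup>deg \<omega>\<^esup> \<omega> \<and> \<partial>e\<^sup>*\<close>; here \<open>deg \<omega>\<close> is one less than the number of
  arguments.\<close>

definition del_conn ::
  "'a topology \<Rightarrow> ('a, 'n::finite) chart set \<Rightarrow> 'a set \<Rightarrow> nat \<Rightarrow>
   ('a set \<times> ('a \<Rightarrow> complex) \<Rightarrow> 'i \<Rightarrow> 'a \<Rightarrow> complex) \<Rightarrow>
   ('a, 'n, 'i) form \<Rightarrow> ('a, 'n, 'i) form" where
  "del_conn X A D N \<iota> \<alpha> c i x vs ws =
     del_form c (\<alpha> c i) x vs ws +
     (- 1) ^ (length vs - 1 + length ws) *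
       wedge_10 (\<alpha> c i) (connection_form X A D N \<iota> c i) x vs ws"

definition delbar_conn :: "('a, 'n::finite, 'i) form \<Rightarrow> ('a, 'n, 'i) form" where
  "delbar_conn \<alpha> c i = delbar_form c (\<alpha> c i)"


section \<open>Kaehler manifolds\<close>

text \<open>A Kaehler form is a closed real positive (1,1)-form \<open>\<omega>\<close>, given in a chart by \<open>\<i>\<close> times a
  positive definite Hermitian form \<open>h(v, w)\<close>. (That \<open>h(v, v)\<close> is real for all \<open>v\<close> forces \<open>h\<close> to be
  Hermitian, i.e. \<open>\<omega>\<close> to be real.)\<close>

definition kaehler_form ::
  "'a topology \<Rightarrow> ('a, 'n::finite) chart set \<Rightarrow> ('a, 'n, unit) form \<Rightarrow> bool" where
  "kaehler_form X A \<omega> \<longleftrightarrow>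
     log_form A {} (trivial_bundle X) 1 1 \<omega> \<and>
     (\<forall>c\<in>A. \<forall>x\<in>fst c. \<forall>v. v \<noteq> 0 \<longrightarrow>
        - \<i> * \<omega> c () x [v] [v] \<in> \<real> \<and> 0 < Re (- \<i> * \<omega> c () x [v] [v])) \<and>
     form_zero A {} (trivial_bundle X) 2 1 (\<lambda>c i. del_form c (\<omega> c i)) \<and>
     form_zero A {} (trivial_bundle X) 1 2 (\<lambda>c i. delbar_form c (\<omega> c i))"

definition compact_kaehler_manifold :: "'a topology \<Rightarrow> ('a, 'n::finite) chart set \<Rightarrow> bool" where
  "compact_kaehler_manifold X A \<longleftrightarrow>
     complex_manifold X A \<and> compact_space X \<and> (\<exists>\<omega>. kaehler_form X A \<omega>)"

end

theory Submission
  imports Defs "HOL-Complex_Analysis.Cauchy_Integral_Formula"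
begin

text \<open>On \<open>X - D\<close> the logarithmic connection is the Chern connection of the flat singular metric on
  \<open>L\<^sup>-\<^sup>1\<close> with \<open>|e\<^sup>*|\<^sup>2 = |z|\<^bsup>2/N\<^esup>\<close>, where \<open>z\<close> is the local equation of \<open>D\<close> with \<open>(e\<^sup>*)\<^sup>N = z \<sigma>\<close>. Since the
  metric of \<open>X\<close> is Kaehler and \<open>\<partial>\<alpha>\<close> is holomorphic, contracting \<open>\<alpha>\<close> with \<open>\<partial>\<alpha>\<close> gives a vector field whose
  divergence is \<open>|\<partial>\<alpha>|\<^sup>2\<close> up to a positive factor. Multiplying by the square of a cutoff function \<open>\<psi>\<close> that vanishes
  near \<open>D\<close> and integrating by parts yields \<open>\<integral> \<psi>\<^sup>2 |\<partial>\<alpha>|\<^sup>2 \<le> 4 \<integral> |\<partial>\<psi> \<and> \<alpha>|\<^sup>2\<close>. Near \<open>D = {z\<^sup>k = 0}\<close> the cutoff depends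
  essentially on \<open>|z\<^sup>k|/\<epsilon>\<close> only, so \<open>\<partial>\<psi>\<close> is, up to a bounded form, a bounded multiple of \<open>dz\<^sup>k/z\<^sup>k\<close> and does not
  increase the order of the simple pole of \<open>\<alpha>\<close>. Hence \<open>|\<partial>\<psi> \<and> \<alpha>|\<^sup>2 = O(|z\<^sup>k|\<^bsup>2/N-2\<^esup>)\<close> on the tube
  \<open>|z\<^sup>k| \<le> \<epsilon>\<close>, and the right-hand side is \<open>O(\<epsilon>\<^bsup>2/N\<^esup>)\<close>.\<close>

section \<open>Multilinear functions on lists of vectors\<close>

text \<open>Forms are functions on lists of vectors, and the inner product \<open>ip\<close> sums
  over all index tuples, so no basis of the exterior powers and no Hodge star occurs. The price is
  the factor \<open>Suc p\<close>: alternating a tensor is the sum \<open>skew\<close> over p + 1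
  positions. The divergence of the contracted field contains derivatives of the metric. Those of the
  volume density and of the outer inverse matrix cancel each other because d\<omega> = 0; those of
  the inner inverse matrices are symmetric, again by d\<omega> = 0, and meet an alternating form.
  The antiholomorphic derivative of \<open>bb\<close> would be the last obstruction, and this is the
  only place where the equation assumed for \<alpha> enters. Integrals over X are sums of chart
  integrals weighted by a partition of unity; the errors from differentiating its members cancel
  because these sum to 1. Only first derivatives of cutoffs are taken, so C^1 functions made from
  squares of positive parts suffice. The bound O(\<epsilon>^(2/N)) forces zero for each fixed
  cutoff, since the weighted energy can only grow as \<epsilon> decreases.\<close>

abbreviation cbasis :: "'n \<Rightarrow> complex ^ 'n" where "cbasis j \<equiv> axis j 1"

text \<open>Linearity is stated in the head only, with the earlier arguments frozen; the recursion
  carries it to every slot. Lists of a length other than m are unconstrained, so forms of all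
  degrees share one type.\<close>

primrec mlin :: "nat \<Rightarrow> ((complex ^ 'n) list \<Rightarrow> complex) \<Rightarrow> bool" where
  "mlin 0 s \<longleftrightarrow> True"
| "mlin (Suc m) s \<longleftrightarrow> (\<forall>v. mlin m (\<lambda>vs. s (v # vs))) \<and>
     (\<forall>vs c v w. length vs = m \<longrightarrow> s ((c *s v + w) # vs) = c * s (v # vs) + s (w # vs))"

text \<open>Only adjacent entries are swapped, at every depth of the list; such transpositions
  generate all permutations. Vanishing on repeated arguments follows, see
  \<open>alt_repeated\<close>.\<close>

primrec alt :: "nat \<Rightarrow> ('v list \<Rightarrow> complex) \<Rightarrow> bool" where
  "alt 0 s \<longleftrightarrow> True"
| "alt (Suc m) s \<longleftrightarrow> (\<forall>v. alt m (\<lambda>vs. s (v # vs))) \<and>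
     (\<forall>v w vs. Suc (length vs) = m \<longrightarrow> s (v # w # vs) = - s (w # v # vs))"

lemma alt_swap: "alt (Suc m) s \<Longrightarrow> Suc (length vs) = m \<Longrightarrow> s (v # w # vs) = - s (w # v # vs)"
  unfolding alt.simps(2) by blast

lemma alt_Cons: "alt (Suc m) s \<Longrightarrow> alt m (\<lambda>vs. s (v # vs))"
  by simp

lemma altI: "(\<And>v. alt m (\<lambda>vs. s (v # vs))) \<Longrightarrow>
    (\<And>v w vs. Suc (length vs) = m \<Longrightarrow> s (v # w # vs) = - s (w # v # vs)) \<Longrightarrow> alt (Suc m) s"
  unfolding alt.simps(2) by blast

declare alt.simps(2) [simp del]

lemma mlin_cong:
  "(\<And>vs. length vs = m \<Longrightarrow> s vs = t vs) \<Longrightarrow> mlin m s \<Longrightarrow> mlin m t"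
proof (induction m arbitrary: s t)
  case (Suc m)
  have "mlin m (\<lambda>vs. t (v # vs))" for v
    by (rule Suc.IH[of "\<lambda>vs. s (v # vs)"]) (use Suc.prems in auto)
  then show ?case using Suc.prems by simp
qed simp

lemma alt_cong:
  "(\<And>vs. length vs = m \<Longrightarrow> s vs = t vs) \<Longrightarrow> alt m s \<Longrightarrow> alt m t"
proof (induction m arbitrary: s t)
  case (Suc m)
  have "alt m (\<lambda>vs. t (v # vs))" for v
    by (rule Suc.IH[of "\<lambda>vs. s (v # vs)"]) (use Suc.prems alt_Cons in auto)
  moreover have "t (v # w # vs) = - t (w # v # vs)" if "Suc (length vs) = m" for v w vs
    using alt_swap[OF Suc.prems(2) that, of v w] Suc.prems(1)[of "v # w # vs"] Suc.prems(1)[of "w # v # vs"] that by simp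
  ultimately show ?case by (rule altI)
qed simp

lemma mlin_lincomb: "mlin m s \<Longrightarrow> mlin m t \<Longrightarrow> mlin m (\<lambda>vs. c * s vs + t vs)"
  by (induction m arbitrary: s t) (auto simp: algebra_simps)

lemma mlin_zero: "mlin m (\<lambda>vs. 0)"
  by (induction m) auto

lemma mlin_cmult: "mlin m s \<Longrightarrow> mlin m (\<lambda>vs. c * s vs)"
  using mlin_lincomb[of m s "\<lambda>_. 0" c] mlin_zero[of m] by simp

lemma mlin_add: "mlin m s \<Longrightarrow> mlin m t \<Longrightarrow> mlin m (\<lambda>vs. s vs + t vs)"
  using mlin_lincomb[of m s t 1] by simp

lemma mlin_sum: "(\<And>i. i \<in> I \<Longrightarrow> mlin m (s i)) \<Longrightarrow> mlin m (\<lambda>vs. \<Sum>i\<in>I. s i vs)"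
  by (induction I rule: infinite_finite_induct) (auto intro: mlin_add mlin_zero)

lemma mlin_Cons: "mlin (Suc m) s \<Longrightarrow> mlin m (\<lambda>vs. s (v # vs))"
  by simp

lemma mlin_lin: "mlin (Suc m) s \<Longrightarrow> length vs = m \<Longrightarrow>
    s ((c *s v + w) # vs) = c * s (v # vs) + s (w # vs)"
  by simp

lemma mlin_0: assumes "mlin (Suc m) s" "length vs = m" shows "s (0 # vs) = 0"
  using mlin_lin[OF assms, of 1 0 0] by simp

lemma mlin_expand_sum:
  assumes "mlin (Suc m) s" "length vs = m" "finite I"
  shows "s ((\<Sum>i\<in>I. c i *s v i) # vs) = (\<Sum>i\<in>I. c i * s (v i # vs))"
  using assms(3) by (induction I rule: finite_induct) (auto simp: mlin_0[OF assms(1,2)] mlin_lin[OF assms(1,2)])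

lemma cbasis_expansion: "(v :: complex ^ 'n) = (\<Sum>j\<in>UNIV. v $ j *s cbasis j)"
  by (simp add: basis_expansion)

lemma mlin_expand:
  fixes s :: "(complex ^ 'n) list \<Rightarrow> complex"
  assumes "mlin (Suc m) s" "length vs = m"
  shows "s (v # vs) = (\<Sum>j\<in>UNIV. v $ j * s (cbasis j # vs))"
  using mlin_expand_sum[OF assms, of UNIV "\<lambda>j. v $ j" cbasis] cbasis_expansion[of v] by simp

lemma mlin_map:
  assumes T: "\<And>c v w. T (c *s v + w) = c *s T v + T w" and "mlin m s"
  shows "mlin m (\<lambda>vs. s (map T vs))"
  using assms(2)
proof (induction m arbitrary: s)
  case (Suc m)
  have "mlin m (\<lambda>vs. s (T v # map T vs))" for v
    using Suc.IH[of "\<lambda>vs. s (T v # vs)"] Suc.prems by simp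
  then show ?case using Suc.prems by (simp add: T)
qed simp

lemma alt_cmult: "alt m s \<Longrightarrow> alt m (\<lambda>vs. c * s vs)"
proof (induction m arbitrary: s)
  case (Suc m)
  have "c * s (v # w # vs) = - (c * s (w # v # vs))" if "Suc (length vs) = m" for v w vs
    using alt_swap[OF Suc.prems that, of v w] by simp
  then show ?case by (intro altI Suc.IH alt_Cons[OF Suc.prems])
qed simp

lemma alt_diff: "alt m s \<Longrightarrow> alt m t \<Longrightarrow> alt m (\<lambda>vs. s vs - t vs)"
proof (induction m arbitrary: s t)
  case (Suc m)
  have "s (v # w # vs) - t (v # w # vs) = - (s (w # v # vs) - t (w # v # vs))"
    if "Suc (length vs) = m" for v w vs
    using alt_swap[OF Suc.prems(1) that, of v w] alt_swap[OF Suc.prems(2) that, of v w] by simp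
  then show ?case by (intro altI Suc.IH alt_Cons[OF Suc.prems(1)] alt_Cons[OF Suc.prems(2)])
qed simp

lemma alt_zero: "alt m (\<lambda>vs. 0)"
  by (induction m) (auto intro: altI)

lemma alt_sum: "(\<And>i. i \<in> I \<Longrightarrow> alt m (s i)) \<Longrightarrow> alt m (\<lambda>vs. \<Sum>i\<in>I. s i vs)"
proof (induction I rule: infinite_finite_induct)
  case (insert i I)
  have "alt m (\<lambda>vs. s i vs - (-1) * (\<Sum>i\<in>I. s i vs))"
    using insert by (intro alt_diff alt_cmult) auto
  then show ?case using insert by simp
qed (auto intro: alt_zero)

lemma mlin_swap:
  "mlin (Suc (Suc m)) s \<Longrightarrow> mlin (Suc (Suc m)) (\<lambda>vs. s (hd (tl vs) # hd vs # tl (tl vs)))"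
  by auto


section \<open>Moving an entry to the front; antisymmetrization\<close>

text \<open>Moving entry a to the front is a product of a adjacent transpositions
  (\<open>rot_Suc\<close> peels off one \<open>swp\<close>). Facts about it are therefore proved by
  induction on a, and alternating functions pick up the sign (-1)^a.\<close>

definition rot :: "nat \<Rightarrow> 'b list \<Rightarrow> 'b list" where
  "rot a vs = vs ! a # remove_nth a vs"

definition swp :: "'b list \<Rightarrow> 'b list" where
  "swp vs = hd (tl vs) # hd vs # tl (tl vs)"

lemma remove_nth_0 [simp]: "remove_nth 0 (v # vs) = vs"
  by (simp add: remove_nth_def)

lemma remove_nth_Suc [simp]: "remove_nth (Suc a) (v # vs) = v # remove_nth a vs"
  by (simp add: remove_nth_def)

lemma length_remove_nth: "a < length vs \<Longrightarrow> length (remove_nth a vs) = length vs - 1"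
  by (simp add: remove_nth_def)

lemma map_remove_nth: "map f (remove_nth a vs) = remove_nth a (map f vs)"
  by (simp add: remove_nth_def take_map drop_map)

lemma length_rot: "a < length vs \<Longrightarrow> length (rot a vs) = length vs"
  by (simp add: rot_def length_remove_nth)

lemma rot_0: "vs \<noteq> [] \<Longrightarrow> rot 0 vs = vs"
  by (cases vs) (auto simp: rot_def)

lemma rot_Suc: "rot (Suc a) (v # vs) = swp (v # rot a vs)"
  by (simp add: rot_def swp_def)

lemma mlin_rot: "a < m \<Longrightarrow> mlin m s \<Longrightarrow> mlin m (\<lambda>vs. s (rot a vs))"
proof (induction a arbitrary: m s)
  case 0
  then obtain k where [simp]: "m = Suc k" by (cases m) auto
  show ?case by (rule mlin_cong[OF _ 0(2)]) (subst rot_0, use 0 in auto)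
next
  case (Suc a)
  then obtain k where m: "m = Suc k" "a < k" by (cases m) auto
  then obtain l where k: "k = Suc l" by (cases k) auto
  define s' where "s' = (\<lambda>vs. s (swp vs))"
  have s': "mlin (Suc k) s'" using mlin_swap[of l s] Suc.prems m k by (auto simp: s'_def swp_def)
  have "mlin k (\<lambda>vs. s' (v # rot a vs))" for v
    using Suc.IH[OF m(2), of "\<lambda>vs. s' (v # vs)"] s' by simp
  moreover have "s (rot (Suc a) ((c *s v + w) # vs)) = c * s (rot (Suc a) (v # vs)) + s (rot (Suc a) (w # vs))"
    if "length vs = k" for c v w vs
    using mlin_lin[OF s', of "rot a vs" c v w] that m by (simp add: rot_Suc s'_def length_rot)
  ultimately show ?case by (simp add: m rot_Suc s'_def)
qed

lemma alt_rot: "a < m \<Longrightarrow> alt m t \<Longrightarrow> length vs = m \<Longrightarrow> t (rot a vs) = (- 1) ^ a * t vs"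
proof (induction a arbitrary: m t vs)
  case 0
  then have "vs \<noteq> []" by auto
  then show ?case by (simp add: rot_0)
next
  case (Suc a)
  then obtain k v us where m: "m = Suc k" "a < k" "vs = v # us" "length us = k"
    by (cases m; cases vs) auto
  then obtain l where k: "k = Suc l" by (cases k) auto
  have "t (us ! a # v # remove_nth a us) = - t (v # us ! a # remove_nth a us)"
    using alt_swap[of k t "remove_nth a us" "us ! a" v] Suc.prems m k by (simp add: length_remove_nth)
  also have "t (v # rot a us) = (- 1) ^ a * t (v # us)"
    using Suc.IH[OF m(2), of "\<lambda>vs. t (v # vs)" us] alt_Cons Suc.prems m by metis
  then have "t (v # us ! a # remove_nth a us) = (- 1) ^ a * t (v # us)"
    by (simp add: rot_def)
  finally show ?case by (simp add: m rot_def)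
qed

text \<open>For s alternating in its tail this is the full alternation, without division by the
  number of positions. With s (v # us) the derivative of a form in direction v it is the exterior
  derivative; with s (v # us) = \<eta> v * a us it is \<eta> \<and> a.\<close>

definition skew :: "('v list \<Rightarrow> complex) \<Rightarrow> 'v list \<Rightarrow> complex" where
  "skew s vs = (\<Sum>a<length vs. (- 1) ^ a * s (rot a vs))"

lemma skew_cong: "(\<And>vs. length vs = m \<Longrightarrow> s vs = t vs) \<Longrightarrow> length vs = m \<Longrightarrow> skew s vs = skew t vs"
  unfolding skew_def by (intro sum.cong) (auto simp: length_rot)

lemma skew_minus: "skew (\<lambda>vs. - s vs) vs = - skew s vs"
  by (simp add: skew_def sum_negf)

text \<open>Either v itself is in front, or another entry passes over it and costs one sign. This is
  the recursion on which all inductions about \<open>skew\<close> rest.\<close>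

lemma skew_Cons:
  "skew s (v # vs) = s (v # vs) - skew (\<lambda>us. s (hd us # v # tl us)) vs"
proof -
  have "skew s (v # vs) = s (v # vs) + (\<Sum>a<length vs. - ((- 1) ^ a * s (rot (Suc a) (v # vs))))"
    unfolding skew_def by (simp add: sum.lessThan_Suc_shift rot_0 del: sum.lessThan_Suc)
  then show ?thesis by (simp add: skew_def rot_def sum_negf)
qed

lemma mlin_skew: "mlin m s \<Longrightarrow> mlin m (skew s)"
  by (rule mlin_cong[of m "\<lambda>vs. \<Sum>a<m. (- 1) ^ a * s (rot a vs)"])
    (auto simp: skew_def intro!: mlin_sum mlin_cmult mlin_rot)

text \<open>Unfolding \<open>skew_Cons\<close> twice at v # w # vs leaves s (v # w # vs) - s (w # v
  # vs), which changes sign under the swap, and a \<open>skew\<close> in which v and w stay in the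
  tail of s, where s alternates by assumption.\<close>

lemma alt_skew: "(\<And>v. alt m (\<lambda>vs. s (v # vs))) \<Longrightarrow> alt (Suc m) (skew s)"
proof (induction m arbitrary: s)
  case (Suc m)
  have 1: "alt (Suc m) (\<lambda>vs. skew s (v # vs))" for v
    unfolding skew_Cons
    by (intro alt_diff Suc.prems Suc.IH) (use alt_Cons[OF Suc.prems] in simp)
  have 2: "skew s (v # w # vs) = - skew s (w # v # vs)" if "length vs = m" for v w vs
  proof -
    have "skew (\<lambda>us. s (hd us # v # w # tl us)) vs = skew (\<lambda>us. - s (hd us # w # v # tl us)) vs"
    proof (cases m)
      case 0
      then show ?thesis using that by (simp add: skew_def)
    next
      case (Suc l)
      show ?thesis
      proof (rule skew_cong[of m])
        fix us :: "'a list" assume "length us = m"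
        then show "s (hd us # v # w # tl us) = - s (hd us # w # v # tl us)"
          using alt_swap[OF Suc.prems, of "tl us" "hd us" v w] \<open>m = Suc l\<close> by simp
      qed (use that in simp)
    qed
    then show ?thesis by (simp add: skew_Cons skew_minus)
  qed
  show ?case by (rule altI[OF 1 2]) simp
qed (auto intro: altI)


section \<open>Contraction with a Hermitian matrix\<close>

text \<open>With G the inverse of a Hermitian metric this is the pointwise inner product of
  covariant tensors; summing over all tuples makes it m! times the usual one on forms. The second
  index of G belongs to s, the first to the conjugated t.\<close>

primrec ip :: "('n::finite \<Rightarrow> 'n \<Rightarrow> complex) \<Rightarrow> nat \<Rightarrow> ((complex ^ 'n) list \<Rightarrow> complex) \<Rightarrow>
    ((complex ^ 'n) list \<Rightarrow> complex) \<Rightarrow> complex" where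
  "ip G 0 s t = s [] * cnj (t [])"
| "ip G (Suc m) s t = (\<Sum>j\<in>UNIV. \<Sum>k\<in>UNIV. G k j *
     ip G m (\<lambda>vs. s (cbasis j # vs)) (\<lambda>vs. t (cbasis k # vs)))"

lemma ip_cong:
  "(\<And>vs. length vs = m \<Longrightarrow> s vs = s' vs) \<Longrightarrow> (\<And>vs. length vs = m \<Longrightarrow> t vs = t' vs) \<Longrightarrow>
    ip G m s t = ip G m s' t'"
proof (induction m arbitrary: s t s' t')
  case (Suc m)
  have "ip G m (\<lambda>vs. s (v # vs)) (\<lambda>vs. t (w # vs)) = ip G m (\<lambda>vs. s' (v # vs)) (\<lambda>vs. t' (w # vs))" for v w
    by (rule Suc.IH) (use Suc.prems in auto)
  then show ?case by simp
qed simp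

lemma ip_lincomb_left: "ip G m (\<lambda>vs. c * s vs + s' vs) t = c * ip G m s t + ip G m s' t"
  by (induction m arbitrary: s s' t)
    (auto simp: algebra_simps sum.distrib sum_distrib_left)

lemma ip_lincomb_right: "ip G m s (\<lambda>vs. c * t vs + t' vs) = cnj c * ip G m s t + ip G m s t'"
  by (induction m arbitrary: s t t')
    (auto simp: algebra_simps sum.distrib sum_distrib_left)

lemma ip_zero_left: "ip G m (\<lambda>vs. 0) t = 0"
  by (induction m arbitrary: t) auto

lemma ip_zero_right: "ip G m s (\<lambda>vs. 0) = 0"
  by (induction m arbitrary: s) auto

lemma ip_cmult_left: "ip G m (\<lambda>vs. c * s vs) t = c * ip G m s t"
  using ip_lincomb_left[of G m c s "\<lambda>_. 0" t] by (simp add: ip_zero_left)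

lemma ip_cmult_right: "ip G m s (\<lambda>vs. c * t vs) = cnj c * ip G m s t"
  using ip_lincomb_right[of G m s c t "\<lambda>_. 0"] by (simp add: ip_zero_right)

lemma ip_minus_right: "ip G m s (\<lambda>vs. - t vs) = - ip G m s t"
  using ip_cmult_right[of G m s "-1" t] by simp

lemma ip_add_left: "ip G m (\<lambda>vs. s vs + s' vs) t = ip G m s t + ip G m s' t"
  using ip_lincomb_left[of G m 1 s s' t] by simp

lemma ip_add_right: "ip G m s (\<lambda>vs. t vs + t' vs) = ip G m s t + ip G m s t'"
  using ip_lincomb_right[of G m s 1 t t'] by simp

lemma ip_sum_left: "ip G m (\<lambda>vs. \<Sum>i\<in>I. s i vs) t = (\<Sum>i\<in>I. ip G m (s i) t)"
  by (induction I rule: infinite_finite_induct) (auto simp: ip_zero_left ip_add_left)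

lemma ip_sum_right: "ip G m s (\<lambda>vs. \<Sum>i\<in>I. t i vs) = (\<Sum>i\<in>I. ip G m s (t i))"
  by (induction I rule: infinite_finite_induct) (auto simp: ip_zero_right ip_add_right)

lemma ip_swp:
  "ip G (Suc (Suc m)) (\<lambda>vs. s (swp vs)) (\<lambda>vs. t (swp vs)) = ip G (Suc (Suc m)) s t"
proof -
  define F where "F a b c d = ip G m (\<lambda>vs. s (cbasis a # cbasis b # vs)) (\<lambda>vs. t (cbasis c # cbasis d # vs))" for a b c d
  have "ip G (Suc (Suc m)) (\<lambda>vs. s (swp vs)) (\<lambda>vs. t (swp vs)) =
      (\<Sum>j\<in>UNIV. \<Sum>k\<in>UNIV. \<Sum>a\<in>UNIV. \<Sum>b\<in>UNIV. G k j * G b a * F a j b k)"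
    by (simp add: F_def swp_def sum_distrib_left mult_ac)
  also have "\<dots> = (\<Sum>j\<in>UNIV. \<Sum>a\<in>UNIV. \<Sum>k\<in>UNIV. \<Sum>b\<in>UNIV. G k j * G b a * F a j b k)"
    by (intro sum.cong refl sum.swap)
  also have "\<dots> = (\<Sum>a\<in>UNIV. \<Sum>j\<in>UNIV. \<Sum>k\<in>UNIV. \<Sum>b\<in>UNIV. G k j * G b a * F a j b k)"
    by (rule sum.swap)
  also have "\<dots> = (\<Sum>a\<in>UNIV. \<Sum>j\<in>UNIV. \<Sum>b\<in>UNIV. \<Sum>k\<in>UNIV. G k j * G b a * F a j b k)"
    by (intro sum.cong refl sum.swap)
  also have "\<dots> = (\<Sum>a\<in>UNIV. \<Sum>b\<in>UNIV. \<Sum>j\<in>UNIV. \<Sum>k\<in>UNIV. G k j * G b a * F a j b k)"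
    by (intro sum.cong refl sum.swap)
  also have "\<dots> = ip G (Suc (Suc m)) s t"
    by (simp add: F_def swp_def sum_distrib_left mult_ac)
  finally show ?thesis .
qed

lemma ip_rot: "a < m \<Longrightarrow> ip G m (\<lambda>vs. s (rot a vs)) (\<lambda>vs. t (rot a vs)) = ip G m s t"
proof (induction a arbitrary: m s t)
  case 0
  then show ?case by (intro ip_cong) (subst rot_0; auto)+
next
  case (Suc a)
  then obtain k where m: "m = Suc k" "a < k" by (cases m) auto
  then obtain l where k: "k = Suc l" by (cases k) auto
  have "ip G m (\<lambda>vs. s (rot (Suc a) vs)) (\<lambda>vs. t (rot (Suc a) vs)) =
      ip G m (\<lambda>vs. s (swp vs)) (\<lambda>vs. t (swp vs))"
    unfolding m(1) ip.simps rot_Suc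
    by (intro sum.cong refl arg_cong2[of _ _ _ _ "(*)"] Suc.IH[OF m(2)])
  then show ?case using ip_swp[of G l s t] by (simp add: m k)
qed

text \<open>\<open>ip\<close> is unchanged when the same rotation is applied to both arguments, and
  t absorbs its rotation with the sign (-1)^a that cancels the one in \<open>skew\<close>. So
  against an alternating t, an unalternated tensor carries the same information as its
  alternation.\<close>

lemma ip_skew:
  assumes "alt m t"
  shows "ip G m (skew s) t = of_nat m * ip G m s t"
proof -
  have "ip G m (skew s) t = ip G m (\<lambda>vs. \<Sum>a<m. (- 1) ^ a * s (rot a vs)) t"
    by (intro ip_cong) (auto simp: skew_def)
  also have "\<dots> = (\<Sum>a<m. (- 1) ^ a * ip G m (\<lambda>vs. s (rot a vs)) t)"
    by (simp add: ip_sum_left ip_cmult_left)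
  also have "\<dots> = (\<Sum>a<m. ip G m s t)"
  proof (intro sum.cong refl)
    fix a assume "a \<in> {..<m}"
    then have a: "a < m" by simp
    have "ip G m (\<lambda>vs. s (rot a vs)) (\<lambda>vs. (- 1) ^ a * t vs) = ip G m (\<lambda>vs. s (rot a vs)) (\<lambda>vs. t (rot a vs))"
      by (intro ip_cong refl) (simp add: alt_rot[OF a assms])
    then show "(- 1) ^ a * ip G m (\<lambda>vs. s (rot a vs)) t = ip G m s t"
      by (simp add: ip_cmult_right ip_rot[OF a])
  qed
  finally show ?thesis by simp
qed

lemma sum_swap4:
  fixes f :: "'i \<Rightarrow> 'j \<Rightarrow> 'k \<Rightarrow> 'l \<Rightarrow> 'a::comm_monoid_add"
  shows "(\<Sum>j\<in>J. \<Sum>k\<in>K. \<Sum>a\<in>A. \<Sum>b\<in>B. f j k a b) = (\<Sum>a\<in>A. \<Sum>b\<in>B. \<Sum>j\<in>J. \<Sum>k\<in>K. f j k a b)"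
proof -
  have "(\<Sum>j\<in>J. \<Sum>k\<in>K. \<Sum>a\<in>A. \<Sum>b\<in>B. f j k a b) = (\<Sum>j\<in>J. \<Sum>a\<in>A. \<Sum>k\<in>K. \<Sum>b\<in>B. f j k a b)"
    by (intro sum.cong refl sum.swap)
  also have "\<dots> = (\<Sum>a\<in>A. \<Sum>j\<in>J. \<Sum>k\<in>K. \<Sum>b\<in>B. f j k a b)" by (rule sum.swap)
  also have "\<dots> = (\<Sum>a\<in>A. \<Sum>j\<in>J. \<Sum>b\<in>B. \<Sum>k\<in>K. f j k a b)"
    by (intro sum.cong refl sum.swap)
  also have "\<dots> = (\<Sum>a\<in>A. \<Sum>b\<in>B. \<Sum>j\<in>J. \<Sum>k\<in>K. f j k a b)"
    by (intro sum.cong refl sum.swap)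
  finally show ?thesis .
qed

text \<open>The derivative of \<open>ip G m s t\<close> with respect to \<open>G\<close>, in the direction \<open>G'\<close>.\<close>

primrec dip :: "('n::finite \<Rightarrow> 'n \<Rightarrow> complex) \<Rightarrow> ('n \<Rightarrow> 'n \<Rightarrow> complex) \<Rightarrow> nat \<Rightarrow>
    ((complex ^ 'n) list \<Rightarrow> complex) \<Rightarrow> ((complex ^ 'n) list \<Rightarrow> complex) \<Rightarrow> complex" where
  "dip G G' 0 s t = 0"
| "dip G G' (Suc m) s t = (\<Sum>j\<in>UNIV. \<Sum>k\<in>UNIV.
     G' k j * ip G m (\<lambda>vs. s (cbasis j # vs)) (\<lambda>vs. t (cbasis k # vs)) +
     G k j * dip G G' m (\<lambda>vs. s (cbasis j # vs)) (\<lambda>vs. t (cbasis k # vs)))"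

lemma dip_cong:
  "(\<And>vs. length vs = m \<Longrightarrow> s vs = s' vs) \<Longrightarrow> (\<And>vs. length vs = m \<Longrightarrow> t vs = t' vs) \<Longrightarrow>
    dip G G' m s t = dip G G' m s' t'"
proof (induction m arbitrary: s t s' t')
  case (Suc m)
  have "dip G G' m (\<lambda>vs. s (v # vs)) (\<lambda>vs. t (w # vs)) = dip G G' m (\<lambda>vs. s' (v # vs)) (\<lambda>vs. t' (w # vs))"
    "ip G m (\<lambda>vs. s (v # vs)) (\<lambda>vs. t (w # vs)) = ip G m (\<lambda>vs. s' (v # vs)) (\<lambda>vs. t' (w # vs))" for v w
    by (rule Suc.IH ip_cong; use Suc.prems in auto)+
  then show ?case by simp
qed simp

lemma dip_minus_right: "dip G G' m s (\<lambda>vs. - t vs) = - dip G G' m s t"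
proof (induction m arbitrary: s t)
  case (Suc m)
  show ?case
    by (simp only: dip.simps ip_minus_right Suc.IH mult_minus_right sum_negf minus_add_distrib[symmetric])
qed simp

text \<open>Peel off one inner slot with indices a, b. If the derivative falls on the matrix of that
  slot, the coefficient is symmetric in k and b by \<open>sym\<close> while t is antisymmetric in
  them. If it falls further inside, swapping k and b in t brings the sum into the form of the
  induction hypothesis.\<close>

lemma dip_contraction:
  assumes sym: "\<And>k b a. (\<Sum>j\<in>UNIV. G k j * G' j b a) = (\<Sum>j\<in>UNIV. G b j * G' j k a)"
  shows "alt (Suc m) t \<Longrightarrow>
    (\<Sum>j\<in>UNIV. \<Sum>k\<in>UNIV. G k j * dip G (G' j) m s (\<lambda>vs. t (cbasis k # vs))) = 0"
proof (induction m arbitrary: s t)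
  case (Suc m)
  define F where "F a b k = ip G m (\<lambda>vs. s (cbasis a # vs)) (\<lambda>vs. t (cbasis k # cbasis b # vs))" for a b k
  define E where "E a b k j = dip G (G' j) m (\<lambda>vs. s (cbasis a # vs)) (\<lambda>vs. t (cbasis k # cbasis b # vs))" for a b k j
  have F: "F a b k = - F a k b" for a b k
  proof -
    have "F a b k = ip G m (\<lambda>vs. s (cbasis a # vs)) (\<lambda>vs. - t (cbasis b # cbasis k # vs))"
      unfolding F_def by (intro ip_cong refl) (simp add: alt_swap[OF Suc.prems, of _ "cbasis k"])
    then show ?thesis by (simp add: F_def ip_minus_right)
  qed
  have E: "(\<Sum>j\<in>UNIV. \<Sum>k\<in>UNIV. G k j * E a b k j) = 0" for a b
  proof -
    have "E a b k j = - dip G (G' j) m (\<lambda>vs. s (cbasis a # vs)) (\<lambda>vs. t (cbasis b # cbasis k # vs))" for k j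
      unfolding E_def dip_minus_right[symmetric]
      by (intro dip_cong refl) (simp add: alt_swap[OF Suc.prems, of _ "cbasis k"])
    then show ?thesis
      using Suc.IH[of "\<lambda>vs. t (cbasis b # vs)" "\<lambda>vs. s (cbasis a # vs)"] alt_Cons[OF Suc.prems, of "cbasis b"]
      by (simp add: sum_negf)
  qed
  have "(\<Sum>j\<in>UNIV. \<Sum>k\<in>UNIV. G k j * dip G (G' j) (Suc m) s (\<lambda>vs. t (cbasis k # vs))) =
     (\<Sum>j\<in>UNIV. \<Sum>k\<in>UNIV. \<Sum>a\<in>UNIV. \<Sum>b\<in>UNIV. (G k j * G' j b a) * F a b k) +
     (\<Sum>j\<in>UNIV. \<Sum>k\<in>UNIV. \<Sum>a\<in>UNIV. \<Sum>b\<in>UNIV. G b a * (G k j * E a b k j))"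
    unfolding dip.simps F_def E_def sum_distrib_left distrib_left sum.distrib mult.assoc
    by (intro arg_cong2[of _ _ _ _ "(+)"] sum.cong refl mult.left_commute)
  also have "(\<Sum>j\<in>UNIV. \<Sum>k\<in>UNIV. \<Sum>a\<in>UNIV. \<Sum>b\<in>UNIV. G b a * (G k j * E a b k j)) =
     (\<Sum>a\<in>UNIV. \<Sum>b\<in>UNIV. \<Sum>j\<in>UNIV. \<Sum>k\<in>UNIV. G b a * (G k j * E a b k j))"
    by (rule sum_swap4)
  also have "\<dots> = 0" using E by (simp flip: sum_distrib_left)
  also have "(\<Sum>j\<in>UNIV. \<Sum>k\<in>UNIV. \<Sum>a\<in>UNIV. \<Sum>b\<in>UNIV. (G k j * G' j b a) * F a b k) = 0"
  proof -
    define S where "S k b a = (\<Sum>j\<in>UNIV. G k j * G' j b a)" for k b a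
    have S: "S k b a = S b k a" for k b a by (simp add: S_def sym)
    have "(\<Sum>j\<in>UNIV. \<Sum>k\<in>UNIV. \<Sum>a\<in>UNIV. \<Sum>b\<in>UNIV. (G k j * G' j b a) * F a b k) =
        (\<Sum>a\<in>UNIV. \<Sum>b\<in>UNIV. \<Sum>j\<in>UNIV. \<Sum>k\<in>UNIV. (G k j * G' j b a) * F a b k)"
      by (rule sum_swap4)
    also have "\<dots> = (\<Sum>a\<in>UNIV. \<Sum>b\<in>UNIV. \<Sum>k\<in>UNIV. \<Sum>j\<in>UNIV. (G k j * G' j b a) * F a b k)"
      by (intro sum.cong refl sum.swap)
    also have "\<dots> = (\<Sum>a\<in>UNIV. \<Sum>b\<in>UNIV. \<Sum>k\<in>UNIV. S k b a * F a b k)"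
      by (simp add: S_def sum_distrib_right)
    also have "\<dots> = 0"
    proof (rule sum.neutral, rule ballI)
      fix a
      have "(\<Sum>b\<in>UNIV. \<Sum>k\<in>UNIV. S k b a * F a b k) = (\<Sum>k\<in>UNIV. \<Sum>b\<in>UNIV. S k b a * F a b k)"
        by (rule sum.swap)
      also have "\<dots> = - (\<Sum>b\<in>UNIV. \<Sum>k\<in>UNIV. S k b a * F a b k)"
        unfolding sum_negf[symmetric] by (intro sum.cong refl) (subst S, subst F, simp)
      finally show "(\<Sum>b\<in>UNIV. \<Sum>k\<in>UNIV. S k b a * F a b k) = 0" by simp
    qed
    finally show ?thesis .
  qed
  finally show ?case unfolding add_0 .
qed (simp only: dip.simps mult_zero_right sum.neutral_const)


section \<open>Positive definite Hermitian forms\<close>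

definition hform :: "complex ^ 'n ^ 'n::finite \<Rightarrow> complex ^ 'n \<Rightarrow> complex ^ 'n \<Rightarrow> complex" where
  "hform H v w = (\<Sum>j\<in>UNIV. \<Sum>k\<in>UNIV. H $ j $ k * v $ j * cnj (w $ k))"

definition posdef :: "complex ^ 'n ^ 'n::finite \<Rightarrow> bool" where
  "posdef H \<longleftrightarrow> (\<forall>v. v \<noteq> 0 \<longrightarrow> hform H v v \<in> \<real> \<and> 0 < Re (hform H v v))"

text \<open>Spanning is recorded as the Fourier expansion of every vector, which avoids counting
  dimensions.\<close>

definition onb :: "complex ^ 'n ^ 'n::finite \<Rightarrow> (complex ^ 'n) set \<Rightarrow> bool" where
  "onb H S \<longleftrightarrow> finite S \<and> (\<forall>b\<in>S. \<forall>c\<in>S. hform H b c = (if b = c then 1 else 0)) \<and>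
     (\<forall>v. v = (\<Sum>b\<in>S. hform H v b *s b))"

abbreviation inv_entry :: "complex ^ 'n ^ 'n::finite \<Rightarrow> 'n \<Rightarrow> 'n \<Rightarrow> complex" where
  "inv_entry H k j \<equiv> matrix_inv H $ k $ j"

lemma hform_add_left: "hform H (v + v') w = hform H v w + hform H v' w"
  and hform_add_right: "hform H v (w + w') = hform H v w + hform H v w'"
  and hform_diff_left: "hform H (v - v') w = hform H v w - hform H v' w"
  and hform_scale_left: "hform H (c *s v) w = c * hform H v w"
  and hform_scale_right: "hform H v (c *s w) = cnj c * hform H v w"
  by (simp_all add: hform_def algebra_simps sum.distrib sum_distrib_left sum_subtractf)

lemma hform_zero [simp]: "hform H 0 w = 0" "hform H v 0 = 0"
  by (simp_all add: hform_def)

lemma hform_sum_left: "hform H (\<Sum>i\<in>I. f i) w = (\<Sum>i\<in>I. hform H (f i) w)"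
  by (induction I rule: infinite_finite_induct) (auto simp: hform_add_left)

text \<open>Polarization: reality of the form at v + w compares imaginary parts, and at v + \<i> w
  real parts.\<close>

lemma posdef_hermitian:
  assumes "posdef H" shows "hform H w v = cnj (hform H v w)"
proof -
  have R: "hform H u u \<in> \<real>" for u
    using assms by (cases "u = 0") (auto simp: posdef_def)
  have "Im (hform H v w + hform H w v) = 0"
    using R[of "v + w"] R[of v] R[of w]
    by (simp add: hform_add_left hform_add_right complex_is_Real_iff)
  moreover have "Re (hform H v w) = Re (hform H w v)"
    using R[of "v + \<i> *s w"] R[of v] R[of w]
    by (simp add: hform_add_left hform_add_right hform_scale_left hform_scale_right complex_is_Real_iff)
  ultimately show ?thesis by (simp add: complex_eq_iff)
qed

lemma hform_cbasis: "hform H (cbasis j) (cbasis k) = H $ j $ k"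
proof -
  have "hform H (cbasis j) (cbasis k) =
      (\<Sum>a\<in>UNIV. \<Sum>b\<in>UNIV. if a = j then (if b = k then H $ a $ b else 0) else 0)"
    unfolding hform_def by (intro sum.cong refl) (auto simp: axis_def)
  also have "\<dots> = (\<Sum>a\<in>UNIV. if a = j then H $ a $ k else 0)"
    by (intro sum.cong refl) auto
  finally show ?thesis by simp
qed

text \<open>Gram-Schmidt over the coordinate vectors. The invariant is that S expands the vectors
  indexed by F, so a coordinate vector whose residue v is zero adds nothing to S.\<close>

lemma exists_onb:
  fixes H :: "complex ^ 'n ^ 'n::finite"
  assumes H: "posdef H"
  shows "\<exists>S. onb H S"
proof -
  have "\<exists>S. finite S \<and> (\<forall>b\<in>S. \<forall>c\<in>S. hform H b c = (if b = c then 1 else 0)) \<and>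
      (\<forall>j\<in>F. cbasis j = (\<Sum>b\<in>S. hform H (cbasis j) b *s b))" if "finite F" for F :: "'n set"
    using that
  proof (induction F rule: finite_induct)
    case empty
    show ?case by (rule exI[of _ "{}"]) simp
  next
    case (insert i F)
    then obtain S where S: "finite S" "\<And>b c. b \<in> S \<Longrightarrow> c \<in> S \<Longrightarrow> hform H b c = (if b = c then 1 else 0)"
      "\<And>j. j \<in> F \<Longrightarrow> cbasis j = (\<Sum>b\<in>S. hform H (cbasis j) b *s b)" by blast
    define v where "v = cbasis i - (\<Sum>b\<in>S. hform H (cbasis i) b *s b)"
    have vS: "hform H v c = 0" if "c \<in> S" for c
    proof -
      have "(\<Sum>b\<in>S. hform H (cbasis i) b * hform H b c) = (\<Sum>b\<in>S. if b = c then hform H (cbasis i) b else 0)"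
        by (intro sum.cong refl) (auto simp: S(2) that)
      then show ?thesis using that S(1)
        by (simp add: v_def hform_diff_left hform_sum_left hform_scale_left)
    qed
    show ?case
    proof (cases "v = 0")
      case True
      then show ?thesis using S by (intro exI[of _ S]) (auto simp: v_def)
    next
      case False
      define r where "r = Re (hform H v v)"
      have r: "r > 0" "hform H v v = of_real r"
        using H False by (auto simp: posdef_def r_def)
      define b0 where "b0 = of_real (1 / sqrt r) *s v"
      have b01: "hform H b0 b0 = 1" using r
        by (simp add: b0_def hform_scale_left hform_scale_right flip: of_real_mult)
      have b0S: "hform H b0 c = 0" if "c \<in> S" for c
        using vS[OF that] by (simp add: b0_def hform_scale_left)
      have Sb0: "hform H c b0 = 0" if "c \<in> S" for c
        using b0S[OF that] posdef_hermitian[OF H, of b0 c] by simp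
      have b0nS: "b0 \<notin> S" using b0S b01 by auto
      have old: "hform H (\<Sum>b\<in>S. f b *s b) b0 = 0" for f
        by (simp add: hform_sum_left hform_scale_left Sb0)
      have vb: "v = of_real (sqrt r) *s b0"
        using r by (simp add: b0_def flip: of_real_mult)
      have "hform H (cbasis i) b0 = hform H v b0"
        by (simp add: v_def hform_diff_left old)
      also have "\<dots> = of_real (sqrt r)" by (subst vb) (simp add: hform_scale_left b01)
      finally have ib0: "hform H (cbasis i) b0 = of_real (sqrt r)" .
      have Fb0: "hform H (cbasis j) b0 = 0" if "j \<in> F" for j
        by (subst S(3)[OF that]) (rule old)
      show ?thesis
      proof (rule exI[of _ "insert b0 S"], intro conjI ballI)
        fix j assume "j \<in> insert i F"
        then show "cbasis j = (\<Sum>b\<in>insert b0 S. hform H (cbasis j) b *s b)"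
          using S(1) b0nS ib0 vb S(3)[of j] Fb0 by (auto simp: v_def algebra_simps)
      qed (use S b01 b0S Sb0 in auto)
    qed
  qed
  then obtain S where S0: "finite S \<and> (\<forall>b\<in>S. \<forall>c\<in>S. hform H b c = (if b = c then 1 else 0)) \<and>
      (\<forall>j\<in>(UNIV::'n set). cbasis j = (\<Sum>b\<in>S. hform H (cbasis j) b *s b))"
    using finite[of "UNIV :: 'n set"] by presburger
  have S: "(\<Sum>b\<in>S. hform H (cbasis j) b *s b) = cbasis j" for j
    using conjunct2[OF conjunct2[OF S0], THEN bspec, of j] by simp
  have "v = (\<Sum>b\<in>S. hform H v b *s b)" for v
  proof -
    have "(\<Sum>b\<in>S. hform H v b *s b) = (\<Sum>b\<in>S. hform H (\<Sum>j\<in>UNIV. v $ j *s cbasis j) b *s b)"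
      using cbasis_expansion[of v] by simp
    also have "\<dots> = (\<Sum>b\<in>S. \<Sum>j\<in>UNIV. v $ j *s (hform H (cbasis j) b *s b))"
      by (simp add: hform_sum_left hform_scale_left vector_smult_assoc vec.scale_sum_left)
    also have "\<dots> = (\<Sum>j\<in>UNIV. v $ j *s (\<Sum>b\<in>S. hform H (cbasis j) b *s b))"
      by (subst sum.swap) (simp add: vec.scale_sum_right)
    also have "\<dots> = v" by (simp only: S cbasis_expansion[symmetric])
    finally show ?thesis by (rule sym)
  qed
  then show ?thesis using S0 unfolding onb_def by (intro exI[of _ S]) simp
qed

text \<open>Multiplying the matrix on the right by H gives the coordinates of the Fourier expansions
  of the coordinate vectors, hence the identity; a left inverse of a square matrix is the
  inverse.\<close>

lemma inv_entry_onb: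
  fixes H :: "complex ^ 'n ^ 'n::finite"
  assumes H: "posdef H" and S: "onb H S"
  shows "inv_entry H k j = (\<Sum>b\<in>S. b $ j * cnj (b $ k))"
proof -
  define G :: "complex ^ 'n ^ 'n" where "G = (\<chi> k j. \<Sum>b\<in>S. b $ j * cnj (b $ k))"
  have "(G ** H) $ k $ l = (if k = l then 1 else 0)" for k l
  proof -
    have c: "(\<Sum>j\<in>UNIV. b $ j * H $ j $ l) = cnj (hform H (cbasis l) b)" for b
    proof -
      have "hform H b (cbasis l) = (\<Sum>j\<in>UNIV. \<Sum>k\<in>UNIV. if k = l then H $ j $ k * b $ j else 0)"
        unfolding hform_def by (intro sum.cong refl) (auto simp: axis_def)
      then have "hform H b (cbasis l) = (\<Sum>j\<in>UNIV. b $ j * H $ j $ l)"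
        by (simp add: mult_ac)
      then show ?thesis using posdef_hermitian[OF H, of b "cbasis l"] by simp
    qed
    have "(G ** H) $ k $ l = (\<Sum>j\<in>UNIV. \<Sum>b\<in>S. cnj (b $ k) * (b $ j * H $ j $ l))"
      unfolding matrix_matrix_mult_def G_def by (simp add: sum_distrib_right) (simp only: mult_ac)
    also have "\<dots> = (\<Sum>b\<in>S. cnj (b $ k) * (\<Sum>j\<in>UNIV. b $ j * H $ j $ l))"
      by (subst sum.swap) (simp add: sum_distrib_left)
    also have "\<dots> = cnj ((\<Sum>b\<in>S. hform H (cbasis l) b *s b) $ k)"
      by (simp add: c mult.commute)
    also have "(\<Sum>b\<in>S. hform H (cbasis l) b *s b) = cbasis l"
      using S by (simp add: onb_def)
    finally show ?thesis by (simp add: axis_def)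
  qed
  then have "G ** H = mat 1" by (simp add: vec_eq_iff mat_def)
  then have HG: "H ** G = mat 1" "G ** H = mat 1" using matrix_left_right_inverse by blast+
  then have "H ** matrix_inv H = mat 1"
    unfolding matrix_inv_def by (metis (mono_tags, lifting) someI_ex)
  then have "matrix_inv H = G" using HG
    by (metis matrix_mul_assoc matrix_mul_lid matrix_mul_rid)
  then show ?thesis by (simp add: G_def)
qed

text \<open>The same inner product in an orthonormal basis. It is diagonal there, so Hermitian
  symmetry, positivity and definiteness can be read off slot by slot and are transported to
  \<open>ip\<close> by \<open>ip_onb\<close>.\<close>

primrec ip_on :: "(complex ^ 'n) set \<Rightarrow> nat \<Rightarrow> ((complex ^ 'n) list \<Rightarrow> complex) \<Rightarrow>
    ((complex ^ 'n) list \<Rightarrow> complex) \<Rightarrow> complex" where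
  "ip_on S 0 s t = s [] * cnj (t [])"
| "ip_on S (Suc m) s t = (\<Sum>b\<in>S. ip_on S m (\<lambda>vs. s (b # vs)) (\<lambda>vs. t (b # vs)))"

lemma ip_onb:
  fixes H :: "complex ^ 'n ^ 'n::finite"
  assumes H: "posdef H" and S: "onb H S"
  shows "mlin m s \<Longrightarrow> mlin m t \<Longrightarrow> ip (inv_entry H) m s t = ip_on S m s t"
proof (induction m arbitrary: s t)
  case (Suc m)
  let ?G = "inv_entry H"
  have "ip_on S (Suc m) s t = (\<Sum>b\<in>S. ip ?G m (\<lambda>vs. s (b # vs)) (\<lambda>vs. t (b # vs)))"
    using Suc by simp
  also have "\<dots> = (\<Sum>b\<in>S. ip ?G m (\<lambda>vs. \<Sum>j\<in>UNIV. b $ j * s (cbasis j # vs)) (\<lambda>vs. \<Sum>k\<in>UNIV. b $ k * t (cbasis k # vs)))"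
    by (intro sum.cong ip_cong mlin_expand[OF Suc.prems(1)] mlin_expand[OF Suc.prems(2)] refl)
  also have "\<dots> = (\<Sum>b\<in>S. \<Sum>j\<in>UNIV. \<Sum>k\<in>UNIV. b $ j * cnj (b $ k) * ip ?G m (\<lambda>vs. s (cbasis j # vs)) (\<lambda>vs. t (cbasis k # vs)))"
    by (simp add: ip_sum_left ip_sum_right ip_cmult_left ip_cmult_right sum_distrib_left mult_ac)
  also have "\<dots> = (\<Sum>j\<in>UNIV. \<Sum>b\<in>S. \<Sum>k\<in>UNIV. b $ j * cnj (b $ k) * ip ?G m (\<lambda>vs. s (cbasis j # vs)) (\<lambda>vs. t (cbasis k # vs)))"
    by (rule sum.swap)
  also have "\<dots> = (\<Sum>j\<in>UNIV. \<Sum>k\<in>UNIV. \<Sum>b\<in>S. b $ j * cnj (b $ k) * ip ?G m (\<lambda>vs. s (cbasis j # vs)) (\<lambda>vs. t (cbasis k # vs)))"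
    by (intro sum.cong refl sum.swap)
  also have "\<dots> = ip ?G (Suc m) s t"
    by (simp add: inv_entry_onb[OF H S] sum_distrib_right)
  finally show ?case by simp
qed simp

lemma ip_on_hermitian: "ip_on S m t s = cnj (ip_on S m s t)"
proof (induction m arbitrary: s t)
  case (Suc m)
  show ?case unfolding ip_on.simps cnj_sum by (intro sum.cong refl Suc.IH)
qed simp

lemma ip_on_self: "ip_on S m s s \<in> \<real> \<and> 0 \<le> Re (ip_on S m s s)"
proof (induction m arbitrary: s)
  case (Suc m)
  then show ?case by (auto intro!: sum_nonneg sum_in_Reals)
qed (simp add: complex_mult_cnj)

lemma ip_on_definite:
  assumes S: "onb H S"
  shows "mlin m s \<Longrightarrow> ip_on S m s s = 0 \<Longrightarrow> length vs = m \<Longrightarrow> s vs = 0"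
proof (induction m arbitrary: s vs)
  case (Suc m)
  obtain v us where vs: "vs = v # us" "length us = m" using Suc.prems(3) by (cases vs) auto
  have fin: "finite S" using S by (simp add: onb_def)
  have "(\<Sum>b\<in>S. Re (ip_on S m (\<lambda>vs. s (b # vs)) (\<lambda>vs. s (b # vs)))) = 0"
    using Suc.prems(2) by (simp flip: Re_sum)
  then have "\<forall>b\<in>S. Re (ip_on S m (\<lambda>vs. s (b # vs)) (\<lambda>vs. s (b # vs))) = 0"
    using ip_on_self fin by (subst (asm) sum_nonneg_eq_0_iff) auto
  then have "\<forall>b\<in>S. ip_on S m (\<lambda>vs. s (b # vs)) (\<lambda>vs. s (b # vs)) = 0"
    using ip_on_self by (metis complex_is_Real_iff complex_eq_iff zero_complex.simps)
  then have *: "s (b # us) = 0" if "b \<in> S" for b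
    using Suc.IH[of "\<lambda>vs. s (b # vs)" us] that vs Suc.prems(1) by simp
  have "s (v # us) = s ((\<Sum>b\<in>S. hform H v b *s b) # us)"
    using S by (metis onb_def)
  also have "\<dots> = 0" using mlin_expand_sum[OF Suc.prems(1) vs(2) fin] * by simp
  finally show ?case by (simp add: vs)
qed simp

lemma ip_self:
  assumes H: "posdef H" and s: "mlin m s"
  shows "ip (inv_entry H) m s s \<in> \<real>" "0 \<le> Re (ip (inv_entry H) m s s)"
proof -
  obtain S where "onb H S" using exists_onb[OF H] ..
  from ip_onb[OF H this s s] ip_on_self[of S m s]
  show "ip (inv_entry H) m s s \<in> \<real>" "0 \<le> Re (ip (inv_entry H) m s s)" by simp_all
qed

lemma ip_definite:
  assumes H: "posdef H" and s: "mlin m s" and "ip (inv_entry H) m s s = 0" "length vs = m"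
  shows "s vs = 0"
proof -
  obtain S where S: "onb H S" using exists_onb[OF H] ..
  from ip_onb[OF H S s s] ip_on_definite[OF S s _ assms(4)] assms(3)
  show ?thesis by simp
qed

lemma ip_hermitian:
  assumes H: "posdef H" and s: "mlin m s" and t: "mlin m t"
  shows "ip (inv_entry H) m t s = cnj (ip (inv_entry H) m s t)"
proof -
  obtain S where S: "onb H S" using exists_onb[OF H] ..
  show ?thesis unfolding ip_onb[OF H S s t] ip_onb[OF H S t s] by (rule ip_on_hermitian)
qed

text \<open>Positivity at 2 c s + t for c = 1 and c = -1. The weight 1/2 on t is what allows half of
  the energy to be absorbed later; the weight 2 on s is the price.\<close>

lemma ip_young:
  assumes H: "posdef H" and s: "mlin m s" and t: "mlin m t"
  shows "\<bar>2 * Re (ip (inv_entry H) m s t)\<bar> \<le>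
    2 * Re (ip (inv_entry H) m s s) + Re (ip (inv_entry H) m t t) / 2"
proof -
  let ?i = "ip (inv_entry H) m"
  have "0 \<le> 4 * Re (?i s s) + Re (?i t t) + 4 * c * Re (?i s t)" if c: "c = 1 \<or> c = -1" for c :: real
  proof -
    let ?u = "\<lambda>vs. of_real (2 * c) * s vs + t vs"
    have "?i ?u ?u = 4 * ?i s s + of_real (2 * c) * ?i s t + of_real (2 * c) * ?i t s + ?i t t"
      unfolding ip_lincomb_left ip_lincomb_right using c by (auto simp: algebra_simps)
    then have "Re (?i ?u ?u) = Re (4 * ?i s s + of_real (2 * c) * ?i s t + of_real (2 * c) * ?i t s + ?i t t)"
      by (rule arg_cong)
    then have "Re (?i ?u ?u) = 4 * Re (?i s s) + 4 * c * Re (?i s t) + Re (?i t t)"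
      unfolding ip_hermitian[OF H s t] by simp
    then show ?thesis using ip_self(2)[OF H mlin_lincomb[OF s t, of "of_real (2 * c)"]] by linarith
  qed
  from this[of 1] this[of "-1"] show ?thesis by linarith
qed

text \<open>Expanding the double sum, each mixed term is at most the mean of the two squares, by
  positivity at s b - s a; this is Cauchy-Schwarz with the constant \<open>card I\<close>.\<close>

lemma ip_sum_le:
  assumes H: "posdef H" and s: "\<And>i. i \<in> I \<Longrightarrow> mlin m (s i)" and I: "finite I"
  shows "Re (ip (inv_entry H) m (\<lambda>vs. \<Sum>i\<in>I. s i vs) (\<lambda>vs. \<Sum>i\<in>I. s i vs)) \<le>
    of_nat (card I) * (\<Sum>i\<in>I. Re (ip (inv_entry H) m (s i) (s i)))"
proof -
  let ?i = "ip (inv_entry H) m"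
  have le: "Re (?i (s a) (s b)) \<le> (Re (?i (s a) (s a)) + Re (?i (s b) (s b))) / 2" if "a \<in> I" "b \<in> I" for a b
  proof -
    let ?u = "\<lambda>vs. (-1) * s a vs + s b vs"
    have "?i ?u ?u = ?i (s a) (s a) - ?i (s a) (s b) - ?i (s b) (s a) + ?i (s b) (s b)"
      by (simp only: ip_lincomb_left ip_lincomb_right) simp
    then have "Re (?i ?u ?u) = Re (?i (s a) (s a) - ?i (s a) (s b) - ?i (s b) (s a) + ?i (s b) (s b))"
      by (rule arg_cong)
    then have "Re (?i ?u ?u) = Re (?i (s a) (s a)) - 2 * Re (?i (s a) (s b)) + Re (?i (s b) (s b))"
      unfolding ip_hermitian[OF H s[OF that(1)] s[OF that(2)]] by simp
    moreover have "0 \<le> Re (?i ?u ?u)"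
      by (rule ip_self(2)[OF H mlin_lincomb[OF s[OF that(1)] s[OF that(2)]]])
    ultimately show ?thesis by argo
  qed
  have "Re (?i (\<lambda>vs. \<Sum>i\<in>I. s i vs) (\<lambda>vs. \<Sum>i\<in>I. s i vs)) = (\<Sum>a\<in>I. \<Sum>b\<in>I. Re (?i (s a) (s b)))"
    by (simp add: ip_sum_left ip_sum_right)
  also have "\<dots> \<le> (\<Sum>a\<in>I. \<Sum>b\<in>I. (Re (?i (s a) (s a)) + Re (?i (s b) (s b))) / 2)"
    by (intro sum_mono le)
  also have "\<dots> = of_nat (card I) * (\<Sum>i\<in>I. Re (?i (s i) (s i)))"
    by (simp add: add_divide_distrib sum.distrib sum_distrib_left flip: sum_divide_distrib)
  finally show ?thesis .
qed

text \<open>T carries an orthonormal basis for H to one for H', and in these bases both sides are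
  the same sum over basis vectors. The entries of the two inverse matrices never have to be
  compared.\<close>

lemma ip_transform:
  fixes T :: "complex ^ 'n \<Rightarrow> complex ^ 'n::finite"
  assumes H: "posdef H" and H': "posdef H'"
    and T: "\<And>c v w. T (c *s v + w) = c *s T v + T w" and bij: "bij T"
    and HH: "\<And>v w. hform H v w = hform H' (T v) (T w)"
    and s: "mlin m s" and t: "mlin m t"
  shows "ip (inv_entry H') m s t = ip (inv_entry H) m (\<lambda>vs. s (map T vs)) (\<lambda>vs. t (map T vs))"
proof -
  obtain S where S: "onb H S" using exists_onb[OF H] by blast
  have T0: "T 0 = 0" using T[of 1 0 0] by simp
  have Tsum: "T (\<Sum>b\<in>I. c b *s b) = (\<Sum>b\<in>I. c b *s T b)" if "finite I" for I c
    using that by (induction I rule: finite_induct) (auto simp: T T0)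
  have inj: "inj_on T S" using bij by (auto simp: bij_def inj_on_def)
  have fin: "finite S" using S by (simp add: onb_def)
  have S': "onb H' (T ` S)"
    unfolding onb_def
  proof (intro conjI allI ballI)
    fix v
    obtain u where u: "v = T u" using bij by (metis bij_pointE)
    have "v = T (\<Sum>b\<in>S. hform H u b *s b)" using u S by (metis onb_def)
    also have "\<dots> = (\<Sum>b\<in>T ` S. hform H' v b *s b)"
      by (simp add: Tsum[OF fin] sum.reindex[OF inj] HH u)
    finally show "v = (\<Sum>b\<in>T ` S. hform H' v b *s b)" .
  next
    fix b c assume "b \<in> T ` S" "c \<in> T ` S"
    then show "hform H' b c = (if b = c then 1 else 0)"
      using S inj by (auto simp: onb_def HH[symmetric] inj_on_def)
  qed (use fin in simp)
  have "ip_on (T ` S) m s t = ip_on S m (\<lambda>vs. s (map T vs)) (\<lambda>vs. t (map T vs))"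
    by (induction m arbitrary: s t) (auto simp: sum.reindex[OF inj])
  then show ?thesis
    unfolding ip_onb[OF H' S' s t] ip_onb[OF H S mlin_map[OF T s] mlin_map[OF T t]] .
qed

text \<open>Each slot contributes n^2 index pairs and one matrix entry, hence the factor n^2 M per
  slot.\<close>

lemma ip_norm_le:
  fixes G :: "'n::finite \<Rightarrow> 'n \<Rightarrow> complex"
  assumes G: "\<And>k j. norm (G k j) \<le> M" and "0 \<le> M" "0 \<le> a" "0 \<le> b"
  shows "(\<And>I. length I = m \<Longrightarrow> norm (s (map cbasis I)) \<le> a) \<Longrightarrow>
    (\<And>I. length I = m \<Longrightarrow> norm (t (map cbasis I)) \<le> b) \<Longrightarrow>
    norm (ip G m s t) \<le> (of_nat (CARD('n)) ^ 2 * M) ^ m * (a * b)"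
proof (induction m arbitrary: s t)
  case 0
  show ?case using 0(1)[of "[]"] 0(2)[of "[]"] \<open>0 \<le> a\<close> \<open>0 \<le> b\<close>
    by (simp add: norm_mult) (intro mult_mono, auto)
next
  case (Suc m)
  let ?K = "(of_nat (CARD('n)) ^ 2 * M) ^ m * (a * b)"
  have "norm (ip G m (\<lambda>vs. s (cbasis j # vs)) (\<lambda>vs. t (cbasis k # vs))) \<le> ?K" for j k
    by (rule Suc.IH) (use Suc.prems(1)[of "j # _"] Suc.prems(2)[of "k # _"] in auto)
  then have "norm (G k j * ip G m (\<lambda>vs. s (cbasis j # vs)) (\<lambda>vs. t (cbasis k # vs))) \<le> M * ?K" for j k
    unfolding norm_mult using G assms(2) by (intro mult_mono) auto
  then have "norm (ip G (Suc m) s t) \<le> (\<Sum>j\<in>(UNIV::'n set). \<Sum>k\<in>(UNIV::'n set). M * ?K)"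
    unfolding ip.simps by (intro sum_norm_le) auto
  then show ?case by (simp add: power2_eq_square mult_ac)
qed


section \<open>Wedge products of covectors\<close>

lemma mlinI_update:
  assumes "\<And>vs i c v w. length vs = m \<Longrightarrow> i < m \<Longrightarrow> s (vs[i := c *s v + w]) = c * s (vs[i := v]) + s (vs[i := w])"
  shows "mlin m s"
  using assms
proof (induction m arbitrary: s)
  case (Suc m)
  have "mlin m (\<lambda>vs. s (u # vs))" for u
  proof (rule Suc.IH)
    fix vs :: "(complex ^ 'a) list" and i c v w assume "length vs = m" "i < m"
    then show "s (u # vs[i := c *s v + w]) = c * s (u # vs[i := v]) + s (u # vs[i := w])"
      using Suc.prems[of "u # vs" "Suc i" c v w] by simp
  qed
  moreover have "s ((c *s v + w) # vs) = c * s (v # vs) + s (w # vs)" if "length vs = m" for c v w vs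
    using Suc.prems[of "v # vs" 0 c v w] that by simp
  ultimately show ?case by simp
qed simp

lemma altI_update:
  assumes "\<And>vs i. length vs = m \<Longrightarrow> Suc i < m \<Longrightarrow> s (vs[i := vs ! Suc i, Suc i := vs ! i]) = - s vs"
  shows "alt m s"
  using assms
proof (induction m arbitrary: s)
  case (Suc m)
  have 1: "alt m (\<lambda>vs. s (u # vs))" for u
  proof (rule Suc.IH)
    fix vs :: "'a list" and i assume "length vs = m" "Suc i < m"
    then show "s (u # vs[i := vs ! Suc i, Suc i := vs ! i]) = - s (u # vs)"
      using Suc.prems[of "u # vs" "Suc i"] by simp
  qed
  have 2: "s (v # w # vs) = - s (w # v # vs)" if "Suc (length vs) = m" for v w vs
    using Suc.prems[of "w # v # vs" 0] that by simp
  show ?case by (rule altI[OF 1 2])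
qed simp

lemma mlin_wedge_covectors:
  assumes lin: "\<And>\<eta> c v w. \<eta> \<in> set \<eta>s \<Longrightarrow> \<eta> (c *s v + w) = c * \<eta> v + \<eta> w"
  shows "mlin (length \<eta>s) (wedge_covectors \<eta>s)"
proof (rule mlinI_update)
  fix vs :: "(complex ^ 'a) list" and i c v w
  assume len: "length vs = length \<eta>s" and i: "i < length \<eta>s"
  have "(\<Prod>a<length \<eta>s. (\<eta>s ! a) (vs[i := c *s v + w] ! \<sigma> a)) =
      c * (\<Prod>a<length \<eta>s. (\<eta>s ! a) (vs[i := v] ! \<sigma> a)) + (\<Prod>a<length \<eta>s. (\<eta>s ! a) (vs[i := w] ! \<sigma> a))"
    if \<sigma>: "\<sigma> permutes {..<length \<eta>s}" for \<sigma>
  proof -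
    \<comment> \<open>Exactly one factor of the product, the one with \<sigma> a0 = i, sees the
      changed argument; the rest is the common factor P.\<close>
    obtain a0 where a0: "a0 < length \<eta>s" "\<sigma> a0 = i"
      using i permutes_image[OF \<sigma>] by (metis imageE lessThan_iff)
    have ne: "\<sigma> a \<noteq> i" if "a \<noteq> a0" for a
      using that a0 permutes_inj[OF \<sigma>] by (metis injD)
    define P where "P = (\<Prod>a\<in>{..<length \<eta>s} - {a0}. (\<eta>s ! a) (vs ! \<sigma> a))"
    have "(\<Prod>a<length \<eta>s. (\<eta>s ! a) (vs[i := u] ! \<sigma> a)) = (\<eta>s ! a0) u * P" for u
    proof -
      have "(\<Prod>a\<in>{..<length \<eta>s} - {a0}. (\<eta>s ! a) (vs[i := u] ! \<sigma> a)) = P"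
        unfolding P_def by (intro prod.cong refl) (simp, metis ne nth_list_update_neq)
      then show ?thesis
        using a0 len i by (subst prod.remove[of _ a0]) auto
    qed
    then show ?thesis using lin[of "\<eta>s ! a0" c v w] a0 by (simp add: algebra_simps)
  qed
  then show "wedge_covectors \<eta>s (vs[i := c *s v + w]) =
      c * wedge_covectors \<eta>s (vs[i := v]) + wedge_covectors \<eta>s (vs[i := w])"
    by (simp add: wedge_covectors_def sum_distrib_left algebra_simps flip: sum.distrib)
qed

text \<open>Exchanging two arguments amounts to composing each permutation with a transposition,
  which reverses its sign and permutes the index set of the sum.\<close>

lemma alt_wedge_covectors: "alt (length \<eta>s) (wedge_covectors \<eta>s)"
proof (rule altI_update)
  fix vs :: "'a list" and i
  assume len: "length vs = length \<eta>s" and i: "Suc i < length \<eta>s"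
  let ?n = "length \<eta>s" and ?t = "Transposition.transpose i (Suc i)"
  have t: "?t permutes {..<?n}" using i by (intro permutes_swap_id) auto
  have nth: "vs[i := vs ! Suc i, Suc i := vs ! i] ! b = vs ! ?t b" if "b < ?n" for b
    using that len i by (auto simp: Transposition.transpose_def nth_list_update)
  let ?F = "\<lambda>\<sigma>. of_int (sign \<sigma>) * (\<Prod>a<?n. (\<eta>s ! a) (vs ! \<sigma> a))"
  have "wedge_covectors \<eta>s (vs[i := vs ! Suc i, Suc i := vs ! i]) =
      (\<Sum>\<sigma> | \<sigma> permutes {..<?n}. of_int (sign \<sigma>) * (\<Prod>a<?n. (\<eta>s ! a) (vs ! ?t (\<sigma> a))))"
    unfolding wedge_covectors_def
  proof (intro sum.cong refl arg_cong2[of _ _ _ _ "(*)"] prod.cong)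
    fix \<sigma> a assume "\<sigma> \<in> {\<sigma>. \<sigma> permutes {..<?n}}" "a \<in> {..<?n}"
    then have "\<sigma> a < ?n" using permutes_in_image by fastforce
    then show "(\<eta>s ! a) (vs[i := vs ! Suc i, Suc i := vs ! i] ! \<sigma> a) = (\<eta>s ! a) (vs ! ?t (\<sigma> a))"
      by (simp add: nth)
  qed
  also have "\<dots> = (\<Sum>\<sigma> | \<sigma> permutes {..<?n}. - ?F (?t \<circ> \<sigma>))"
  proof (intro sum.cong refl)
    fix \<sigma> assume "\<sigma> \<in> {\<sigma>. \<sigma> permutes {..<?n}}"
    then have "permutation \<sigma>" using permutation_permutes by blast
    moreover have "permutation ?t" by (rule permutation_swap_id)
    ultimately have "sign (?t \<circ> \<sigma>) = - sign \<sigma>"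
      by (simp add: sign_compose sign_swap_id)
    then show "of_int (sign \<sigma>) * (\<Prod>a<?n. (\<eta>s ! a) (vs ! ?t (\<sigma> a))) = - ?F (?t \<circ> \<sigma>)"
      by simp
  qed
  also have "\<dots> = - (\<Sum>\<sigma> | \<sigma> permutes {..<?n}. ?F (?t \<circ> \<sigma>))" by (rule sum_negf)
  also have "(\<Sum>\<sigma> | \<sigma> permutes {..<?n}. ?F (?t \<circ> \<sigma>)) = (\<Sum>\<sigma> | \<sigma> permutes {..<?n}. ?F \<sigma>)"
    by (rule sum.reindex_bij_witness[of _ "\<lambda>\<sigma>. ?t \<circ> \<sigma>" "\<lambda>\<sigma>. ?t \<circ> \<sigma>"])
      (auto intro: permutes_compose[OF _ t] simp flip: comp_assoc)
  finally show "wedge_covectors \<eta>s (vs[i := vs ! Suc i, Suc i := vs ! i]) = - wedge_covectors \<eta>s vs"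
    by (simp add: wedge_covectors_def)
qed

text \<open>The bound \<open>B\<close> depends on the basis vector and not on the covector. In
  logarithmic coframes only the vector e_k produces a pole, so the order of the pole is read off
  from the arguments J.\<close>

lemma norm_wedge_covectors_le:
  assumes B: "\<And>\<eta> j. \<eta> \<in> set \<eta>s \<Longrightarrow> norm (\<eta> (cbasis j)) \<le> B j"
    and len: "length J = length \<eta>s"
  shows "norm (wedge_covectors \<eta>s (map cbasis J)) \<le> fact (length J) * (\<Prod>a<length J. B (J ! a))"
proof -
  let ?n = "length J"
  have "norm (of_int (sign \<sigma>) * (\<Prod>a<?n. (\<eta>s ! a) (map cbasis J ! \<sigma> a))) \<le> (\<Prod>a<?n. B (J ! a))"
    if \<sigma>: "\<sigma> permutes {..<?n}" for \<sigma>
  proof -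
    have "norm (of_int (sign \<sigma>) * (\<Prod>a<?n. (\<eta>s ! a) (map cbasis J ! \<sigma> a))) =
        (\<Prod>a<?n. norm ((\<eta>s ! a) (map cbasis J ! \<sigma> a)))"
      by (auto simp: norm_mult prod_norm sign_def)
    also have "\<dots> \<le> (\<Prod>a<?n. B (J ! \<sigma> a))"
    proof (intro prod_mono conjI norm_ge_zero)
      fix a assume "a \<in> {..<?n}"
      moreover from this have "\<sigma> a < ?n" using permutes_in_image[OF \<sigma>] by simp
      ultimately show "norm ((\<eta>s ! a) (map cbasis J ! \<sigma> a)) \<le> B (J ! \<sigma> a)"
        using B[of "\<eta>s ! a" "J ! \<sigma> a"] len by simp
    qed
    also have "\<dots> = (\<Prod>a<?n. B (J ! a))"
      using prod.permute[OF \<sigma>, of "\<lambda>a. B (J ! a)"] by (simp add: o_def)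
    finally show ?thesis .
  qed
  then have "norm (wedge_covectors \<eta>s (map cbasis J)) \<le>
      of_nat (card {\<sigma>. \<sigma> permutes {..<?n}}) * (\<Prod>a<?n. B (J ! a))"
    unfolding wedge_covectors_def len[symmetric] by (intro sum_norm_bound) simp
  then show ?thesis by (simp add: card_permutations)
qed


section \<open>Holomorphic functions of several variables are smooth\<close>

abbreviation fd :: "('v::real_normed_vector \<Rightarrow> 'w::real_normed_vector) \<Rightarrow> 'v \<Rightarrow> 'v \<Rightarrow> 'w" where
  "fd f z \<equiv> frechet_derivative f (at z)"

lemma fd_works: "f differentiable (at z) \<Longrightarrow> (f has_derivative fd f z) (at z)"
  by (simp add: frechet_derivative_works)

lemma fd_eq: "(f has_derivative f') (at z) \<Longrightarrow> fd f z = f'"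
  using frechet_derivative_at[of f f' z] by simp

lemma linear_fd: "f differentiable (at z) \<Longrightarrow> linear (fd f z)"
  by (rule linear_frechet_derivative)

lemma has_derivative_cong_open:
  assumes "(f has_derivative f') (at z)" "open S" "z \<in> S" "\<And>x. x \<in> S \<Longrightarrow> f x = g x"
  shows "(g has_derivative f') (at z)"
  using has_derivative_transform_within_open[OF assms(1-3)] assms(4) by auto

lemma differentiable_cong_open:
  assumes "open S" "z \<in> S" "\<And>x. x \<in> S \<Longrightarrow> f x = g x"
  shows "f differentiable (at z) \<longleftrightarrow> g differentiable (at z)"
  unfolding differentiable_def
  using has_derivative_cong_open[of f _ z S g] has_derivative_cong_open[of g _ z S f] assms
  by auto

lemma fd_cong_open:
  assumes "open S" "z \<in> S" "\<And>x. x \<in> S \<Longrightarrow> f x = g x"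
  shows "fd f z = fd g z"
proof -
  have "(\<lambda>f'. (f has_derivative f') (at z)) = (\<lambda>f'. (g has_derivative f') (at z))"
    using has_derivative_cong_open[of f _ z S g] has_derivative_cong_open[of g _ z S f] assms by (intro ext iffI) auto
  then show ?thesis by (simp add: frechet_derivative_def)
qed

lemma holo_onD:
  assumes "holo_on f S" "z \<in> S"
  shows "f differentiable (at z)" "(f has_derivative fd f z) (at z)" "fd f z (c *s v) = c * fd f z v"
proof -
  obtain f' where f': "(f has_derivative f') (at z)" "\<And>c v. f' (c *s v) = c * f' v"
    using assms by (auto simp: holo_on_def)
  have "fd f z = f'" using f'(1) by (rule fd_eq)
  then show "f differentiable (at z)" "(f has_derivative fd f z) (at z)" "fd f z (c *s v) = c * fd f z v"
    using f' by (auto simp: differentiable_def)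
qed

lemma holo_on_subset: "holo_on f S \<Longrightarrow> T \<subseteq> S \<Longrightarrow> holo_on f T"
  by (auto simp: holo_on_def)

lemma holo_on_continuous: "holo_on f S \<Longrightarrow> continuous_on S f"
  by (meson continuous_at_imp_continuous_on differentiable_imp_continuous_within holo_onD(1))

lemma bounded_linear_smult_vec: "bounded_linear (\<lambda>t::complex. t *s (v :: complex ^ 'n::finite))"
proof -
  have "linear (\<lambda>t::complex. t *s v)"
    by (rule linearI) (simp_all add: vec_eq_iff distrib_left distrib_right)
  then show ?thesis by (rule linear_conv_bounded_linear[THEN iffD1])
qed

lemmas continuous_on_smult_vec [continuous_intros] =
  bounded_linear.continuous_on[OF bounded_linear_smult_vec]

lemma holo_on_line:
  assumes f: "holo_on f S" and "z + t *s v \<in> S"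
  shows "((\<lambda>t. f (z + t *s v)) has_field_derivative fd f (z + t *s v) v) (at t)"
proof -
  have "((\<lambda>t. f (z + t *s v)) has_derivative (\<lambda>h. fd f (z + t *s v) (h *s v))) (at t)"
    using holo_onD(2)[OF f assms(2)]
    by (rule has_derivative_compose[rotated])
      (auto intro!: derivative_eq_intros bounded_linear.has_derivative[OF bounded_linear_smult_vec])
  then show ?thesis
    by (simp add: has_field_derivative_def holo_onD(3)[OF assms] mult_commute_abs)
qed

abbreviation circ :: "real \<Rightarrow> real \<Rightarrow> complex" where
  "circ r s \<equiv> of_real r * exp (2 * of_real pi * \<i> * of_real s)"

text \<open>Cauchy's formula on the complex line through z with direction v. The derivative becomes
  an integral over values of f, from which continuity and further differentiability follow.\<close>

lemma holo_fd_eq_integral: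
  assumes f: "holo_on f S" and r: "r > 0" and S: "\<And>t. norm t \<le> r \<Longrightarrow> z + t *s v \<in> S"
  shows "fd f z v = integral (cbox 0 1) (\<lambda>s. f (z + circ r s *s v) / circ r s)"
proof -
  let ?F = "\<lambda>t. f (z + t *s v)"
  have hol: "?F holomorphic_on cball 0 r"
    by (rule holomorphic_onI, rule field_differentiable_at_within)
      (use holo_on_line[OF f S] in \<open>auto simp: field_differentiable_def dist_norm\<close>)
  have "deriv ?F 0 = 1 / (2 * pi * \<i>) * contour_integral (circlepath 0 r) (\<lambda>u. ?F u / (u - 0)\<^sup>2)"
    using Cauchy_derivative_integral_circlepath(2)[of 0 r ?F 0] hol r
    by (simp add: DERIV_imp_deriv holomorphic_on_imp_continuous_on holomorphic_on_subset[OF hol ball_subset_cball])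
  also have "contour_integral (circlepath 0 r) (\<lambda>u. ?F u / (u - 0)\<^sup>2) =
      integral {0..1} (\<lambda>s. (2 * pi * \<i>) * (?F (circ r s) / circ r s))"
    unfolding contour_integral_integral
  proof (rule integral_cong)
    fix s :: real
    have "circ r s \<noteq> 0" using r by simp
    then show "?F (circlepath 0 r s) / (circlepath 0 r s - 0)\<^sup>2 * vector_derivative (circlepath 0 r) (at s) =
        2 * pi * \<i> * (?F (circ r s) / circ r s)"
      unfolding vector_derivative_circlepath unfolding circlepath by (simp add: power2_eq_square)
  qed
  also have "\<dots> = (2 * pi * \<i>) * integral {0..1} (\<lambda>s. ?F (circ r s) / circ r s)"
    by (rule integral_mult_right)
  finally have "deriv ?F 0 = integral {0..1} (\<lambda>s. ?F (circ r s) / circ r s)" by simp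
  moreover have "deriv ?F 0 = fd f z v"
    using holo_on_line[OF f S, of 0] r by (simp add: DERIV_imp_deriv)
  ultimately show ?thesis by (simp add: cbox_interval)
qed

text \<open>A single radius serves all centres near z0. Only then is the Cauchy integral with fixed
  r a formula for the derivative on a whole neighbourhood, which can be differentiated in the
  centre.\<close>

lemma nbhd_discs:
  fixes v :: "complex ^ 'n::finite"
  assumes "open S" "z0 \<in> S"
  obtains r d where "r > 0" "d > 0" "\<And>z t. z \<in> ball z0 d \<Longrightarrow> norm t \<le> r \<Longrightarrow> z + t *s v \<in> S"
proof -
  obtain e where e: "e > 0" "ball z0 e \<subseteq> S" using assms openE by blast
  obtain K where K: "\<And>t::complex. norm (t *s v) \<le> norm t * K" "K > 0"
    using bounded_linear.pos_bounded[OF bounded_linear_smult_vec[of v]] by blast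
  show ?thesis
  proof
    fix z and t :: complex assume z: "z \<in> ball z0 (e / 2)" and t: "norm t \<le> e / (2 * K)"
    have "norm (t *s v) \<le> e / (2 * K) * K" using order_trans[OF K(1) mult_right_mono[OF t]] K(2) by simp
    also have "\<dots> = e / 2" using K(2) by simp
    finally have "dist z0 (z + t *s v) < e"
      using z dist_triangle[of z0 "z + t *s v" z] by (simp add: dist_norm)
    then show "z + t *s v \<in> S" using e by auto
  qed (use e K in auto)
qed

lemma continuous_on_circ [continuous_intros]: "continuous_on A (circ r)"
  by (intro continuous_intros)

lemma holo_continuous_fd:
  assumes f: "holo_on f S" and S: "open S"
  shows "continuous_on S (\<lambda>z. fd f z v)"
proof (rule continuous_at_imp_continuous_on, rule ballI)
  fix z0 assume "z0 \<in> S"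
  then obtain r d where rd: "r > 0" "d > 0" "\<And>z t. z \<in> ball z0 d \<Longrightarrow> norm t \<le> r \<Longrightarrow> z + t *s v \<in> S"
    using nbhd_discs[OF S] by metis
  have nc: "norm (circ r s) \<le> r" "circ r s \<noteq> 0" for s
    using rd(1) by (auto simp: norm_mult norm_exp_eq_Re)
  have "continuous_on (ball z0 d) (\<lambda>z. integral (cbox 0 1) (\<lambda>s. f (z + circ r s *s v) / circ r s))"
  proof (rule integral_continuous_on_param)
    have "continuous_on (ball z0 d \<times> cbox 0 1) (\<lambda>x. f (fst x + circ r (snd x) *s v) / circ r (snd x))"
      using nc rd(1)
      by (intro continuous_intros continuous_on_compose2[OF holo_on_continuous[OF f]])
        (auto intro!: rd(3) continuous_intros)
    then show "continuous_on (ball z0 d \<times> cbox 0 1) (\<lambda>(z, s). f (z + circ r s *s v) / circ r s)"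
      by (simp add: case_prod_beta)
  qed
  then have "continuous_on (ball z0 d) (\<lambda>z. fd f z v)"
    by (rule continuous_on_eq) (use holo_fd_eq_integral[OF f rd(1) rd(3)] in auto)
  then show "continuous (at z0) (\<lambda>z. fd f z v)"
    using rd(2) by (simp add: continuous_on_eq_continuous_at)
qed

text \<open>Differentiation under the Cauchy integral. In the resulting formula the direction v
  enters only through the circle, and u only through the first derivative of f; both holomorphy and
  symmetry of the second derivative are visible there.\<close>

lemma holo_fd_has_derivative:
  assumes f: "holo_on f S" and S: "open S"
    and rd: "r > 0" "d > 0" "\<And>z t. z \<in> ball z0 d \<Longrightarrow> norm t \<le> r \<Longrightarrow> z + t *s v \<in> S"
  obtains g' where "((\<lambda>z. fd f z v) has_derivative g') (at z0)"
    "\<And>u. g' u = integral (cbox 0 1) (\<lambda>s. fd f (z0 + circ r s *s v) u / circ r s)"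
proof -
  have nc: "norm (circ r s) \<le> r" "circ r s \<noteq> 0" for s
    using rd(1) by (auto simp: norm_mult norm_exp_eq_Re)
  \<comment> \<open>The Leibniz rule asks for the derivative as a bounded linear map depending
    continuously on the parameters; in finite dimension this is checked on basis vectors, for which
    \<open>cont\<close> is available.\<close>
  define fx where "fx z s = Blinfun (\<lambda>u. fd f (z + circ r s *s v) u / circ r s)" for z s
  have fx: "blinfun_apply (fx z s) = (\<lambda>u. fd f (z + circ r s *s v) u / circ r s)" if "z \<in> ball z0 d" for z s
    unfolding fx_def
    using has_derivative_bounded_linear[OF holo_onD(2)[OF f rd(3)[OF that nc(1)]]]
    by (intro bounded_linear_Blinfun_apply) (simp add: divide_inverse bounded_linear_mult_const)
  have cont: "continuous_on (ball z0 d \<times> cbox 0 1) (\<lambda>x. fd f (fst x + circ r (snd x) *s v) u / circ r (snd x))" for u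
    using nc rd(1)
    by (intro continuous_intros continuous_on_compose2[OF holo_continuous_fd[OF f S]])
      (auto intro!: rd(3) continuous_intros)
  have cfx: "continuous_on (ball z0 d \<times> cbox 0 1) (\<lambda>(z, s). fx z s)"
    unfolding case_prod_beta
  proof (rule continuous_on_blinfun_componentwise)
    fix i :: "complex ^ 'a" assume "i \<in> Basis"
    show "continuous_on (ball z0 d \<times> cbox 0 1) (\<lambda>x. blinfun_apply (fx (fst x) (snd x)) i)"
      by (rule continuous_on_eq[OF cont[of i]]) (auto simp: fx)
  qed
  have "((\<lambda>z. integral (cbox 0 1) (\<lambda>s. f (z + circ r s *s v) / circ r s)) has_derivative
      blinfun_apply (integral (cbox 0 1) (fx z0))) (at z0 within ball z0 d)"
  proof (rule leibniz_rule[OF _ _ cfx])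
    fix z and s :: real assume z: "z \<in> ball z0 d"
    show "((\<lambda>z. f (z + circ r s *s v) / circ r s) has_derivative blinfun_apply (fx z s)) (at z within ball z0 d)"
    proof (rule has_derivative_at_withinI)
      have "((\<lambda>z. f (z + circ r s *s v)) has_derivative fd f (z + circ r s *s v)) (at z)"
        using holo_onD(2)[OF f rd(3)[OF z nc(1)]]
        by (rule has_derivative_compose[rotated]) (auto intro!: derivative_eq_intros)
      then show "((\<lambda>z. f (z + circ r s *s v) / circ r s) has_derivative blinfun_apply (fx z s)) (at z)"
        unfolding fx[OF z] divide_inverse by (rule has_derivative_mult_left)
    qed
  next
    fix z assume z: "z \<in> ball z0 d"
    show "(\<lambda>s. f (z + circ r s *s v) / circ r s) integrable_on cbox 0 1"
      using nc rd(1) z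
      by (intro integrable_continuous continuous_intros continuous_on_compose2[OF holo_on_continuous[OF f]])
        (auto intro!: rd(3) continuous_intros)
  qed (use rd(2) in auto)
  then have "((\<lambda>z. integral (cbox 0 1) (\<lambda>s. f (z + circ r s *s v) / circ r s)) has_derivative
      blinfun_apply (integral (cbox 0 1) (fx z0))) (at z0)"
    using rd(2) by (simp only: at_within_open[of z0 "ball z0 d"] open_ball centre_in_ball)
  then have D: "((\<lambda>z. fd f z v) has_derivative blinfun_apply (integral (cbox 0 1) (fx z0))) (at z0)"
    by (rule has_derivative_cong_open[of _ _ _ "ball z0 d"])
      (use rd(2) holo_fd_eq_integral[OF f rd(1) rd(3)] in auto)
  have "continuous_on (cbox 0 1) (\<lambda>s. case (z0, s) of (z, s) \<Rightarrow> fx z s)"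
    by (rule continuous_on_compose2[OF cfx]) (use rd(2) in \<open>auto intro!: continuous_intros continuous_on_Pair\<close>)
  then have "fx z0 integrable_on cbox 0 1" by (intro integrable_continuous) simp
  then have "blinfun_apply (integral (cbox 0 1) (fx z0)) u = integral (cbox 0 1) (\<lambda>s. fd f (z0 + circ r s *s v) u / circ r s)" for u
    using rd(2) by (simp add: blinfun_apply_integral fx)
  with D show ?thesis using that by blast
qed

lemma holo_on_fd:
  assumes f: "holo_on f S" and S: "open S"
  shows "holo_on (\<lambda>z. fd f z v) S"
  unfolding holo_on_def
proof
  fix z0 assume "z0 \<in> S"
  then obtain r d where rd: "r > 0" "d > 0" "\<And>z t. z \<in> ball z0 d \<Longrightarrow> norm t \<le> r \<Longrightarrow> z + t *s v \<in> S"
    using nbhd_discs[OF S] by metis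
  obtain g' where g': "((\<lambda>z. fd f z v) has_derivative g') (at z0)"
    "\<And>u. g' u = integral (cbox 0 1) (\<lambda>s. fd f (z0 + circ r s *s v) u / circ r s)"
    using holo_fd_has_derivative[OF f S rd] by blast
  have nc: "norm (circ r s) \<le> r" for s
    using rd(1) by (auto simp: norm_mult norm_exp_eq_Re)
  have "g' (c *s u) = c * g' u" for c u
    unfolding g'(2) using rd(2) holo_onD(3)[OF f rd(3)[OF _ nc]]
    by (simp flip: integral_mult_right)
  with g'(1) show "\<exists>f'. ((\<lambda>z. fd f z v) has_derivative f') (at z0) \<and> (\<forall>c v. f' (c *s v) = c * f' v)"
    by blast
qed

text \<open>Both sides equal one Cauchy integral of the derivative in direction u over a circle in
  direction v: once by differentiating the integral for direction v, once by applying Cauchy's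
  formula to the holomorphic function \<open>fd f\<close> in direction u.\<close>

lemma holo_fd_symmetric:
  assumes f: "holo_on f S" and S: "open S" and z: "z \<in> S"
  shows "fd (\<lambda>z. fd f z v) z u = fd (\<lambda>z. fd f z u) z v"
proof -
  obtain r d where rd: "r > 0" "d > 0" "\<And>w t. w \<in> ball z d \<Longrightarrow> norm t \<le> r \<Longrightarrow> w + t *s v \<in> S"
    using nbhd_discs[OF S z] by metis
  obtain g' where g': "((\<lambda>z. fd f z v) has_derivative g') (at z)"
    "\<And>u. g' u = integral (cbox 0 1) (\<lambda>s. fd f (z + circ r s *s v) u / circ r s)"
    using holo_fd_has_derivative[OF f S rd] by blast
  have "fd (\<lambda>z. fd f z u) z v = integral (cbox 0 1) (\<lambda>s. fd f (z + circ r s *s v) u / circ r s)"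
    using rd by (intro holo_fd_eq_integral[OF holo_on_fd[OF f S], of r]) auto
  then show ?thesis using g' fd_eq by metis
qed

lemma holo_on_Ck: "holo_on f S \<Longrightarrow> open S \<Longrightarrow> Ck_on k f S"
  by (induction k arbitrary: f) (auto simp: holo_on_continuous holo_onD intro: holo_on_fd)


section \<open>Calculus of \<open>C\<^sup>k\<close> functions\<close>

lemma Ck_on_cong_open:
  assumes "open S"
  shows "(\<And>x. x \<in> S \<Longrightarrow> f x = g x) \<Longrightarrow> Ck_on k f S \<Longrightarrow> Ck_on k g S"
proof (induction k arbitrary: f g)
  case 0
  then show ?case by (auto intro: continuous_on_eq)
next
  case (Suc k)
  have "Ck_on k (\<lambda>x. fd g x v) S" for v
    by (rule Suc.IH[of "\<lambda>x. fd f x v"])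
      (use Suc.prems fd_cong_open[OF assms, of _ f g] in auto)
  moreover have "g differentiable (at x)" if "x \<in> S" for x
    using Suc.prems differentiable_cong_open[OF assms that, of f g] that by auto
  ultimately show ?case by simp
qed

lemma Ck_on_pred: "Ck_on (Suc k) f S \<Longrightarrow> Ck_on k f S"
proof (induction k arbitrary: f)
  case 0
  then show ?case
    by (auto intro!: continuous_at_imp_continuous_on differentiable_imp_continuous_within)
next
  case (Suc k)
  have "Ck_on k (\<lambda>x. fd f x v) S" for v
    by (rule Suc.IH) (use Suc.prems in simp)
  with Suc.prems show ?case by simp
qed

lemma Ck_on_le: "Ck_on k f S \<Longrightarrow> j \<le> k \<Longrightarrow> Ck_on j f S"
  by (induction k) (auto simp: le_Suc_eq simp del: Ck_on.simps(2) dest: Ck_on_pred)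

lemma Ck_on_continuous: "Ck_on k f S \<Longrightarrow> continuous_on S f"
  using Ck_on_le[of k f S 0] by simp

lemma Ck_on_const: "Ck_on k (\<lambda>x. c) S"
  by (induction k arbitrary: c) auto

lemma fd_add: "f differentiable (at z) \<Longrightarrow> g differentiable (at z) \<Longrightarrow>
    fd (\<lambda>x. f x + g x) z = (\<lambda>v. fd f z v + fd g z v)"
  by (rule fd_eq) (intro has_derivative_add fd_works)

lemma fd_mult: "f differentiable (at z) \<Longrightarrow> g differentiable (at z) \<Longrightarrow>
    fd (\<lambda>x. f x * g x :: 'a::real_normed_algebra) z = (\<lambda>v. f z * fd g z v + fd f z v * g z)"
  by (rule fd_eq) (intro has_derivative_mult fd_works)

lemma fd_linear: "bounded_linear L \<Longrightarrow> f differentiable (at z) \<Longrightarrow>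
    fd (\<lambda>x. L (f x)) z = (\<lambda>v. L (fd f z v))"
  by (rule fd_eq, rule bounded_linear.has_derivative, assumption, rule fd_works)

lemma Ck_on_add:
  assumes "open S"
  shows "Ck_on k f S \<Longrightarrow> Ck_on k g S \<Longrightarrow> Ck_on k (\<lambda>x. f x + g x) S"
proof (induction k arbitrary: f g)
  case (Suc k)
  have "Ck_on k (\<lambda>x. fd (\<lambda>x. f x + g x) x v) S" for v
    by (rule Ck_on_cong_open[OF assms, of "\<lambda>x. fd f x v + fd g x v"])
      (use Suc in \<open>auto simp: fd_add\<close>)
  then show ?case using Suc.prems by (auto intro: differentiable_add)
qed (auto intro: continuous_intros)

lemma Ck_on_mult:
  fixes f g :: "_ \<Rightarrow> 'a::real_normed_algebra"
  assumes "open S"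
  shows "Ck_on k f S \<Longrightarrow> Ck_on k g S \<Longrightarrow> Ck_on k (\<lambda>x. f x * g x) S"
proof (induction k arbitrary: f g)
  case (Suc k)
  have "Ck_on k (\<lambda>x. fd (\<lambda>x. f x * g x) x v) S" for v
  proof (rule Ck_on_cong_open[OF assms, of "\<lambda>x. f x * fd g x v + fd f x v * g x"])
    show "Ck_on k (\<lambda>x. f x * fd g x v + fd f x v * g x) S"
      by (intro Ck_on_add[OF assms] Suc.IH Ck_on_pred[OF Suc.prems(1)] Ck_on_pred[OF Suc.prems(2)])
        (use Suc.prems in auto)
  qed (use Suc.prems in \<open>simp add: fd_mult\<close>)
  then show ?case using Suc.prems by (auto intro: differentiable_mult)
qed (auto intro: continuous_intros)

lemma Ck_on_linear:
  assumes "open S" and L: "bounded_linear L"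
  shows "Ck_on k f S \<Longrightarrow> Ck_on k (\<lambda>x. L (f x)) S"
proof (induction k arbitrary: f)
  case 0
  then show ?case by (simp add: bounded_linear.continuous_on[OF L])
next
  case (Suc k)
  have "Ck_on k (\<lambda>x. fd (\<lambda>x. L (f x)) x v) S" for v
    by (rule Ck_on_cong_open[OF assms(1), of "\<lambda>x. L (fd f x v)"])
      (use Suc in \<open>auto simp: fd_linear[OF L]\<close>)
  moreover have "(\<lambda>x. L (f x)) differentiable (at x)" if "x \<in> S" for x
    using bounded_linear.has_derivative[OF L fd_works, of f x] Suc.prems that
    by (auto simp: differentiable_def)
  ultimately show ?case by simp
qed

lemma Ck_on_sum:
  assumes "open S"
  shows "(\<And>i. i \<in> I \<Longrightarrow> Ck_on k (f i) S) \<Longrightarrow> Ck_on k (\<lambda>x. \<Sum>i\<in>I. f i x) S"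
  by (induction I rule: infinite_finite_induct) (auto intro: Ck_on_const Ck_on_add[OF assms])

lemma Ck_on_prod:
  fixes f :: "_ \<Rightarrow> _ \<Rightarrow> 'a::real_normed_field"
  assumes "open S"
  shows "(\<And>i. i \<in> I \<Longrightarrow> Ck_on k (f i) S) \<Longrightarrow> Ck_on k (\<lambda>x. \<Prod>i\<in>I. f i x) S"
  by (induction I rule: infinite_finite_induct) (auto intro: Ck_on_const Ck_on_mult[OF assms])

lemma Ck_on_cmult:
  fixes f :: "_ \<Rightarrow> 'a::real_normed_algebra"
  shows "open S \<Longrightarrow> Ck_on k f S \<Longrightarrow> Ck_on k (\<lambda>x. c * f x) S"
  by (intro Ck_on_mult Ck_on_const)

abbreviation C1_on :: "('v::real_normed_vector \<Rightarrow> 'w::real_normed_vector) \<Rightarrow> 'v set \<Rightarrow> bool" where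
  "C1_on \<equiv> Ck_on (Suc 0)"

lemma C1_onI:
  assumes "\<And>x. x \<in> S \<Longrightarrow> (f has_derivative f' x) (at x)" "\<And>v. continuous_on S (\<lambda>x. f' x v)"
  shows "C1_on f S"
proof -
  have "continuous_on S (\<lambda>x. fd f x v)" for v
    by (rule continuous_on_eq[OF assms(2)[of v]]) (simp add: fd_eq[OF assms(1)])
  then show ?thesis using assms(1) by (auto simp: differentiable_def)
qed

lemma C1_onD:
  assumes "C1_on f S"
  shows "x \<in> S \<Longrightarrow> f differentiable (at x)" "x \<in> S \<Longrightarrow> (f has_derivative fd f x) (at x)"
    "continuous_on S (\<lambda>x. fd f x v)" "continuous_on S f"
  using assms Ck_on_continuous[OF assms] by (auto simp: fd_works)

lemma C1_on_inverse:
  fixes f :: "_ \<Rightarrow> 'a::real_normed_field"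
  assumes f: "C1_on f S" and nz: "\<And>x. x \<in> S \<Longrightarrow> f x \<noteq> 0"
  shows "C1_on (\<lambda>x. inverse (f x)) S"
proof (rule C1_onI)
  show "((\<lambda>x. inverse (f x)) has_derivative (\<lambda>h. - (inverse (f x) * fd f x h * inverse (f x)))) (at x)" if "x \<in> S" for x
    by (intro Deriv.has_derivative_inverse C1_onD(2)[OF f that] nz[OF that])
  show "continuous_on S (\<lambda>x. - (inverse (f x) * fd f x h * inverse (f x)))" for h
    using nz by (intro continuous_intros C1_onD[OF f]) auto
qed

lemma C1_on_divide:
  fixes f g :: "_ \<Rightarrow> 'a::real_normed_field"
  assumes "open S" "C1_on f S" "C1_on g S" "\<And>x. x \<in> S \<Longrightarrow> g x \<noteq> 0"
  shows "C1_on (\<lambda>x. f x / g x) S"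
  unfolding divide_inverse using assms by (intro Ck_on_mult C1_on_inverse)

lemma C1_on_real_compose:
  fixes u :: "_ \<Rightarrow> real"
  assumes u: "C1_on u S" and g: "\<And>x. x \<in> S \<Longrightarrow> (g has_real_derivative g' (u x)) (at (u x))"
    and g': "continuous_on (u ` S) g'"
  shows "C1_on (\<lambda>x. g (u x)) S"
proof (rule C1_onI)
  show "((\<lambda>x. g (u x)) has_derivative (\<lambda>h. fd u x h * g' (u x))) (at x)" if "x \<in> S" for x
    using has_derivative_compose[OF C1_onD(2)[OF u that] g[OF that, unfolded has_field_derivative_def]]
    by (simp add: mult.commute)
  show "continuous_on S (\<lambda>x. fd u x h * g' (u x))" for h
    by (intro continuous_intros C1_onD[OF u] continuous_on_compose2[OF g' C1_onD(4)[OF u]]) auto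
qed

lemma fd_compose:
  assumes "f differentiable (at (T z))" "T differentiable (at z)"
  shows "fd (\<lambda>x. f (T x)) z v = fd f (T z) (fd T z v)"
    and "(\<lambda>x. f (T x)) differentiable (at z)"
proof -
  have *: "((\<lambda>x. f (T x)) has_derivative (\<lambda>v. fd f (T z) (fd T z v))) (at z)"
    by (rule has_derivative_compose[OF fd_works[OF assms(2)] fd_works[OF assms(1)]])
  then show "fd (\<lambda>x. f (T x)) z v = fd f (T z) (fd T z v)" by (simp add: fd_eq)
  show "(\<lambda>x. f (T x)) differentiable (at z)" using * by (auto simp: differentiable_def)
qed

lemma C1_on_compose:
  fixes T :: "'v::real_normed_vector \<Rightarrow> 'u::euclidean_space" and f :: "'u \<Rightarrow> 'w::real_normed_vector"
  assumes T: "C1_on T S" and f: "C1_on f S'" and sub: "T ` S \<subseteq> S'"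
  shows "C1_on (\<lambda>x. f (T x)) S"
proof (rule C1_onI)
  show "((\<lambda>x. f (T x)) has_derivative (\<lambda>v. fd f (T x) (fd T x v))) (at x)" if "x \<in> S" for x
    using has_derivative_compose[OF C1_onD(2)[OF T that] C1_onD(2)[OF f]] sub that by blast
  fix v
  \<comment> \<open>Continuity of the derivative of f is known for fixed directions only, so the
    moving direction \<open>fd T x v\<close> is expanded in the standard basis.\<close>
  have "fd f (T x) (fd T x v) = (\<Sum>b\<in>Basis. (fd T x v \<bullet> b) *\<^sub>R fd f (T x) b)" if "x \<in> S" for x
  proof -
    have lin: "linear (fd f (T x))"
      using linear_fd C1_onD(1)[OF f] sub that by blast
    have "fd f (T x) (fd T x v) = fd f (T x) (\<Sum>b\<in>Basis. (fd T x v \<bullet> b) *\<^sub>R b)"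
      by (simp add: euclidean_representation)
    then show ?thesis by (simp add: linear_sum[OF lin] linear_cmul[OF lin])
  qed
  moreover have "continuous_on S (\<lambda>x. \<Sum>b\<in>Basis. (fd T x v \<bullet> b) *\<^sub>R fd f (T x) b)"
    by (intro continuous_intros C1_onD[OF T] continuous_on_compose2[OF C1_onD(3)[OF f] C1_onD(4)[OF T] sub])
  ultimately show "continuous_on S (\<lambda>x. fd f (T x) (fd T x v))"
    by (simp cong: continuous_on_cong)
qed

lemma C1_on_local:
  assumes "\<And>x. x \<in> S \<Longrightarrow> \<exists>U. open U \<and> x \<in> U \<and> C1_on f U"
  shows "C1_on f S"
proof -
  have "continuous (at x) (\<lambda>x. fd f x v)" if x: "x \<in> S" for x v
  proof -
    obtain U where U: "open U" "x \<in> U" "C1_on f U" using assms[OF x] by blast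
    show ?thesis using C1_onD(3)[OF U(3), of v] U(1,2) by (simp only: continuous_on_eq_continuous_at)
  qed
  moreover have "f differentiable (at x)" if "x \<in> S" for x
    using assms[OF that] C1_onD(1) by blast
  ultimately show ?thesis by (auto intro: continuous_at_imp_continuous_on)
qed


section \<open>Wirtinger derivatives\<close>

definition del :: "(complex ^ 'n \<Rightarrow> complex) \<Rightarrow> complex ^ 'n \<Rightarrow> complex ^ 'n \<Rightarrow> complex" where
  "del f z v = (fd f z v - \<i> * fd f z (\<i> *s v)) / 2"

definition delb :: "(complex ^ 'n \<Rightarrow> complex) \<Rightarrow> complex ^ 'n \<Rightarrow> complex ^ 'n \<Rightarrow> complex" where
  "delb f z v = (fd f z v + \<i> * fd f z (\<i> *s v)) / 2"

lemma complex_scale_decompose: "c *s v = Re c *\<^sub>R v + Im c *\<^sub>R (\<i> *s (v :: complex ^ 'n))"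
proof -
  have "c * x = Re c *\<^sub>R x + Im c *\<^sub>R (\<i> * x)" for x
    by (auto simp: complex_eq_iff)
  then show ?thesis by (simp add: vec_eq_iff)
qed

lemma del_lin:
  fixes f :: "complex ^ 'n::finite \<Rightarrow> complex"
  assumes "f differentiable (at z)"
  shows "del f z (c *s v + w) = c * del f z v + del f z w"
proof -
  have lin: "linear (fd f z)" by (rule linear_fd[OF assms])
  have a: "fd f z (c *s v) = of_real (Re c) * fd f z v + of_real (Im c) * fd f z (\<i> *s v)" for c v
    by (subst complex_scale_decompose) (simp only: linear_add[OF lin] linear_cmul[OF lin] scaleR_conv_of_real[where 'a = complex])
  have b: "\<i> *s (c *s v + w) = (\<i> * c) *s v + \<i> *s w"
    by (simp add: vec_eq_iff algebra_simps)
  have c: "c = of_real (Re c) + \<i> * of_real (Im c)" by (simp add: complex_eq_iff)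
  have t: "2 * del f z u = fd f z u - \<i> * fd f z (\<i> *s u)" for u by (simp add: del_def)
  have "2 * del f z (c *s v + w) = (fd f z (c *s v) - \<i> * fd f z ((\<i> * c) *s v)) + (fd f z w - \<i> * fd f z (\<i> *s w))"
    unfolding t b linear_add[OF lin] by (simp add: algebra_simps)
  also have "fd f z (c *s v) - \<i> * fd f z ((\<i> * c) *s v) = (of_real (Re c) + \<i> * of_real (Im c)) * (fd f z v - \<i> * fd f z (\<i> *s v))"
    unfolding a[of c v] a[of "\<i> * c" v] by (simp add: algebra_simps)
  finally have "2 * del f z (c *s v + w) = 2 * (c * del f z v + del f z w)"
    unfolding c[symmetric] t[symmetric] by (simp add: algebra_simps)
  then show ?thesis by (simp only: mult_cancel_left) simp
qed

lemma del_cong_open: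
  "open S \<Longrightarrow> z \<in> S \<Longrightarrow> (\<And>x. x \<in> S \<Longrightarrow> f x = g x) \<Longrightarrow> del f z = del g z"
  "open S \<Longrightarrow> z \<in> S \<Longrightarrow> (\<And>x. x \<in> S \<Longrightarrow> f x = g x) \<Longrightarrow> delb f z = delb g z"
  using fd_cong_open[of S z f g] by (auto simp: del_def delb_def)

lemma del_const [simp]: "del (\<lambda>z. c) z v = 0"
  by (simp add: del_def)

lemma del_add:
  "f differentiable (at z) \<Longrightarrow> g differentiable (at z) \<Longrightarrow>
    del (\<lambda>x. f x + g x) z v = del f z v + del g z v"
  by (simp add: del_def fd_add field_simps)

lemma del_mult:
  "f differentiable (at z) \<Longrightarrow> g differentiable (at z) \<Longrightarrow>
    del (\<lambda>x. f x * g x) z v = f z * del g z v + del f z v * g z"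
  by (simp add: del_def fd_mult field_simps)

lemma del_cmult: "f differentiable (at z) \<Longrightarrow> del (\<lambda>x. c * f x) z v = c * del f z v"
  using del_mult[of "\<lambda>_. c" z f v] by simp

lemma del_sum:
  "(\<And>i. i \<in> I \<Longrightarrow> f i differentiable (at z)) \<Longrightarrow> del (\<lambda>x. \<Sum>i\<in>I. f i x) z v = (\<Sum>i\<in>I. del (f i) z v)"
  by (induction I rule: infinite_finite_induct) (auto simp: del_add differentiable_sum)

lemma del_prod:
  "finite I \<Longrightarrow> (\<And>i. i \<in> I \<Longrightarrow> f i differentiable (at z)) \<Longrightarrow>
    (\<lambda>x. \<Prod>i\<in>I. f i x) differentiable (at z) \<and>
    del (\<lambda>x. \<Prod>i\<in>I. f i x) z v = (\<Sum>i\<in>I. (\<Prod>j\<in>I - {i}. f j z) * del (f i) z v)"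
proof (induction I rule: finite_induct)
  case (insert i I)
  have "(\<Sum>j\<in>I. (\<Prod>k\<in>insert i I - {j}. f k z) * del (f j) z v) = (\<Sum>j\<in>I. f i z * ((\<Prod>k\<in>I - {j}. f k z) * del (f j) z v))"
  proof (intro sum.cong refl)
    fix j assume "j \<in> I"
    then have "insert i I - {j} = insert i (I - {j})" using insert by auto
    then show "(\<Prod>k\<in>insert i I - {j}. f k z) * del (f j) z v = f i z * ((\<Prod>k\<in>I - {j}. f k z) * del (f j) z v)"
      using insert by simp
  qed
  moreover have "insert i I - {i} = I" using insert by auto
  ultimately show ?case using insert
    by (simp add: del_mult differentiable_mult sum_distrib_left)
qed simp

lemma differentiable_cnj: "f differentiable (at z) \<Longrightarrow> (\<lambda>x. cnj (f x)) differentiable (at z)"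
  using bounded_linear.has_derivative[OF bounded_linear_cnj fd_works] by (auto simp: differentiable_def)

lemma del_cnj: "f differentiable (at z) \<Longrightarrow> del (\<lambda>x. cnj (f x)) z v = cnj (delb f z v)"
  by (simp add: del_def delb_def fd_linear[OF bounded_linear_cnj])

lemma differentiable_of_real: "f differentiable (at z) \<Longrightarrow> (\<lambda>x. complex_of_real (f x)) differentiable (at z)"
  using bounded_linear.has_derivative[OF bounded_linear_of_real fd_works] by (auto simp: differentiable_def)

lemma del_real_compose:
  assumes u: "u differentiable (at z)" and g: "(g has_real_derivative g') (at (u z))"
  shows "(\<lambda>x. g (u x)) differentiable (at z)"
    and "del (\<lambda>x. complex_of_real (g (u x))) z v = of_real g' * del (\<lambda>x. complex_of_real (u x)) z v"
proof -
  have D: "((\<lambda>x. g (u x)) has_derivative (\<lambda>h. g' * fd u z h)) (at z)"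
    using has_derivative_compose[OF fd_works[OF u] g[unfolded has_field_derivative_def]] .
  then show d: "(\<lambda>x. g (u x)) differentiable (at z)" by (auto simp: differentiable_def)
  show "del (\<lambda>x. complex_of_real (g (u x))) z v = of_real g' * del (\<lambda>x. complex_of_real (u x)) z v"
    unfolding del_def fd_linear[OF bounded_linear_of_real d] fd_linear[OF bounded_linear_of_real u] fd_eq[OF D]
    by (simp add: algebra_simps)
qed

lemma del_holo:
  assumes "holo_on f S" "z \<in> S"
  shows "del f z v = fd f z v" "delb f z v = 0"
  using holo_onD(3)[OF assms, of \<i> v] by (simp_all add: del_def delb_def)

lemma del_compose:
  assumes f: "f differentiable (at (T z))" and T: "T differentiable (at z)"
    and lin: "\<And>c v. fd T z (c *s v) = c *s fd T z v"
  shows "del (\<lambda>x. f (T x)) z v = del f (T z) (fd T z v)"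
    and "delb (\<lambda>x. f (T x)) z v = delb f (T z) (fd T z v)"
  by (simp_all add: del_def delb_def fd_compose[OF f T] lin)

lemma Ck_on_del: "open S \<Longrightarrow> Ck_on (Suc k) f S \<Longrightarrow> Ck_on k (\<lambda>x. del f x v) S"
proof -
  assume S: "open S" and f: "Ck_on (Suc k) f S"
  have "Ck_on k (\<lambda>x. (1 / 2) * fd f x v + (- \<i> / 2) * fd f x (\<i> *s v)) S"
    using f by (intro Ck_on_add[OF S] Ck_on_cmult[OF S]) simp_all
  then show ?thesis by (rule Ck_on_cong_open[OF S, rotated]) (simp add: del_def field_simps)
qed


section \<open>The divergence identity\<close>

lemma posdef_inverse:
  fixes H :: "complex ^ 'n ^ 'n::finite"
  assumes "posdef H"
  shows "matrix_inv H ** H = mat 1" "H ** matrix_inv H = mat 1" "det H \<noteq> 0"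
proof -
  have "x = 0" if "H *v x = 0" for x
  proof (rule ccontr)
    assume "x \<noteq> 0"
    \<comment> \<open>Multiplication by H contracts the conjugate-linear slot of
      \<open>hform\<close>, so the test vector is the complex conjugate of x.\<close>
    define w :: "complex ^ 'n" where "w = (\<chi> k. cnj (x $ k))"
    have "hform H w w = (\<Sum>j\<in>UNIV. w $ j * (H *v x) $ j)"
      by (simp add: hform_def w_def matrix_vector_mult_def sum_distrib_left mult_ac)
    then have "hform H w w = 0" using that by simp
    moreover have "w \<noteq> 0" using \<open>x \<noteq> 0\<close> by (auto simp: w_def vec_eq_iff)
    ultimately show False using assms by (auto simp: posdef_def)
  qed
  then have inv: "invertible H"
    using matrix_left_invertible_ker[of H] invertible_left_inverse[of H] by blast
  then have "\<exists>A'. H ** A' = mat 1 \<and> A' ** H = mat 1" by (simp add: invertible_def)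
  from someI_ex[OF this] show "matrix_inv H ** H = mat 1" "H ** matrix_inv H = mat 1"
    by (simp_all add: matrix_inv_def)
  show "det H \<noteq> 0" using inv by (simp add: invertible_det_nz)
qed

lemma inv_entry_mult:
  fixes H :: "complex ^ 'n ^ 'n::finite"
  assumes "posdef H"
  shows "(\<Sum>l\<in>UNIV. inv_entry H k l * H $ l $ m) = (if k = m then 1 else 0)"
    and "(\<Sum>l\<in>UNIV. H $ k $ l * inv_entry H l m) = (if k = m then 1 else 0)"
proof -
  have "(matrix_inv H ** H) $ k $ m = mat 1 $ k $ m" "(H ** matrix_inv H) $ k $ m = mat 1 $ k $ m"
    using posdef_inverse[OF assms] by simp_all
  then show "(\<Sum>l\<in>UNIV. inv_entry H k l * H $ l $ m) = (if k = m then 1 else 0)"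
    "(\<Sum>l\<in>UNIV. H $ k $ l * inv_entry H l m) = (if k = m then 1 else 0)"
    by (simp_all add: matrix_matrix_mult_def mat_def)
qed

lemma posdef_entry_hermitian: "posdef H \<Longrightarrow> H $ k $ j = cnj (H $ j $ k)"
  using posdef_hermitian[of H "cbasis k" "cbasis j"] by (simp add: hform_cbasis)

lemma inv_entry_hermitian:
  fixes H :: "complex ^ 'n ^ 'n::finite"
  assumes "posdef H"
  shows "inv_entry H k j = cnj (inv_entry H j k)"
proof -
  obtain S where S: "onb H S" using exists_onb[OF assms] ..
  show ?thesis unfolding inv_entry_onb[OF assms S] by (simp add: mult.commute)
qed

lemma Ck_on_det:
  fixes A :: "'v::real_normed_vector \<Rightarrow> 'a::real_normed_field ^ 'n ^ 'n::finite"
  assumes "open S" "\<And>i j. Ck_on k (\<lambda>z. A z $ i $ j) S"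
  shows "Ck_on k (\<lambda>z. det (A z)) S"
  unfolding det_def
  by (intro Ck_on_sum[OF assms(1)] Ck_on_mult[OF assms(1)] Ck_on_prod[OF assms(1)] Ck_on_const assms(2))

text \<open>Cramer's rule displays the entries of the inverse as quotients of polynomials in the
  entries of H, so they are as differentiable in the base point as the metric.\<close>

lemma inv_entry_cramer:
  fixes H :: "complex ^ 'n ^ 'n::finite"
  assumes "posdef H"
  shows "inv_entry H k j = det (\<chi> i l. if l = k then (axis j 1 :: complex ^ 'n) $ i else H $ i $ l) / det H"
proof -
  have "H *v (matrix_inv H *v axis j 1) = axis j 1"
    by (simp add: matrix_vector_mul_assoc posdef_inverse[OF assms])
  then have "matrix_inv H *v axis j 1 =
      (\<chi> k. det (\<chi> i l. if l = k then (axis j 1 :: complex ^ 'n) $ i else H $ i $ l) / det H)"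
    using cramer[OF posdef_inverse(3)[OF assms]] by blast
  moreover have "(matrix_inv H *v axis j 1) $ k = inv_entry H k j"
    by (simp add: matrix_vector_mult_def axis_def if_distrib cong: if_cong)
  ultimately show ?thesis by simp
qed

lemma C1_on_inv_entry:
  fixes H :: "'v::real_normed_vector \<Rightarrow> complex ^ 'n ^ 'n::finite"
  assumes S: "open S" and H: "\<And>i j. C1_on (\<lambda>z. H z $ i $ j) S" and pd: "\<And>z. z \<in> S \<Longrightarrow> posdef (H z)"
  shows "C1_on (\<lambda>z. inv_entry (H z) k j) S"
proof (rule Ck_on_cong_open[OF S])
  show "C1_on (\<lambda>z. det (\<chi> i l. if l = k then (axis j 1 :: complex ^ 'n) $ i else H z $ i $ l) / det (H z)) S"
  proof (intro C1_on_divide[OF S] Ck_on_det[OF S] H)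
    fix i l
    show "C1_on (\<lambda>z. (\<chi> i l. if l = k then (axis j 1 :: complex ^ 'n) $ i else H z $ i $ l) $ i $ l) S"
      by (cases "l = k") (simp_all add: Ck_on_const H del: Ck_on.simps)
  qed (simp add: posdef_inverse(3)[OF pd])
qed (simp add: inv_entry_cramer[OF pd])

text \<open>With G the inverse this is G' = - G H' G, from differentiating G H = 1 and multiplying
  by G on the right.\<close>

lemma del_inv_entry:
  fixes H :: "complex ^ 'n \<Rightarrow> complex ^ 'n ^ 'n::finite"
  assumes S: "open S" and H: "\<And>i j. C1_on (\<lambda>z. H z $ i $ j) S" and pd: "\<And>z. z \<in> S \<Longrightarrow> posdef (H z)"
    and z: "z \<in> S"
  shows "del (\<lambda>z. inv_entry (H z) k j) z v =
    - (\<Sum>a\<in>UNIV. \<Sum>b\<in>UNIV. inv_entry (H z) k a * del (\<lambda>z. H z $ a $ b) z v * inv_entry (H z) b j)"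
proof -
  let ?G = "\<lambda>z k j. inv_entry (H z) k j"
  let ?dG = "\<lambda>k j. del (\<lambda>z. ?G z k j) z v" and ?dH = "\<lambda>k j. del (\<lambda>z. H z $ k $ j) z v"
  note dG = C1_onD(1)[OF C1_on_inv_entry[OF S H pd] z]
  note dH = C1_onD(1)[OF H z]
  have dm: "(\<lambda>z. ?G z k l * H z $ l $ m) differentiable (at z)" for l m
    by (rule differentiable_mult[OF dG dH])
  have dmm: "del (\<lambda>z. ?G z k l * H z $ l $ m) z v = ?G z k l * ?dH l m + ?dG k l * H z $ l $ m" for l m
    by (rule del_mult[OF dG dH])
  have eq: "(\<Sum>l\<in>UNIV. ?dG k l * H z $ l $ m) = - (\<Sum>l\<in>UNIV. ?G z k l * ?dH l m)" for m
  proof -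
    have "del (\<lambda>z. \<Sum>l\<in>UNIV. ?G z k l * H z $ l $ m) z = del (\<lambda>z. if k = m then 1 else 0) z"
      by (rule del_cong_open(1)[OF S z]) (simp add: inv_entry_mult[OF pd])
    then have "del (\<lambda>z. \<Sum>l\<in>UNIV. ?G z k l * H z $ l $ m) z v = 0" by simp
    moreover have "del (\<lambda>z. \<Sum>l\<in>UNIV. ?G z k l * H z $ l $ m) z v =
        (\<Sum>l\<in>UNIV. ?G z k l * ?dH l m + ?dG k l * H z $ l $ m)"
      by (simp only: del_sum[OF dm] dmm)
    ultimately show ?thesis by (simp add: sum.distrib eq_neg_iff_add_eq_0 add.commute)
  qed
  have "?dG k j = (\<Sum>l\<in>UNIV. ?dG k l * (\<Sum>m\<in>UNIV. H z $ l $ m * ?G z m j))"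
    unfolding inv_entry_mult(2)[OF pd[OF z]] by (simp add: if_distrib cong: if_cong)
  also have "\<dots> = (\<Sum>l\<in>UNIV. \<Sum>m\<in>UNIV. ?dG k l * H z $ l $ m * ?G z m j)"
    by (simp add: sum_distrib_left mult.assoc)
  also have "\<dots> = (\<Sum>m\<in>UNIV. \<Sum>l\<in>UNIV. ?dG k l * H z $ l $ m * ?G z m j)"
    by (rule sum.swap)
  also have "\<dots> = (\<Sum>m\<in>UNIV. (\<Sum>l\<in>UNIV. ?dG k l * H z $ l $ m) * ?G z m j)"
    by (simp add: sum_distrib_right)
  also have "\<dots> = - (\<Sum>m\<in>UNIV. \<Sum>l\<in>UNIV. ?G z k l * ?dH l m * ?G z m j)"
    unfolding eq by (simp add: sum_negf sum_distrib_right)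
  also have "(\<Sum>m\<in>UNIV. \<Sum>l\<in>UNIV. ?G z k l * ?dH l m * ?G z m j) =
      (\<Sum>l\<in>UNIV. \<Sum>m\<in>UNIV. ?G z k l * ?dH l m * ?G z m j)" by (rule sum.swap)
  finally show ?thesis .
qed

text \<open>The second argument of \<open>ip\<close> is conjugated, so its derivative is the
  conjugate-linear one; it disappears when t is holomorphic.\<close>

lemma del_ip:
  fixes z :: "complex ^ 'n::finite"
  assumes G: "\<And>k j. (\<lambda>y. G y k j) differentiable (at z)"
  shows "(\<And>vs. length vs = m \<Longrightarrow> (\<lambda>y. s y vs) differentiable (at z)) \<Longrightarrow>
    (\<And>vs. length vs = m \<Longrightarrow> (\<lambda>y. t y vs) differentiable (at z)) \<Longrightarrow>
    (\<lambda>y. ip (G y) m (s y) (t y)) differentiable (at z) \<and>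
    del (\<lambda>y. ip (G y) m (s y) (t y)) z v =
      dip (G z) (\<lambda>k j. del (\<lambda>y. G y k j) z v) m (s z) (t z) +
      ip (G z) m (\<lambda>vs. del (\<lambda>y. s y vs) z v) (t z) +
      ip (G z) m (s z) (\<lambda>vs. delb (\<lambda>y. t y vs) z v)"
proof (induction m arbitrary: s t)
  case 0
  have d: "(\<lambda>y. s y []) differentiable (at z)" "(\<lambda>y. t y []) differentiable (at z)"
    using 0(1)[of "[]"] 0(2)[of "[]"] by simp_all
  show ?case
    unfolding ip.simps dip.simps del_mult[OF d(1) differentiable_cnj[OF d(2)]] del_cnj[OF d(2)]
    using differentiable_mult[OF d(1) differentiable_cnj[OF d(2)]] by (simp add: add.commute)
next
  case (Suc m)
  let ?I = "\<lambda>j k y. ip (G y) m (\<lambda>vs. s y (cbasis j # vs)) (\<lambda>vs. t y (cbasis k # vs))"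
  have IH: "?I j k differentiable (at z) \<and> del (?I j k) z v =
      dip (G z) (\<lambda>k j. del (\<lambda>y. G y k j) z v) m (\<lambda>vs. s z (cbasis j # vs)) (\<lambda>vs. t z (cbasis k # vs)) +
      ip (G z) m (\<lambda>vs. del (\<lambda>y. s y (cbasis j # vs)) z v) (\<lambda>vs. t z (cbasis k # vs)) +
      ip (G z) m (\<lambda>vs. s z (cbasis j # vs)) (\<lambda>vs. delb (\<lambda>y. t y (cbasis k # vs)) z v)" for j k
    by (rule Suc.IH) (use Suc.prems in auto)
  have d: "(\<lambda>y. G y k j * ?I j k y) differentiable (at z)" for j k
    using IH by (intro differentiable_mult G) auto
  have 1: "(\<lambda>y. ip (G y) (Suc m) (s y) (t y)) differentiable (at z)"
    unfolding ip.simps by (intro differentiable_sum finite ballI d)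
  have 2: "del (\<lambda>y. ip (G y) (Suc m) (s y) (t y)) z v =
      (\<Sum>j\<in>UNIV. \<Sum>k\<in>UNIV. G z k j * del (?I j k) z v + del (\<lambda>y. G y k j) z v * ?I j k z)"
    unfolding ip.simps
    by (subst del_sum, intro differentiable_sum finite ballI d, intro sum.cong refl,
        subst del_sum, rule d, intro sum.cong refl, rule del_mult, rule G, use IH in blast)
  show ?case
    unfolding 2 unfolding ip.simps(2)[of "G z"] dip.simps sum.distrib[symmetric]
    using 1 IH by (simp add: algebra_simps)
qed

text \<open>\<open>R\<close> stands for \<open>\<rho> w\<close>, with \<open>\<rho>\<close> the volume density and \<open>w\<close> the weight of the line bundle.\<close>

lemma divergence_identity:
  fixes H :: "complex ^ 'n \<Rightarrow> complex ^ 'n ^ 'n::finite"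
    and a b :: "complex ^ 'n \<Rightarrow> (complex ^ 'n) list \<Rightarrow> complex"
  assumes S: "open S" and H: "\<And>i j. C1_on (\<lambda>z. H z $ i $ j) S" and pd: "\<And>z. z \<in> S \<Longrightarrow> posdef (H z)"
    and z: "z \<in> S"
    and kaehler: "\<And>i j k. del (\<lambda>z. H z $ i $ k) z (cbasis j) = del (\<lambda>z. H z $ j $ k) z (cbasis i)"
    and da: "\<And>vs. length vs = p \<Longrightarrow> (\<lambda>y. a y vs) differentiable (at z)"
    and db: "\<And>vs. length vs = Suc p \<Longrightarrow> (\<lambda>y. b y vs) differentiable (at z)"
    and bbar: "\<And>vs v. length vs = Suc p \<Longrightarrow> delb (\<lambda>y. b y vs) z v = 0"
    and alt_b: "alt (Suc p) (b z)"
    and b: "\<And>vs. length vs = Suc p \<Longrightarrow>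
      b z vs = skew (\<lambda>us. del (\<lambda>y. a y (tl us)) z (hd us) + \<theta> (hd us) * a z (tl us)) vs"
    and f: "f differentiable (at z)" and R: "R differentiable (at z)"
    and dR: "\<And>v. del R z v = R z *
      (\<theta> v + (\<Sum>i\<in>UNIV. \<Sum>k\<in>UNIV. inv_entry (H z) k i * del (\<lambda>z. H z $ i $ k) z v))"
  shows "(\<Sum>j\<in>UNIV. del (\<lambda>y. f y * (R y * (\<Sum>k\<in>UNIV. inv_entry (H y) k j *
        ip (inv_entry (H y)) p (a y) (\<lambda>vs. b y (cbasis k # vs))))) z (cbasis j)) =
    R z * (f z / of_nat (Suc p) * ip (inv_entry (H z)) (Suc p) (b z) (b z) +
      ip (inv_entry (H z)) (Suc p) (\<lambda>us. del f z (hd us) * a z (tl us)) (b z))"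
proof -
  define G where "G = inv_entry (H z)"
  define dH where "dH j i k = del (\<lambda>z. H z $ i $ k) z (cbasis j)" for i j k
  define dG where "dG j k i = del (\<lambda>y. inv_entry (H y) k i) z (cbasis j)" for i j k
  define I where "I k y = ip (inv_entry (H y)) p (a y) (\<lambda>vs. b y (cbasis k # vs))" for k y
  define J where "J j k = ip G p (\<lambda>vs. del (\<lambda>y. a y vs) z (cbasis j)) (\<lambda>vs. b z (cbasis k # vs))" for j k
  define E where "E j k = dip G (dG j) p (a z) (\<lambda>vs. b z (cbasis k # vs))" for j k
  have Gz: "G k j = inv_entry (H z) k j" for k j by (simp add: G_def)
  have dGd: "(\<lambda>y. inv_entry (H y) k i) differentiable (at z)" for k i
    by (rule C1_onD(1)[OF C1_on_inv_entry[OF S H pd] z])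
  have dH: "dH j i k = dH i j k" for i j k by (simp add: dH_def kaehler)
  have dG: "dG j k i = - (\<Sum>c\<in>UNIV. \<Sum>d\<in>UNIV. G k c * dH j c d * G d i)" for i j k
    unfolding dG_def dH_def G_def by (rule del_inv_entry[OF S H pd z])
  have I: "I k differentiable (at z) \<and> del (I k) z (cbasis j) = E j k + J j k" for j k
  proof -
    have "ip G p (a z) (\<lambda>vs. delb (\<lambda>y. b y (cbasis k # vs)) z (cbasis j)) = ip G p (a z) (\<lambda>vs. 0)"
      by (intro ip_cong refl bbar) simp
    then show ?thesis
      using del_ip[of "\<lambda>y. inv_entry (H y)" z p a "\<lambda>y vs. b y (cbasis k # vs)" "cbasis j"] dGd da db
      by (simp add: I_def[abs_def] E_def J_def G_def dG_def[abs_def] ip_zero_right)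
  qed
  \<comment> \<open>The logarithmic derivative of the volume density in direction e_j, which is the
    second summand in the assumption \<open>dR\<close>.\<close>
  define tr where "tr j = (\<Sum>i\<in>UNIV. \<Sum>l\<in>UNIV. G l i * dH j i l)" for j
  \<comment> \<open>The product rule, grouped by what is differentiated: f; the density and the
    outer inverse matrix; the form a together with its connection term; the inverse matrices inside
    \<open>ip\<close>. The second and the fourth group will vanish.\<close>
  have *: "del (\<lambda>y. f y * (R y * (\<Sum>k\<in>UNIV. inv_entry (H y) k j * I k y))) z (cbasis j) =
      R z * (\<Sum>k\<in>UNIV. del f z (cbasis j) * G k j * I k z) +
      f z * R z * (\<Sum>k\<in>UNIV. tr j * G k j * I k z + dG j k j * I k z) +
      f z * R z * (\<Sum>k\<in>UNIV. G k j * (\<theta> (cbasis j) * I k z + J j k)) +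
      f z * R z * (\<Sum>k\<in>UNIV. G k j * E j k)" for j
  proof -
    let ?P = "\<lambda>k y. inv_entry (H y) k j * I k y"
    have dP: "?P k differentiable (at z)" for k using dGd I by (intro differentiable_mult) auto
    have dS: "(\<lambda>y. \<Sum>k\<in>UNIV. ?P k y) differentiable (at z)" by (intro differentiable_sum finite ballI dP)
    have "del (?P k) z (cbasis j) = G k j * (E j k + J j k) + dG j k j * I k z" for k
      using del_mult[OF dGd, of "I k" k j "cbasis j"] I[of k j] by (simp add: G_def dG_def)
    then have 1: "del (\<lambda>y. \<Sum>k\<in>UNIV. ?P k y) z (cbasis j) = (\<Sum>k\<in>UNIV. G k j * (E j k + J j k) + dG j k j * I k z)"
      by (simp add: del_sum[OF dP])
    have eq: "del (\<lambda>y. f y * (R y * (\<Sum>k\<in>UNIV. ?P k y))) z (cbasis j) =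
        f z * (R z * del (\<lambda>y. \<Sum>k\<in>UNIV. ?P k y) z (cbasis j) + del R z (cbasis j) * (\<Sum>k\<in>UNIV. ?P k z))
        + del f z (cbasis j) * (R z * (\<Sum>k\<in>UNIV. ?P k z))"
      by (simp add: del_mult[OF f differentiable_mult[OF R dS]] del_mult[OF R dS])
    show ?thesis
      unfolding eq 1 dR Gz[symmetric] dH_def[symmetric] tr_def[symmetric]
      by (simp add: algebra_simps sum.distrib sum_distrib_left)
  qed
  \<comment> \<open>Since G' = - G H' G, the divergence of the outer inverse matrix is minus the
    trace term once the Kaehler symmetry \<open>dH\<close> has exchanged the direction of
    differentiation with the first index of H.\<close>
  have B: "(\<Sum>j\<in>UNIV. (\<Sum>i\<in>UNIV. \<Sum>l\<in>UNIV. G l i * dH j i l) * G k j + dG j k j) = 0" for k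
  proof -
    have "(\<Sum>j\<in>UNIV. (\<Sum>i\<in>UNIV. \<Sum>l\<in>UNIV. G l i * dH j i l) * G k j) =
        (\<Sum>j\<in>UNIV. \<Sum>i\<in>UNIV. \<Sum>l\<in>UNIV. G k j * dH i j l * G l i)"
      by (simp add: sum_distrib_right sum_distrib_left mult_ac dH[of _ _ "_"] flip: dH) 
    also have "\<dots> = (\<Sum>i\<in>UNIV. \<Sum>j\<in>UNIV. \<Sum>l\<in>UNIV. G k j * dH i j l * G l i)" by (rule sum.swap)
    finally show ?thesis by (simp add: sum_subtractf dG)
  qed
  \<comment> \<open>The second use of the Kaehler symmetry: the contracted derivative of the inverse
    matrix is symmetric in its two conjugate indices, as \<open>dip_contraction\<close>
    requires.\<close>
  have sym: "(\<Sum>j\<in>UNIV. G k j * dG j l i) = (\<Sum>j\<in>UNIV. G l j * dG j k i)" for k l i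
  proof -
    have "(\<Sum>j\<in>UNIV. G k j * dG j l i) = - (\<Sum>j\<in>UNIV. \<Sum>c\<in>UNIV. \<Sum>d\<in>UNIV. G k j * G l c * dH j c d * G d i)" for k l
      by (simp add: dG sum_distrib_left mult_ac sum_negf)
    moreover have "(\<Sum>j\<in>UNIV. \<Sum>c\<in>UNIV. \<Sum>d\<in>UNIV. G k j * G l c * dH j c d * G d i) =
        (\<Sum>j\<in>UNIV. \<Sum>c\<in>UNIV. \<Sum>d\<in>UNIV. G l j * G k c * dH j c d * G d i)"
    proof -
      have "(\<Sum>j\<in>UNIV. \<Sum>c\<in>UNIV. \<Sum>d\<in>UNIV. G k j * G l c * dH j c d * G d i) =
          (\<Sum>c\<in>UNIV. \<Sum>j\<in>UNIV. \<Sum>d\<in>UNIV. G k j * G l c * dH j c d * G d i)" by (rule sum.swap)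
      also have "\<dots> = (\<Sum>c\<in>UNIV. \<Sum>j\<in>UNIV. \<Sum>d\<in>UNIV. G l c * G k j * dH c j d * G d i)"
        by (intro sum.cong refl) (subst dH, simp add: mult_ac)
      finally show ?thesis .
    qed
    ultimately show ?thesis by simp
  qed
  have C: "(\<Sum>j\<in>UNIV. \<Sum>k\<in>UNIV. G k j * E j k) = 0"
    unfolding E_def by (rule dip_contraction[OF sym alt_b])
  \<comment> \<open>The remaining terms are the unalternated covariant derivative of a paired with
    b. As b is its alternation and is itself alternating, \<open>ip_skew\<close> turns the pairing
    into the square norm of b divided by p + 1.\<close>
  have D: "(\<Sum>j\<in>UNIV. \<Sum>k\<in>UNIV. G k j * (\<theta> (cbasis j) * I k z + J j k)) = ip G (Suc p) (b z) (b z) / of_nat (Suc p)"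
  proof -
    let ?n = "\<lambda>us. del (\<lambda>y. a y (tl us)) z (hd us) + \<theta> (hd us) * a z (tl us)"
    have "ip G (Suc p) (b z) (b z) = ip G (Suc p) (skew ?n) (b z)"
      by (intro ip_cong b refl)
    also have "\<dots> = of_nat (Suc p) * ip G (Suc p) ?n (b z)" by (rule ip_skew[OF alt_b])
    also have "ip G (Suc p) ?n (b z) = (\<Sum>j\<in>UNIV. \<Sum>k\<in>UNIV. G k j * (\<theta> (cbasis j) * I k z + J j k))"
      by (simp add: I_def J_def G_def ip_add_left ip_cmult_left distrib_left sum.distrib)
    finally show ?thesis
      by (simp del: ip.simps of_nat_Suc)
  qed
  have A: "(\<Sum>j\<in>UNIV. \<Sum>k\<in>UNIV. del f z (cbasis j) * G k j * I k z) =
      ip G (Suc p) (\<lambda>us. del f z (hd us) * a z (tl us)) (b z)"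
    by (simp add: I_def G_def ip_cmult_left) (simp only: mult_ac)
  have B': "(\<Sum>j\<in>UNIV. \<Sum>k\<in>UNIV. (\<Sum>i\<in>UNIV. \<Sum>l\<in>UNIV. G l i * dH j i l) * G k j * I k z + dG j k j * I k z) = 0"
    by (subst sum.swap) (simp only: distrib_right[symmetric] sum_distrib_right[symmetric] B mult_zero_left sum.neutral_const)
  have "(\<Sum>j\<in>UNIV. del (\<lambda>y. f y * (R y * (\<Sum>k\<in>UNIV. inv_entry (H y) k j * I k y))) z (cbasis j)) =
     R z * (\<Sum>j\<in>UNIV. \<Sum>k\<in>UNIV. del f z (cbasis j) * G k j * I k z) +
     f z * R z * (\<Sum>j\<in>UNIV. \<Sum>k\<in>UNIV. (\<Sum>i\<in>UNIV. \<Sum>l\<in>UNIV. G l i * dH j i l) * G k j * I k z + dG j k j * I k z) +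
     f z * R z * (\<Sum>j\<in>UNIV. \<Sum>k\<in>UNIV. G k j * (\<theta> (cbasis j) * I k z + J j k)) +
     f z * R z * (\<Sum>j\<in>UNIV. \<Sum>k\<in>UNIV. G k j * E j k)"
    unfolding * tr_def[symmetric] sum.distrib sum_distrib_left[symmetric] ..
  then show ?thesis unfolding A B' C D I_def[symmetric] G_def[symmetric]
    by (simp add: algebra_simps del: ip.simps)
qed


section \<open>Real coordinates\<close>

text \<open>The change of variables formula of the library is stated for \<open>real ^ 'm\<close> with a wellordered
  index type \<open>'m\<close>, hence the following copy of \<open>'n \<times> bool\<close>.\<close>

typedef 'n ridx = "UNIV :: ('n \<times> bool) set" by simp

lemma Abs_ridx_inject': "Abs_ridx x = Abs_ridx y \<longleftrightarrow> x = y"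
  by (simp add: Abs_ridx_inject)

lemma Rep_Abs_ridx [simp]: "Rep_ridx (Abs_ridx x) = x"
  by (simp add: Abs_ridx_inverse)

lemma UNIV_ridx: "(UNIV :: 'n ridx set) = range Abs_ridx"
  by (metis Rep_ridx_inverse rangeI UNIV_eq_I)

instance ridx :: (finite) finite
  by standard (simp add: UNIV_ridx)

definition ridx_nat :: "'n::finite ridx \<Rightarrow> nat" where
  "ridx_nat = (SOME f. inj f)"

lemma inj_ridx_nat: "inj (ridx_nat :: 'n::finite ridx \<Rightarrow> nat)"
proof -
  have "\<exists>f :: 'n ridx \<Rightarrow> nat. inj f"
    using finite_imp_inj_to_nat_seg[OF finite[of "UNIV :: 'n ridx set"]] by blast
  then show ?thesis unfolding ridx_nat_def by (rule someI_ex)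
qed

instantiation ridx :: (finite) wellorder
begin

definition less_eq_ridx :: "'a ridx \<Rightarrow> 'a ridx \<Rightarrow> bool" where "less_eq_ridx a b \<longleftrightarrow> ridx_nat a \<le> ridx_nat b"
definition less_ridx :: "'a ridx \<Rightarrow> 'a ridx \<Rightarrow> bool" where "less_ridx a b \<longleftrightarrow> ridx_nat a < ridx_nat b"

instance
proof
  fix P :: "'a ridx \<Rightarrow> bool" and a :: "'a ridx"
  assume *: "\<And>x. (\<And>y. y < x \<Longrightarrow> P y) \<Longrightarrow> P x"
  show "P a"
    by (induction a rule: measure_induct_rule[of ridx_nat]) (auto intro: * simp: less_ridx_def)
qed (auto simp: less_eq_ridx_def less_ridx_def dest: injD[OF inj_ridx_nat])

end

lemma sum_ridx: "(\<Sum>a\<in>(UNIV :: 'n::finite ridx set). f a) = (\<Sum>j\<in>UNIV. f (Abs_ridx (j, False)) + f (Abs_ridx (j, True)))"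
proof -
  have "(\<Sum>a\<in>(UNIV :: 'n ridx set). f a) = (\<Sum>x\<in>UNIV \<times> UNIV. f (Abs_ridx x))"
    unfolding UNIV_ridx by (subst sum.reindex) (auto simp: inj_on_def Abs_ridx_inject')
  also have "\<dots> = (\<Sum>j\<in>UNIV. \<Sum>b\<in>UNIV. f (Abs_ridx (j, b)))"
    by (simp add: sum.cartesian_product)
  finally show ?thesis by (simp add: UNIV_bool)
qed

definition toC :: "real ^ 'n ridx \<Rightarrow> complex ^ 'n::finite" where
  "toC x = (\<chi> j. Complex (x $ Abs_ridx (j, False)) (x $ Abs_ridx (j, True)))"

definition ofC :: "complex ^ 'n::finite \<Rightarrow> real ^ 'n ridx" where
  "ofC z = (\<chi> a. if snd (Rep_ridx a) then Im (z $ fst (Rep_ridx a)) else Re (z $ fst (Rep_ridx a)))"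

lemma toC_ofC [simp]: "toC (ofC z) = z"
  by (simp add: toC_def ofC_def vec_eq_iff)

lemma ofC_toC [simp]: "ofC (toC x) = x"
proof -
  have "ofC (toC x) $ a = x $ a" for a
    by (cases a, cases "Rep_ridx a") (auto simp: ofC_def toC_def)
  then show ?thesis by (simp add: vec_eq_iff)
qed

lemma linear_toC: "linear toC"
  by (rule linearI) (auto simp: toC_def vec_eq_iff complex_eq_iff)

lemma linear_ofC: "linear ofC"
  by (rule linearI) (auto simp: ofC_def vec_eq_iff)

lemma bounded_linear_toC: "bounded_linear toC"
  using linear_toC by (simp add: linear_conv_bounded_linear)

lemma bounded_linear_ofC: "bounded_linear ofC"
  using linear_ofC by (simp add: linear_conv_bounded_linear)

lemma continuous_on_toC [continuous_intros]: "continuous_on S f \<Longrightarrow> continuous_on S (\<lambda>x. toC (f x))"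
  by (rule bounded_linear.continuous_on[OF bounded_linear_toC])

lemma toC_vimage: "toC -` S = ofC ` S"
  by (auto simp: image_iff) (metis ofC_toC)

lemma open_toC_vimage: "open S \<Longrightarrow> open (toC -` S)"
  by (intro open_vimage continuous_intros)

lemma compact_toC_vimage: "compact S \<Longrightarrow> compact (toC -` S)"
  unfolding toC_vimage
  by (intro compact_continuous_image bounded_linear.continuous_on[OF bounded_linear_ofC] continuous_on_id)

lemma toC_axis:
  "toC (axis (Abs_ridx (j, False)) 1) = cbasis j" "toC (axis (Abs_ridx (j, True)) 1) = \<i> *s cbasis j"
  by (auto simp: toC_def vec_eq_iff complex_eq_iff axis_def Abs_ridx_inject')


section \<open>The volume density\<close>

text \<open>Multiples of the other rows produce a determinant with two equal rows. Summed over k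
  this is how the trace appears in Jacobi's formula.\<close>

lemma det_replace_row_combination:
  fixes A :: "'a::comm_ring_1 ^ 'm ^ 'm::finite"
  shows "det (\<chi> i. if i = k then (\<Sum>l\<in>UNIV. c l *s A $ l) else A $ i) = c k * det A"
proof -
  have "det (\<chi> i. if i = k then (\<Sum>l\<in>UNIV. c l *s A $ l) else A $ i) =
      (\<Sum>l\<in>UNIV. c l * det (\<chi> i. if i = k then A $ l else A $ i))"
    using det_linear_row_sum[OF finite[of UNIV], of k "\<lambda>_ l. c l *s A $ l" "\<lambda>i. A $ i"]
    by (simp add: det_row_mul[of k])
  also have "\<dots> = (\<Sum>l\<in>UNIV. if l = k then c k * det A else 0)"
  proof (intro sum.cong refl)
    fix l
    show "c l * det (\<chi> i. if i = k then A $ l else A $ i) = (if l = k then c k * det A else 0)"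
    proof (cases "l = k")
      case True
      then have "(\<chi> i. if i = k then A $ l else A $ i) = A" by (simp add: vec_eq_iff)
      then show ?thesis using True by simp
    next
      case False
      then have "det (\<chi> i. if i = k then A $ l else A $ i) = 0"
        by (intro det_identical_rows[of l k]) (auto simp: row_def vec_eq_iff)
      then show ?thesis using False by simp
    qed
  qed
  finally show ?thesis by simp
qed

lemma has_derivative_det:
  fixes A :: "'v::real_normed_vector \<Rightarrow> real ^ 'm ^ 'm::finite"
  assumes A: "\<And>i j. ((\<lambda>x. A x $ i $ j) has_derivative (\<lambda>v. A' v $ i $ j)) (at z)"
  shows "((\<lambda>x. det (A x)) has_derivative (\<lambda>v. \<Sum>k\<in>UNIV. det (\<chi> i. if i = k then A' v $ i else A z $ i))) (at z)"
proof -
  let ?P = "{p. p permutes (UNIV :: 'm set)}"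
  have "((\<lambda>x. det (A x)) has_derivative
      (\<lambda>v. \<Sum>p\<in>?P. of_int (sign p) * (\<Sum>k\<in>UNIV. A' v $ k $ p k * (\<Prod>i\<in>UNIV - {k}. A z $ i $ p i)))) (at z)"
    unfolding det_def
    by (intro has_derivative_sum has_derivative_mult_right has_derivative_prod A)
  moreover have "(\<Sum>p\<in>?P. of_int (sign p) * (\<Sum>k\<in>UNIV. A' v $ k $ p k * (\<Prod>i\<in>UNIV - {k}. A z $ i $ p i))) =
      (\<Sum>k\<in>UNIV. det (\<chi> i. if i = k then A' v $ i else A z $ i))" for v
  proof -
    have "(\<Prod>i\<in>UNIV. (if i = k then A' v $ i else A z $ i) $ p i) = A' v $ k $ p k * (\<Prod>i\<in>UNIV - {k}. A z $ i $ p i)" for k p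
      by (subst prod.remove[of _ k]) auto
    then have "det (\<chi> i. if i = k then A' v $ i else A z $ i) =
        (\<Sum>p\<in>?P. of_int (sign p) * (A' v $ k $ p k * (\<Prod>i\<in>UNIV - {k}. A z $ i $ p i)))" for k
      by (simp add: det_def)
    then show ?thesis by (simp add: sum_distrib_left) (rule sum.swap)
  qed
  ultimately show ?thesis by simp
qed

definition gram :: "complex ^ 'n ^ 'n::finite \<Rightarrow> real ^ 'n ridx ^ 'n ridx" where
  "gram H = (\<chi> a b. Re (hform H (toC (axis a 1)) (toC (axis b 1))))"

text \<open>The Riemannian volume density of Re h. The absolute value stands in for positivity of
  the Gram determinant, so that nonvanishing (\<open>det_gram_nonzero\<close>) is enough.\<close>

definition rho :: "complex ^ 'n ^ 'n::finite \<Rightarrow> real" where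
  "rho H = sqrt \<bar>det (gram H)\<bar>"

lemma toC_expand: "toC x = (\<Sum>a\<in>UNIV. x $ a *\<^sub>R toC (axis a 1))"
proof -
  have "toC x = toC (\<Sum>a\<in>UNIV. x $ a *s axis a 1)" by (simp add: basis_expansion)
  also have "\<dots> = (\<Sum>a\<in>UNIV. x $ a *\<^sub>R toC (axis a 1))"
    unfolding linear_sum[OF linear_toC] scalar_mult_eq_scaleR linear_cmul[OF linear_toC] ..
  finally show ?thesis .
qed

lemma hform_scaleR_left: "hform H (r *\<^sub>R v) w = r *\<^sub>R hform H v w"
  and hform_scaleR_right: "hform H v (r *\<^sub>R w) = r *\<^sub>R hform H v w"
  by (simp_all add: hform_def scaleR_sum_right)

lemma hform_sum_right: "hform H v (\<Sum>i\<in>I. f i) = (\<Sum>i\<in>I. hform H v (f i))"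
  by (induction I rule: infinite_finite_induct) (auto simp: hform_add_right)

lemma Re_hform_toC: "Re (hform H (toC x) (toC y)) = (\<Sum>a\<in>UNIV. \<Sum>b\<in>UNIV. x $ a * y $ b * gram H $ a $ b)"
  unfolding toC_expand[of x] toC_expand[of y] gram_def
  by (simp add: hform_sum_left hform_sum_right hform_scaleR_left hform_scaleR_right sum_distrib_left mult.assoc)
    (subst sum.swap, simp add: mult.left_commute)

lemma det_gram_nonzero:
  assumes "posdef H" shows "det (gram H) \<noteq> 0"
proof -
  have "x = 0" if "gram H *v x = 0" for x
  proof (rule ccontr)
    assume "x \<noteq> 0"
    then have "toC x \<noteq> 0" by (metis ofC_toC linear_0[OF linear_ofC])
    then have "0 < Re (hform H (toC x) (toC x))" using assms by (simp add: posdef_def)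
    also have "Re (hform H (toC x) (toC x)) = (\<Sum>a\<in>UNIV. x $ a * (gram H *v x) $ a)"
      unfolding Re_hform_toC matrix_vector_mult_def by (simp add: sum_distrib_left mult_ac)
    finally show False using that by simp
  qed
  then have "invertible (gram H)"
    using matrix_left_invertible_ker[of "gram H"] invertible_left_inverse[of "gram H"] by blast
  then show ?thesis by (simp add: invertible_det_nz)
qed

lemma rho_pos: "posdef H \<Longrightarrow> 0 < rho H"
  using det_gram_nonzero by (auto simp: rho_def)

definition jac :: "(complex ^ 'n \<Rightarrow> complex ^ 'n::finite) \<Rightarrow> real" where
  "jac T = \<bar>det (matrix (\<lambda>x. ofC (T (toC x))))\<bar>"

text \<open>The Gram matrices are related by congruence with the real Jacobian matrix, which enters
  the determinant squared and the density once, up to sign.\<close>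

lemma rho_transform:
  fixes T :: "complex ^ 'n \<Rightarrow> complex ^ 'n::finite"
  assumes "linear T" and HH: "\<And>v w. hform H v w = hform H' (T v) (T w)"
  shows "rho H = jac T * rho H'"
proof -
  define M where "M = matrix (\<lambda>x. ofC (T (toC x)))"
  have "gram H $ a $ b = (Finite_Cartesian_Product.transpose M ** (gram H' ** M)) $ a $ b" for a b
  proof -
    have "gram H $ a $ b = Re (hform H' (toC (ofC (T (toC (axis a 1))))) (toC (ofC (T (toC (axis b 1))))))"
      by (simp add: gram_def HH)
    also have "\<dots> = (\<Sum>c\<in>UNIV. \<Sum>d\<in>UNIV. M $ c $ a * M $ d $ b * gram H' $ c $ d)"
      unfolding Re_hform_toC M_def matrix_def by simp
    also have "\<dots> = (Finite_Cartesian_Product.transpose M ** (gram H' ** M)) $ a $ b"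
      by (simp add: matrix_matrix_mult_def Finite_Cartesian_Product.transpose_def sum_distrib_left mult_ac)
    finally show ?thesis .
  qed
  then have "gram H = Finite_Cartesian_Product.transpose M ** (gram H' ** M)" by (simp add: vec_eq_iff)
  then have "det (gram H) = det M * det M * det (gram H')"
    by (simp add: det_mul det_transpose)
  then show ?thesis
    by (simp add: rho_def jac_def M_def[symmetric] abs_mult real_sqrt_mult)
qed

text \<open>The variation H' is represented by the complex endomorphism E with H'(x, y) = H(E x, y),
  and R is its real matrix. The trace of a complex linear map over the reals is twice the real part
  of its complex trace, hence the factor 2.\<close>

lemma gram_derivative:
  fixes H :: "complex ^ 'n ^ 'n::finite"
  assumes H: "posdef H"
  obtains R :: "real ^ 'n ridx ^ 'n ridx"
  where "\<And>a. gram H' $ a = (\<Sum>c\<in>UNIV. R $ c $ a *s gram H $ c)"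
    "(\<Sum>a\<in>UNIV. R $ a $ a) = 2 * Re (\<Sum>i\<in>UNIV. \<Sum>k\<in>UNIV. inv_entry H k i * H' $ i $ k)"
proof -
  define E :: "complex ^ 'n \<Rightarrow> complex ^ 'n" where
    "E x = (\<chi> l. \<Sum>j\<in>UNIV. \<Sum>k\<in>UNIV. x $ j * H' $ j $ k * inv_entry H k l)" for x
  define R :: "real ^ 'n ridx ^ 'n ridx" where "R = (\<chi> c a. ofC (E (toC (axis a 1))) $ c)"
  have E: "hform H' x y = hform H (E x) y" for x y
  proof -
    have "hform H (E x) y = (\<Sum>l\<in>UNIV. \<Sum>m\<in>UNIV. \<Sum>j\<in>UNIV. \<Sum>k\<in>UNIV. x $ j * H' $ j $ k * cnj (y $ m) * (inv_entry H k l * H $ l $ m))"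
      by (simp add: hform_def E_def sum_distrib_left sum_distrib_right mult_ac)
    also have "\<dots> = (\<Sum>j\<in>UNIV. \<Sum>k\<in>UNIV. \<Sum>l\<in>UNIV. \<Sum>m\<in>UNIV. x $ j * H' $ j $ k * cnj (y $ m) * (inv_entry H k l * H $ l $ m))"
      by (rule sum_swap4)
    also have "\<dots> = (\<Sum>j\<in>UNIV. \<Sum>k\<in>UNIV. \<Sum>m\<in>UNIV. \<Sum>l\<in>UNIV. x $ j * H' $ j $ k * cnj (y $ m) * (inv_entry H k l * H $ l $ m))"
      by (intro sum.cong refl sum.swap)
    also have "\<dots> = (\<Sum>j\<in>UNIV. \<Sum>k\<in>UNIV. \<Sum>m\<in>UNIV. x $ j * H' $ j $ k * cnj (y $ m) * (if k = m then 1 else 0))"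
      unfolding sum_distrib_left[symmetric] inv_entry_mult(1)[OF H] ..
    also have "\<dots> = hform H' x y"
      by (simp add: hform_def if_distrib mult_ac cong: if_cong)
    finally show ?thesis by simp
  qed
  have "gram H' $ a = (\<Sum>c\<in>UNIV. R $ c $ a *s gram H $ c)" for a
  proof -
    have "gram H' $ a $ b = (\<Sum>c\<in>UNIV. R $ c $ a *s gram H $ c) $ b" for b
    proof -
      have "gram H' $ a $ b = Re (hform H (toC (ofC (E (toC (axis a 1))))) (toC (axis b 1)))"
        by (simp add: gram_def E)
      also have "\<dots> = (\<Sum>c\<in>UNIV. \<Sum>d\<in>UNIV. R $ c $ a * axis b 1 $ d * gram H $ c $ d)"
        unfolding Re_hform_toC R_def by simp
      also have "\<dots> = (\<Sum>c\<in>UNIV. \<Sum>d\<in>UNIV. if d = b then R $ c $ a * gram H $ c $ b else 0)"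
        by (intro sum.cong refl) (auto simp: axis_def)
      finally show ?thesis by simp
    qed
    then show ?thesis by (simp add: vec_eq_iff)
  qed
  moreover have "(\<Sum>a\<in>UNIV. R $ a $ a) = 2 * Re (\<Sum>i\<in>UNIV. \<Sum>k\<in>UNIV. inv_entry H k i * H' $ i $ k)"
  proof -
    have "E (cbasis j) $ j = (\<Sum>k\<in>UNIV. inv_entry H k j * H' $ j $ k)" for j
    proof -
      have "E (cbasis j) $ j = (\<Sum>i\<in>UNIV. if i = j then \<Sum>k\<in>UNIV. inv_entry H k j * H' $ j $ k else 0)"
        unfolding E_def vec_lambda_beta by (intro sum.cong refl) (auto simp: axis_def mult_ac)
      then show ?thesis by simp
    qed
    moreover have "E (\<i> *s x) = \<i> *s E x" for x
      by (simp add: E_def vec_eq_iff sum_distrib_left mult_ac)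
    ultimately show ?thesis
      by (simp add: sum_ridx R_def toC_axis ofC_def sum_distrib_left)
  qed
  ultimately show ?thesis using that by blast
qed

text \<open>Jacobi's formula for the Gram determinant; the factor 2 between real and complex trace
  is cancelled by the square root. The sign of the determinant is treated by cases.\<close>

lemma rho_has_derivative:
  fixes H :: "'v::real_normed_vector \<Rightarrow> complex ^ 'n ^ 'n::finite"
  assumes pd: "posdef (H z)" and H: "\<And>i j. ((\<lambda>x. H x $ i $ j) has_derivative (\<lambda>v. H' v $ i $ j)) (at z)"
  shows "((\<lambda>x. rho (H x)) has_derivative (\<lambda>v. rho (H z) *
    Re (\<Sum>i\<in>UNIV. \<Sum>k\<in>UNIV. inv_entry (H z) k i * H' v $ i $ k))) (at z)"
proof -
  have "((\<lambda>x. gram (H x) $ a $ b) has_derivative (\<lambda>v. gram (H' v) $ a $ b)) (at z)" for a b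
    unfolding gram_def hform_def vec_lambda_beta
    by (intro has_derivative_Re has_derivative_sum has_derivative_mult_left H)
  from has_derivative_det[of "\<lambda>x. gram (H x)" "\<lambda>v. gram (H' v)", OF this]
  have D: "((\<lambda>x. det (gram (H x))) has_derivative
    (\<lambda>v. \<Sum>k\<in>UNIV. det (\<chi> i. if i = k then gram (H' v) $ i else gram (H z) $ i))) (at z)" .
  let ?d = "det (gram (H z))"
  let ?t = "\<lambda>v. Re (\<Sum>i\<in>UNIV. \<Sum>k\<in>UNIV. inv_entry (H z) k i * H' v $ i $ k)"
  have "(\<Sum>k\<in>UNIV. det (\<chi> i. if i = k then gram (H' v) $ i else gram (H z) $ i)) = 2 * ?t v * ?d" for v
  proof (rule gram_derivative[OF pd, of "H' v"])
    fix R :: "real ^ 'n ridx ^ 'n ridx"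
    assume R: "\<And>a. gram (H' v) $ a = (\<Sum>c\<in>UNIV. R $ c $ a *s gram (H z) $ c)"
      "(\<Sum>a\<in>UNIV. R $ a $ a) = 2 * ?t v"
    have "det (\<chi> i. if i = k then gram (H' v) $ i else gram (H z) $ i) = R $ k $ k * ?d" for k
    proof -
      have "(\<chi> i. if i = k then gram (H' v) $ i else gram (H z) $ i) =
          (\<chi> i. if i = k then (\<Sum>c\<in>UNIV. R $ c $ k *s gram (H z) $ c) else gram (H z) $ i)"
        by (simp add: vec_eq_iff R(1))
      then show ?thesis
        by (simp only: det_replace_row_combination[of k "\<lambda>c. R $ c $ k"])
    qed
    then show ?thesis by (simp add: R(2) flip: sum_distrib_right)
  qed
  then have D': "((\<lambda>x. det (gram (H x))) has_derivative (\<lambda>v. 2 * ?t v * ?d)) (at z)" using D by simp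
  have nz: "?d \<noteq> 0" by (rule det_gram_nonzero[OF pd])
  have "((\<lambda>t. sqrt \<bar>t\<bar>) has_real_derivative rho (H z) / (2 * ?d)) (at ?d)"
  proof (cases "?d > 0")
    case True
    then have "(sqrt has_real_derivative inverse (sqrt ?d) / 2) (at ?d)" by (rule DERIV_real_sqrt)
    then have "((\<lambda>t. sqrt \<bar>t\<bar>) has_real_derivative inverse (sqrt ?d) / 2) (at ?d)"
      by (rule has_field_derivative_transform_within_open[of _ _ _ "{0<..}"]) (use True in auto)
    moreover have "inverse (sqrt ?d) / 2 = rho (H z) / (2 * ?d)"
      using True real_sqrt_mult_self[of ?d] by (simp add: rho_def field_simps)
    ultimately show ?thesis by simp
  next
    case False
    then have neg: "?d < 0" using nz by simp
    then have "((\<lambda>t. sqrt (- t)) has_real_derivative - (inverse (sqrt (- ?d)) / 2)) (at ?d)"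
      by (auto intro!: derivative_eq_intros)
    then have "((\<lambda>t. sqrt \<bar>t\<bar>) has_real_derivative - (inverse (sqrt (- ?d)) / 2)) (at ?d)"
      by (rule has_field_derivative_transform_within_open[of _ _ _ "{..<0}"]) (use neg in auto)
    moreover have "- (inverse (sqrt (- ?d)) / 2) = rho (H z) / (2 * ?d)"
      using neg real_sqrt_mult_self[of "- ?d"] by (simp add: rho_def field_simps)
    ultimately show ?thesis by simp
  qed
  from has_derivative_compose[OF D' this[unfolded has_field_derivative_def]]
  show ?thesis using nz by (simp add: rho_def[symmetric] field_simps)
qed

lemma C1_on_rho:
  fixes H :: "'v::real_normed_vector \<Rightarrow> complex ^ 'n ^ 'n::finite"
  assumes S: "open S" and H: "\<And>i j. C1_on (\<lambda>z. H z $ i $ j) S" and pd: "\<And>z. z \<in> S \<Longrightarrow> posdef (H z)"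
  shows "C1_on (\<lambda>z. rho (H z)) S"
proof (rule C1_onI)
  fix z assume z: "z \<in> S"
  show "((\<lambda>z. rho (H z)) has_derivative (\<lambda>v. rho (H z) *
      Re (\<Sum>i\<in>UNIV. \<Sum>k\<in>UNIV. inv_entry (H z) k i * fd (\<lambda>x. H x $ i $ k) z v))) (at z)"
    using rho_has_derivative[where H = H and z = z, OF pd[OF z], of "\<lambda>v. \<chi> i j. fd (\<lambda>x. H x $ i $ j) z v"] C1_onD(2)[OF H z] by simp
next
  fix v
  have "C1_on (\<lambda>z. det (gram (H z))) S"
    unfolding gram_def hform_def
    by (intro Ck_on_det[OF S], unfold vec_lambda_beta)
      (intro Ck_on_linear[OF S bounded_linear_Re] Ck_on_sum[OF S] Ck_on_mult[OF S] Ck_on_const H)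
  then have "continuous_on S (\<lambda>z. rho (H z))"
    unfolding rho_def by (intro continuous_intros C1_onD(4))
  then show "continuous_on S (\<lambda>z. rho (H z) *
      Re (\<Sum>i\<in>UNIV. \<Sum>k\<in>UNIV. inv_entry (H z) k i * fd (\<lambda>x. H x $ i $ k) z v))"
    by (intro continuous_intros C1_onD(3)[OF H] C1_onD(4)[OF C1_on_inv_entry[OF S H pd]])
qed

lemma del_rho:
  fixes H :: "complex ^ 'n \<Rightarrow> complex ^ 'n ^ 'n::finite"
  assumes S: "open S" and H: "\<And>i j. C1_on (\<lambda>z. H z $ i $ j) S" and pd: "\<And>z. z \<in> S \<Longrightarrow> posdef (H z)"
    and z: "z \<in> S"
  shows "del (\<lambda>z. of_real (rho (H z))) z v = of_real (rho (H z)) *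
    (\<Sum>i\<in>UNIV. \<Sum>k\<in>UNIV. inv_entry (H z) k i * del (\<lambda>x. H x $ i $ k) z v)"
proof -
  let ?t = "\<lambda>v. \<Sum>i\<in>UNIV. \<Sum>k\<in>UNIV. inv_entry (H z) k i * fd (\<lambda>x. H x $ i $ k) z v"
  have D: "((\<lambda>z. rho (H z)) has_derivative (\<lambda>v. rho (H z) * Re (?t v))) (at z)"
    using rho_has_derivative[where H = H and z = z, OF pd[OF z], of "\<lambda>v. \<chi> i j. fd (\<lambda>x. H x $ i $ j) z v"] C1_onD(2)[OF H z] by simp
  have herm: "fd (\<lambda>x. H x $ k $ i) z v = cnj (fd (\<lambda>x. H x $ i $ k) z v)" for i k v
  proof -
    have "fd (\<lambda>x. H x $ k $ i) z = fd (\<lambda>x. cnj (H x $ i $ k)) z"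
      by (rule fd_cong_open[OF S z]) (rule posdef_entry_hermitian[OF pd])
    then show ?thesis by (simp add: fd_linear[OF bounded_linear_cnj C1_onD(1)[OF H z]])
  qed
  have "?t v \<in> \<real>" for v
  proof -
    have "cnj (?t v) = (\<Sum>i\<in>UNIV. \<Sum>k\<in>UNIV. inv_entry (H z) i k * fd (\<lambda>x. H x $ k $ i) z v)"
      by (simp add: herm[symmetric] inv_entry_hermitian[OF pd[OF z], symmetric])
    also have "\<dots> = ?t v" by (rule sum.swap)
    finally show ?thesis by (simp add: Reals_cnj_iff)
  qed
  then have R: "of_real (Re (?t v)) = ?t v" for v by (rule of_real_Re)
  have d: "(\<lambda>z. rho (H z)) differentiable (at z)" using D by (auto simp: differentiable_def)
  have fdr: "fd (\<lambda>z. complex_of_real (rho (H z))) z v = of_real (rho (H z)) * ?t v" for v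
    unfolding fd_linear[OF bounded_linear_of_real d] fd_eq[OF D] of_real_mult R ..
  have "del (\<lambda>z. of_real (rho (H z))) z v = of_real (rho (H z)) * ((?t v - \<i> * ?t (\<i> *s v)) / 2)"
    unfolding del_def fdr by (simp add: algebra_simps)
  also have "(?t v - \<i> * ?t (\<i> *s v)) / 2 = (\<Sum>i\<in>UNIV. \<Sum>k\<in>UNIV. inv_entry (H z) k i * del (\<lambda>x. H x $ i $ k) z v)"
    unfolding del_def sum_distrib_left sum_subtractf[symmetric] sum_divide_distrib
    by (intro sum.cong refl) (simp add: algebra_simps)
  finally show ?thesis .
qed


section \<open>Integration in a chart\<close>

lemma compact_support_bounded:
  fixes g :: "'e::euclidean_space \<Rightarrow> 'w::real_normed_vector"
  assumes "continuous_on UNIV g" "compact K" "\<And>x. x \<notin> K \<Longrightarrow> g x = 0"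
  obtains M where "0 \<le> M" "\<And>x. norm (g x) \<le> M"
proof -
  have "bounded (g ` K)"
    by (intro compact_imp_bounded compact_continuous_image continuous_on_subset[OF assms(1)] assms(2)) simp
  then obtain M where M: "\<And>x. x \<in> K \<Longrightarrow> norm (g x) \<le> M" by (auto simp: bounded_iff)
  have "norm (g x) \<le> max M 0" for x
    using M[of x] assms(3)[of x] by (cases "x \<in> K") auto
  then show ?thesis using that[of "max M 0"] by auto
qed

lemma compact_support_integrable:
  fixes g :: "'e::euclidean_space \<Rightarrow> 'w::euclidean_space"
  assumes g: "continuous_on UNIV g" and K: "compact K" "\<And>x. x \<notin> K \<Longrightarrow> g x = 0"
  shows "g absolutely_integrable_on UNIV"
proof -
  obtain a where a: "K \<subseteq> cbox (- a) a"
    using bounded_subset_cbox_symmetric[OF compact_imp_bounded[OF K(1)]] by blast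
  have "g absolutely_integrable_on cbox (- a) a"
    by (intro absolutely_integrable_continuous continuous_on_subset[OF g]) simp
  then have "(\<lambda>x. if x \<in> cbox (- a) a then g x else 0) absolutely_integrable_on UNIV"
    by (simp only: absolutely_integrable_restrict_UNIV)
  moreover have "(\<lambda>x. if x \<in> cbox (- a) a then g x else 0) = g"
    using a K(2) by (intro ext) auto
  ultimately show ?thesis by simp
qed

lemma has_integral_shift_compact_support:
  fixes g :: "'e::euclidean_space \<Rightarrow> 'w::euclidean_space"
  assumes g: "continuous_on UNIV g" and K: "compact K" "\<And>x. x \<notin> K \<Longrightarrow> g x = 0"
  shows "((\<lambda>x. g (x + c)) has_integral integral UNIV g) UNIV"
proof -
  have "bounded ((\<lambda>x. x - c) ` K)"
    by (intro compact_imp_bounded compact_continuous_image K(1) continuous_intros)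
  then obtain a where a: "(\<lambda>x. x - c) ` K \<subseteq> cbox (- a) a" using bounded_subset_cbox_symmetric by blast
  have K': "x \<in> cbox (- a + c) (a + c)" if "x \<in> K" for x
  proof -
    have "x - c \<in> cbox (- a) a" using a that by auto
    then show ?thesis by (auto simp: mem_box inner_diff_left inner_add_left algebra_simps)
  qed
  obtain I where I: "(g has_integral I) (cbox (- a + c) (a + c))"
    using integrable_continuous[OF continuous_on_subset[OF g], of "- a + c" "a + c"] by auto
  have "(g has_integral I) UNIV"
    by (rule has_integral_on_superset[OF I]) (use K K' in auto)
  then have I': "integral UNIV g = I" by (rule integral_unique)
  have "((\<lambda>x. g (x + c)) has_integral I) (cbox (- a) a)"
    using I has_integral_shift_cbox_iff[of g c I "- a" a] by (simp add: o_def add.commute)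
  then show ?thesis unfolding I'
  proof (rule has_integral_on_superset)
    fix x assume "x \<notin> cbox (- a) a"
    then have "x + c \<notin> K" using a by force
    then show "g (x + c) = 0" by (rule K(2))
  qed simp
qed

text \<open>By translation invariance the difference quotients have integral 0. They are bounded by
  the supremum of the derivative and supported in one box, so dominated convergence passes to the
  limit without iterated integrals.\<close>

lemma integral_directional_derivative:
  fixes f :: "'e::euclidean_space \<Rightarrow> 'w::euclidean_space"
  assumes f: "C1_on f UNIV" and K: "compact K" "\<And>x. x \<notin> K \<Longrightarrow> f x = 0"
  shows "(\<lambda>x. fd f x v) absolutely_integrable_on UNIV" "integral UNIV (\<lambda>x. fd f x v) = 0"
proof -
  note cf = C1_onD(4)[OF f] and cd = C1_onD(3)[OF f, of v]
  have Kd: "fd f x v = 0" if "x \<notin> K" for x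
  proof -
    have "fd f x = fd (\<lambda>x. 0) x"
      by (rule fd_cong_open[of "- K"]) (use K that compact_imp_closed[OF K(1)] in auto)
    then show ?thesis by simp
  qed
  show "(\<lambda>x. fd f x v) absolutely_integrable_on UNIV"
    by (rule compact_support_integrable[OF cd K(1) Kd])
  obtain M where M: "0 \<le> M" "\<And>x. norm (fd f x v) \<le> M"
    using compact_support_bounded[OF cd K(1) Kd] by blast
  define q where "q n x = real (Suc n) *\<^sub>R (f (x + (1 / real (Suc n)) *\<^sub>R v) - f x)" for n x
  have qM: "norm (q n x) \<le> M" for n x
  proof -
    let ?t = "1 / real (Suc n)"
    have "norm (f (x + ?t *\<^sub>R v) - f (x + 0 *\<^sub>R v)) \<le> M * norm (?t - 0)"
    proof (rule differentiable_bound[of UNIV "\<lambda>s. f (x + s *\<^sub>R v)" "\<lambda>s h. fd f (x + s *\<^sub>R v) (h *\<^sub>R v)"])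
      fix s :: real
      show "((\<lambda>s. f (x + s *\<^sub>R v)) has_derivative (\<lambda>h. fd f (x + s *\<^sub>R v) (h *\<^sub>R v))) (at s within UNIV)"
        by (rule has_derivative_compose[OF _ C1_onD(2)[OF f]]) (auto intro!: derivative_eq_intros)
      have lin: "linear (fd f (x + s *\<^sub>R v))" by (rule linear_fd[OF C1_onD(1)[OF f]]) simp
      show "onorm (\<lambda>h. fd f (x + s *\<^sub>R v) (h *\<^sub>R v)) \<le> M"
        using M(1) mult_right_mono[OF M(2)[of "x + s *\<^sub>R v"], of "\<bar>_\<bar>"]
        by (intro onorm_bound) (auto simp: linear_cmul[OF lin] mult.commute)
    qed auto
    then have "norm (f (x + ?t *\<^sub>R v) - f x) \<le> M * ?t" by simp
    then have "real (Suc n) * norm (f (x + ?t *\<^sub>R v) - f x) \<le> real (Suc n) * (M * ?t)"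
      by (intro mult_left_mono) auto
    then show ?thesis by (simp add: q_def)
  qed
  have qlim: "(\<lambda>n. q n x) \<longlonglongrightarrow> fd f x v" for x
  proof -
    have "((\<lambda>s. f (x + s *\<^sub>R v)) has_derivative (\<lambda>h. fd f (x + 0 *\<^sub>R v) (h *\<^sub>R v))) (at 0)"
      by (rule has_derivative_compose[OF _ C1_onD(2)[OF f]]) (auto intro!: derivative_eq_intros)
    moreover have lin: "linear (fd f x)" by (rule linear_fd[OF C1_onD(1)[OF f]]) simp
    ultimately have "((\<lambda>s. f (x + s *\<^sub>R v)) has_vector_derivative fd f x v) (at 0)"
      by (simp add: has_vector_derivative_def linear_cmul[OF lin])
    then have "((\<lambda>h. norm (f (x + h *\<^sub>R v) - f x - h *\<^sub>R fd f x v) / norm h) \<longlongrightarrow> 0) (at 0)"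
      unfolding has_vector_derivative_def has_derivative_at by simp
    moreover have "norm (f (x + h *\<^sub>R v) - f x - h *\<^sub>R fd f x v) / norm h =
        norm ((1 / h) *\<^sub>R (f (x + h *\<^sub>R v) - f x) - fd f x v)" if "h \<noteq> 0" for h
    proof -
      have "(1 / h) *\<^sub>R (f (x + h *\<^sub>R v) - f x) - fd f x v = (1 / h) *\<^sub>R (f (x + h *\<^sub>R v) - f x - h *\<^sub>R fd f x v)"
        using that by (simp add: algebra_simps)
      then show ?thesis by (simp add: divide_inverse mult.commute)
    qed
    then have "\<forall>\<^sub>F h in at 0. norm (f (x + h *\<^sub>R v) - f x - h *\<^sub>R fd f x v) / norm h =
        norm ((1 / h) *\<^sub>R (f (x + h *\<^sub>R v) - f x) - fd f x v)"
      by (auto simp: eventually_at_filter)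
    ultimately have "((\<lambda>h. norm ((1 / h) *\<^sub>R (f (x + h *\<^sub>R v) - f x) - fd f x v)) \<longlongrightarrow> 0) (at 0)"
      by (rule Lim_transform_eventually)
    then have "((\<lambda>h. (1 / h) *\<^sub>R (f (x + h *\<^sub>R v) - f x)) \<longlongrightarrow> fd f x v) (at 0)"
      by (simp add: tendsto_norm_zero_iff LIM_zero_iff)
    moreover have "filterlim (\<lambda>n. 1 / real (Suc n)) (at 0) sequentially"
      unfolding filterlim_at using LIMSEQ_inverse_real_of_nat by (simp add: inverse_eq_divide)
    ultimately have "(\<lambda>n. (1 / (1 / real (Suc n))) *\<^sub>R (f (x + (1 / real (Suc n)) *\<^sub>R v) - f x)) \<longlonglongrightarrow> fd f x v"
      by (rule filterlim_compose)
    then show ?thesis by (simp add: q_def)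
  qed
  have qint: "(q n has_integral 0) UNIV" for n
  proof -
    have "f integrable_on UNIV"
      using compact_support_integrable[OF cf K] set_lebesgue_integral_eq_integral(1) by blast
    then have "((\<lambda>x. f (x + (1 / real (Suc n)) *\<^sub>R v) - f x) has_integral (integral UNIV f - integral UNIV f)) UNIV"
      using K by (intro has_integral_diff has_integral_shift_compact_support[OF cf K(1)] integrable_integral) auto
    from has_integral_cmul[OF this, of "real (Suc n)"] show ?thesis by (simp add: q_def[abs_def])
  qed
  \<comment> \<open>The union of the translates of K by - t v for t in [0, 1] is compact and
    contains the supports of all difference quotients, whose steps 1/(n + 1) lie in that
    interval.\<close>
  define K' where "K' = (\<lambda>(x, t). x - t *\<^sub>R v) ` (K \<times> {0..1})"
  have K': "compact K'"
    unfolding K'_def by (intro compact_continuous_image compact_Times K(1)) (auto simp: case_prod_beta intro!: continuous_intros)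
  then obtain a where a: "K' \<subseteq> cbox (- a) a"
    using bounded_subset_cbox_symmetric[OF compact_imp_bounded] by blast
  have q0: "q n x = 0" if "x \<notin> cbox (- a) a" for n x
  proof -
    have "f (x + t *\<^sub>R v) = 0" if "t \<in> {0..1}" for t
    proof (rule K(2), rule notI)
      assume "x + t *\<^sub>R v \<in> K"
      then have "(x + t *\<^sub>R v) - t *\<^sub>R v \<in> K'" using that unfolding K'_def by force
      then show False using a \<open>x \<notin> cbox (- a) a\<close> by auto
    qed
    from this[of "1 / real (Suc n)"] this[of 0] show ?thesis by (simp add: q_def)
  qed
  define h where "h x = (if x \<in> cbox (- a) a then M else 0)" for x
  have "h integrable_on UNIV"
    unfolding h_def integrable_restrict_UNIV by (rule integrable_const)
  moreover have "norm (q n x) \<le> h x" for n x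
    using qM[of n x] q0[of x n] M(1) by (auto simp: h_def)
  ultimately have "(\<lambda>n. integral UNIV (q n)) \<longlonglongrightarrow> integral UNIV (\<lambda>x. fd f x v)"
    using qint qlim by (intro dominated_convergence(2)[of q UNIV h]) (auto simp: integrable_on_def)
  moreover have "integral UNIV (q n) = 0" for n using qint by (rule integral_unique)
  ultimately show "integral UNIV (\<lambda>x. fd f x v) = 0" by (simp add: LIMSEQ_const_iff)
qed

section \<open>Integrals of functions of n complex variables\<close>

definition cint :: "(complex ^ 'n::finite \<Rightarrow> real) \<Rightarrow> real" where
  "cint F = integral UNIV (\<lambda>x. F (toC x))"

definition cabs :: "(complex ^ 'n::finite \<Rightarrow> real) \<Rightarrow> bool" where
  "cabs F \<longleftrightarrow> (\<lambda>x. F (toC x)) absolutely_integrable_on UNIV"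

lemma cabs_integrable: "cabs F \<Longrightarrow> (\<lambda>x. F (toC x)) integrable_on UNIV"
  unfolding cabs_def by (rule set_lebesgue_integral_eq_integral(1))

lemma cabs_continuous:
  fixes F :: "complex ^ 'n::finite \<Rightarrow> real"
  assumes "continuous_on UNIV F" "compact K" "\<And>z. z \<notin> K \<Longrightarrow> F z = 0"
  shows "cabs F"
  unfolding cabs_def
  by (rule compact_support_integrable[of _ "toC -` K"])
    (use assms in \<open>auto intro!: compact_toC_vimage continuous_on_compose2[OF assms(1)] continuous_intros\<close>)

lemma cint_add: "cabs F \<Longrightarrow> cabs G \<Longrightarrow> cint (\<lambda>z. F z + G z) = cint F + cint G"
  unfolding cint_def by (rule integral_add) (auto intro: cabs_integrable)

lemma cint_cmult: "cint (\<lambda>z. c * F z) = c * cint F"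
  unfolding cint_def by (rule integral_mult_right)

lemma cabs_cmult: "cabs F \<Longrightarrow> cabs (\<lambda>z. c * F z)"
  unfolding cabs_def by simp

lemma cint_sum: "finite I \<Longrightarrow> (\<And>i. i \<in> I \<Longrightarrow> cabs (F i)) \<Longrightarrow> cint (\<lambda>z. \<Sum>i\<in>I. F i z) = (\<Sum>i\<in>I. cint (F i))"
  unfolding cint_def by (rule integral_sum) (auto intro: cabs_integrable)

lemma cint_mono: "cabs F \<Longrightarrow> cabs G \<Longrightarrow> (\<And>z. F z \<le> G z) \<Longrightarrow> cint F \<le> cint G"
  unfolding cint_def by (rule integral_le) (auto intro: cabs_integrable)

lemma cint_del:
  fixes f :: "complex ^ 'n::finite \<Rightarrow> complex"
  assumes f: "C1_on f UNIV" and K: "compact K" "\<And>z. z \<notin> K \<Longrightarrow> f z = 0"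
  shows "cabs (\<lambda>z. Re (del f z v))" "cint (\<lambda>z. Re (del f z v)) = 0"
proof -
  let ?g = "\<lambda>x. f (toC x)"
  have toC1: "C1_on toC UNIV"
    by (rule C1_onI[of _ _ "\<lambda>_. toC"]) (auto intro: bounded_linear.has_derivative bounded_linear_toC bounded_linear_imp_has_derivative)
  have g: "C1_on ?g UNIV" by (rule C1_on_compose[OF toC1 f]) simp
  have gK: "?g x = 0" if "x \<notin> toC -` K" for x using K(2) that by auto
  have fg: "fd f (toC x) w = fd ?g x (ofC w)" for x w
  proof -
    have "(?g has_derivative (\<lambda>u. fd f (toC x) (toC u))) (at x)"
      by (rule has_derivative_compose[OF bounded_linear_imp_has_derivative[OF bounded_linear_toC] C1_onD(2)[OF f]]) simp
    then show ?thesis by (simp add: fd_eq)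
  qed
  note I = integral_directional_derivative[OF g compact_toC_vimage[OF K(1)] gK]
  have A: "(\<lambda>x. Re (fd ?g x u)) absolutely_integrable_on UNIV" "integral UNIV (\<lambda>x. Re (fd ?g x u)) = 0"
    "(\<lambda>x. Im (fd ?g x u)) absolutely_integrable_on UNIV" "integral UNIV (\<lambda>x. Im (fd ?g x u)) = 0" for u
  proof -
    have i: "(\<lambda>x. fd ?g x u) integrable_on UNIV" using I(1) set_lebesgue_integral_eq_integral(1) by blast
    show "(\<lambda>x. Re (fd ?g x u)) absolutely_integrable_on UNIV" "(\<lambda>x. Im (fd ?g x u)) absolutely_integrable_on UNIV"
      using absolutely_integrable_linear[OF I(1) bounded_linear_Re] absolutely_integrable_linear[OF I(1) bounded_linear_Im]
      by (simp_all add: o_def)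
    show "integral UNIV (\<lambda>x. Re (fd ?g x u)) = 0" "integral UNIV (\<lambda>x. Im (fd ?g x u)) = 0"
      using integral_linear[OF i bounded_linear_Re] integral_linear[OF i bounded_linear_Im] I(2) by (simp_all add: o_def)
  qed
  have eq: "Re (del f (toC x) v) = 1 / 2 * Re (fd ?g x (ofC v)) + 1 / 2 * Im (fd ?g x (ofC (\<i> *s v)))" for x
    by (simp add: del_def fg)
  show "cabs (\<lambda>z. Re (del f z v))"
    unfolding cabs_def eq by (intro set_integral_add(1) set_integrable_mult_right A)
  show "cint (\<lambda>z. Re (del f z v)) = 0"
    unfolding cint_def eq
    by (subst integral_add) (use A in \<open>auto intro!: integrable_on_mult_right set_lebesgue_integral_eq_integral(1)\<close>)
qed

lemma cint_change:
  fixes \<tau> :: "complex ^ 'n \<Rightarrow> complex ^ 'n::finite"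
  assumes U: "open U" and \<tau>: "inj_on \<tau> U" "\<And>z. z \<in> U \<Longrightarrow> \<tau> differentiable (at z)"
    and F: "cabs F" "\<And>z. z \<notin> \<tau> ` U \<Longrightarrow> F z = 0"
    and G: "\<And>z. z \<in> U \<Longrightarrow> G z = jac (fd \<tau> z) * F (\<tau> z)" "\<And>z. z \<notin> U \<Longrightarrow> G z = 0"
  shows "cint G = cint F"
proof -
  let ?S = "toC -` U" and ?g = "\<lambda>x. ofC (\<tau> (toC x))"
  let ?g' = "\<lambda>x v. ofC (fd \<tau> (toC x) (toC v))"
  have gS: "x \<in> ?g ` ?S \<longleftrightarrow> toC x \<in> \<tau> ` U" for x
  proof
    assume "toC x \<in> \<tau> ` U"
    then obtain z where "z \<in> U" "toC x = \<tau> z" by auto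
    then show "x \<in> ?g ` ?S" by (intro image_eqI[of _ _ "ofC z"]) (auto simp flip: \<open>toC x = \<tau> z\<close>)
  qed auto
  have "(\<lambda>x. if x \<in> ?g ` ?S then vec (F (toC x)) else 0 :: real ^ 1) = (\<lambda>x. vec (F (toC x)))"
    using F(2) gS by (intro ext) (auto simp: vec_eq_iff)
  then have fS: "(\<lambda>x. vec (F (toC x)) :: real ^ 1) absolutely_integrable_on (?g ` ?S)"
    "integral (?g ` ?S) (\<lambda>x. vec (F (toC x)) :: real ^ 1) = vec (cint F)"
    unfolding absolutely_integrable_restrict_UNIV[of "?g ` ?S", symmetric] integral_restrict_UNIV[of "?g ` ?S", symmetric]
    using F(1) by (simp_all add: cabs_def cint_def absolutely_integrable_on_1_iff integral_on_1_eq)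
  have "(\<lambda>x. \<bar>det (matrix (?g' x))\<bar> *\<^sub>R (vec (F (toC (?g x))) :: real ^ 1)) absolutely_integrable_on ?S \<and>
    integral ?S (\<lambda>x. \<bar>det (matrix (?g' x))\<bar> *\<^sub>R (vec (F (toC (?g x))) :: real ^ 1)) = vec (cint F)"
  proof (subst has_absolute_integral_change_of_variables)
    show "?S \<in> sets lebesgue" using open_toC_vimage[OF U] by (simp add: borel_open)
    show "inj_on ?g ?S"
      using \<tau>(1) by (auto simp: inj_on_def) (metis toC_ofC ofC_toC)
    fix x assume "x \<in> ?S"
    then have "(\<tau> has_derivative fd \<tau> (toC x)) (at (toC x))" using \<tau>(2) fd_works by auto
    from has_derivative_compose[OF bounded_linear_imp_has_derivative[OF bounded_linear_toC] this]
    have "(?g has_derivative ?g' x) (at x)"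
      by (rule bounded_linear.has_derivative[OF bounded_linear_ofC])
    then show "(?g has_derivative ?g' x) (at x within ?S)" by (rule has_derivative_at_withinI)
  qed (use fS in simp)
  then have "integral ?S (\<lambda>x. \<bar>det (matrix (?g' x))\<bar> * F (\<tau> (toC x))) = cint F"
    by (auto simp: integral_on_1_eq vec_eq_iff)
  moreover have "integral ?S (\<lambda>x. \<bar>det (matrix (?g' x))\<bar> * F (\<tau> (toC x))) = cint G"
  proof -
    have "(\<lambda>x. if x \<in> ?S then \<bar>det (matrix (?g' x))\<bar> * F (\<tau> (toC x)) else 0) = (\<lambda>x. G (toC x))"
      using G by (intro ext) (auto simp: jac_def)
    then show ?thesis unfolding cint_def integral_restrict_UNIV[of ?S, symmetric] by simp
  qed
  ultimately show ?thesis by simp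
qed


text \<open>Since \<open>s > -2\<close>, the power \<open>|z|\<^sup>s\<close> is integrable over a disc in the plane; its integral is estimated
  by decomposing the disc into dyadic shells.\<close>

lemma cint_tube_bound:
  fixes k :: "'n::finite"
  assumes s: "- 2 < s" "s \<le> 0" and r: "0 \<le> r"
  shows "\<exists>C\<ge>0. \<forall>\<epsilon>>0. \<forall>F :: complex ^ 'n \<Rightarrow> real. cabs F \<longrightarrow> (\<forall>z. 0 \<le> F z) \<longrightarrow>
    (\<forall>z. F z \<noteq> 0 \<longrightarrow> (\<forall>j. norm (z $ j) \<le> r) \<and> 0 < norm (z $ k) \<and> norm (z $ k) \<le> \<epsilon> \<and> F z \<le> norm (z $ k) powr s) \<longrightarrow>
    cint F \<le> C * \<epsilon> powr (2 + s)"
proof -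
  define P where "P = (\<Prod>a\<in>UNIV - {Abs_ridx (k, False), Abs_ridx (k, True)}. 2 * r)"
  have P: "0 \<le> P" using r by (simp add: P_def prod_nonneg)
  \<comment> \<open>The ratio of the contributions of successive shells: the area shrinks by 1/4
    while the bound for the power grows by 2^(-s). It is below 1 precisely because s > -2.\<close>
  define q where "q = (2::real) powr (- (2 + s))"
  have q: "0 < q" "q < 1" using s powr_less_mono[of "- (2 + s)" 0 2] by (auto simp: q_def)
  define C where "C = 2 powr (- s) * 4 * P * (1 / (1 - q))"
  have "cint F \<le> C * \<epsilon> powr (2 + s)"
    if e: "0 < \<epsilon>" and F: "cabs F" "\<And>z. 0 \<le> F z"
      "\<And>z. F z \<noteq> 0 \<Longrightarrow> (\<forall>j. norm (z $ j) \<le> r) \<and> 0 < norm (z $ k) \<and> norm (z $ k) \<le> \<epsilon> \<and> F z \<le> norm (z $ k) powr s"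
    for \<epsilon> and F :: "complex ^ 'n \<Rightarrow> real"
  proof -
    \<comment> \<open>The n-th shell is enclosed in a box that is thin in the two real coordinates
      of z^k and of half-width r in the others, so its volume is 4 P (\<epsilon>/2^n)^2.\<close>
    define b :: "nat \<Rightarrow> real ^ 'n ridx" where "b n = (\<chi> a. if fst (Rep_ridx a) = k then \<epsilon> / 2 ^ n else r)" for n
    define B where "B n = cbox (- b n) (b n)" for n
    \<comment> \<open>As s \<le> 0, the power |z^k|^s on the n-th shell is at most its value at the
      inner radius \<epsilon>/2^(n+1).\<close>
    define c where "c n = (\<epsilon> / 2 ^ Suc n) powr s" for n
    have cB: "c n * measure lborel (B n) = 2 powr (- s) * 4 * P * \<epsilon> powr (2 + s) * q ^ n" for n
    proof -
      have "0 \<in> cbox (- b n) (b n)" using e r by (auto simp: mem_box_cart b_def)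
      then have "measure lborel (B n) = (\<Prod>a\<in>UNIV. 2 * b n $ a)"
        unfolding B_def by (subst content_cbox_cart) auto
      also have "\<dots> = (2 * b n $ Abs_ridx (k, False)) * ((2 * b n $ Abs_ridx (k, True)) *
          (\<Prod>a\<in>UNIV - {Abs_ridx (k, False)} - {Abs_ridx (k, True)}. 2 * b n $ a))"
        by (subst prod.remove[of _ "Abs_ridx (k, False)"], simp, simp,
            subst prod.remove[of _ "Abs_ridx (k, True)"]) (auto simp: Abs_ridx_inject')
      also have "(\<Prod>a\<in>UNIV - {Abs_ridx (k, False)} - {Abs_ridx (k, True)}. 2 * b n $ a) = P"
        unfolding P_def
      proof (rule prod.cong)
        fix a assume "a \<in> UNIV - {Abs_ridx (k, False), Abs_ridx (k, True)}"
        then have "fst (Rep_ridx a) \<noteq> k"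
          by (cases a, cases "Rep_ridx a") (auto, metis (full_types))
        then show "2 * b n $ a = 2 * r" by (simp add: b_def)
      qed auto
      finally have "measure lborel (B n) = 4 * P * (\<epsilon> / 2 ^ n) powr 2"
        using e by (simp add: b_def power2_eq_square powr_numeral)
      moreover have "c n = 2 powr (- s) * (\<epsilon> / 2 ^ n) powr s"
      proof -
        have "\<epsilon> / 2 ^ Suc n = (\<epsilon> / 2 ^ n) * (1 / 2)" by simp
        then have "c n = (\<epsilon> / 2 ^ n) powr s * (1 / 2) powr s"
          unfolding c_def using e by (simp only: powr_mult)
        then show ?thesis by (simp add: powr_divide powr_minus field_simps)
      qed
      moreover have "(\<epsilon> / 2 ^ n) powr s * (\<epsilon> / 2 ^ n) powr 2 = \<epsilon> powr (2 + s) * q ^ n"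
      proof -
        have "(\<epsilon> / 2 ^ n) powr s * (\<epsilon> / 2 ^ n) powr 2 = (\<epsilon> / 2 ^ n) powr (2 + s)"
          by (simp add: powr_add)
        also have "\<dots> = \<epsilon> powr (2 + s) * ((1 / 2 ^ n) powr (2 + s))"
          using e powr_mult[of \<epsilon> "1 / 2 ^ n" "2 + s"] by simp
        also have "(1 / 2 ^ n) powr (2 + s) = q ^ n"
        proof -
          have "(1 / 2 ^ n) powr (2 + s) = ((2::real) powr (- real n)) powr (2 + s)"
            by (simp add: powr_minus_divide powr_realpow)
          also have "\<dots> = (2 powr (- (2 + s))) powr real n"
            unfolding powr_powr by (rule arg_cong[of _ _ "\<lambda>t. 2 powr t"]) (simp add: algebra_simps)
          finally show ?thesis by (simp add: q_def powr_realpow)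
        qed
        finally show ?thesis .
      qed
      ultimately show ?thesis by (simp add: mult_ac)
    qed
    have ptw: "ennreal (F (toC x)) \<le> (\<Sum>n. ennreal (c n) * indicator (B n) x)" for x
    proof (cases "F (toC x) = 0")
      case False
      define t where "t = norm (toC x $ k)"
      have t: "0 < t" "t \<le> \<epsilon>" "F (toC x) \<le> t powr s" "\<And>j. norm (toC x $ j) \<le> r"
        using F(3)[OF False] by (auto simp: t_def)
      obtain N where N: "\<epsilon> / 2 ^ N < t"
        using real_arch_pow_inv[of "t / \<epsilon>" "1 / 2"] t(1) e by (auto simp: field_simps power_divide)
      \<comment> \<open>The index of the shell containing the point; it exists because z^k is
        nonzero wherever F is.\<close>
      define n where "n = (LEAST n. \<epsilon> / 2 ^ Suc n < t)"
      have "\<epsilon> / 2 ^ Suc N < t"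
        using N e by (smt (verit) frac_le power_increasing_iff zero_less_power le_add1 plus_1_eq_Suc add.commute divide_left_mono mult_pos_pos power_Suc)
      then have n1: "\<epsilon> / 2 ^ Suc n < t" unfolding n_def by (rule LeastI)
      have n2: "t \<le> \<epsilon> / 2 ^ n"
      proof (cases n)
        case (Suc m)
        then show ?thesis using not_less_Least[of m "\<lambda>n. \<epsilon> / 2 ^ Suc n < t"] n_def by (metis lessI not_less)
      qed (use t in simp)
      have "x \<in> B n"
      proof -
        have "\<bar>x $ a\<bar> \<le> b n $ a" for a
        proof -
          obtain j p where a: "a = Abs_ridx (j, p)" by (metis Abs_ridx_cases surj_pair)
          have "x $ a = (if p then Im (toC x $ j) else Re (toC x $ j))" by (simp add: a toC_def)
          then have "\<bar>x $ a\<bar> \<le> norm (toC x $ j)"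
            using abs_Re_le_cmod abs_Im_le_cmod by simp
          moreover have "norm (toC x $ j) \<le> b n $ a"
            using n2 t(4)[of j] by (auto simp: a b_def t_def)
          ultimately show ?thesis by simp
        qed
        then show ?thesis by (auto simp: B_def mem_box_cart abs_le_iff minus_le_iff)
      qed
      moreover have "F (toC x) \<le> c n"
        using t(3) powr_mono2'[OF s(2) _ less_imp_le[OF n1]] e by (auto simp: c_def intro: order_trans)
      ultimately have "ennreal (F (toC x)) \<le> ennreal (c n) * indicator (B n) x"
        by (simp add: ennreal_leI)
      also have "\<dots> = (\<Sum>i\<in>{n}. ennreal (c i) * indicator (B i) x)"
        by (simp del: sum_mult_indicator)
      also have "\<dots> \<le> (\<Sum>n. ennreal (c n) * indicator (B n) x)" by (intro sum_le_suminf) auto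
      finally show ?thesis .
    qed simp
    have Fi: "integrable lebesgue (\<lambda>x. F (toC x))"
      using F(1) by (simp add: cabs_def set_integrable_def)
    have "cint F = integral\<^sup>L lebesgue (\<lambda>x. F (toC x))"
      unfolding cint_def using Fi lebesgue_integral_eq_integral[of UNIV "\<lambda>x. F (toC x)"]
      by (simp add: lebesgue_on_UNIV_eq)
    then have "ennreal (cint F) = (\<integral>\<^sup>+x. ennreal (F (toC x)) \<partial>lebesgue)"
      using nn_integral_eq_integral[OF Fi] F(2) by simp
    also have "\<dots> \<le> (\<integral>\<^sup>+x. (\<Sum>n. ennreal (c n) * indicator (B n) x) \<partial>lebesgue)"
      by (intro nn_integral_mono ptw)
    also have "\<dots> = (\<Sum>n. \<integral>\<^sup>+x. ennreal (c n) * indicator (B n) x \<partial>lebesgue)"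
      by (intro nn_integral_suminf borel_measurable_times_ennreal borel_measurable_const borel_measurable_indicator)
        (simp add: B_def)
    also have "\<dots> = (\<Sum>n. ennreal (c n * measure lborel (B n)))"
    proof (intro suminf_cong)
      fix n
      have "emeasure lebesgue (B n) = ennreal (measure lborel (B n))"
      proof -
        have "emeasure lborel (B n) \<noteq> top"
          using emeasure_lborel_cbox_finite[of "- b n" "b n"] unfolding B_def by auto
        from emeasure_eq_ennreal_measure[OF this] show ?thesis by (simp add: B_def)
      qed
      then show "(\<integral>\<^sup>+x. ennreal (c n) * indicator (B n) x \<partial>lebesgue) = ennreal (c n * measure lborel (B n))"
        by (subst nn_integral_cmult_indicator) (auto simp: B_def c_def ennreal_mult)
    qed
    also have "\<dots> = ennreal (\<Sum>n. c n * measure lborel (B n))"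
      unfolding cB using q P
      by (intro suminf_ennreal2) (auto intro!: summable_mult summable_geometric mult_nonneg_nonneg)
    also have "(\<Sum>n. c n * measure lborel (B n)) = C * \<epsilon> powr (2 + s)"
      unfolding cB C_def using q by (simp add: suminf_mult suminf_geometric summable_geometric)
    finally have "ennreal (cint F) \<le> ennreal (C * \<epsilon> powr (2 + s))" .
    moreover have "0 \<le> C * \<epsilon> powr (2 + s)" using P q by (simp add: C_def)
    ultimately show ?thesis by (simp only: ennreal_le_iff)
  qed
  moreover have "0 \<le> C" using P q by (simp add: C_def)
  ultimately show ?thesis by blast
qed


section \<open>Charts and transition maps\<close>

lemma has_derivative_vec_complex:
  fixes f :: "'v::real_normed_vector \<Rightarrow> complex ^ 'n::finite"
  assumes "\<And>k. ((\<lambda>x. f x $ k) has_derivative (\<lambda>v. f' v $ k)) F"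
  shows "(f has_derivative f') F"
proof -
  have e: "(\<Sum>k\<in>UNIV. g $ k *s cbasis k) = g" for g :: "complex ^ 'n"
    by (rule basis_expansion)
  have "((\<lambda>x. \<Sum>k\<in>UNIV. f x $ k *s cbasis k) has_derivative (\<lambda>v. \<Sum>k\<in>UNIV. f' v $ k *s cbasis k)) F"
    by (intro has_derivative_sum bounded_linear.has_derivative[OF bounded_linear_smult_vec] assms)
  then show ?thesis by (simp add: e)
qed

lemma holo_on_cong_open:
  assumes "open S" "\<And>z. z \<in> S \<Longrightarrow> f z = g z" "holo_on f S"
  shows "holo_on g S"
  unfolding holo_on_def
proof
  fix z assume z: "z \<in> S"
  show "\<exists>f'. (g has_derivative f') (at z) \<and> (\<forall>c v. f' (c *s v) = c * f' v)"
    using has_derivative_cong_open[OF holo_onD(2)[OF assms(3) z] assms(1) z assms(2)] holo_onD(3)[OF assms(3) z]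
    by blast
qed

abbreviation kap :: "('a, 'n) chart \<Rightarrow> complex ^ 'n \<Rightarrow> 'a" where
  "kap c \<equiv> inv_into (fst c) (snd c)"

lemma in_chart_eq: "in_chart c f = (\<lambda>z. f (kap c z))"
  by (cases c) (simp add: in_chart_def o_def)

lemma transition_eq: "transition c c' = (\<lambda>z. snd c' (kap c z))"
  by (cases c; cases c') (simp add: transition_def o_def)

locale cmanifold =
  fixes X :: "'a topology" and A :: "('a, 'n::finite) chart set"
  assumes cm: "complex_manifold X A"
begin

lemma is_chart: "c \<in> A \<Longrightarrow> is_chart X c"
  using cm by (simp add: complex_manifold_def)

lemma chart_facts:
  assumes "c \<in> A"
  shows "openin X (fst c)" "open (snd c ` fst c)"
    "homeomorphic_map (subtopology X (fst c)) (top_of_set (snd c ` fst c)) (snd c)"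
  using is_chart[OF assms] by (auto simp: is_chart_def case_prod_beta)

lemma chart_subset: "c \<in> A \<Longrightarrow> fst c \<subseteq> topspace X"
  by (rule openin_subset[OF chart_facts(1)])

lemma inj_chart: "c \<in> A \<Longrightarrow> inj_on (snd c) (fst c)"
  using homeomorphic_imp_injective_map[OF chart_facts(3), of c] chart_subset[of c]
  by (simp add: inf.absorb2)

lemma kap_chart [simp]: "c \<in> A \<Longrightarrow> x \<in> fst c \<Longrightarrow> kap c (snd c x) = x"
  by (simp add: inj_chart)

lemma kap_in: "z \<in> snd c ` fst c \<Longrightarrow> kap c z \<in> fst c"
  by (rule inv_into_into)

lemma chart_kap: "z \<in> snd c ` fst c \<Longrightarrow> snd c (kap c z) = z"
  by (rule f_inv_into_f)

lemma open_chart_image: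
  assumes c: "c \<in> A" and V: "openin X V" "V \<subseteq> fst c"
  shows "open (snd c ` V)"
proof -
  have "openin (subtopology X (fst c)) V"
    using V by (auto simp: openin_subtopology)
  then have "openin (top_of_set (snd c ` fst c)) (snd c ` V)"
    using homeomorphic_map_openness_eq[OF chart_facts(3)[OF c]] by blast
  then show ?thesis using chart_facts(2)[OF c] by (rule openin_open_trans)
qed

lemma openin_chart_preimage:
  assumes c: "c \<in> A" and S: "open S"
  shows "openin X {x \<in> fst c. snd c x \<in> S}"
proof -
  have "continuous_map (subtopology X (fst c)) (top_of_set (snd c ` fst c)) (snd c)"
    by (rule homeomorphic_imp_continuous_map[OF chart_facts(3)[OF c]])
  moreover have "openin (top_of_set (snd c ` fst c)) (snd c ` fst c \<inter> S)"
    using S by (simp add: openin_open_Int)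
  ultimately have "openin (subtopology X (fst c)) {x \<in> topspace (subtopology X (fst c)). snd c x \<in> snd c ` fst c \<inter> S}"
    by (rule openin_continuous_map_preimage)
  moreover have "{x \<in> topspace (subtopology X (fst c)). snd c x \<in> snd c ` fst c \<inter> S} = {x \<in> fst c. snd c x \<in> S}"
    using chart_subset[OF c] by auto
  ultimately have "openin (subtopology X (fst c)) {x \<in> fst c. snd c x \<in> S}" by (simp only:)
  then show ?thesis using chart_facts(1)[OF c] by (rule openin_trans_full)
qed

lemma compactin_kap:
  assumes c: "c \<in> A" and K: "compact K" "K \<subseteq> snd c ` fst c"
  shows "compactin X (kap c ` K)" "closedin X (kap c ` K)"
proof -
  have sub: "kap c ` K \<subseteq> fst c" by (rule image_subsetI, rule kap_in) (use K(2) in auto)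
  have "snd c ` kap c ` K = (\<lambda>z. z) ` K"
    unfolding image_image by (rule image_cong[OF refl]) (rule chart_kap, use K(2) in auto)
  then have "snd c ` kap c ` K = K" by simp
  moreover have "compactin (top_of_set (snd c ` fst c)) K"
    using K by (simp add: compactin_subtopology)
  ultimately have "compactin (subtopology X (fst c)) (kap c ` K)"
    using homeomorphic_map_compactness_eq[OF chart_facts(3)[OF c], of "kap c ` K"] sub chart_subset[OF c]
    by auto
  then show "compactin X (kap c ` K)" by (simp add: compactin_subtopology)
  then show "closedin X (kap c ` K)"
    using cm by (intro compactin_imp_closedin) (simp add: complex_manifold_def)
qed

lemma compact_chart_image:
  assumes c: "c \<in> A" and K: "compactin X K" "K \<subseteq> fst c"
  shows "compact (snd c ` K)"
proof -
  have "compactin (subtopology X (fst c)) K" using K by (simp add: compactin_subtopology)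
  then have "compactin (top_of_set (snd c ` fst c)) (snd c ` K)"
    using homeomorphic_map_compactness_eq[OF chart_facts(3)[OF c]] by blast
  then show ?thesis by (simp add: compactin_subtopology)
qed

lemma kap_restrict: "c \<in> A \<Longrightarrow> z \<in> snd c ` (fst c \<inter> W) \<Longrightarrow> kap (fst c \<inter> W, snd c) z = kap c z"
  using inj_chart[of c] by (auto simp: inj_on_Int)

lemma compatible: "c \<in> A \<Longrightarrow> c' \<in> A \<Longrightarrow> compatible c c'"
  using cm by (auto simp: complex_manifold_def)

lemma transition_holo:
  assumes "c \<in> A" "c' \<in> A"
  shows "holo_on (\<lambda>z. transition c c' z $ k) (snd c ` (fst c \<inter> fst c'))"
  using compatible[OF assms] by (simp add: compatible_def)

text \<open>Maximality of the atlas: a restricted chart is compatible with every chart of A. This is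
  how charts are shrunk into the domain of a frame, off D, or off the other components of D.\<close>

lemma chart_restrict:
  assumes c: "c \<in> A" and W: "openin X W"
  shows "(fst c \<inter> W, snd c) \<in> A"
proof -
  let ?c = "(fst c \<inter> W, snd c)"
  have oUW: "openin X (fst c \<inter> W)" using chart_facts(1)[OF c] W by blast
  have sub: "topspace X \<inter> (fst c \<inter> W) = fst c \<inter> W" using chart_subset[OF c] by auto
  have "homeomorphic_map (subtopology (subtopology X (fst c)) (fst c \<inter> W))
      (subtopology (top_of_set (snd c ` fst c)) (snd c ` (fst c \<inter> W))) (snd c)"
  proof (rule homeomorphic_map_subtopologies[OF chart_facts(3)[OF c]])
    show "snd c ` (topspace (subtopology X (fst c)) \<inter> (fst c \<inter> W)) =
        topspace (top_of_set (snd c ` fst c)) \<inter> snd c ` (fst c \<inter> W)"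
      using chart_subset[OF c] by auto
  qed
  then have hom: "homeomorphic_map (subtopology X (fst c \<inter> W)) (top_of_set (snd c ` (fst c \<inter> W))) (snd c)"
    by (simp add: subtopology_subtopology inf.absorb2 image_mono)
  have op: "open (snd c ` (fst c \<inter> W))" by (rule open_chart_image[OF c oUW]) simp
  have "is_chart X ?c" using oUW op hom by (simp add: is_chart_def)
  moreover have "compatible ?c c'" if c': "c' \<in> A" for c'
    unfolding compatible_def
  proof (intro conjI allI)
    fix k
    let ?S = "snd c ` (fst c \<inter> W \<inter> fst c')"
    have oS: "open ?S"
      by (rule open_chart_image[OF c]) (use oUW chart_facts(1)[OF c'] in auto)
    have "holo_on (\<lambda>z. transition c c' z $ k) ?S"
      by (rule holo_on_subset[OF transition_holo[OF c c']]) auto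
    then show "holo_on (\<lambda>z. transition ?c c' z $ k) (snd ?c ` (fst ?c \<inter> fst c'))"
      unfolding fst_conv snd_conv
    proof (rule holo_on_cong_open[OF oS, rotated])
      fix z assume "z \<in> ?S"
      then have "z \<in> snd c ` (fst c \<inter> W)" by auto
      from kap_restrict[OF c this] show "transition c c' z $ k = transition ?c c' z $ k"
        by (simp add: transition_eq)
    qed
    let ?S' = "snd c' ` (fst c' \<inter> (fst c \<inter> W))"
    have "holo_on (\<lambda>z. transition c' c z $ k) ?S'"
      by (rule holo_on_subset[OF transition_holo[OF c' c]]) auto
    then show "holo_on (\<lambda>z. transition c' ?c z $ k) (snd c' ` (fst ?c \<inter> fst c'))"
      by (simp add: transition_eq Int_commute)
  qed
  moreover have "\<forall>c. is_chart X c \<and> (\<forall>c'\<in>A. compatible c c') \<longrightarrow> c \<in> A"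
    using cm unfolding complex_manifold_def by (elim conjE)
  ultimately show ?thesis by blast
qed

lemma transition_maps:
  assumes "c \<in> A" "c' \<in> A" "x \<in> fst c" "x \<in> fst c'"
  shows "transition c c' (snd c x) = snd c' x"
  using assms by (simp add: transition_eq)

lemma open_overlap: "c \<in> A \<Longrightarrow> c' \<in> A \<Longrightarrow> open (snd c ` (fst c \<inter> fst c'))"
  by (rule open_chart_image) (simp_all add: openin_Int chart_facts(1))

lemma transition_derivative:
  assumes c: "c \<in> A" and c': "c' \<in> A" and z: "z \<in> snd c ` (fst c \<inter> fst c')"
  shows "(transition c c' has_derivative fd (transition c c') z) (at z)"
    "transition c c' differentiable (at z)"
    "fd (transition c c') z v $ k = fd (\<lambda>z. transition c c' z $ k) z v"
    "fd (transition c c') z (a *s v + w) = a *s fd (transition c c') z v + fd (transition c c') z w"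
proof -
  have D: "(transition c c' has_derivative (\<lambda>v. \<chi> k. fd (\<lambda>z. transition c c' z $ k) z v)) (at z)"
    by (rule has_derivative_vec_complex) (simp add: holo_onD(2)[OF transition_holo[OF c c'] z])
  note eq = fd_eq[OF D]
  show "(transition c c' has_derivative fd (transition c c') z) (at z)" using D by (simp only: eq)
  show "transition c c' differentiable (at z)" using D by (auto simp: differentiable_def)
  show "fd (transition c c') z v $ k = fd (\<lambda>z. transition c c' z $ k) z v" by (simp add: eq)
  have "linear (fd (\<lambda>z. transition c c' z $ k) z)" for k
    by (rule linear_fd[OF holo_onD(1)[OF transition_holo[OF c c'] z]])
  then show "fd (transition c c') z (a *s v + w) = a *s fd (transition c c') z v + fd (transition c c') z w"
    by (simp add: eq vec_eq_iff linear_add holo_onD(3)[OF transition_holo[OF c c'] z])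
qed

lemma transition_C1: "c \<in> A \<Longrightarrow> c' \<in> A \<Longrightarrow> C1_on (transition c c') (snd c ` (fst c \<inter> fst c'))"
proof (rule C1_onI)
  assume c: "c \<in> A" "c' \<in> A"
  show "(transition c c' has_derivative fd (transition c c') z) (at z)" if "z \<in> snd c ` (fst c \<inter> fst c')" for z
    by (rule transition_derivative(1)[OF c that])
  fix v
  have "continuous_on (snd c ` (fst c \<inter> fst c')) (\<lambda>z. \<chi> k. fd (\<lambda>z. transition c c' z $ k) z v)"
    by (intro continuous_intros holo_continuous_fd[OF transition_holo[OF c] open_overlap[OF c]])
  then show "continuous_on (snd c ` (fst c \<inter> fst c')) (\<lambda>z. fd (transition c c') z v)"
    by (rule continuous_on_eq) (simp add: vec_eq_iff transition_derivative(3)[OF c])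
qed

lemma transition_inverse:
  assumes c: "c \<in> A" and c': "c' \<in> A" and x: "x \<in> fst c" "x \<in> fst c'"
  shows "fd (transition c' c) (snd c' x) (fd (transition c c') (snd c x) v) = v"
    and "bij (fd (transition c c') (snd c x))"
proof -
  have inv: "fd (transition c' c) (snd c' x) (fd (transition c c') (snd c x) v) = v"
    if c: "c \<in> A" and c': "c' \<in> A" and x: "x \<in> fst c" "x \<in> fst c'" for c c' v
  proof -
    let ?z = "snd c x"
    have z: "?z \<in> snd c ` (fst c \<inter> fst c')" "snd c' x \<in> snd c' ` (fst c' \<inter> fst c)" using x by auto
    have t: "transition c c' ?z = snd c' x" by (rule transition_maps[OF c c' x])
    have "((\<lambda>z. transition c' c (transition c c' z)) has_derivative
        (\<lambda>v. fd (transition c' c) (snd c' x) (fd (transition c c') ?z v))) (at ?z)"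
      by (rule has_derivative_compose[OF transition_derivative(1)[OF c c' z(1)]])
        (simp add: t transition_derivative(1)[OF c' c z(2)])
    moreover have "((\<lambda>z. transition c' c (transition c c' z)) has_derivative (\<lambda>v. v)) (at ?z)"
      by (rule has_derivative_cong_open[OF has_derivative_ident open_overlap[OF c c'] z(1)])
        (use c c' in \<open>auto simp: transition_maps\<close>)
    ultimately show ?thesis by (metis has_derivative_unique)
  qed
  show "fd (transition c' c) (snd c' x) (fd (transition c c') (snd c x) v) = v"
    by (rule inv[OF c c' x])
  show "bij (fd (transition c c') (snd c x))"
    by (rule o_bij[of "fd (transition c' c) (snd c' x)"])
      (simp_all add: fun_eq_iff inv[OF c c' x] inv[OF c' c x(2,1)])
qed


section \<open>Functions of class \<open>C\<^sup>1\<close> on the manifold\<close>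

definition C1_fun :: "('a \<Rightarrow> real) \<Rightarrow> bool" where
  "C1_fun f \<longleftrightarrow> (\<forall>c\<in>A. C1_on (\<lambda>z. f (kap c z)) (snd c ` fst c))"

lemma C1_funD: "C1_fun f \<Longrightarrow> c \<in> A \<Longrightarrow> C1_on (\<lambda>z. f (kap c z)) (snd c ` fst c)"
  by (simp add: C1_fun_def)

lemma C1_fun_const: "C1_fun (\<lambda>x. a)"
  by (simp add: C1_fun_def Ck_on_const del: Ck_on.simps)

lemma C1_fun_add: "C1_fun f \<Longrightarrow> C1_fun g \<Longrightarrow> C1_fun (\<lambda>x. f x + g x)"
  unfolding C1_fun_def using Ck_on_add[OF chart_facts(2)] by blast

lemma C1_fun_mult: "C1_fun f \<Longrightarrow> C1_fun g \<Longrightarrow> C1_fun (\<lambda>x. f x * g x)"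
  unfolding C1_fun_def using Ck_on_mult[OF chart_facts(2)] by blast

lemma C1_fun_diff: "C1_fun f \<Longrightarrow> C1_fun g \<Longrightarrow> C1_fun (\<lambda>x. f x - g x)"
  using C1_fun_add[of f "\<lambda>x. (- 1) * g x"] C1_fun_mult[OF C1_fun_const[of "- 1"], of g] by simp

lemma C1_fun_sum: "(\<And>i. i \<in> I \<Longrightarrow> C1_fun (f i)) \<Longrightarrow> C1_fun (\<lambda>x. \<Sum>i\<in>I. f i x)"
  by (induction I rule: infinite_finite_induct) (auto intro: C1_fun_const C1_fun_add)

lemma C1_fun_prod: "(\<And>i. i \<in> I \<Longrightarrow> C1_fun (f i)) \<Longrightarrow> C1_fun (\<lambda>x. \<Prod>i\<in>I. f i x)"
  by (induction I rule: infinite_finite_induct) (auto intro: C1_fun_const C1_fun_mult)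

lemma C1_fun_inverse:
  assumes "C1_fun f" "\<And>x. x \<in> topspace X \<Longrightarrow> f x \<noteq> 0"
  shows "C1_fun (\<lambda>x. inverse (f x))"
  unfolding C1_fun_def
proof
  fix c assume c: "c \<in> A"
  show "C1_on (\<lambda>z. inverse (f (kap c z))) (snd c ` fst c)"
  proof (rule C1_on_inverse[OF C1_funD[OF assms(1) c]])
    fix z assume "z \<in> snd c ` fst c"
    from kap_in[OF this] chart_subset[OF c] show "f (kap c z) \<noteq> 0" by (intro assms(2)) auto
  qed
qed

lemma C1_fun_compose:
  assumes f: "C1_fun f" and g: "\<And>t. (g has_real_derivative g' t) (at t)" "continuous_on UNIV g'"
  shows "C1_fun (\<lambda>x. g (f x))"
  unfolding C1_fun_def
proof
  fix c assume "c \<in> A"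
  from C1_on_real_compose[OF C1_funD[OF f this], of g g', OF g(1) continuous_on_subset[OF g(2)]]
  show "C1_on (\<lambda>z. g (f (kap c z))) (snd c ` fst c)" by simp
qed

text \<open>Any chart is covered by its overlap with c, where the transition map transports
  differentiability, and the complement of the closed set K, where the function is zero.\<close>

lemma C1_fun_extend:
  assumes c: "c \<in> A" and f: "C1_on (\<lambda>z. f (kap c z)) (snd c ` fst c)"
    and K: "closedin X K" "K \<subseteq> fst c" "\<And>x. x \<notin> K \<Longrightarrow> f x = 0"
  shows "C1_fun f"
  unfolding C1_fun_def
proof
  fix c' assume c': "c' \<in> A"
  let ?S1 = "snd c' ` (fst c' \<inter> fst c)" and ?S2 = "snd c' ` (fst c' - K)"
  have o1: "open ?S1" by (rule open_overlap[OF c' c])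
  have "openin X (fst c' - K)" using chart_facts(1)[OF c'] K(1) by (rule openin_diff)
  then have o2: "open ?S2" by (rule open_chart_image[OF c']) auto
  have "C1_on (\<lambda>z. f (kap c' z)) ?S1"
  proof (rule Ck_on_cong_open[OF o1])
    show "C1_on (\<lambda>z. f (kap c (transition c' c z))) ?S1"
      by (rule C1_on_compose[OF transition_C1[OF c' c] f]) (use c c' in \<open>auto simp: transition_maps\<close>)
    fix z assume "z \<in> ?S1"
    then show "f (kap c (transition c' c z)) = f (kap c' z)" using c c' by (auto simp: transition_maps)
  qed
  moreover have "C1_on (\<lambda>z. f (kap c' z)) ?S2"
    by (rule Ck_on_cong_open[OF o2 _ Ck_on_const[of _ 0]]) (use K(3) c' in auto)
  note S = this calculation
  show "C1_on (\<lambda>z. f (kap c' z)) (snd c' ` fst c')"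
  proof (rule C1_on_local)
    fix z assume "z \<in> snd c' ` fst c'"
    then consider "z \<in> ?S1" | "z \<in> ?S2" using K(2) by auto
    then show "\<exists>U. open U \<and> z \<in> U \<and> C1_on (\<lambda>z. f (kap c' z)) U"
    proof cases
      case 1 then show ?thesis using o1 S(2) by (intro exI[of _ ?S1] conjI)
    next
      case 2 then show ?thesis using o2 S(1) by (intro exI[of _ ?S2] conjI)
    qed
  qed
qed

end


section \<open>Step functions\<close>

text \<open>The square of the positive part is C^1 but not C^2 at 0; one continuous derivative is
  all that the integration by parts asks of cutoffs.\<close>

definition bmp :: "real \<Rightarrow> real" where "bmp t = (max 0 t)\<^sup>2"

text \<open>A C^1 step from 0 to 1, equal to 1 - (1 - t^2)^2 on [0, 1], with slope at most 4
  (\<open>stp'_range\<close>).\<close>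

definition stp :: "real \<Rightarrow> real" where "stp t = 1 - bmp (1 - bmp t)"

lemma bmp_deriv: "(bmp has_real_derivative 2 * max 0 t) (at t)"
proof (cases "t > 0")
  case True
  have "((\<lambda>t. t\<^sup>2) has_real_derivative 2 * t) (at t)" by (auto intro!: derivative_eq_intros)
  then have "(bmp has_real_derivative 2 * t) (at t)"
    by (rule has_field_derivative_transform_within_open[of _ _ _ "{0<..}"]) (use True in \<open>auto simp: bmp_def\<close>)
  then show ?thesis using True by simp
next
  case False
  show ?thesis
  proof (cases "t = 0")
    case True
    have "((\<lambda>h. (bmp (0 + h) - bmp 0) / h) \<longlongrightarrow> 0) (at 0)"
    proof (rule Lim_null_comparison)
      show "\<forall>\<^sub>F h in at 0. norm ((bmp (0 + h) - bmp 0) / h) \<le> \<bar>h\<bar>"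
        by (rule always_eventually) (auto simp: bmp_def max_def power2_eq_square)
      show "((\<lambda>h. \<bar>h\<bar>) \<longlongrightarrow> 0) (at (0::real))" by (auto intro!: tendsto_eq_intros)
    qed
    then show ?thesis using True by (simp add: DERIV_def)
  next
    case False
    with \<open>\<not> 0 < t\<close> have "t < 0" by simp
    have "((\<lambda>t. 0) has_real_derivative 0) (at t)" by simp
    then have "(bmp has_real_derivative 0) (at t)"
      by (rule has_field_derivative_transform_within_open[of _ _ _ "{..<0}"]) (use \<open>t < 0\<close> in \<open>auto simp: bmp_def\<close>)
    then show ?thesis using \<open>t < 0\<close> by simp
  qed
qed

definition stp' :: "real \<Rightarrow> real" where
  "stp' t = 2 * max 0 (1 - bmp t) * (2 * max 0 t)"

lemma stp_deriv: "(stp has_real_derivative stp' t) (at t)"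
  unfolding stp_def stp'_def
  by (auto intro!: derivative_eq_intros DERIV_chain2[OF bmp_deriv] bmp_deriv)

lemma continuous_on_bmp: "continuous_on S bmp"
  unfolding bmp_def by (intro continuous_intros)

lemma continuous_on_stp': "continuous_on S stp'"
  unfolding stp'_def by (intro continuous_intros continuous_on_bmp)

lemma bmp_nonneg: "0 \<le> bmp t"
  by (simp add: bmp_def)

lemma bmp_ge_1: "1 \<le> t \<Longrightarrow> 1 \<le> bmp t"
  by (simp add: bmp_def one_le_power)

lemma stp_0: "t \<le> 0 \<Longrightarrow> stp t = 0"
  by (simp add: stp_def bmp_def)

lemma stp_1: "1 \<le> t \<Longrightarrow> stp t = 1"
  using bmp_ge_1[of t] by (simp add: stp_def bmp_def[of "1 - bmp t"] max_def)

lemma stp_range: "0 \<le> stp t" "stp t \<le> 1"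
proof -
  have "(max 0 (1 - bmp t))\<^sup>2 \<le> 1\<^sup>2"
    by (rule power_mono) (use bmp_nonneg[of t] in auto)
  then show "0 \<le> stp t" "stp t \<le> 1" by (auto simp: stp_def bmp_def[of "1 - bmp t"])
qed

lemma stp'_range: "0 \<le> stp' t" "stp' t \<le> 4"
proof -
  show "0 \<le> stp' t" by (simp add: stp'_def)
  show "stp' t \<le> 4"
  proof (cases "t \<le> 1")
    case True
    have "max 0 (1 - bmp t) * max 0 t \<le> 1 * 1"
      using True bmp_nonneg[of t] by (intro mult_mono) auto
    then show ?thesis by (simp add: stp'_def)
  next
    case False
    then show ?thesis using bmp_ge_1[of t] by (simp add: stp'_def max_def)
  qed
qed

section \<open>Change of coordinates for antisymmetrized derivatives\<close>

lemma skew_diff: "skew (\<lambda>vs. s vs - t vs) vs = skew s vs - skew t vs"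
  by (simp add: skew_def sum_subtractf algebra_simps)

lemma skew_add: "skew (\<lambda>vs. s vs + t vs) vs = skew s vs + skew t vs"
  by (simp add: skew_def sum.distrib algebra_simps)

lemma skew_cmult: "skew (\<lambda>vs. c * s vs) vs = c * skew s vs"
  by (simp add: skew_def sum_distrib_left mult.left_commute)

text \<open>The algebra behind d d = 0. Peel off v: the terms where v lands in the first slot of P
  cancel those where it lands in the second by symmetry, and the terms where v stays behind are the
  induction hypothesis for P with v inserted.\<close>

lemma skew_skew_symmetric:
  assumes "\<And>u v r. P u v r = P v u r"
  shows "skew (\<lambda>us. skew (\<lambda>rs. P (hd us) (hd rs) (tl rs)) (tl us)) vs = 0"
  using assms
proof (induction vs arbitrary: P)
  case Nil
  show ?case by (simp add: skew_def)
next
  case (Cons v vs)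
  let ?Z = "\<lambda>us. skew (\<lambda>rs. P (hd us) (hd rs) (v # tl rs)) (tl us)"
  have Z: "skew ?Z vs = 0" by (rule Cons.IH) (rule Cons.prems)
  have "skew (\<lambda>us. skew (\<lambda>rs. P (hd us) (hd rs) (tl rs)) (tl us)) (v # vs) =
      skew (\<lambda>rs. P v (hd rs) (tl rs)) vs - skew (\<lambda>us. P (hd us) v (tl us) - ?Z us) vs"
    by (subst skew_Cons) (simp add: skew_Cons)
  also have "\<dots> = skew (\<lambda>rs. P v (hd rs) (tl rs)) vs - skew (\<lambda>us. P (hd us) v (tl us)) vs"
    by (simp add: skew_diff Z)
  also have "(\<lambda>us. P (hd us) v (tl us)) = (\<lambda>us. P v (hd us) (tl us))"
    by (rule ext) (rule Cons.prems)
  finally show ?case by simp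
qed

text \<open>The product rule for a multilinear function whose arguments \<open>M z u\<close> move
  with the point. Expanding the head in the coordinate basis turns the moving vector into scalar
  coefficients, and the induction treats the tail.\<close>

lemma del_mlin_compose:
  fixes s :: "complex ^ 'n \<Rightarrow> (complex ^ 'n) list \<Rightarrow> complex" and M :: "complex ^ 'n \<Rightarrow> complex ^ 'n \<Rightarrow> complex ^ 'n::finite"
  assumes S: "open S" "z0 \<in> S" and M: "\<And>u k. (\<lambda>z. M z u $ k) differentiable (at z0)"
  shows "(\<And>vs. length vs = m \<Longrightarrow> (\<lambda>z. s z vs) differentiable (at z0)) \<Longrightarrow> (\<And>z. z \<in> S \<Longrightarrow> mlin m (s z)) \<Longrightarrow>
    length us = m \<Longrightarrow> (\<lambda>z. s z (map (M z) us)) differentiable (at z0) \<and>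
    del (\<lambda>z. s z (map (M z) us)) z0 v = del (\<lambda>z. s z (map (M z0) us)) z0 v +
      (\<Sum>i<m. s z0 ((map (M z0) us)[i := (\<chi> k. del (\<lambda>z. M z (us ! i) $ k) z0 v)]))"
proof (induction us arbitrary: s m)
  case Nil
  then show ?case by simp
next
  case (Cons u us)
  obtain m' where m: "m = Suc m'" "length us = m'" using Cons.prems(3) by auto
  let ?dM = "\<lambda>w. (\<chi> k. del (\<lambda>z. M z w $ k) z0 v)"
  let ?W = "map (M z0) us"
  have ml: "mlin (Suc m') (s z)" if "z \<in> S" for z using Cons.prems(2)[OF that] m by simp
  have IH: "(\<lambda>z. s z (cbasis j # map (M z) us)) differentiable (at z0) \<and>
      del (\<lambda>z. s z (cbasis j # map (M z) us)) z0 v = del (\<lambda>z. s z (cbasis j # ?W)) z0 v +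
      (\<Sum>i<m'. s z0 (cbasis j # ?W[i := ?dM (us ! i)]))" for j
    by (rule Cons.IH[of m' "\<lambda>z vs. s z (cbasis j # vs)"]) (use Cons.prems(1) m mlin_Cons[OF ml] in auto)
  have ds: "(\<lambda>z. s z (cbasis j # ?W)) differentiable (at z0)" for j
    by (rule Cons.prems(1)) (simp add: m)
  have E: "s z (map (M z) (u # us)) = (\<Sum>j\<in>UNIV. M z u $ j * s z (cbasis j # map (M z) us))" if "z \<in> S" for z
    using mlin_expand[OF ml[OF that], of "map (M z) us" "M z u"] m by simp
  have d1: "(\<lambda>z. M z u $ j * s z (cbasis j # map (M z) us)) differentiable (at z0)" for j
    using IH by (intro differentiable_mult M) auto
  have dsum: "(\<lambda>z. \<Sum>j\<in>UNIV. M z u $ j * s z (cbasis j # map (M z) us)) differentiable (at z0)"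
    by (intro differentiable_sum finite ballI d1)
  have "(\<lambda>z. s z (map (M z) (u # us))) differentiable (at z0)"
    using dsum differentiable_cong_open[where f = "\<lambda>z. s z (map (M z) (u # us))" and
      g = "\<lambda>z. \<Sum>j\<in>UNIV. M z u $ j * s z (cbasis j # map (M z) us)", OF S E] by simp
  moreover have "del (\<lambda>z. s z (map (M z) (u # us))) z0 v = del (\<lambda>z. s z (map (M z0) (u # us))) z0 v +
      (\<Sum>i<m. s z0 ((map (M z0) (u # us))[i := ?dM ((u # us) ! i)]))"
  proof -
    have "del (\<lambda>z. s z (map (M z) (u # us))) z0 v = del (\<lambda>z. \<Sum>j\<in>UNIV. M z u $ j * s z (cbasis j # map (M z) us)) z0 v"
      using del_cong_open(1)[OF S E] by simp
    also have "\<dots> = (\<Sum>j\<in>UNIV. M z0 u $ j * del (\<lambda>z. s z (cbasis j # map (M z) us)) z0 v +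
        del (\<lambda>z. M z u $ j) z0 v * s z0 (cbasis j # ?W))"
      unfolding del_sum[OF d1] by (intro sum.cong refl del_mult M) (use IH in blast)
    also have "\<dots> = (\<Sum>j\<in>UNIV. M z0 u $ j * del (\<lambda>z. s z (cbasis j # ?W)) z0 v) +
        (\<Sum>j\<in>UNIV. \<Sum>i<m'. M z0 u $ j * s z0 (cbasis j # ?W[i := ?dM (us ! i)])) +
        (\<Sum>j\<in>UNIV. ?dM u $ j * s z0 (cbasis j # ?W))"
      by (simp add: IH distrib_left sum.distrib sum_distrib_left)
    also have "(\<Sum>j\<in>UNIV. ?dM u $ j * s z0 (cbasis j # ?W)) = s z0 (?dM u # ?W)"
      by (rule mlin_expand[OF ml[OF S(2)], symmetric]) (simp add: m)
    also have "(\<Sum>j\<in>UNIV. \<Sum>i<m'. M z0 u $ j * s z0 (cbasis j # ?W[i := ?dM (us ! i)])) =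
        (\<Sum>i<m'. s z0 (M z0 u # ?W[i := ?dM (us ! i)]))"
    proof (subst sum.swap, intro sum.cong refl)
      fix i
      show "(\<Sum>j\<in>UNIV. M z0 u $ j * s z0 (cbasis j # ?W[i := ?dM (us ! i)])) = s z0 (M z0 u # ?W[i := ?dM (us ! i)])"
        by (rule mlin_expand[OF ml[OF S(2)], symmetric]) (simp add: m)
    qed
    also have "(\<Sum>j\<in>UNIV. M z0 u $ j * del (\<lambda>z. s z (cbasis j # ?W)) z0 v) =
        del (\<lambda>z. \<Sum>j\<in>UNIV. M z0 u $ j * s z (cbasis j # ?W)) z0 v"
    proof -
      have "(\<lambda>z. M z0 u $ j * s z (cbasis j # ?W)) differentiable (at z0)" for j
        by (intro differentiable_mult differentiable_const ds)
      then show ?thesis by (simp add: del_sum del_cmult[OF ds])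
    qed
    also have "del (\<lambda>z. \<Sum>j\<in>UNIV. M z0 u $ j * s z (cbasis j # ?W)) z0 v = del (\<lambda>z. s z (M z0 u # ?W)) z0 v"
    proof -
      have "s z (M z0 u # ?W) = (\<Sum>j\<in>UNIV. M z0 u $ j * s z (cbasis j # ?W))" if "z \<in> S" for z
        by (rule mlin_expand[OF ml[OF that]]) (simp add: m)
      from del_cong_open(1)[OF S this] show ?thesis by simp
    qed
    finally show ?thesis
      by (simp add: m sum.lessThan_Suc_shift del: sum.lessThan_Suc)
  qed
  ultimately show ?case by blast
qed

lemma remove_nth_update: "remove_nth i (vs[i := x]) = remove_nth i vs"
  by (simp add: remove_nth_def)

text \<open>Moving the changed slot to the front costs (-1)^i, which is exactly the sign carried by
  \<open>skew\<close>.\<close>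

lemma alt_update_sum:
  assumes "alt m s" "length us = m"
  shows "(\<Sum>i<m. s ((map T us)[i := B (us ! i)])) = skew (\<lambda>rs. s (B (hd rs) # map T (tl rs))) us"
proof -
  have "s ((map T us)[i := B (us ! i)]) = (- 1) ^ i * s (B (us ! i) # map T (remove_nth i us))" if "i < m" for i
  proof -
    have "s (rot i ((map T us)[i := B (us ! i)])) = (- 1) ^ i * s ((map T us)[i := B (us ! i)])"
      by (rule alt_rot[OF that assms(1)]) (simp add: assms(2))
    moreover have "rot i ((map T us)[i := B (us ! i)]) = B (us ! i) # map T (remove_nth i us)"
      using that assms(2) by (simp add: rot_def remove_nth_update map_remove_nth)
    ultimately have "(- 1) ^ i * s (B (us ! i) # map T (remove_nth i us)) = ((- 1) ^ i * (- 1) ^ i) * s ((map T us)[i := B (us ! i)])"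
      by simp
    then show ?thesis by (simp flip: power_add mult_2)
  qed
  then show ?thesis unfolding skew_def by (simp add: assms(2) rot_def)
qed

text \<open>The second derivatives of the coordinate change \<open>\<tau>\<close> cancel because they are symmetric.\<close>

lemma skew_del_transform:
  fixes a a' :: "complex ^ 'n \<Rightarrow> (complex ^ 'n) list \<Rightarrow> complex" and \<tau> :: "complex ^ 'n \<Rightarrow> complex ^ 'n::finite"
  assumes S: "open S" "z0 \<in> S" and \<tau>: "\<And>k. holo_on (\<lambda>z. \<tau> z $ k) S"
    and a: "\<And>z vs. z \<in> S \<Longrightarrow> length vs = p \<Longrightarrow> a z vs = u z * a' (\<tau> z) (map (fd \<tau> z) vs)"
    and a': "\<And>vs. length vs = p \<Longrightarrow> (\<lambda>y. a' y vs) differentiable (at (\<tau> z0))"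
    and ml: "\<And>z. z \<in> S \<Longrightarrow> mlin p (a' (\<tau> z))" and al: "alt p (a' (\<tau> z0))"
    and u: "u differentiable (at z0)"
    and \<theta>: "\<And>v. del u z0 v + \<theta> v * u z0 = u z0 * \<theta>' (fd \<tau> z0 v)"
    and vs: "length vs = Suc p"
  shows "skew (\<lambda>us. del (\<lambda>y. a y (tl us)) z0 (hd us) + \<theta> (hd us) * a z0 (tl us)) vs =
    u z0 * skew (\<lambda>us. del (\<lambda>y. a' y (tl us)) (\<tau> z0) (hd us) + \<theta>' (hd us) * a' (\<tau> z0) (tl us)) (map (fd \<tau> z0) vs)"
proof -
  have D: "(\<tau> has_derivative (\<lambda>v. \<chi> k. fd (\<lambda>z. \<tau> z $ k) z v)) (at z)" if "z \<in> S" for z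
    by (rule has_derivative_vec_complex) (simp add: holo_onD(2)[OF \<tau> that])
  have fdk: "fd \<tau> z v $ k = fd (\<lambda>z. \<tau> z $ k) z v" if "z \<in> S" for z v k
    by (simp add: fd_eq[OF D[OF that]])
  have d\<tau>: "\<tau> differentiable (at z0)" using D[OF S(2)] by (auto simp: differentiable_def)
  have lin: "fd \<tau> z0 (c *s v) = c *s fd \<tau> z0 v" for c v
    by (simp add: vec_eq_iff fdk[OF S(2)] holo_onD(3)[OF \<tau> S(2)])
  have hM: "holo_on (\<lambda>z. fd \<tau> z v $ k) S" for v k
    by (rule holo_on_cong_open[OF S(1) _ holo_on_fd[OF \<tau> S(1)]]) (simp add: fdk)
  have M: "(\<lambda>z. fd \<tau> z v $ k) differentiable (at z0)" for v k by (rule holo_onD(1)[OF hM S(2)])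
  \<comment> \<open>The second derivative of the coordinate change, a symmetric bilinear map by
    \<open>holo_fd_symmetric\<close>.\<close>
  define B where "B v w = (\<chi> k. del (\<lambda>z. fd \<tau> z w $ k) z0 v)" for v w
  have B: "B v w = B w v" for v w
  proof -
    have "del (\<lambda>z. fd \<tau> z w $ k) z0 v = fd (\<lambda>z. fd (\<lambda>z. \<tau> z $ k) z w) z0 v" for v w k
      unfolding del_holo(1)[OF hM S(2)]
      by (rule fun_cong[OF fd_cong_open[OF S]]) (simp add: fdk)
    then show ?thesis by (simp add: B_def holo_fd_symmetric[OF \<tau> S])
  qed
  let ?T = "fd \<tau> z0"
  \<comment> \<open>Before alternation the covariant derivative is not tensorial: the last term,
    which involves B, is the defect. The derivative of the factor u is absorbed by the gauge law
    \<theta>.\<close>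
  have step: "del (\<lambda>y. a y us) z0 v + \<theta> v * a z0 us =
      u z0 * (del (\<lambda>y. a' y (map ?T us)) (\<tau> z0) (?T v) + \<theta>' (?T v) * a' (\<tau> z0) (map ?T us)) +
      u z0 * skew (\<lambda>rs. a' (\<tau> z0) (B v (hd rs) # map ?T (tl rs))) us"
    if us: "length us = p" for us v
  proof -
    have dc: "(\<lambda>z. a' (\<tau> z) ws) differentiable (at z0)" if "length ws = p" for ws
      by (rule fd_compose(2)[OF a'[OF that] d\<tau>])
    have C: "(\<lambda>z. a' (\<tau> z) (map (fd \<tau> z) us)) differentiable (at z0) \<and>
        del (\<lambda>z. a' (\<tau> z) (map (fd \<tau> z) us)) z0 v = del (\<lambda>z. a' (\<tau> z) (map ?T us)) z0 v +
        (\<Sum>i<p. a' (\<tau> z0) ((map ?T us)[i := (\<chi> k. del (\<lambda>z. fd \<tau> z (us ! i) $ k) z0 v)]))"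
      by (rule del_mlin_compose[OF S M dc ml us])
    have "(\<Sum>i<p. a' (\<tau> z0) ((map ?T us)[i := B v (us ! i)])) = skew (\<lambda>rs. a' (\<tau> z0) (B v (hd rs) # map ?T (tl rs))) us"
      by (rule alt_update_sum[OF al us])
    then have C2: "del (\<lambda>z. a' (\<tau> z) (map (fd \<tau> z) us)) z0 v = del (\<lambda>y. a' y (map ?T us)) (\<tau> z0) (?T v) +
        skew (\<lambda>rs. a' (\<tau> z0) (B v (hd rs) # map ?T (tl rs))) us"
      using C del_compose(1)[OF a'[of "map ?T us"] d\<tau> lin, of v] us by (simp add: B_def)
    have "del (\<lambda>y. a y us) z0 v = del (\<lambda>z. u z * a' (\<tau> z) (map (fd \<tau> z) us)) z0 v"
      using del_cong_open(1)[OF S, of "\<lambda>y. a y us" "\<lambda>z. u z * a' (\<tau> z) (map (fd \<tau> z) us)"] a us by simp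
    also have "\<dots> = u z0 * del (\<lambda>z. a' (\<tau> z) (map (fd \<tau> z) us)) z0 v + del u z0 v * a' (\<tau> z0) (map ?T us)"
      by (rule del_mult[OF u]) (use C in blast)
    finally have "del (\<lambda>y. a y us) z0 v + \<theta> v * a z0 us =
        u z0 * del (\<lambda>z. a' (\<tau> z) (map (fd \<tau> z) us)) z0 v + (del u z0 v + \<theta> v * u z0) * a' (\<tau> z0) (map ?T us)"
      by (simp add: a[OF S(2) us] algebra_simps)
    then show ?thesis unfolding \<theta> C2 by (simp add: algebra_simps)
  qed
  let ?F = "\<lambda>us. del (\<lambda>y. a' y (tl us)) (\<tau> z0) (hd us) + \<theta>' (hd us) * a' (\<tau> z0) (tl us)"
  let ?Q = "\<lambda>us. skew (\<lambda>rs. a' (\<tau> z0) (B (hd us) (hd rs) # map ?T (tl rs))) (tl us)"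
  have "skew (\<lambda>us. del (\<lambda>y. a y (tl us)) z0 (hd us) + \<theta> (hd us) * a z0 (tl us)) vs =
      skew (\<lambda>us. u z0 * ?F (map ?T us) + u z0 * ?Q us) vs"
  proof (rule skew_cong[OF _ vs])
    fix us :: "(complex ^ 'n) list" assume "length us = Suc p"
    then obtain v ws where us: "us = v # ws" "length ws = p" by (cases us) auto
    show "del (\<lambda>y. a y (tl us)) z0 (hd us) + \<theta> (hd us) * a z0 (tl us) = u z0 * ?F (map ?T us) + u z0 * ?Q us"
      unfolding us using step[OF us(2), of v] by simp
  qed
  also have "\<dots> = u z0 * skew (\<lambda>us. ?F (map ?T us)) vs + u z0 * skew ?Q vs"
    by (simp add: skew_add skew_cmult)
  also have "skew ?Q vs = 0"
    by (rule skew_skew_symmetric[of "\<lambda>v w r. a' (\<tau> z0) (B v w # map ?T r)"]) (simp only: B[of _ _])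
  also have "skew (\<lambda>us. ?F (map ?T us)) vs = skew ?F (map ?T vs)"
    unfolding skew_def by (intro sum.cong) (auto simp: rot_def map_remove_nth)
  finally show ?thesis by simp
qed


section \<open>The data of the theorem in local coordinates\<close>

lemma lists_length_1: "{I. length I = 1} = (\<lambda>j. [j]) ` UNIV"
  by (auto simp: length_Suc_conv)

lemma wedge_covectors_single: "wedge_covectors [\<eta>] [v] = \<eta> v"
proof -
  have "{\<sigma>. \<sigma> permutes {..<Suc 0}} = {id}"
    by (auto simp: lessThan_Suc permutes_sing)
  then show ?thesis by (simp add: wedge_covectors_def)
qed

lemma holo_on_divide:
  assumes f: "holo_on f S" and g: "holo_on g S" and nz: "\<And>z. z \<in> S \<Longrightarrow> g z \<noteq> 0"
  shows "holo_on (\<lambda>z. f z / g z) S"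
  unfolding holo_on_def
proof
  fix z assume z: "z \<in> S"
  have "((\<lambda>z. f z / g z) has_derivative
      (\<lambda>h. - f z * (inverse (g z) * fd g z h * inverse (g z)) + fd f z h / g z)) (at z)"
    by (rule has_derivative_divide[OF holo_onD(2)[OF f z] holo_onD(2)[OF g z] nz[OF z]])
  then show "\<exists>f'. ((\<lambda>z. f z / g z) has_derivative f') (at z) \<and> (\<forall>c v. f' (c *s v) = c * f' v)"
    by (intro exI[of _ "\<lambda>h. - f z * (inverse (g z) * fd g z h * inverse (g z)) + fd f z h / g z"] conjI)
      (simp_all add: holo_onD(3)[OF f z] holo_onD(3)[OF g z] algebra_simps)
qed

lemma holo_on_cmult: "holo_on f S \<Longrightarrow> holo_on (\<lambda>z. c * f z) S"
  unfolding holo_on_def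
proof
  fix z assume "\<forall>z\<in>S. \<exists>f'. (f has_derivative f') (at z) \<and> (\<forall>c v. f' (c *s v) = c * f' v)" "z \<in> S"
  then obtain f' where "(f has_derivative f') (at z)" "\<forall>c v. f' (c *s v) = c * f' v" by blast
  then show "\<exists>f'. ((\<lambda>z. c * f z) has_derivative f') (at z) \<and> (\<forall>c v. f' (c *s v) = c * f' v)"
    by (intro exI[of _ "\<lambda>v. c * f' v"]) (auto intro: has_derivative_mult_right)
qed

lemma holo_on_local:
  assumes "\<And>z. z \<in> S \<Longrightarrow> \<exists>U. z \<in> U \<and> holo_on f U" shows "holo_on f S"
  using assms unfolding holo_on_def by meson

lemma dir_del_eq: "dir_del c f x v = del (\<lambda>z. f (kap c z)) (snd c x) v"
  and dir_delbar_eq: "dir_delbar c f x v = delb (\<lambda>z. f (kap c z)) (snd c x) v"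
  by (simp_all add: dir_del_def dir_delbar_def del_def delb_def in_chart_eq Let_def)

lemma log_form_coefficients:
  assumes "log_form A D E p q \<alpha>" "c \<in> A" "adapted D c K" "i \<in> idx E"
  shows "\<exists>f. (\<forall>I J. smooth_on (f I J) (snd c ` (fst c \<inter> cover E i))) \<and>
    (\<forall>x\<in>(fst c \<inter> cover E i) - D. \<forall>vs ws. length vs = p \<and> length ws = q \<longrightarrow>
      \<alpha> c i x vs ws = (\<Sum>I | length I = p. \<Sum>J | length J = q. f I J (snd c x) *
        wedge_covectors (map (log_coframe K (snd c x)) I) vs * wedge_covectors (map conj_coframe J) ws))"
  by (rule conjunct2[OF assms(1)[unfolded log_form_def], THEN bspec, OF assms(2), THEN spec, THEN mp,
        OF assms(3), THEN bspec, OF assms(4)])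

lemma log_form_transform:
  assumes "log_form A D E p q \<alpha>" "c \<in> A" "c' \<in> A" "i \<in> idx E" "j \<in> idx E"
    "x \<in> (fst c \<inter> fst c' \<inter> cover E i \<inter> cover E j) - D" "length vs = p" "length ws = q"
  shows "\<alpha> c i x vs ws = cocycle E i j x *
    \<alpha> c' j x (map (fd (transition c c') (snd c x)) vs) (map (fd (transition c c') (snd c x)) ws)"
  using conjunct1[OF assms(1)[unfolded log_form_def], THEN bspec, OF assms(2), THEN bspec, OF assms(3),
      THEN bspec, OF assms(4), THEN bspec, OF assms(5), THEN bspec, OF assms(6), THEN spec, THEN spec, THEN mp,
      OF conjI, OF assms(7,8)] by (simp only: Let_def)

lemma form_zeroD:
  assumes "form_zero A D E p q \<alpha>" "c \<in> A" "i \<in> idx E" "x \<in> (fst c \<inter> cover E i) - D" "length vs = p" "length ws = q"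
  shows "\<alpha> c i x vs ws = 0"
  using assms unfolding form_zero_def by blast

text \<open>A Kaehler form is fixed here, and the components of the divisor are replaced by what the
  analysis uses of them: D is closed and locally a coordinate hyperplane.\<close>

locale log_setup = cmanifold X A
  for X :: "'a topology" and A :: "('a, 'n::finite) chart set" +
  fixes D :: "'a set" and L :: "('a, 'i) line_bundle" and N p :: nat
    and \<iota> :: "'a set \<times> ('a \<Rightarrow> complex) \<Rightarrow> 'i \<Rightarrow> 'a \<Rightarrow> complex"
    and \<alpha> :: "('a, 'n, 'i) form" and \<omega> :: "('a, 'n, unit) form"
  assumes compact: "compact_space X" and kf: "kaehler_form X A \<omega>"
    and D_closed: "closedin X D"
    and D_local: "\<And>x. x \<in> D \<Longrightarrow> \<exists>c\<in>A. \<exists>k. x \<in> fst c \<and> D \<inter> fst c = {y \<in> fst c. snd c y $ k = 0}"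
    and lb: "holomorphic_line_bundle X A L" and N: "N \<ge> 1"
    and iso: "line_bundle_iso A (tensor_power L N) (divisor_bundle X A D) \<iota>"
    and lf: "log_form A D (dual_bundle L) p 0 \<alpha>"
    and hol: "form_zero A D (dual_bundle L) (p + 1) 1 (delbar_conn (del_conn X A D N \<iota> \<alpha>))"
begin

subsection \<open>Defining functions\<close>

text \<open>Off D the constant 1 on the complement serves, and near D the coordinate cutting it out.
  Existence at every point makes the choice inside \<open>frame_equation\<close> meaningful.\<close>

lemma defining_function_exists:
  assumes "x \<in> topspace X"
  shows "\<exists>j. j \<in> idx (divisor_bundle X A D) \<and> x \<in> cover (divisor_bundle X A D) j"
proof (cases "x \<in> D")
  case False
  have "holo_fun_on A (topspace X - D) (\<lambda>_. 1)"
    unfolding holo_fun_on_def in_chart_eq holo_on_def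
    by (intro ballI exI[of _ "\<lambda>_. 0"]) simp
  then have "defining_function X A D (topspace X - D) (\<lambda>_. 1)"
    using D_closed by (auto simp: defining_function_def)
  then show ?thesis using False assms by (intro exI[of _ "(topspace X - D, \<lambda>_. 1)"]) (simp add: divisor_bundle_def)
next
  case True
  then obtain c k where c: "c \<in> A" "x \<in> fst c" "D \<inter> fst c = {y \<in> fst c. snd c y $ k = 0}"
    using D_local by blast
  let ?f = "\<lambda>y. snd c y $ k"
  have "holo_on (in_chart c' ?f) (snd c' ` (fst c' \<inter> fst c))" if "c' \<in> A" for c'
    using transition_holo[OF that c(1), of k] by (simp add: in_chart_eq transition_eq)
  moreover have "\<exists>v. fd (in_chart c' ?f) (snd c' y) v \<noteq> 0" if c': "c' \<in> A" and y: "y \<in> D \<inter> fst c \<inter> fst c'" for c' y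
  proof -
    let ?z = "snd c' y"
    have z: "?z \<in> snd c' ` (fst c' \<inter> fst c)" using y by auto
    \<comment> \<open>The derivative of a transition map is bijective, so in every chart some vector
      is sent to e_k; this gives multiplicity one.\<close>
    obtain v where v: "fd (transition c' c) ?z v = cbasis k"
      using transition_inverse(2)[OF c' c(1), of y] y by (metis IntD1 IntD2 bij_pointE)
    have "fd (\<lambda>z. transition c' c z $ k) ?z v = 1"
      using transition_derivative(3)[OF c' c(1) z, of v k] v by (simp add: axis_def)
    then show ?thesis by (intro exI[of _ v]) (simp add: in_chart_eq transition_eq)
  qed
  ultimately have "defining_function X A D (fst c) ?f"
    using chart_facts(1)[OF c(1)] c(3) by (simp add: defining_function_def holo_fun_on_def)
  then show ?thesis using c(2) by (intro exI[of _ "(fst c, ?f)"]) (simp add: divisor_bundle_def)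
qed

abbreviation \<zeta> :: "'i \<Rightarrow> 'a \<Rightarrow> complex" where "\<zeta> \<equiv> frame_equation X A D \<iota>"

lemma cover_facts:
  assumes "i \<in> idx L"
  shows "openin X (cover L i)" "x \<in> cover L i \<Longrightarrow> cocycle L i i x = 1"
  using lb assms by (simp_all add: holomorphic_line_bundle_def)

lemma cover_all: "x \<in> topspace X \<Longrightarrow> \<exists>i\<in>idx L. x \<in> cover L i"
  using lb by (auto simp: holomorphic_line_bundle_def)

lemma cocycle_facts:
  assumes "i \<in> idx L" "j \<in> idx L"
  shows "holo_fun_on A (cover L i \<inter> cover L j) (cocycle L i j)"
    "x \<in> cover L i \<Longrightarrow> x \<in> cover L j \<Longrightarrow> cocycle L i j x \<noteq> 0"
  using lb assms by (simp_all add: holomorphic_line_bundle_def)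

lemma defining_function_facts:
  assumes "defining_function X A D V f"
  shows "openin X V" "holo_fun_on A V f" "x \<in> V \<Longrightarrow> f x = 0 \<longleftrightarrow> x \<in> D"
  using assms by (auto simp: defining_function_def)

lemma iso_facts:
  assumes "i \<in> idx L" "defining_function X A D V f"
  shows "holo_fun_on A (cover L i \<inter> V) (\<iota> (V, f) i)" "x \<in> cover L i \<Longrightarrow> x \<in> V \<Longrightarrow> \<iota> (V, f) i x \<noteq> 0"
  using iso assms by (auto simp: line_bundle_iso_def tensor_power_def divisor_bundle_def)

lemma iso_cocycle:
  assumes "i \<in> idx L" "i' \<in> idx L" "defining_function X A D V f" "defining_function X A D V' f'"
    "x \<in> cover L i" "x \<in> cover L i'" "x \<in> V" "x \<in> V'" "x \<notin> D"
  shows "\<iota> (V, f) i x * cocycle L i i' x ^ N = f x / f' x * \<iota> (V', f') i' x"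
proof -
  have "\<forall>i\<in>idx L. \<forall>i'\<in>idx L. \<forall>j\<in>idx (divisor_bundle X A D). \<forall>j'\<in>idx (divisor_bundle X A D).
      \<forall>x\<in>cover L i \<inter> cover L i' \<inter> cover (divisor_bundle X A D) j \<inter> cover (divisor_bundle X A D) j'.
      \<iota> j i x * cocycle L i i' x ^ N = cocycle (divisor_bundle X A D) j j' x * \<iota> j' i' x"
    using iso by (simp add: line_bundle_iso_def tensor_power_def)
  from this[rule_format, OF assms(1,2), of "(V, f)" "(V', f')" x] assms
  show ?thesis by (simp add: divisor_bundle_def)
qed

text \<open>The value does not depend on the defining function picked by choice. Off D this is
  compatibility of the isomorphism with the cocycles for a single frame i; on D both numerators
  vanish.\<close>

lemma zeta_eq:
  assumes i: "i \<in> idx L" "x \<in> cover L i" and f: "defining_function X A D V f" "x \<in> V"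
  shows "\<zeta> i x = f x / \<iota> (V, f) i x"
proof -
  define j where "j = (SOME j. j \<in> idx (divisor_bundle X A D) \<and> x \<in> cover (divisor_bundle X A D) j)"
  have "j \<in> idx (divisor_bundle X A D) \<and> x \<in> cover (divisor_bundle X A D) j"
    unfolding j_def by (rule someI_ex[OF defining_function_exists])
      (use openin_subset[OF defining_function_facts(1)[OF f(1)]] f(2) in auto)
  then obtain V' f' where j: "j = (V', f')" "defining_function X A D V' f'" "x \<in> V'"
    by (cases j) (auto simp: divisor_bundle_def)
  have z: "\<zeta> i x = f' x / \<iota> (V', f') i x"
    unfolding frame_equation_def j_def[symmetric] Let_def by (simp add: j(1))
  show ?thesis
  proof (cases "x \<in> D")
    case True
    then show ?thesis using defining_function_facts(3)[OF f] defining_function_facts(3)[OF j(2,3)] z by simp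
  next
    case False
    then have nz: "f x \<noteq> 0" "f' x \<noteq> 0"
      using defining_function_facts(3)[OF f] defining_function_facts(3)[OF j(2,3)] by auto
    have "\<iota> (V, f) i x = f x / f' x * \<iota> (V', f') i x"
      using iso_cocycle[OF i(1) i(1) f(1) j(2) i(2,2) f(2) j(3) False] cover_facts(2)[OF i] by simp
    then show ?thesis unfolding z using nz iso_facts(2)[OF i(1) j(2) i(2) j(3)] by simp
  qed
qed

lemma obtain_defining_function:
  assumes "x \<in> topspace X"
  obtains V f where "defining_function X A D V f" "x \<in> V"
  using defining_function_exists[OF assms] by (auto simp: divisor_bundle_def)

lemma zeta_zero_iff:
  assumes "i \<in> idx L" "x \<in> cover L i"
  shows "\<zeta> i x = 0 \<longleftrightarrow> x \<in> D"
proof -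
  obtain V f where f: "defining_function X A D V f" "x \<in> V"
    using obtain_defining_function openin_subset[OF cover_facts(1)[OF assms(1)]] assms(2) by blast
  show ?thesis unfolding zeta_eq[OF assms f]
    using defining_function_facts(3)[OF f] iso_facts(2)[OF assms(1) f(1) assms(2) f(2)] by simp
qed

text \<open>The N-th power of the cocycle is the source of two later facts: its logarithmic
  derivative, divided by N, is the gauge term of the connection, and its modulus to the power 2/N is
  the change of the weight.\<close>

lemma zeta_transform:
  assumes "i \<in> idx L" "i' \<in> idx L" "x \<in> cover L i" "x \<in> cover L i'" "x \<notin> D"
  shows "\<zeta> i x = \<zeta> i' x * cocycle L i i' x ^ N"
proof -
  obtain V f where f: "defining_function X A D V f" "x \<in> V"
    using obtain_defining_function openin_subset[OF cover_facts(1)[OF assms(1)]] assms(3) by blast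
  have "f x \<noteq> 0" using defining_function_facts(3)[OF f] assms(5) by simp
  then have "\<iota> (V, f) i x * cocycle L i i' x ^ N = \<iota> (V, f) i' x"
    using iso_cocycle[OF assms(1,2) f(1,1) assms(3,4) f(2,2) assms(5)] by simp
  then show ?thesis unfolding zeta_eq[OF assms(1,3) f] zeta_eq[OF assms(2,4) f]
    using iso_facts(2)[OF assms(1) f(1) assms(3) f(2)] cocycle_facts(2)[OF assms(1-4)]
    by (auto simp: field_simps)
qed

lemma holo_fun_onD: "holo_fun_on A W f \<Longrightarrow> c \<in> A \<Longrightarrow> holo_on (\<lambda>z. f (kap c z)) (snd c ` (fst c \<inter> W))"
  by (simp add: holo_fun_on_def in_chart_eq)

lemma zeta_holo:
  assumes c: "c \<in> A" and i: "i \<in> idx L"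
  shows "holo_on (\<lambda>z. \<zeta> i (kap c z)) (snd c ` (fst c \<inter> cover L i))"
proof (rule holo_on_local)
  fix z assume "z \<in> snd c ` (fst c \<inter> cover L i)"
  then obtain x where x: "x \<in> fst c" "x \<in> cover L i" "z = snd c x" by auto
  obtain V f where f: "defining_function X A D V f" "x \<in> V"
    using obtain_defining_function chart_subset[OF c] x(1) by blast
  let ?S = "snd c ` (fst c \<inter> (cover L i \<inter> V))"
  have "open ?S"
    by (rule open_chart_image[OF c]) (simp_all add: openin_Int chart_facts(1)[OF c] cover_facts(1)[OF i] defining_function_facts(1)[OF f(1)])
  moreover have "holo_on (\<lambda>z. f (kap c z) / \<iota> (V, f) i (kap c z)) ?S"
  proof (rule holo_on_divide)
    show "holo_on (\<lambda>z. f (kap c z)) ?S"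
      by (rule holo_on_subset[OF holo_fun_onD[OF defining_function_facts(2)[OF f(1)] c]]) auto
    show "holo_on (\<lambda>z. \<iota> (V, f) i (kap c z)) ?S"
      by (rule holo_fun_onD[OF iso_facts(1)[OF i f(1)] c])
  next
    fix z assume "z \<in> ?S"
    then obtain y where y: "y \<in> fst c" "y \<in> cover L i" "y \<in> V" "z = snd c y" by blast
    then have "kap c z = y" using c by simp
    then show "\<iota> (V, f) i (kap c z) \<noteq> 0" using iso_facts(2)[OF i f(1) y(2,3)] by simp
  qed
  note S = this calculation
  have "holo_on (\<lambda>z. \<zeta> i (kap c z)) ?S"
  proof (rule holo_on_cong_open[OF S(2) _ S(1)])
    fix z assume "z \<in> ?S"
    then obtain y where y: "y \<in> fst c" "y \<in> cover L i" "y \<in> V" "z = snd c y" by blast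
    then have "kap c z = y" using c by simp
    then show "f (kap c z) / \<iota> (V, f) i (kap c z) = \<zeta> i (kap c z)"
      using zeta_eq[OF i y(2) f(1) y(3)] by simp
  qed
  then show "\<exists>U. z \<in> U \<and> holo_on (\<lambda>z. \<zeta> i (kap c z)) U"
    using x f(2) by (intro exI[of _ ?S]) auto
qed


subsection \<open>The Kaehler metric\<close>

definition HH :: "('a, 'n) chart \<Rightarrow> complex ^ 'n \<Rightarrow> complex ^ 'n ^ 'n" where
  "HH c z = (\<chi> j k. - \<i> * \<omega> c () (kap c z) [cbasis j] [cbasis k])"

lemma omega_form: "log_form A {} (trivial_bundle X) 1 1 \<omega>"
  using kf by (simp add: kaehler_form_def)

lemma omega_coefficients:
  assumes c: "c \<in> A"
  obtains F where "\<And>j k. smooth_on (F j k) (snd c ` fst c)"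
    "\<And>x v w. x \<in> fst c \<Longrightarrow> \<omega> c () x [v] [w] = (\<Sum>j\<in>UNIV. \<Sum>k\<in>UNIV. F j k (snd c x) * v $ j * cnj (w $ k))"
proof -
  have int: "fst c \<inter> topspace X = fst c" using chart_subset[OF c] by auto
  have "adapted {} c None" by (simp add: adapted_def case_prod_beta)
  from log_form_coefficients[OF omega_form c this, of "()"]
  obtain f where f0: "(\<forall>I J. smooth_on (f I J) (snd c ` (fst c \<inter> topspace X))) \<and>
    (\<forall>x\<in>(fst c \<inter> topspace X) - {}. \<forall>vs ws. length vs = 1 \<and> length ws = 1 \<longrightarrow>
      \<omega> c () x vs ws = (\<Sum>I | length I = 1. \<Sum>J | length J = 1. f I J (snd c x) *
        wedge_covectors (map (log_coframe None (snd c x)) I) vs * wedge_covectors (map conj_coframe J) ws))"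
    unfolding trivial_bundle_def by auto
  note f = conjunct1[OF f0, rule_format] conjunct2[OF f0, rule_format]
  show ?thesis
  proof
    show "smooth_on (f [j] [k]) (snd c ` fst c)" for j k
      using f(1)[of "[j]" "[k]"] by (simp add: int)
    fix x v w assume x: "x \<in> fst c"
    have "\<omega> c () x [v] [w] = (\<Sum>I | length I = 1. \<Sum>J | length J = 1. f I J (snd c x) *
        wedge_covectors (map (log_coframe None (snd c x)) I) [v] * wedge_covectors (map conj_coframe J) [w])"
      by (rule f(2)) (use x int in simp_all)
    then show "\<omega> c () x [v] [w] = (\<Sum>j\<in>UNIV. \<Sum>k\<in>UNIV. f [j] [k] (snd c x) * v $ j * cnj (w $ k))"
      unfolding lists_length_1
      by (simp add: sum.reindex inj_on_def wedge_covectors_single log_coframe_def conj_coframe_def)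
  qed
qed

lemma HH_coefficients:
  assumes c: "c \<in> A"
  obtains F where "\<And>j k. smooth_on (F j k) (snd c ` fst c)"
    "\<And>z j k. z \<in> snd c ` fst c \<Longrightarrow> HH c z $ j $ k = - \<i> * F j k z"
    "\<And>z v w. z \<in> snd c ` fst c \<Longrightarrow> \<omega> c () (kap c z) [v] [w] = (\<Sum>j\<in>UNIV. \<Sum>k\<in>UNIV. F j k z * v $ j * cnj (w $ k))"
proof (rule omega_coefficients[OF c])
  fix F assume F: "\<And>j k. smooth_on (F j k) (snd c ` fst c)"
    "\<And>x v w. x \<in> fst c \<Longrightarrow> \<omega> c () x [v] [w] = (\<Sum>j\<in>UNIV. \<Sum>k\<in>UNIV. F j k (snd c x) * v $ j * cnj (w $ k))"
  have w: "\<omega> c () (kap c z) [v] [w] = (\<Sum>j\<in>UNIV. \<Sum>k\<in>UNIV. F j k z * v $ j * cnj (w $ k))"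
    if "z \<in> snd c ` fst c" for z v w
    using F(2)[OF kap_in[OF that]] by (simp add: chart_kap[OF that])
  have "HH c z $ j $ k = - \<i> * F j k z" if z: "z \<in> snd c ` fst c" for z j k
  proof -
    have "\<omega> c () (kap c z) [cbasis j] [cbasis k] = (\<Sum>a\<in>UNIV. \<Sum>b\<in>UNIV. if a = j then (if b = k then F j k z else 0) else 0)"
      unfolding w[OF z] by (intro sum.cong refl) (auto simp: axis_def)
    also have "\<dots> = (\<Sum>a\<in>UNIV. if a = j then F j k z else 0)"
      by (intro sum.cong refl) auto
    finally show ?thesis by (simp add: HH_def)
  qed
  from that[OF F(1) this w] show ?thesis .
qed

lemma HH_Ck:
  assumes c: "c \<in> A"
  shows "Ck_on m (\<lambda>z. HH c z $ j $ k) (snd c ` fst c)"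
proof (rule HH_coefficients[OF c])
  fix F assume F: "\<And>j k. smooth_on (F j k) (snd c ` fst c)"
    and eq: "\<And>z j k. z \<in> snd c ` fst c \<Longrightarrow> HH c z $ j $ k = - \<i> * F j k z"
  have "Ck_on m (F j k) (snd c ` fst c)" using F(1) by (simp add: smooth_on_def)
  then have "Ck_on m (\<lambda>z. - \<i> * F j k z) (snd c ` fst c)" by (rule Ck_on_cmult[OF chart_facts(2)[OF c]])
  then show ?thesis by (rule Ck_on_cong_open[OF chart_facts(2)[OF c], rotated]) (simp only: eq)
qed

lemma hform_HH:
  assumes c: "c \<in> A" and z: "z \<in> snd c ` fst c"
  shows "hform (HH c z) v w = - \<i> * \<omega> c () (kap c z) [v] [w]"
proof (rule HH_coefficients[OF c])
  fix F assume eq: "\<And>z j k. z \<in> snd c ` fst c \<Longrightarrow> HH c z $ j $ k = - \<i> * F j k z"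
    "\<And>z v w. z \<in> snd c ` fst c \<Longrightarrow> \<omega> c () (kap c z) [v] [w] = (\<Sum>j\<in>UNIV. \<Sum>k\<in>UNIV. F j k z * v $ j * cnj (w $ k))"
  show ?thesis
    unfolding hform_def eq(2)[OF z] eq(1)[OF z] by (simp add: sum_distrib_left mult.assoc)
qed

lemma HH_posdef:
  assumes c: "c \<in> A" and z: "z \<in> snd c ` fst c"
  shows "posdef (HH c z)"
  unfolding posdef_def hform_HH[OF c z]
  using kf c kap_in[OF z] by (auto simp: kaehler_form_def)

lemma HH_transform:
  assumes c: "c \<in> A" and c': "c' \<in> A" and x: "x \<in> fst c" "x \<in> fst c'"
  shows "hform (HH c (snd c x)) v w =
    hform (HH c' (snd c' x)) (fd (transition c c') (snd c x) v) (fd (transition c c') (snd c x) w)"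
proof -
  have "\<omega> c () x [v] [w] = \<omega> c' () x (map (fd (transition c c') (snd c x)) [v]) (map (fd (transition c c') (snd c x)) [w])"
    using log_form_transform[OF omega_form c c', of "()" "()" x "[v]" "[w]"] x chart_subset[OF c]
    by (auto simp: trivial_bundle_def)
  then show ?thesis using x c c' by (simp add: hform_HH)
qed

text \<open>The (2,1)-part of d\<omega> evaluated on e_j, e_i and e_k has just these two terms, with
  opposite signs.\<close>

lemma HH_kaehler:
  assumes c: "c \<in> A" and z: "z \<in> snd c ` fst c"
  shows "del (\<lambda>z. HH c z $ i $ k) z (cbasis j) = del (\<lambda>z. HH c z $ j $ k) z (cbasis i)"
proof -
  have "form_zero A {} (trivial_bundle X) 2 1 (\<lambda>c i. del_form c (\<omega> c i))"
    using kf by (simp add: kaehler_form_def)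
  then have "del_form c (\<omega> c ()) (kap c z) [cbasis j, cbasis i] [cbasis k] = 0"
    using form_zeroD[OF _ c, of "{}" "trivial_bundle X" 2 1 "\<lambda>c i. del_form c (\<omega> c i)" "()" "kap c z" "[cbasis j, cbasis i]" "[cbasis k]"]
      kap_in[OF z] chart_subset[OF c] by (auto simp: trivial_bundle_def)
  then have eq: "del (\<lambda>z. \<omega> c () (kap c z) [cbasis i] [cbasis k]) z (cbasis j) =
      del (\<lambda>z. \<omega> c () (kap c z) [cbasis j] [cbasis k]) z (cbasis i)"
    by (simp add: del_form_def dir_del_eq numeral_2_eq_2 chart_kap[OF z] remove_nth_def)
  have d: "(\<lambda>z. \<omega> c () (kap c z) [cbasis i] [cbasis k]) differentiable (at z)" for i
  proof -
    have "(\<lambda>z. \<i> * HH c z $ i $ k) differentiable (at z)"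
      by (intro differentiable_mult differentiable_const C1_onD(1)[OF HH_Ck[OF c] z])
    then show ?thesis by (simp add: HH_def flip: mult.assoc)
  qed
  show ?thesis
    unfolding HH_def vec_lambda_beta del_cmult[OF d] eq ..
qed

end


section \<open>Wirtinger calculus for families of multilinear functions, powers and inverses\<close>

lemma mlin_del:
  fixes s :: "complex ^ 'n \<Rightarrow> (complex ^ 'n) list \<Rightarrow> complex"
  assumes S: "open S" "z \<in> S"
  shows "(\<And>y. y \<in> S \<Longrightarrow> mlin m (s y)) \<Longrightarrow> (\<And>vs. length vs = m \<Longrightarrow> (\<lambda>y. s y vs) differentiable (at z)) \<Longrightarrow>
    mlin m (\<lambda>vs. del (\<lambda>y. s y vs) z v)"
proof (induction m arbitrary: s)
  case (Suc m)
  have 1: "mlin m (\<lambda>vs. del (\<lambda>y. s y (u # vs)) z v)" for u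
    by (rule Suc.IH[of "\<lambda>y vs. s y (u # vs)"]) (use Suc.prems(2) mlin_Cons[OF Suc.prems(1)] in auto)
  have 2: "del (\<lambda>y. s y ((c *s u + w) # vs)) z v = c * del (\<lambda>y. s y (u # vs)) z v + del (\<lambda>y. s y (w # vs)) z v"
    if "length vs = m" for c u w vs
  proof -
    have d: "(\<lambda>y. s y (u # vs)) differentiable (at z)" for u
      by (rule Suc.prems(2)) (simp add: that)
    have "del (\<lambda>y. s y ((c *s u + w) # vs)) z = del (\<lambda>y. c * s y (u # vs) + s y (w # vs)) z"
      by (rule del_cong_open(1)[OF S]) (rule mlin_lin[OF Suc.prems(1) that])
    then show ?thesis
      by (simp add: del_add[OF differentiable_mult[OF differentiable_const d] d] del_cmult[OF d])
  qed
  show ?case unfolding mlin.simps using 1 2 by blast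
qed simp

lemma alt_del:
  fixes s :: "complex ^ 'n \<Rightarrow> (complex ^ 'n) list \<Rightarrow> complex"
  assumes S: "open S" "z \<in> S"
  shows "(\<And>y. y \<in> S \<Longrightarrow> alt m (s y)) \<Longrightarrow> (\<And>vs. length vs = m \<Longrightarrow> (\<lambda>y. s y vs) differentiable (at z)) \<Longrightarrow>
    alt m (\<lambda>vs. del (\<lambda>y. s y vs) z v)"
proof (induction m arbitrary: s)
  case (Suc m)
  have 1: "alt m (\<lambda>vs. del (\<lambda>y. s y (u # vs)) z v)" for u
    by (rule Suc.IH[of "\<lambda>y vs. s y (u # vs)"]) (use Suc.prems(2) alt_Cons[OF Suc.prems(1)] in auto)
  have 2: "del (\<lambda>y. s y (u # w # vs)) z v = - del (\<lambda>y. s y (w # u # vs)) z v"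
    if "Suc (length vs) = m" for u w vs
  proof -
    have d: "(\<lambda>y. s y (w # u # vs)) differentiable (at z)"
      by (rule Suc.prems(2)) (use that in simp)
    have "del (\<lambda>y. s y (u # w # vs)) z = del (\<lambda>y. (- 1) * s y (w # u # vs)) z"
      by (rule del_cong_open(1)[OF S]) (simp only: mult_minus1 alt_swap[OF Suc.prems(1) that, of _ u w])
    then show ?thesis using del_cmult[OF d, of "- 1"] by simp
  qed
  show ?case by (rule altI[OF 1 2])
qed simp

lemma del_power:
  assumes "f differentiable (at z)"
  shows "(\<lambda>z. f z ^ n) differentiable (at z) \<and> del (\<lambda>z. f z ^ n) z v = of_nat n * f z ^ (n - 1) * del f z v"
proof (induction n)
  case (Suc n)
  have d: "(\<lambda>z. f z ^ n) differentiable (at z)" using Suc by simp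
  have "del (\<lambda>z. f z ^ Suc n) z v = f z * del (\<lambda>z. f z ^ n) z v + del f z v * f z ^ n"
    using del_mult[OF assms d] by simp
  also have "f z * del (\<lambda>z. f z ^ n) z v = of_nat n * f z ^ n * del f z v"
    using Suc by (cases n) (auto simp: algebra_simps)
  finally show ?case using differentiable_mult[OF assms d] by (simp add: algebra_simps)
qed simp

lemma del_inverse:
  assumes f: "f differentiable (at z)" and nz: "f z \<noteq> (0::complex)"
  shows "(\<lambda>z. inverse (f z)) differentiable (at z)" "del (\<lambda>z. inverse (f z)) z v = - del f z v / (f z)\<^sup>2"
proof -
  have D: "((\<lambda>z. inverse (f z)) has_derivative (\<lambda>h. - (inverse (f z) * fd f z h * inverse (f z)))) (at z)"
    by (rule Deriv.has_derivative_inverse[OF nz fd_works[OF f]])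
  then show "(\<lambda>z. inverse (f z)) differentiable (at z)" by (auto simp: differentiable_def)
  show "del (\<lambda>z. inverse (f z)) z v = - del f z v / (f z)\<^sup>2"
    unfolding del_def fd_eq[OF D] using nz by (simp add: field_simps power2_eq_square)
qed

context log_setup
begin

subsection \<open>The form and its derivative\<close>

text \<open>A chart off D inside the domain of the i-th frame. There \<alpha>, the connection form
  and the weight are all regular, so each local computation is done in such charts.\<close>

definition adm :: "('a, 'n) chart \<Rightarrow> 'i \<Rightarrow> bool" where
  "adm c i \<longleftrightarrow> c \<in> A \<and> i \<in> idx L \<and> fst c \<subseteq> cover L i \<and> fst c \<inter> D = {}"

definition aa :: "('a, 'n) chart \<Rightarrow> 'i \<Rightarrow> complex ^ 'n \<Rightarrow> (complex ^ 'n) list \<Rightarrow> complex" where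
  "aa c i z vs = \<alpha> c i (kap c z) vs []"

definition theta :: "('a, 'n) chart \<Rightarrow> 'i \<Rightarrow> complex ^ 'n \<Rightarrow> complex ^ 'n \<Rightarrow> complex" where
  "theta c i z v = 1 / of_nat N * (del (\<lambda>z. \<zeta> i (kap c z)) z v / \<zeta> i (kap c z))"

definition bb :: "('a, 'n) chart \<Rightarrow> 'i \<Rightarrow> complex ^ 'n \<Rightarrow> (complex ^ 'n) list \<Rightarrow> complex" where
  "bb c i z vs = del_conn X A D N \<iota> \<alpha> c i (kap c z) vs []"

text \<open>Writing the weight as a power of the squared modulus lets it be differentiated through
  \<zeta> times its conjugate, a product of a holomorphic and an antiholomorphic function.\<close>

definition wt :: "'i \<Rightarrow> 'a \<Rightarrow> real" where
  "wt i x = (cmod (\<zeta> i x))\<^sup>2 powr (1 / real N)"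

abbreviation img :: "('a, 'n) chart \<Rightarrow> (complex ^ 'n) set" where "img c \<equiv> snd c ` fst c"

lemma admD:
  assumes "adm c i"
  shows "c \<in> A" "i \<in> idx L" "x \<in> fst c \<Longrightarrow> x \<in> cover L i" "x \<in> fst c \<Longrightarrow> x \<notin> D" "open (img c)"
    "x \<in> fst c \<Longrightarrow> x \<in> topspace X"
  using assms chart_facts(2)[of c] chart_subset[of c] by (auto simp: adm_def)

lemma dual_bundle_simps [simp]:
  "idx (dual_bundle L) = idx L" "cover (dual_bundle L) = cover L"
  "cocycle (dual_bundle L) i j x = inverse (cocycle L i j x)"
  by (simp_all add: dual_bundle_def)

text \<open>The adapted coordinate K is left open: \<open>None\<close> gives ordinary smoothness off
  D, \<open>Some k\<close> the simple poles near D. For q = 0 only the empty list J remains in the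
  double sum.\<close>

lemma alpha_expand:
  assumes c: "c \<in> A" and K: "adapted D c K" and i: "i \<in> idx L" and sub: "fst c \<subseteq> cover L i"
  shows "\<exists>f. (\<forall>I. smooth_on (f I) (img c)) \<and>
    (\<forall>z vs. z \<in> img c \<longrightarrow> kap c z \<notin> D \<longrightarrow> length vs = p \<longrightarrow>
      aa c i z vs = (\<Sum>I | length I = p. f I z * wedge_covectors (map (log_coframe K z) I) vs))"
proof -
  have int: "fst c \<inter> cover L i = fst c" using sub by auto
  from log_form_coefficients[OF lf c K, of i] i
  obtain f where f0: "(\<forall>I J. smooth_on (f I J) (img c)) \<and>
    (\<forall>x\<in>fst c - D. \<forall>vs ws. length vs = p \<and> length ws = 0 \<longrightarrow>
      \<alpha> c i x vs ws = (\<Sum>I | length I = p. \<Sum>J | length J = 0. f I J (snd c x) *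
        wedge_covectors (map (log_coframe K (snd c x)) I) vs * wedge_covectors (map conj_coframe J) ws))"
    by (auto simp: int)
  note f = conjunct1[OF f0, rule_format] conjunct2[OF f0, rule_format]
  have w: "wedge_covectors [] [] = 1"
    by (simp add: wedge_covectors_def)
  show ?thesis
  proof (intro exI[of _ "\<lambda>I. f I []"] conjI allI impI)
    show "smooth_on (f I []) (img c)" for I by (rule f(1))
    fix z and vs :: "(complex ^ 'n) list" assume z: "z \<in> img c" "kap c z \<notin> D" and vs: "length vs = p"
    have "aa c i z vs = (\<Sum>I | length I = p. \<Sum>J | length J = 0. f I J (snd c (kap c z)) *
        wedge_covectors (map (log_coframe K (snd c (kap c z))) I) vs * wedge_covectors (map conj_coframe J) [])"
      unfolding aa_def by (rule f(2)) (use kap_in[OF z(1)] z(2) vs in auto)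
    then show "aa c i z vs = (\<Sum>I | length I = p. f I [] z * wedge_covectors (map (log_coframe K z) I) vs)"
      by (simp add: chart_kap[OF z(1)] w)
  qed
qed

lemma aa_facts:
  assumes adm: "adm c i"
  shows "length vs = p \<Longrightarrow> Ck_on m (\<lambda>z. aa c i z vs) (img c)"
    "z \<in> img c \<Longrightarrow> mlin p (aa c i z)" "z \<in> img c \<Longrightarrow> alt p (aa c i z)"
proof -
  have ad: "adapted D c None" using adm by (auto simp: adapted_def adm_def case_prod_beta)
  have sub: "fst c \<subseteq> cover L i" using adm by (simp add: adm_def)
  from alpha_expand[OF admD(1)[OF adm] ad admD(2)[OF adm] sub]
  obtain f where f0: "(\<forall>I. smooth_on (f I) (img c)) \<and>
    (\<forall>z vs. z \<in> img c \<longrightarrow> kap c z \<notin> D \<longrightarrow> length vs = p \<longrightarrow>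
      aa c i z vs = (\<Sum>I | length I = p. f I z * wedge_covectors (map (log_coframe None z) I) vs))" ..
  note f = conjunct1[OF f0, rule_format] conjunct2[OF f0, rule_format]
  have cof: "log_coframe None z = (\<lambda>j v. v $ j)" for z :: "complex ^ 'n"
    by (simp add: fun_eq_iff log_coframe_def)
  have f2: "aa c i z vs = (\<Sum>I | length I = p. f I z * wedge_covectors (map (\<lambda>j v. v $ j) I) vs)"
    if "z \<in> img c" "length vs = p" for z vs
    using f(2)[OF that(1) admD(4)[OF adm kap_in[OF that(1)]] that(2)] by (simp only: cof)
  show "Ck_on m (\<lambda>z. aa c i z vs) (img c)" if vs: "length vs = p"
  proof (rule Ck_on_cong_open[OF admD(5)[OF adm]])
    show "Ck_on m (\<lambda>z. \<Sum>I | length I = p. f I z * wedge_covectors (map (\<lambda>j v. v $ j) I) vs) (img c)"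
      using f(1) by (intro Ck_on_sum[OF admD(5)[OF adm]] Ck_on_mult[OF admD(5)[OF adm]] Ck_on_const)
        (simp add: smooth_on_def)
  qed (simp add: f2 vs)
  have "mlin p (\<lambda>vs. \<Sum>I | length I = p. f I z * wedge_covectors (map (\<lambda>j v. v $ j) I) vs)" for z
  proof (intro mlin_sum mlin_cmult)
    fix I :: "'n list" assume "I \<in> {I. length I = p}"
    moreover have "mlin (length (map (\<lambda>j v :: complex ^ 'n. v $ j) I)) (wedge_covectors (map (\<lambda>j v :: complex ^ 'n. v $ j) I))"
      by (rule mlin_wedge_covectors) auto
    ultimately show "mlin p (wedge_covectors (map (\<lambda>j v. v $ j) I))" by simp
  qed
  then show "mlin p (aa c i z)" if "z \<in> img c" by (rule mlin_cong[rotated]) (simp add: f2[OF that])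
  have "alt p (\<lambda>vs. \<Sum>I | length I = p. f I z * wedge_covectors (map (\<lambda>j v :: complex ^ 'n. v $ j) I) vs)" for z
  proof (intro alt_sum alt_cmult)
    fix I :: "'n list" assume "I \<in> {I. length I = p}"
    then show "alt p (wedge_covectors (map (\<lambda>j v :: complex ^ 'n. v $ j) I))"
      using alt_wedge_covectors[of "map (\<lambda>j v :: complex ^ 'n. v $ j) I"] by simp
  qed
  then show "alt p (aa c i z)" if "z \<in> img c" by (rule alt_cong[rotated]) (simp add: f2[OF that])
qed

lemma aa_differentiable:
  "adm c i \<Longrightarrow> z \<in> img c \<Longrightarrow> length vs = p \<Longrightarrow> (\<lambda>z. aa c i z vs) differentiable (at z)"
  by (rule C1_onD(1)[OF aa_facts(1)])

lemma zeta_adm: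
  assumes adm: "adm c i"
  shows "holo_on (\<lambda>z. \<zeta> i (kap c z)) (img c)" "z \<in> img c \<Longrightarrow> \<zeta> i (kap c z) \<noteq> 0"
proof -
  have int: "fst c \<inter> cover L i = fst c" using adm by (auto simp: adm_def)
  show "holo_on (\<lambda>z. \<zeta> i (kap c z)) (img c)"
    using zeta_holo[OF admD(1,2)[OF adm]] by (simp add: int)
  show "\<zeta> i (kap c z) \<noteq> 0" if z: "z \<in> img c"
    using zeta_zero_iff[OF admD(2,3)[OF adm], OF kap_in[OF z]] admD(4)[OF adm kap_in[OF z]] by simp
qed

lemma theta_facts:
  assumes adm: "adm c i"
  shows "Ck_on m (\<lambda>z. theta c i z v) (img c)"
    "z \<in> img c \<Longrightarrow> theta c i z (a *s v + w) = a * theta c i z v + theta c i z w"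
proof -
  note O = admD(5)[OF adm] and Z = zeta_adm[OF adm]
  have "holo_on (\<lambda>z. 1 / of_nat N * (fd (\<lambda>z. \<zeta> i (kap c z)) z v / \<zeta> i (kap c z))) (img c)"
    by (intro holo_on_cmult holo_on_divide holo_on_fd[OF Z(1) O] Z)
  then have "Ck_on m (\<lambda>z. 1 / of_nat N * (fd (\<lambda>z. \<zeta> i (kap c z)) z v / \<zeta> i (kap c z))) (img c)"
    by (rule holo_on_Ck[OF _ O])
  then show "Ck_on m (\<lambda>z. theta c i z v) (img c)"
    by (rule Ck_on_cong_open[OF O, rotated]) (simp add: theta_def del_holo(1)[OF Z(1)])
  show "theta c i z (a *s v + w) = a * theta c i z v + theta c i z w" if "z \<in> img c"
    unfolding theta_def del_lin[OF holo_onD(1)[OF Z(1) that]]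
    by (simp add: add_divide_distrib algebra_simps)
qed

text \<open>The sign (-1)^p of the Leibniz rule and the sign (-1)^(p - a) of moving the connection
  form into place combine to (-1)^a. Hence the connection is covariant differentiation followed by
  \<open>skew\<close>.\<close>

lemma bb_skew:
  assumes z: "z \<in> img c" and vs: "length vs = Suc p"
  shows "bb c i z vs = skew (\<lambda>us. del (\<lambda>y. aa c i y (tl us)) z (hd us) + theta c i z (hd us) * aa c i z (tl us)) vs"
proof -
  have sgn: "(- 1) ^ p * ((- 1) ^ (p - a)) = ((- 1) ^ a :: complex)" if "a < Suc p" for a
  proof -
    have "p + (p - a) + a = 2 * p" using that by simp
    then have "(- 1) ^ p * (- 1) ^ (p - a) * (- 1) ^ a = (1::complex)"
      by (simp flip: power_add)
    then show ?thesis by (metis (no_types, lifting) left_minus_one_mult_self mult.commute mult.right_neutral)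
  qed
  have "bb c i z vs = (\<Sum>a<Suc p. (- 1) ^ a * del (\<lambda>z. aa c i z (remove_nth a vs)) z (vs ! a)) +
      (- 1) ^ p * (\<Sum>a<Suc p. (- 1) ^ (p - a) * aa c i z (remove_nth a vs) * theta c i z (vs ! a))"
    unfolding bb_def del_conn_def del_form_def wedge_10_def connection_form_def dir_del_eq vs theta_def aa_def
    by (simp add: chart_kap[OF z])
  also have "(- 1) ^ p * (\<Sum>a<Suc p. (- 1) ^ (p - a) * aa c i z (remove_nth a vs) * theta c i z (vs ! a)) =
      (\<Sum>a<Suc p. (- 1) ^ a * (theta c i z (vs ! a) * aa c i z (remove_nth a vs)))"
    unfolding sum_distrib_left
  proof (intro sum.cong refl)
    fix a assume "a \<in> {..<Suc p}"
    then have "a < Suc p" by simp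
    have "(- 1) ^ p * ((- 1) ^ (p - a) * aa c i z (remove_nth a vs) * theta c i z (vs ! a)) =
        ((- 1) ^ p * (- 1) ^ (p - a)) * (theta c i z (vs ! a) * aa c i z (remove_nth a vs))"
      by (simp only: mult_ac)
    then show "(- 1) ^ p * ((- 1) ^ (p - a) * aa c i z (remove_nth a vs) * theta c i z (vs ! a)) =
        (- 1) ^ a * (theta c i z (vs ! a) * aa c i z (remove_nth a vs))"
      by (simp only: sgn[OF \<open>a < Suc p\<close>])
  qed
  finally show ?thesis
    unfolding skew_def vs by (simp only: sum.distrib[symmetric] distrib_left[symmetric] rot_def list.sel)
qed

lemma bb_facts:
  assumes adm: "adm c i"
  shows "length vs = Suc p \<Longrightarrow> C1_on (\<lambda>z. bb c i z vs) (img c)"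
    "z \<in> img c \<Longrightarrow> mlin (Suc p) (bb c i z)" "z \<in> img c \<Longrightarrow> alt (Suc p) (bb c i z)"
    "z \<in> img c \<Longrightarrow> length vs = Suc p \<Longrightarrow> delb (\<lambda>z. bb c i z vs) z w = 0"
proof -
  note O = admD(5)[OF adm]
  let ?s = "\<lambda>z us. del (\<lambda>y. aa c i y (tl us)) z (hd us) + theta c i z (hd us) * aa c i z (tl us)"
  show "C1_on (\<lambda>z. bb c i z vs) (img c)" if vs: "length vs = Suc p"
  proof (rule Ck_on_cong_open[OF O])
    show "C1_on (\<lambda>z. \<Sum>a<Suc p. (- 1) ^ a * (del (\<lambda>y. aa c i y (remove_nth a vs)) z (vs ! a) +
        theta c i z (vs ! a) * aa c i z (remove_nth a vs))) (img c)"
      by (intro Ck_on_sum[OF O] Ck_on_mult[OF O] Ck_on_add[OF O] Ck_on_const Ck_on_del[OF O] aa_facts(1)[OF adm] theta_facts(1)[OF adm])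
        (auto simp: length_remove_nth vs)
    fix z assume "z \<in> img c"
    from bb_skew[OF this vs] show "(\<Sum>a<Suc p. (- 1) ^ a * (del (\<lambda>y. aa c i y (remove_nth a vs)) z (vs ! a) +
        theta c i z (vs ! a) * aa c i z (remove_nth a vs))) = bb c i z vs"
      by (simp only: skew_def vs rot_def list.sel)
  qed
  fix z assume z: "z \<in> img c"
  note da = aa_differentiable[OF adm z]
  have tail: "mlin p (\<lambda>us. ?s z (v # us))" "alt p (\<lambda>us. ?s z (v # us))" for v
  proof -
    show "mlin p (\<lambda>us. ?s z (v # us))"
      unfolding list.sel
      by (intro mlin_add mlin_cmult aa_facts(2)[OF adm z] mlin_del[OF O z] aa_facts(2)[OF adm] da)
    have "alt p (\<lambda>us. del (\<lambda>y. aa c i y us) z v - (- theta c i z v) * aa c i z us)"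
      by (intro alt_diff alt_cmult aa_facts(3)[OF adm z] alt_del[OF O z] aa_facts(3)[OF adm] da)
    then show "alt p (\<lambda>us. ?s z (v # us))" by simp
  qed
  have "mlin (Suc p) (?s z)"
    unfolding mlin.simps
  proof (intro conjI allI impI tail)
    fix us :: "(complex ^ 'n) list" and a v w assume "length us = p"
    then show "?s z ((a *s v + w) # us) = a * ?s z (v # us) + ?s z (w # us)"
      by (simp only: list.sel del_lin[OF da] theta_facts(2)[OF adm z]) (simp add: algebra_simps)
  qed
  then have "mlin (Suc p) (skew (?s z))" by (rule mlin_skew)
  then show "mlin (Suc p) (bb c i z)" by (rule mlin_cong[rotated]) (simp only: bb_skew[OF z])
  have "alt (Suc p) (skew (?s z))" by (rule alt_skew) (rule tail)
  then show "alt (Suc p) (bb c i z)" by (rule alt_cong[rotated]) (simp only: bb_skew[OF z])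
  assume vs: "length vs = Suc p"
  have "delbar_conn (del_conn X A D N \<iota> \<alpha>) c i (kap c z) vs [w] = 0"
    by (rule form_zeroD[OF hol admD(1)[OF adm]])
      (use admD(2-4)[OF adm] kap_in[OF z] vs in auto)
  then show "delb (\<lambda>z. bb c i z vs) z w = 0"
    by (simp add: delbar_conn_def delbar_form_def dir_delbar_eq chart_kap[OF z] bb_def)
qed

lemma cocycle_overlap:
  assumes 1: "adm c i" and 2: "adm c' i'" and z: "z \<in> snd c ` (fst c \<inter> fst c')"
  shows "(\<lambda>z. cocycle L i i' (kap c z)) differentiable (at z)" "cocycle L i i' (kap c z) \<noteq> 0"
proof -
  have "holo_on (\<lambda>z. cocycle L i i' (kap c z)) (snd c ` (fst c \<inter> (cover L i \<inter> cover L i')))"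
    by (rule holo_fun_onD[OF cocycle_facts(1)[OF admD(2)[OF 1] admD(2)[OF 2]] admD(1)[OF 1]])
  then have "holo_on (\<lambda>z. cocycle L i i' (kap c z)) (snd c ` (fst c \<inter> fst c'))"
    by (rule holo_on_subset) (use 1 2 in \<open>auto simp: adm_def\<close>)
  then show "(\<lambda>z. cocycle L i i' (kap c z)) differentiable (at z)" by (rule holo_onD(1)[OF _ z])
  obtain x where x: "x \<in> fst c" "x \<in> fst c'" "z = snd c x" using z by auto
  then show "cocycle L i i' (kap c z) \<noteq> 0"
    using cocycle_facts(2)[OF admD(2)[OF 1] admD(2)[OF 2] admD(3)[OF 1 x(1)] admD(3)[OF 2 x(2)]] admD(1)[OF 1] by simp
qed

lemma aa_transform:
  assumes 1: "adm c i" and 2: "adm c' i'" and x: "x \<in> fst c" "x \<in> fst c'" and vs: "length vs = p"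
  shows "aa c i (snd c x) vs = inverse (cocycle L i i' x) * aa c' i' (snd c' x) (map (fd (transition c c') (snd c x)) vs)"
  using log_form_transform[OF lf admD(1)[OF 1] admD(1)[OF 2], of i i' x vs "[]"] 1 2 x vs admD[OF 1] admD[OF 2]
  by (auto simp: aa_def)

text \<open>Covariance of the connection under a simultaneous change of chart and frame. The chart
  part is \<open>skew_del_transform\<close> with u the inverse cocycle; what has to be supplied is
  its gauge hypothesis.\<close>

lemma bb_transform:
  assumes 1: "adm c i" and 2: "adm c' i'" and x: "x \<in> fst c" "x \<in> fst c'" and vs: "length vs = Suc p"
  shows "bb c i (snd c x) vs = inverse (cocycle L i i' x) * bb c' i' (snd c' x) (map (fd (transition c c') (snd c x)) vs)"
proof -
  note c = admD(1)[OF 1] and c' = admD(1)[OF 2]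
  let ?S = "snd c ` (fst c \<inter> fst c')" and ?z = "snd c x" and ?\<tau> = "transition c c'"
  let ?g = "\<lambda>z. cocycle L i i' (kap c z)"
  let ?u = "\<lambda>z. inverse (?g z)"
  have z: "?z \<in> ?S" "?z \<in> img c" "snd c' x \<in> img c'" using x by auto
  have tz: "?\<tau> ?z = snd c' x" by (rule transition_maps[OF c c' x])
  note g = cocycle_overlap[OF 1 2 z(1)]
  let ?Z = "\<lambda>z. \<zeta> i (kap c z)" and ?Z' = "\<lambda>z. \<zeta> i' (kap c' z)"
  note dZ' = holo_onD(1)[OF zeta_adm(1)[OF 2] z(3)]
  note t = transition_derivative[OF c c' z(1)]
  have t0: "fd ?\<tau> ?z (a *s v) = a *s fd ?\<tau> ?z v" for a v
    using t(4)[of a v 0] t(4)[of 1 0 0] by simp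
  \<comment> \<open>The logarithmic derivative of \<zeta> = \<zeta>' g^N, divided by N, says that
    \<open>theta\<close> changes by dg/g; the derivative of 1/g contributes the opposite
    term.\<close>
  have th: "del ?u ?z v + theta c i ?z v * ?u ?z = ?u ?z * theta c' i' (?\<tau> ?z) (fd ?\<tau> ?z v)" for v
  proof -
    have Zeq: "?Z y = ?Z' (?\<tau> y) * ?g y ^ N" if "y \<in> ?S" for y
      using that zeta_transform[OF admD(2)[OF 1] admD(2)[OF 2] admD(3)[OF 1] admD(3)[OF 2] admD(4)[OF 1]] c c'
      by (auto simp: transition_maps)
    have dc: "(\<lambda>y. ?Z' (?\<tau> y)) differentiable (at ?z)"
      by (rule fd_compose(2)[OF _ t(2)]) (simp add: tz dZ')
    have "del ?Z ?z v = del (\<lambda>y. ?Z' (?\<tau> y) * ?g y ^ N) ?z v"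
      using del_cong_open(1)[OF open_overlap[OF c c'] z(1), of ?Z "\<lambda>y. ?Z' (?\<tau> y) * ?g y ^ N"] Zeq by simp
    also have "\<dots> = ?Z' (?\<tau> ?z) * del (\<lambda>y. ?g y ^ N) ?z v + del (\<lambda>y. ?Z' (?\<tau> y)) ?z v * ?g ?z ^ N"
      using del_power[OF g(1)] by (intro del_mult dc) blast
    also have "del (\<lambda>y. ?Z' (?\<tau> y)) ?z v = del ?Z' (?\<tau> ?z) (fd ?\<tau> ?z v)"
      by (rule del_compose(1)[OF _ t(2) t0]) (simp add: tz dZ')
    also have "del (\<lambda>y. ?g y ^ N) ?z v = of_nat N * ?g ?z ^ (N - 1) * del ?g ?z v"
      using del_power[OF g(1)] by blast
    finally have dZ: "del ?Z ?z v = ?Z' (?\<tau> ?z) * (of_nat N * ?g ?z ^ (N - 1) * del ?g ?z v) +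
        del ?Z' (?\<tau> ?z) (fd ?\<tau> ?z v) * ?g ?z ^ N" .
    define G where "G = ?g ?z"
    define Z' where "Z' = ?Z' (?\<tau> ?z)"
    have nz: "G \<noteq> 0" "Z' \<noteq> 0" using g(2) zeta_adm(2)[OF 2 z(3)] by (simp_all add: G_def Z'_def tz)
    have N0: "of_nat N \<noteq> (0::complex)" using N by simp
    have GN: "G ^ N = G ^ (N - 1) * G" using N by (metis Suc_diff_1 power_Suc2 zero_less_one order_less_le_trans)
    have "theta c i ?z v = 1 / of_nat N * ((Z' * (of_nat N * G ^ (N - 1) * del ?g ?z v) +
        del ?Z' (?\<tau> ?z) (fd ?\<tau> ?z v) * G ^ N) / (Z' * G ^ N))"
      unfolding theta_def dZ G_def[symmetric] Z'_def[symmetric] using Zeq[OF z(1)] by (simp only: G_def Z'_def)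
    also have "\<dots> = del ?g ?z v / G + 1 / of_nat N * (del ?Z' (?\<tau> ?z) (fd ?\<tau> ?z v) / Z')"
      using nz N0 by (simp add: GN field_simps)
    finally have e1: "theta c i ?z v = del ?g ?z v / G + theta c' i' (?\<tau> ?z) (fd ?\<tau> ?z v)"
      by (simp add: theta_def Z'_def)
    have e2: "del ?u ?z v = - del ?g ?z v / G\<^sup>2"
      unfolding G_def by (rule del_inverse(2)[OF g])
    show ?thesis unfolding e1 e2 G_def[symmetric] using nz by (simp add: field_simps power2_eq_square)
  qed
  have "skew (\<lambda>us. del (\<lambda>y. aa c i y (tl us)) ?z (hd us) + theta c i ?z (hd us) * aa c i ?z (tl us)) vs =
    ?u ?z * skew (\<lambda>us. del (\<lambda>y. aa c' i' y (tl us)) (?\<tau> ?z) (hd us) + theta c' i' (?\<tau> ?z) (hd us) * aa c' i' (?\<tau> ?z) (tl us))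
      (map (fd ?\<tau> ?z) vs)"
  proof (rule skew_del_transform[OF open_overlap[OF c c'] z(1) transition_holo[OF c c'] _ _ _ _ _ th vs])
    fix y and us :: "(complex ^ 'n) list" assume "y \<in> ?S" and us: "length us = p"
    then obtain x' where x': "x' \<in> fst c" "x' \<in> fst c'" "y = snd c x'" by auto
    show "aa c i y us = ?u y * aa c' i' (?\<tau> y) (map (fd ?\<tau> y) us)"
      using aa_transform[OF 1 2 x'(1,2) us] x' c c' by (simp add: transition_maps)
  next
    fix us :: "(complex ^ 'n) list" assume "length us = p"
    then show "(\<lambda>y. aa c' i' y us) differentiable (at (?\<tau> ?z))"
      unfolding tz by (rule aa_differentiable[OF 2 z(3)])
  next
    fix y assume "y \<in> ?S"
    then have "?\<tau> y \<in> img c'" using c c' by (auto simp: transition_maps)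
    then show "mlin p (aa c' i' (?\<tau> y))" by (rule aa_facts(2)[OF 2])
  next
    show "alt p (aa c' i' (?\<tau> ?z))" unfolding tz by (rule aa_facts(3)[OF 2 z(3)])
    show "?u differentiable (at ?z)" by (rule del_inverse(1)[OF g])
  qed
  then show ?thesis
    using bb_skew[OF z(2) vs, of i] bb_skew[OF z(3), of "map (fd ?\<tau> ?z) vs" i'] vs x c by (simp add: tz)
qed

text \<open>Raising |g^N|^2 to the power 1/N returns |g|^2, which compensates the cocycle acting on
  both arguments of a Hermitian pairing.\<close>

lemma wt_transform:
  assumes 1: "adm c i" and 2: "adm c' i'" and x: "x \<in> fst c" "x \<in> fst c'"
  shows "wt i x * (cmod (inverse (cocycle L i i' x)))\<^sup>2 = wt i' x"
proof -
  let ?g = "cmod (cocycle L i i' x)"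
  have g: "?g > 0" using cocycle_facts(2)[OF admD(2)[OF 1] admD(2)[OF 2] admD(3)[OF 1 x(1)] admD(3)[OF 2 x(2)]] by simp
  have "wt i x = ((cmod (\<zeta> i' x))\<^sup>2 * (?g ^ N)\<^sup>2) powr (1 / real N)"
    using zeta_transform[OF admD(2)[OF 1] admD(2)[OF 2] admD(3)[OF 1 x(1)] admD(3)[OF 2 x(2)] admD(4)[OF 1 x(1)]]
    by (simp add: wt_def norm_mult norm_power power_mult_distrib)
  also have "\<dots> = wt i' x * ((?g ^ N)\<^sup>2) powr (1 / real N)"
    by (simp add: wt_def powr_mult)
  also have "(?g ^ N)\<^sup>2 = (?g\<^sup>2) powr real N"
    using g by (simp add: powr_realpow flip: power_mult power_mult_distrib) (simp add: mult.commute)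
  also have "((?g\<^sup>2) powr real N) powr (1 / real N) = ?g\<^sup>2"
    using g N by (simp add: powr_powr)
  finally show ?thesis using g by (simp add: norm_inverse power_inverse)
qed

end


section \<open>Weight, density and divergence formula in a chart off the divisor\<close>

lemma Ck_on_ip:
  fixes s t :: "'v::real_normed_vector \<Rightarrow> (complex ^ 'n) list \<Rightarrow> complex"
  assumes S: "open S" and G: "\<And>k j. Ck_on r (\<lambda>y. G y k j) S"
  shows "(\<And>vs. length vs = m \<Longrightarrow> Ck_on r (\<lambda>y. s y vs) S) \<Longrightarrow> (\<And>vs. length vs = m \<Longrightarrow> Ck_on r (\<lambda>y. t y vs) S) \<Longrightarrow>
    Ck_on r (\<lambda>y. ip (G y :: 'n::finite \<Rightarrow> 'n \<Rightarrow> complex) m (s y) (t y)) S"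
proof (induction m arbitrary: s t)
  case 0
  have "Ck_on r (\<lambda>y. s y [] * cnj (t y [])) S"
    by (intro Ck_on_mult[OF S] Ck_on_linear[OF S bounded_linear_cnj] 0) simp_all
  then show ?case by simp
next
  case (Suc m)
  have "Ck_on r (\<lambda>y. ip (G y) m (\<lambda>vs. s y (v # vs)) (\<lambda>vs. t y (w # vs))) S" for v w
    by (rule Suc.IH) (use Suc.prems in auto)
  then show ?case unfolding ip.simps by (intro Ck_on_sum[OF S] Ck_on_mult[OF S] G)
qed

lemma del_of_real_const: "open S \<Longrightarrow> z \<in> S \<Longrightarrow> (\<And>y. y \<in> S \<Longrightarrow> f y = c) \<Longrightarrow> del (\<lambda>z. complex_of_real (f z)) z v = 0"
  using del_cong_open(1)[of S z "\<lambda>z. complex_of_real (f z)" "\<lambda>z. complex_of_real c"] by simp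

lemma Re_scale_of_real: "Re (of_real r * z) = r * Re z"
  by simp

context log_setup
begin

lemma C1_HH: "adm c i \<Longrightarrow> C1_on (\<lambda>z. HH c z $ j $ k) (img c)"
  by (rule HH_Ck[OF admD(1)])

lemma posdef_HH: "adm c i \<Longrightarrow> z \<in> img c \<Longrightarrow> posdef (HH c z)"
  by (rule HH_posdef[OF admD(1)])

text \<open>The formula for \<open>del\<close> of the weight is compatibility of the connection with
  the metric: of |\<zeta>|^2 only the holomorphic factor is differentiated, and the exponent 1/N
  matches the one in \<open>theta\<close>.\<close>

lemma wt_facts:
  assumes adm: "adm c i"
  shows "C1_on (\<lambda>z. wt i (kap c z)) (img c)" "z \<in> img c \<Longrightarrow> 0 < wt i (kap c z)"
    "z \<in> img c \<Longrightarrow> del (\<lambda>z. of_real (wt i (kap c z))) z v = of_real (wt i (kap c z)) * theta c i z v"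
proof -
  note O = admD(5)[OF adm] and Z = zeta_adm[OF adm]
  let ?Z = "\<lambda>z. \<zeta> i (kap c z)"
  let ?u = "\<lambda>z. (cmod (?Z z))\<^sup>2"
  let ?e = "1 / real N"
  have u: "complex_of_real (?u z) = ?Z z * cnj (?Z z)" for z by (rule complex_norm_square)
  have C1Z: "C1_on ?Z (img c)" by (rule holo_on_Ck[OF Z(1) O])
  have "C1_on (\<lambda>z. Re (?Z z * cnj (?Z z))) (img c)"
    by (intro Ck_on_linear[OF O bounded_linear_Re] Ck_on_mult[OF O] Ck_on_linear[OF O bounded_linear_cnj] C1Z)
  then have C1u: "C1_on ?u (img c)" by (simp only: u[symmetric] Re_complex_of_real)
  have pos: "?u z > 0" if "z \<in> img c" for z using Z(2)[OF that] by simp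
  have g: "((\<lambda>t. t powr ?e) has_real_derivative ?e * t powr (?e - 1)) (at t)" if "t > 0" for t
    by (rule has_real_derivative_powr[OF that])
  show "C1_on (\<lambda>z. wt i (kap c z)) (img c)"
    unfolding wt_def
  proof (rule C1_on_real_compose[OF C1u])
    show "continuous_on (?u ` img c) (\<lambda>t. ?e * t powr (?e - 1))"
      using Z(2) by (intro continuous_intros) auto
  qed (use g pos in blast)
  assume z: "z \<in> img c"
  show "0 < wt i (kap c z)" using Z(2)[OF z] by (simp add: wt_def)
  note dZ = holo_onD(1)[OF Z(1) z]
  have "del (\<lambda>z. of_real (wt i (kap c z))) z v = of_real (?e * ?u z powr (?e - 1)) * del (\<lambda>z. of_real (?u z)) z v"
    unfolding wt_def by (rule del_real_compose(2)[OF C1_onD(1)[OF C1u z] g[OF pos[OF z]]])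
  also have "del (\<lambda>z. of_real (?u z)) z v = del ?Z z v * cnj (?Z z)"
    unfolding u del_mult[OF dZ differentiable_cnj[OF dZ]] del_cnj[OF dZ] del_holo(2)[OF Z(1) z] by simp
  also have "of_real (?e * ?u z powr (?e - 1)) = of_real ?e * of_real (?u z powr ?e) / (?Z z * cnj (?Z z))"
  proof -
    have "?u z powr (?e - 1) = ?u z powr ?e / ?u z" using pos[OF z] by (simp add: powr_diff)
    then have "complex_of_real (?e * ?u z powr (?e - 1)) = of_real ?e * of_real (?u z powr ?e) / of_real (?u z)"
      by simp
    then show ?thesis by (simp only: u)
  qed
  finally show "del (\<lambda>z. of_real (wt i (kap c z))) z v = of_real (wt i (kap c z)) * theta c i z v"
    using Z(2)[OF z] by (simp add: theta_def wt_def field_simps)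
qed

definition RR :: "('a, 'n) chart \<Rightarrow> 'i \<Rightarrow> complex ^ 'n \<Rightarrow> complex" where
  "RR c i z = of_real (rho (HH c z)) * of_real (wt i (kap c z))"

lemma RR_facts:
  assumes adm: "adm c i"
  shows "C1_on (RR c i) (img c)"
    "z \<in> img c \<Longrightarrow> del (RR c i) z v = RR c i z *
      (theta c i z v + (\<Sum>a\<in>UNIV. \<Sum>k\<in>UNIV. inv_entry (HH c z) k a * del (\<lambda>z. HH c z $ a $ k) z v))"
proof -
  note O = admD(5)[OF adm]
  have 1: "C1_on (\<lambda>z. complex_of_real (rho (HH c z))) (img c)"
    by (intro Ck_on_linear[OF O bounded_linear_of_real] C1_on_rho[OF O C1_HH[OF adm] posdef_HH[OF adm]])
  have 2: "C1_on (\<lambda>z. complex_of_real (wt i (kap c z))) (img c)"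
    by (intro Ck_on_linear[OF O bounded_linear_of_real] wt_facts(1)[OF adm])
  show "C1_on (RR c i) (img c)" unfolding RR_def by (rule Ck_on_mult[OF O 1 2])
  assume z: "z \<in> img c"
  show "del (RR c i) z v = RR c i z *
      (theta c i z v + (\<Sum>a\<in>UNIV. \<Sum>k\<in>UNIV. inv_entry (HH c z) k a * del (\<lambda>z. HH c z $ a $ k) z v))"
  proof -
    have e: "del (\<lambda>z. complex_of_real (rho (HH c z))) z v = of_real (rho (HH c z)) *
        (\<Sum>a\<in>UNIV. \<Sum>k\<in>UNIV. inv_entry (HH c z) k a * del (\<lambda>z. HH c z $ a $ k) z v)"
      by (rule del_rho[OF O C1_HH[OF adm] posdef_HH[OF adm] z])
    show ?thesis
      unfolding RR_def[abs_def] del_mult[OF C1_onD(1)[OF 1 z] C1_onD(1)[OF 2 z]] wt_facts(3)[OF adm z] e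
      by (simp add: algebra_simps)
  qed
qed

text \<open>The j-th component of the vector field obtained by contracting \<alpha> with
  \<partial>\<alpha>, multiplied by the density, so that its divergence is a sum of plain coordinate
  derivatives.\<close>

definition YY :: "('a, 'n) chart \<Rightarrow> 'i \<Rightarrow> 'n \<Rightarrow> complex ^ 'n \<Rightarrow> complex" where
  "YY c i j z = RR c i z * (\<Sum>k\<in>UNIV. inv_entry (HH c z) k j *
     ip (inv_entry (HH c z)) p (aa c i z) (\<lambda>vs. bb c i z (cbasis k # vs)))"

lemma YY_C1:
  assumes adm: "adm c i"
  shows "C1_on (YY c i j) (img c)"
proof -
  note O = admD(5)[OF adm]
  have G: "C1_on (\<lambda>z. inv_entry (HH c z) k j) (img c)" for k j
    by (rule C1_on_inv_entry[OF O C1_HH[OF adm] posdef_HH[OF adm]])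
  have "C1_on (\<lambda>z. ip (inv_entry (HH c z)) p (aa c i z) (\<lambda>vs. bb c i z (cbasis k # vs))) (img c)" for k
    by (rule Ck_on_ip[OF O G], erule aa_facts(1)[OF adm], rule bb_facts(1)[OF adm], simp)
  then show ?thesis
    unfolding YY_def[abs_def] by (intro Ck_on_mult[OF O] Ck_on_sum[OF O] RR_facts(1)[OF adm] G)
qed

definition fc :: "('a, 'n) chart \<Rightarrow> ('a \<Rightarrow> real) \<Rightarrow> complex ^ 'n \<Rightarrow> complex" where
  "fc c f z = of_real (f (kap c z))"

text \<open>The tensor \<partial>f \<otimes> \<alpha> before alternation; this is the form in which
  \<partial>f comes out of the divergence formula.\<close>

definition da :: "('a, 'n) chart \<Rightarrow> 'i \<Rightarrow> ('a \<Rightarrow> real) \<Rightarrow> complex ^ 'n \<Rightarrow> (complex ^ 'n) list \<Rightarrow> complex" where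
  "da c i f z us = del (fc c f) z (hd us) * aa c i z (tl us)"

definition pairing :: "('a, 'n) chart \<Rightarrow> 'i \<Rightarrow> complex ^ 'n \<Rightarrow> ((complex ^ 'n) list \<Rightarrow> complex) \<Rightarrow>
    ((complex ^ 'n) list \<Rightarrow> complex) \<Rightarrow> real" where
  "pairing c i z s t = wt i (kap c z) * Re (ip (inv_entry (HH c z)) (Suc p) s t)"

lemma fc_C1: "C1_fun f \<Longrightarrow> c \<in> A \<Longrightarrow> C1_on (fc c f) (img c)"
  unfolding fc_def[abs_def] by (rule Ck_on_linear[OF chart_facts(2) bounded_linear_of_real C1_funD])

lemma divergence_chart:
  assumes adm: "adm c i" and f: "C1_fun f" and z: "z \<in> img c"
  shows "Re (\<Sum>j\<in>UNIV. del (\<lambda>y. fc c f y * YY c i j y) z (cbasis j)) =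
    rho (HH c z) * (f (kap c z) / real (Suc p) * pairing c i z (bb c i z) (bb c i z) + pairing c i z (da c i f z) (bb c i z))"
proof -
  note O = admD(5)[OF adm]
  have alg: "R * w * (F * a + b) = R * (F * (w * a) + w * b)" for R w F a b :: real
    by (simp add: algebra_simps)
  have D: "(\<Sum>j\<in>UNIV. del (\<lambda>y. fc c f y * YY c i j y) z (cbasis j)) =
    RR c i z * (fc c f z / of_nat (Suc p) * ip (inv_entry (HH c z)) (Suc p) (bb c i z) (bb c i z) +
      ip (inv_entry (HH c z)) (Suc p) (\<lambda>us. del (fc c f) z (hd us) * aa c i z (tl us)) (bb c i z))"
    unfolding YY_def
    by (rule divergence_identity[OF O C1_HH[OF adm] posdef_HH[OF adm] z HH_kaehler[OF admD(1)[OF adm] z]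
          aa_differentiable[OF adm z] C1_onD(1)[OF bb_facts(1)[OF adm] z] bb_facts(4)[OF adm z] bb_facts(3)[OF adm z]
          bb_skew[OF z] C1_onD(1)[OF fc_C1[OF f admD(1)[OF adm]] z] C1_onD(1)[OF RR_facts(1)[OF adm] z]
          RR_facts(2)[OF adm z]])
  have Re: "Re (RR c i z * (fc c f z / of_nat (Suc p) * ip (inv_entry (HH c z)) (Suc p) (bb c i z) (bb c i z) +
      ip (inv_entry (HH c z)) (Suc p) (\<lambda>us. del (fc c f) z (hd us) * aa c i z (tl us)) (bb c i z))) = rho (HH c z) * wt i (kap c z) * (f (kap c z) / real (Suc p) *
      Re (ip (inv_entry (HH c z)) (Suc p) (bb c i z) (bb c i z)) +
      Re (ip (inv_entry (HH c z)) (Suc p) (\<lambda>us. del (fc c f) z (hd us) * aa c i z (tl us)) (bb c i z)))"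
  proof -
    have "RR c i z = of_real (rho (HH c z) * wt i (kap c z))" by (simp add: RR_def)
    moreover have "fc c f z / of_nat (Suc p) = of_real (f (kap c z) / real (Suc p))" by (simp add: fc_def)
    ultimately show ?thesis by (simp only: Re_complex_of_real Re_scale_of_real plus_complex.sel)
  qed
  show ?thesis unfolding D Re pairing_def da_def by (rule alg)
qed


subsection \<open>Independence of the chart\<close>

text \<open>The change of chart is an isometry of the metrics (\<open>ip_transform\<close>), and the
  squared modulus of the cocycle is absorbed by the weight.\<close>

lemma pairing_transform:
  assumes 1: "adm c i" and 2: "adm c' i'" and x: "x \<in> fst c" "x \<in> fst c'"
    and s: "\<And>vs. length vs = Suc p \<Longrightarrow> s vs = inverse (cocycle L i i' x) * s' (map (fd (transition c c') (snd c x)) vs)"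
    and t: "\<And>vs. length vs = Suc p \<Longrightarrow> t vs = inverse (cocycle L i i' x) * t' (map (fd (transition c c') (snd c x)) vs)"
    and ml: "mlin (Suc p) s'" "mlin (Suc p) t'"
  shows "pairing c i (snd c x) s t = pairing c' i' (snd c' x) s' t'"
proof -
  note c = admD(1)[OF 1] and c' = admD(1)[OF 2]
  let ?T = "fd (transition c c') (snd c x)" and ?u = "inverse (cocycle L i i' x)"
  have z: "snd c x \<in> snd c ` (fst c \<inter> fst c')" "snd c x \<in> img c" "snd c' x \<in> img c'" using x by auto
  have "ip (inv_entry (HH c' (snd c' x))) (Suc p) s' t' =
      ip (inv_entry (HH c (snd c x))) (Suc p) (\<lambda>vs. s' (map ?T vs)) (\<lambda>vs. t' (map ?T vs))"
    by (rule ip_transform[OF posdef_HH[OF 1 z(2)] posdef_HH[OF 2 z(3)] transition_derivative(4)[OF c c' z(1)]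
          transition_inverse(2)[OF c c' x] HH_transform[OF c c' x] ml])
  moreover have "ip (inv_entry (HH c (snd c x))) (Suc p) s t =
      ip (inv_entry (HH c (snd c x))) (Suc p) (\<lambda>vs. ?u * s' (map ?T vs)) (\<lambda>vs. ?u * t' (map ?T vs))"
    by (rule ip_cong) (simp_all only: s t)
  ultimately have "ip (inv_entry (HH c (snd c x))) (Suc p) s t = (?u * cnj ?u) * ip (inv_entry (HH c' (snd c' x))) (Suc p) s' t'"
    unfolding ip_cmult_left ip_cmult_right by (simp only: mult_ac)
  also have "?u * cnj ?u = of_real ((cmod ?u)\<^sup>2)" by (rule complex_norm_square[symmetric])
  finally have "Re (ip (inv_entry (HH c (snd c x))) (Suc p) s t) = (cmod ?u)\<^sup>2 * Re (ip (inv_entry (HH c' (snd c' x))) (Suc p) s' t')"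
    by (simp only: Re_scale_of_real) 
  then show ?thesis
    unfolding pairing_def kap_chart[OF c x(1)] kap_chart[OF c' x(2)] wt_transform[OF 1 2 x, symmetric] by (simp only: mult.assoc)
qed

lemma fc_transform:
  assumes 1: "adm c i" and 2: "adm c' i'" and x: "x \<in> fst c" "x \<in> fst c'" and f: "C1_fun f"
  shows "del (fc c f) (snd c x) v = del (fc c' f) (snd c' x) (fd (transition c c') (snd c x) v)"
proof -
  note c = admD(1)[OF 1] and c' = admD(1)[OF 2]
  have z: "snd c x \<in> snd c ` (fst c \<inter> fst c')" "snd c' x \<in> img c'" using x by auto
  note t = transition_derivative[OF c c' z(1)] and tz = transition_maps[OF c c' x]
  have t0: "fd (transition c c') (snd c x) (a *s v) = a *s fd (transition c c') (snd c x) v" for a v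
    using t(4)[of a v 0] t(4)[of 1 0 0] by simp
  have "del (fc c f) (snd c x) = del (\<lambda>z. fc c' f (transition c c' z)) (snd c x)"
    by (rule del_cong_open(1)[OF open_overlap[OF c c'] z(1)]) (use c c' in \<open>auto simp: fc_def transition_maps\<close>)
  also have "\<dots> = (\<lambda>v. del (fc c' f) (snd c' x) (fd (transition c c') (snd c x) v))"
    by (rule ext, subst del_compose(1)[OF _ t(2) t0, of "fc c' f"])
      (use C1_onD(1)[OF fc_C1[OF f c'] z(2)] in \<open>simp_all only: tz\<close>)
  finally show ?thesis by simp
qed

lemma da_mlin:
  assumes adm: "adm c i" and f: "C1_fun f" and z: "z \<in> img c"
  shows "mlin (Suc p) (da c i f z)" "alt p (\<lambda>us. da c i f z (v # us))"
proof -
  note df = C1_onD(1)[OF fc_C1[OF f admD(1)[OF adm]] z]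
  show "mlin (Suc p) (da c i f z)"
    unfolding mlin.simps da_def list.sel
    by (intro conjI allI impI mlin_cmult aa_facts(2)[OF adm z]) (simp only: del_lin[OF df] distrib_right mult.assoc)
  show "alt p (\<lambda>us. da c i f z (v # us))"
    unfolding da_def list.sel by (intro alt_cmult aa_facts(3)[OF adm z])
qed

lemma da_transform:
  assumes 1: "adm c i" and 2: "adm c' i'" and x: "x \<in> fst c" "x \<in> fst c'" and f: "C1_fun f" and us: "length us = Suc p"
  shows "da c i f (snd c x) us = inverse (cocycle L i i' x) * da c' i' f (snd c' x) (map (fd (transition c c') (snd c x)) us)"
proof -
  obtain v vs where "us = v # vs" "length vs = p" using us by (cases us) auto
  then show ?thesis
    using aa_transform[OF 1 2 x, of vs] fc_transform[OF 1 2 x f, of v] by (simp add: da_def)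
qed

text \<open>The form \<partial>f \<and> \<alpha>. Against the alternating \<open>bb\<close> it
  differs from \<open>da\<close> by the factor p + 1, but its own norm is smaller near D:
  \<open>da\<close> may contain dz^k/z^k twice, and the alternation removes such terms.\<close>

definition gam :: "('a, 'n) chart \<Rightarrow> 'i \<Rightarrow> ('a \<Rightarrow> real) \<Rightarrow> complex ^ 'n \<Rightarrow> (complex ^ 'n) list \<Rightarrow> complex" where
  "gam c i f z = skew (da c i f z)"

lemma gam_transform:
  assumes 1: "adm c i" and 2: "adm c' i'" and x: "x \<in> fst c" "x \<in> fst c'" and f: "C1_fun f" and us: "length us = Suc p"
  shows "gam c i f (snd c x) us = inverse (cocycle L i i' x) * gam c' i' f (snd c' x) (map (fd (transition c c') (snd c x)) us)"
proof -
  let ?T = "fd (transition c c') (snd c x)"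
  have "skew (da c i f (snd c x)) us = skew (\<lambda>us. inverse (cocycle L i i' x) * da c' i' f (snd c' x) (map ?T us)) us"
    by (rule skew_cong[OF da_transform[OF 1 2 x f] us])
  also have "\<dots> = inverse (cocycle L i i' x) * skew (\<lambda>us. da c' i' f (snd c' x) (map ?T us)) us"
    by (rule skew_cmult)
  also have "skew (\<lambda>us. da c' i' f (snd c' x) (map ?T us)) us = skew (da c' i' f (snd c' x)) (map ?T us)"
    unfolding skew_def by (intro sum.cong) (auto simp: rot_def map_remove_nth)
  finally show ?thesis by (simp only: gam_def)
qed

lemma gam_mlin:
  assumes "adm c i" "C1_fun f" "z \<in> img c"
  shows "mlin (Suc p) (gam c i f z)"
  unfolding gam_def by (rule mlin_skew[OF da_mlin(1)[OF assms]])

definition somechart :: "'a \<Rightarrow> ('a, 'n) chart \<times> 'i" where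
  "somechart x = (SOME ci. adm (fst ci) (snd ci) \<and> x \<in> fst (fst ci))"

definition atx :: "(('a, 'n) chart \<Rightarrow> 'i \<Rightarrow> complex ^ 'n \<Rightarrow> real) \<Rightarrow> 'a \<Rightarrow> real" where
  "atx F x = F (fst (somechart x)) (snd (somechart x)) (snd (fst (somechart x)) x)"

text \<open>Here \<open>somechart\<close> merely picks a chart and a frame; the three quantities are \<open>|\<partial>\<alpha>|\<^sup>2\<close>, the real part of
  \<open>\<langle>\<partial>f \<and> \<alpha>, \<partial>\<alpha>\<rangle>\<close> and \<open>|\<partial>f \<and> \<alpha>|\<^sup>2\<close> up to normalization, and do not depend on the choice.\<close>

definition del_norm_sq :: "'a \<Rightarrow> real" where
  "del_norm_sq = atx (\<lambda>c i z. pairing c i z (bb c i z) (bb c i z))"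

definition cross_term :: "('a \<Rightarrow> real) \<Rightarrow> 'a \<Rightarrow> real" where
  "cross_term f = atx (\<lambda>c i z. pairing c i z (da c i f z) (bb c i z))"

definition wedge_norm_sq :: "('a \<Rightarrow> real) \<Rightarrow> 'a \<Rightarrow> real" where
  "wedge_norm_sq f = atx (\<lambda>c i z. pairing c i z (gam c i f z) (gam c i f z))"

lemma atx_eq:
  assumes inv: "\<And>c i c' i' x. adm c i \<Longrightarrow> adm c' i' \<Longrightarrow> x \<in> fst c \<Longrightarrow> x \<in> fst c' \<Longrightarrow> F c i (snd c x) = F c' i' (snd c' x)"
    and adm: "adm c i" and x: "x \<in> fst c"
  shows "atx F x = F c i (snd c x)"
proof -
  have "\<exists>ci. adm (fst ci) (snd ci) \<and> x \<in> fst (fst ci)" using adm x by (intro exI[of _ "(c, i)"]) simp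
  from someI_ex[OF this] have "adm (fst (somechart x)) (snd (somechart x))" "x \<in> fst (fst (somechart x))"
    by (simp_all add: somechart_def)
  then show ?thesis unfolding atx_def by (intro inv adm x)
qed

lemma del_norm_sq_eq:
  assumes "adm c i" "x \<in> fst c"
  shows "del_norm_sq x = pairing c i (snd c x) (bb c i (snd c x)) (bb c i (snd c x))"
  unfolding del_norm_sq_def
proof (rule atx_eq)
  fix c i c' i' x assume *: "adm c i" "adm c' i'" "x \<in> fst c" "x \<in> fst c'"
  have z: "snd c' x \<in> img c'" using *(4) by simp
  show "pairing c i (snd c x) (bb c i (snd c x)) (bb c i (snd c x)) = pairing c' i' (snd c' x) (bb c' i' (snd c' x)) (bb c' i' (snd c' x))"
    by (rule pairing_transform[OF *]) (erule bb_transform[OF *] | rule bb_facts(2)[OF *(2) z])+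
qed (use assms in simp_all)

lemma cross_term_eq:
  assumes f: "C1_fun f" and "adm c i" "x \<in> fst c"
  shows "cross_term f x = pairing c i (snd c x) (da c i f (snd c x)) (bb c i (snd c x))"
  unfolding cross_term_def
proof (rule atx_eq)
  fix c i c' i' x assume *: "adm c i" "adm c' i'" "x \<in> fst c" "x \<in> fst c'"
  have z: "snd c' x \<in> img c'" using *(4) by simp
  show "pairing c i (snd c x) (da c i f (snd c x)) (bb c i (snd c x)) = pairing c' i' (snd c' x) (da c' i' f (snd c' x)) (bb c' i' (snd c' x))"
    by (rule pairing_transform[OF *]) (erule da_transform[OF * f] | erule bb_transform[OF *] | rule da_mlin(1)[OF *(2) f z] | rule bb_facts(2)[OF *(2) z])+
qed (use assms in simp_all)

lemma wedge_norm_sq_eq: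
  assumes f: "C1_fun f" and "adm c i" "x \<in> fst c"
  shows "wedge_norm_sq f x = pairing c i (snd c x) (gam c i f (snd c x)) (gam c i f (snd c x))"
  unfolding wedge_norm_sq_def
proof (rule atx_eq)
  fix c i c' i' x assume *: "adm c i" "adm c' i'" "x \<in> fst c" "x \<in> fst c'"
  have z: "snd c' x \<in> img c'" using *(4) by simp
  show "pairing c i (snd c x) (gam c i f (snd c x)) (gam c i f (snd c x)) = pairing c' i' (snd c' x) (gam c' i' f (snd c' x)) (gam c' i' f (snd c' x))"
    by (rule pairing_transform[OF *]) (erule gam_transform[OF * f] | rule gam_mlin[OF *(2) f z])+
qed (use assms in simp_all)


subsection \<open>Algebra of the invariant quantities\<close>

lemma fc_simps:
  assumes c: "c \<in> A" and f: "C1_fun f" and g: "C1_fun g" and z: "z \<in> img c"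
  shows "del (fc c (\<lambda>x. f x * g x)) z v = f (kap c z) * del (fc c g) z v + g (kap c z) * del (fc c f) z v"
proof -
  have "fc c (\<lambda>x. f x * g x) = (\<lambda>z. fc c f z * fc c g z)" by (simp add: fc_def[abs_def])
  then show ?thesis
    using del_mult[OF C1_onD(1)[OF fc_C1[OF f c] z] C1_onD(1)[OF fc_C1[OF g c] z], of v]
    by (simp add: fc_def)
qed

lemma cross_term_mult:
  assumes f: "C1_fun f" and g: "C1_fun g" and adm: "adm c i" and x: "x \<in> fst c"
  shows "cross_term (\<lambda>x. f x * g x) x = f x * cross_term g x + g x * cross_term f x"
proof -
  let ?z = "snd c x"
  have z: "?z \<in> img c" using x by simp
  have "da c i (\<lambda>x. f x * g x) ?z = (\<lambda>us. of_real (f x) * da c i g ?z us + of_real (g x) * da c i f ?z us)"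
    using fc_simps[OF admD(1)[OF adm] f g z] admD(1)[OF adm] x by (simp add: da_def[abs_def] algebra_simps fun_eq_iff)
  then have "cross_term (\<lambda>x. f x * g x) x = pairing c i ?z (\<lambda>us. of_real (f x) * da c i g ?z us + of_real (g x) * da c i f ?z us) (bb c i ?z)"
    using cross_term_eq[OF C1_fun_mult[OF f g] adm x] by simp
  also have "\<dots> = f x * pairing c i ?z (da c i g ?z) (bb c i ?z) + g x * pairing c i ?z (da c i f ?z) (bb c i ?z)"
    unfolding pairing_def ip_lincomb_left ip_cmult_left by (simp add: algebra_simps del: ip.simps)
  finally show ?thesis by (simp only: cross_term_eq[OF f adm x] cross_term_eq[OF g adm x])
qed

text \<open>The differentials of functions with constant sum add up to zero, and the pairing is
  linear in them.\<close>

lemma cross_term_sum_const: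
  assumes f: "\<And>q. q \<in> I \<Longrightarrow> C1_fun (f q)" and I: "finite I" and one: "\<And>y. y \<in> topspace X \<Longrightarrow> (\<Sum>q\<in>I. f q y) = 1"
    and adm: "adm c i" and x: "x \<in> fst c"
  shows "(\<Sum>q\<in>I. cross_term (f q) x) = 0"
proof -
  let ?z = "snd c x"
  have z: "?z \<in> img c" using x by simp
  have d0: "(\<Sum>q\<in>I. del (fc c (f q)) ?z v) = 0" for v
  proof -
    have "del (\<lambda>z. \<Sum>q\<in>I. fc c (f q) z) ?z v = 0"
      using del_cong_open(1)[OF admD(5)[OF adm] z, of "\<lambda>z. \<Sum>q\<in>I. fc c (f q) z" "\<lambda>z. 1"] one admD(6)[OF adm kap_in]
      by (simp add: fc_def flip: of_real_sum)
    then show ?thesis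
      using del_sum[of I "\<lambda>q. fc c (f q)" ?z v] C1_onD(1)[OF fc_C1[OF f admD(1)[OF adm]] z] by simp
  qed
  have "(\<Sum>q\<in>I. cross_term (f q) x) = (\<Sum>q\<in>I. pairing c i ?z (da c i (f q) ?z) (bb c i ?z))"
    by (intro sum.cong refl cross_term_eq f adm x)
  also have "\<dots> = pairing c i ?z (\<lambda>us. \<Sum>q\<in>I. da c i (f q) ?z us) (bb c i ?z)"
    unfolding pairing_def ip_sum_left by (simp add: sum_distrib_left del: ip.simps)
  also have "(\<lambda>us. \<Sum>q\<in>I. da c i (f q) ?z us) = (\<lambda>us. 0)"
    by (simp add: da_def d0 flip: sum_distrib_right)
  also have "pairing c i ?z (\<lambda>us. 0) (bb c i ?z) = 0" unfolding pairing_def ip_zero_left by simp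
  finally show ?thesis .
qed

lemma locally_const:
  assumes V: "openin X V" "x \<in> V" "\<And>y. y \<in> V \<Longrightarrow> f y = r" and adm: "adm c i" and x: "x \<in> fst c"
  shows "del (fc c f) (snd c x) v = 0"
proof -
  have "openin X (fst c \<inter> V)" using chart_facts(1)[OF admD(1)[OF adm]] V(1) by blast
  then have o: "open (snd c ` (fst c \<inter> V))" by (rule open_chart_image[OF admD(1)[OF adm]]) simp
  show ?thesis unfolding fc_def
    by (rule del_of_real_const[OF o]) (use x V admD(1)[OF adm] in auto)
qed

lemma cross_term_wedge_norm_sq_locally_const:
  assumes f: "C1_fun f" and V: "openin X V" "x \<in> V" "\<And>y. y \<in> V \<Longrightarrow> f y = r" and adm: "adm c i" and x: "x \<in> fst c"
  shows "cross_term f x = 0" "wedge_norm_sq f x = 0"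
proof -
  have da: "da c i f (snd c x) = (\<lambda>us. 0)"
    using locally_const[OF V adm x] by (simp add: da_def[abs_def])
  show "cross_term f x = 0" unfolding cross_term_eq[OF f adm x] da pairing_def ip_zero_left by simp
  have "gam c i f (snd c x) = (\<lambda>us. 0)" unfolding gam_def da by (simp add: skew_def fun_eq_iff)
  then show "wedge_norm_sq f x = 0" unfolding wedge_norm_sq_eq[OF f adm x] pairing_def by (simp only: ip_zero_left) simp
qed

lemma pairing_nonneg:
  assumes adm: "adm c i" and z: "z \<in> img c" and s: "mlin (Suc p) s"
  shows "0 \<le> pairing c i z s s"
  unfolding pairing_def using ip_self(2)[OF posdef_HH[OF adm z] s] wt_facts(2)[OF adm z]
  by (intro mult_nonneg_nonneg) auto

lemma del_norm_sq_nonneg: "adm c i \<Longrightarrow> x \<in> fst c \<Longrightarrow> 0 \<le> del_norm_sq x"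
  using del_norm_sq_eq[of c i x] pairing_nonneg[OF _ _ bb_facts(2)] by simp

lemma wedge_norm_sq_nonneg: "C1_fun f \<Longrightarrow> adm c i \<Longrightarrow> x \<in> fst c \<Longrightarrow> 0 \<le> wedge_norm_sq f x"
  using wedge_norm_sq_eq[of f c i x] pairing_nonneg[OF _ _ gam_mlin] by simp

text \<open>As \<partial>(f^2) = 2 f \<partial>f, one factor f can be moved to \<open>bb\<close>.
  The factor p + 1 replaces \<open>da\<close> by \<open>gam\<close>, and \<open>ip_young\<close> is
  applied to \<open>gam\<close> and f times \<open>bb\<close>.\<close>

lemma cross_term_bound:
  assumes f: "C1_fun f" and adm: "adm c i" and x: "x \<in> fst c"
  shows "- (2 * wedge_norm_sq f x + (f x)\<^sup>2 * del_norm_sq x / 2) \<le> real (Suc p) * cross_term (\<lambda>x. f x * f x) x"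
proof -
  let ?z = "snd c x" and ?G = "inv_entry (HH c (snd c x))"
  have z: "?z \<in> img c" using x by simp
  note pd = posdef_HH[OF adm z] and mg = gam_mlin[OF adm f z] and mb = bb_facts(2)[OF adm z]
  have w: "0 < wt i x" using wt_facts(2)[OF adm z] admD(1)[OF adm] x by simp
  have k: "kap c ?z = x" using admD(1)[OF adm] x by simp
  have "ip ?G (Suc p) (gam c i f ?z) (bb c i ?z) = of_nat (Suc p) * ip ?G (Suc p) (da c i f ?z) (bb c i ?z)"
    unfolding gam_def by (rule ip_skew[OF bb_facts(3)[OF adm z]])
  then have "ip ?G (Suc p) (gam c i f ?z) (bb c i ?z) = of_real (real (Suc p)) * ip ?G (Suc p) (da c i f ?z) (bb c i ?z)"
    by (simp only: of_real_of_nat_eq)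
  then have Re1: "Re (ip ?G (Suc p) (gam c i f ?z) (bb c i ?z)) = real (Suc p) * Re (ip ?G (Suc p) (da c i f ?z) (bb c i ?z))"
    by (simp only: Re_scale_of_real)
  have "\<bar>2 * Re (ip ?G (Suc p) (gam c i f ?z) (\<lambda>vs. of_real (f x) * bb c i ?z vs))\<bar> \<le>
      2 * Re (ip ?G (Suc p) (gam c i f ?z) (gam c i f ?z)) +
      Re (ip ?G (Suc p) (\<lambda>vs. of_real (f x) * bb c i ?z vs) (\<lambda>vs. of_real (f x) * bb c i ?z vs)) / 2"
    by (rule ip_young[OF pd mg mlin_cmult[OF mb]])
  then have Y: "\<bar>2 * (f x * (real (Suc p) * Re (ip ?G (Suc p) (da c i f ?z) (bb c i ?z))))\<bar> \<le>
      2 * Re (ip ?G (Suc p) (gam c i f ?z) (gam c i f ?z)) +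
      f x * (f x * Re (ip ?G (Suc p) (bb c i ?z) (bb c i ?z))) / 2"
    unfolding ip_cmult_left ip_cmult_right complex_cnj_complex_of_real Re_scale_of_real Re1 .
  define P1 where "P1 = Re (ip ?G (Suc p) (gam c i f ?z) (gam c i f ?z))"
  define P2 where "P2 = Re (ip ?G (Suc p) (bb c i ?z) (bb c i ?z))"
  define P3 where "P3 = Re (ip ?G (Suc p) (da c i f ?z) (bb c i ?z))"
  have "- (2 * P1 + f x * (f x * P2) / 2) \<le> 2 * (f x * (real (Suc p) * P3))"
    using Y unfolding P1_def[symmetric] P2_def[symmetric] P3_def[symmetric] by linarith
  from mult_left_mono[OF this less_imp_le[OF w]]
  have "- (2 * (wt i x * P1) + (f x)\<^sup>2 * (wt i x * P2) / 2) \<le> real (Suc p) * (f x * (wt i x * P3) + f x * (wt i x * P3))"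
    by (simp add: algebra_simps power2_eq_square del: of_nat_Suc)
  then show ?thesis
    unfolding cross_term_mult[OF f f adm x] wedge_norm_sq_eq[OF f adm x] del_norm_sq_eq[OF adm x] cross_term_eq[OF f adm x] pairing_def k
      P1_def P2_def P3_def .
qed

text \<open>The product rule writes \<partial> of the product, wedged with \<alpha>, as a sum of
  \<open>card I\<close> terms, whose norm is estimated by \<open>ip_sum_le\<close>.\<close>

lemma wedge_norm_sq_prod:
  assumes f: "\<And>q. q \<in> I \<Longrightarrow> C1_fun (f q)" and I: "finite I" and adm: "adm c i" and x: "x \<in> fst c"
  shows "wedge_norm_sq (\<lambda>x. \<Prod>q\<in>I. f q x) x \<le> real (card I) * (\<Sum>q\<in>I. (\<Prod>r\<in>I - {q}. f r x)\<^sup>2 * wedge_norm_sq (f q) x)"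
proof -
  let ?z = "snd c x" and ?G = "inv_entry (HH c (snd c x))"
  have z: "?z \<in> img c" using x by simp
  have k: "kap c ?z = x" using admD(1)[OF adm] x by simp
  let ?P = "\<lambda>q. \<Prod>r\<in>I - {q}. f r x"
  have d: "fc c (f q) differentiable (at ?z)" if "q \<in> I" for q
    by (rule C1_onD(1)[OF fc_C1[OF f[OF that] admD(1)[OF adm]] z])
  have "del (fc c (\<lambda>x. \<Prod>q\<in>I. f q x)) ?z v = (\<Sum>q\<in>I. of_real (?P q) * del (fc c (f q)) ?z v)" for v
  proof -
    have "fc c (\<lambda>x. \<Prod>q\<in>I. f q x) = (\<lambda>z. \<Prod>q\<in>I. fc c (f q) z)" by (simp add: fc_def[abs_def])
    then show ?thesis using del_prod[OF I d, where v = v] k by (simp add: fc_def)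
  qed
  then have "da c i (\<lambda>x. \<Prod>q\<in>I. f q x) ?z = (\<lambda>us. \<Sum>q\<in>I. of_real (?P q) * da c i (f q) ?z us)"
    by (simp add: da_def[abs_def] sum_distrib_right mult.assoc fun_eq_iff)
  then have g: "gam c i (\<lambda>x. \<Prod>q\<in>I. f q x) ?z = (\<lambda>us. \<Sum>q\<in>I. of_real (?P q) * gam c i (f q) ?z us)"
    unfolding gam_def by (simp add: skew_def sum_distrib_left fun_eq_iff mult.left_commute) (intro allI sum.swap)
  have "Re (ip ?G (Suc p) (gam c i (\<lambda>x. \<Prod>q\<in>I. f q x) ?z) (gam c i (\<lambda>x. \<Prod>q\<in>I. f q x) ?z)) \<le>
      of_nat (card I) * (\<Sum>q\<in>I. Re (ip ?G (Suc p) (\<lambda>us. of_real (?P q) * gam c i (f q) ?z us) (\<lambda>us. of_real (?P q) * gam c i (f q) ?z us)))"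
    unfolding g by (rule ip_sum_le[OF posdef_HH[OF adm z] mlin_cmult[OF gam_mlin[OF adm f z]] I])
  also have "(\<Sum>q\<in>I. Re (ip ?G (Suc p) (\<lambda>us. of_real (?P q) * gam c i (f q) ?z us) (\<lambda>us. of_real (?P q) * gam c i (f q) ?z us))) =
      (\<Sum>q\<in>I. (?P q)\<^sup>2 * Re (ip ?G (Suc p) (gam c i (f q) ?z) (gam c i (f q) ?z)))"
    unfolding ip_cmult_left ip_cmult_right complex_cnj_complex_of_real Re_scale_of_real power2_eq_square mult.assoc ..
  finally have le: "Re (ip ?G (Suc p) (gam c i (\<lambda>x. \<Prod>q\<in>I. f q x) ?z) (gam c i (\<lambda>x. \<Prod>q\<in>I. f q x) ?z)) \<le>
      real (card I) * (\<Sum>q\<in>I. (?P q)\<^sup>2 * Re (ip ?G (Suc p) (gam c i (f q) ?z) (gam c i (f q) ?z)))" .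
  have w: "0 \<le> wt i x" by (simp add: wt_def)
  have e: "(\<Sum>q\<in>I. (?P q)\<^sup>2 * wedge_norm_sq (f q) x) = wt i x * (\<Sum>q\<in>I. (?P q)\<^sup>2 * Re (ip ?G (Suc p) (gam c i (f q) ?z) (gam c i (f q) ?z)))"
    unfolding sum_distrib_left by (intro sum.cong refl) (simp only: wedge_norm_sq_eq[OF f adm x] pairing_def k mult_ac)
  have e2: "wedge_norm_sq (\<lambda>x. \<Prod>q\<in>I. f q x) x = pairing c i ?z (gam c i (\<lambda>x. \<Prod>q\<in>I. f q x) ?z) (gam c i (\<lambda>x. \<Prod>q\<in>I. f q x) ?z)"
    by (rule wedge_norm_sq_eq[OF C1_fun_prod adm x]) (rule f)
  show ?thesis
    unfolding e2 e unfolding pairing_def k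
    using mult_left_mono[OF le w] by (simp only: mult_ac)
qed

lemma continuous_ip_pairing:
  assumes adm: "adm c i" and s: "\<And>us. length us = Suc p \<Longrightarrow> continuous_on (img c) (\<lambda>z. s z us)"
    and t: "\<And>us. length us = Suc p \<Longrightarrow> continuous_on (img c) (\<lambda>z. t z us)"
  shows "continuous_on (img c) (\<lambda>z. pairing c i z (s z) (t z))"
proof -
  note O = admD(5)[OF adm]
  have "Ck_on 0 (\<lambda>z. ip (inv_entry (HH c z)) (Suc p) (s z) (t z)) (img c)"
    by (rule Ck_on_ip[OF O]) (use s t C1_onD(4)[OF C1_on_inv_entry[OF O C1_HH[OF adm] posdef_HH[OF adm]]] in auto)
  then have "continuous_on (img c) (\<lambda>z. ip (inv_entry (HH c z)) (Suc p) (s z) (t z))"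
    by (simp only: Ck_on.simps(1))
  then show ?thesis
    unfolding pairing_def by (intro continuous_intros C1_onD(4)[OF wt_facts(1)[OF adm]])
qed

lemma da_continuous:
  assumes adm: "adm c i" and f: "C1_fun f" and us: "length us = Suc p"
  shows "continuous_on (img c) (\<lambda>z. da c i f z us)"
proof -
  have "continuous_on (img c) (\<lambda>z. del (fc c f) z v)" for v
    using Ck_on_del[OF admD(5)[OF adm] fc_C1[OF f admD(1)[OF adm]], of v] by simp
  moreover have "continuous_on (img c) (\<lambda>z. aa c i z (tl us))"
    by (rule C1_onD(4)[OF aa_facts(1)[OF adm]]) (use us in simp)
  ultimately show ?thesis unfolding da_def by (intro continuous_intros)
qed

lemma invariant_continuous:
  assumes adm: "adm c i"
  shows "continuous_on (img c) (\<lambda>z. del_norm_sq (kap c z))"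
    "C1_fun f \<Longrightarrow> continuous_on (img c) (\<lambda>z. cross_term f (kap c z))"
    "C1_fun f \<Longrightarrow> continuous_on (img c) (\<lambda>z. wedge_norm_sq f (kap c z))"
proof -
  note b = C1_onD(4)[OF bb_facts(1)[OF adm]]
  have "continuous_on (img c) (\<lambda>z. pairing c i z (bb c i z) (bb c i z))"
    by (rule continuous_ip_pairing[OF adm b b])
  then show "continuous_on (img c) (\<lambda>z. del_norm_sq (kap c z))"
    by (rule continuous_on_eq) (simp add: del_norm_sq_eq[OF adm kap_in] chart_kap)
  assume f: "C1_fun f"
  note d = da_continuous[OF adm f]
  have "continuous_on (img c) (\<lambda>z. pairing c i z (da c i f z) (bb c i z))"
    by (rule continuous_ip_pairing[OF adm d b])
  then show "continuous_on (img c) (\<lambda>z. cross_term f (kap c z))"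
    by (rule continuous_on_eq) (simp add: cross_term_eq[OF f adm kap_in] chart_kap)
  have g: "continuous_on (img c) (\<lambda>z. gam c i f z us)" if "length us = Suc p" for us
    unfolding gam_def skew_def by (intro continuous_intros d) (use that in \<open>simp add: length_rot\<close>)
  have "continuous_on (img c) (\<lambda>z. pairing c i z (gam c i f z) (gam c i f z))"
    by (rule continuous_ip_pairing[OF adm g g])
  then show "continuous_on (img c) (\<lambda>z. wedge_norm_sq f (kap c z))"
    by (rule continuous_on_eq) (simp add: wedge_norm_sq_eq[OF f adm kap_in] chart_kap)
qed

lemma del_norm_sq_zero:
  assumes adm: "adm c i" and x: "x \<in> fst c" and 0: "del_norm_sq x = 0" and vs: "length vs = Suc p"
  shows "bb c i (snd c x) vs = 0"
proof -
  let ?z = "snd c x"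
  have z: "?z \<in> img c" using x by simp
  note pd = posdef_HH[OF adm z] and mb = bb_facts(2)[OF adm z]
  have "Re (ip (inv_entry (HH c ?z)) (Suc p) (bb c i ?z) (bb c i ?z)) = 0"
    using 0 wt_facts(2)[OF adm z] unfolding del_norm_sq_eq[OF adm x] pairing_def by simp
  then have "ip (inv_entry (HH c ?z)) (Suc p) (bb c i ?z) (bb c i ?z) = 0"
    using ip_self(1)[OF pd mb] by (simp only: complex_is_Real_iff complex_eq_iff zero_complex.sel)
  then show ?thesis by (rule ip_definite[OF pd mb _ vs])
qed

end


section \<open>Integration by parts on the complement of the divisor\<close>

lemma extend_continuous:
  fixes h :: "'v::t2_space \<Rightarrow> 'w::real_normed_vector"
  assumes U: "open U" and K: "compact K" "K \<subseteq> U" and h: "continuous_on U h" "\<And>z. z \<in> U \<Longrightarrow> z \<notin> K \<Longrightarrow> h z = 0"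
  shows "continuous_on UNIV (\<lambda>z. if z \<in> U then h z else 0)"
proof -
  have "continuous_on (U \<union> - K) (\<lambda>z. if z \<in> U then h z else 0)"
  proof (rule continuous_on_open_Un)
    show "open (- K)" using compact_imp_closed[OF K(1)] by auto
    show "continuous_on U (\<lambda>z. if z \<in> U then h z else 0)"
      by (rule continuous_on_eq[OF h(1)]) simp
    show "continuous_on (- K) (\<lambda>z. if z \<in> U then h z else 0)"
      by (rule continuous_on_eq[OF continuous_on_const[of _ 0]]) (use h(2) in auto)
  qed (rule U)
  moreover have "U \<union> - K = UNIV" using K(2) by auto
  ultimately show ?thesis by simp
qed

lemma extend_C1:
  fixes h :: "'v::real_normed_vector \<Rightarrow> 'w::real_normed_vector"
  assumes U: "open U" and K: "compact K" "K \<subseteq> U" and h: "C1_on h U" "\<And>z. z \<in> U \<Longrightarrow> z \<notin> K \<Longrightarrow> h z = 0"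
  shows "C1_on (\<lambda>z. if z \<in> U then h z else 0) UNIV"
proof (rule C1_on_local)
  fix z
  have o: "open (- K)" using compact_imp_closed[OF K(1)] by auto
  have 1: "C1_on (\<lambda>z. if z \<in> U then h z else 0) U"
    by (rule Ck_on_cong_open[OF U _ h(1)]) simp
  have 2: "C1_on (\<lambda>z. if z \<in> U then h z else 0) (- K)"
    by (rule Ck_on_cong_open[OF o _ Ck_on_const[of _ 0]]) (use h(2) in auto)
  show "\<exists>V. open V \<and> z \<in> V \<and> C1_on (\<lambda>z. if z \<in> U then h z else 0) V"
  proof (cases "z \<in> U")
    case True then show ?thesis using U 1 by (intro exI[of _ U] conjI)
  next
    case False
    then have "z \<in> - K" using K(2) by auto
    then show ?thesis using o 2 by (intro exI[of _ "- K"] conjI)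
  qed
qed

section \<open>Chart integrals against the volume density\<close>

context log_setup
begin

definition ci :: "('a, 'n) chart \<Rightarrow> ('a \<Rightarrow> real) \<Rightarrow> complex ^ 'n \<Rightarrow> real" where
  "ci c F z = (if z \<in> img c then rho (HH c z) * F (kap c z) else 0)"

definition CI :: "('a, 'n) chart \<Rightarrow> ('a \<Rightarrow> real) \<Rightarrow> real" where
  "CI c F = cint (ci c F)"

text \<open>Continuity is asked only on the chart, and the compact set K lies inside it, so F may be
  unspecified elsewhere, for instance on D when the chart avoids D. Extension by zero is then
  continuous.\<close>

definition supp :: "('a, 'n) chart \<Rightarrow> 'a set \<Rightarrow> ('a \<Rightarrow> real) \<Rightarrow> bool" where
  "supp c K F \<longleftrightarrow> continuous_on (img c) (\<lambda>z. F (kap c z)) \<and> compactin X K \<and> K \<subseteq> fst c \<and>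
     (\<forall>x\<in>fst c - K. F x = 0)"

lemma rho_continuous: "c \<in> A \<Longrightarrow> continuous_on (img c) (\<lambda>z. rho (HH c z))"
  by (rule C1_onD(4)[OF C1_on_rho[OF chart_facts(2) HH_Ck HH_posdef]])

lemma ci_facts:
  assumes c: "c \<in> A" and F: "supp c K F"
  shows "compact (snd c ` K)" "z \<notin> snd c ` K \<Longrightarrow> ci c F z = 0" "continuous_on UNIV (ci c F)"
proof -
  show K': "compact (snd c ` K)"
    using F compact_chart_image[OF c] by (auto simp: supp_def)
  have K2: "snd c ` K \<subseteq> img c" using F by (auto simp: supp_def)
  have h0: "rho (HH c z) * F (kap c z) = 0" if "z \<in> img c" "z \<notin> snd c ` K" for z
  proof -
    have "kap c z \<notin> K" using that chart_kap[OF that(1)] by (metis imageI)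
    then show ?thesis using F kap_in[OF that(1)] by (simp add: supp_def)
  qed
  then show "z \<notin> snd c ` K \<Longrightarrow> ci c F z = 0" by (simp add: ci_def)
  show "continuous_on UNIV (ci c F)"
    unfolding ci_def
    by (rule extend_continuous[OF chart_facts(2)[OF c] K' K2 _ h0])
      (use F in \<open>auto simp: supp_def intro!: continuous_intros rho_continuous[OF c]\<close>)
qed

lemma supp_ci: "c \<in> A \<Longrightarrow> supp c K F \<Longrightarrow> cabs (ci c F)"
  by (rule cabs_continuous[OF ci_facts(3,1,2)])

lemma supp_add: "supp c K F \<Longrightarrow> supp c K G \<Longrightarrow> supp c K (\<lambda>x. F x + G x)"
  by (auto simp: supp_def intro: continuous_on_add)

lemma supp_mult: "supp c K F \<Longrightarrow> continuous_on (img c) (\<lambda>z. g (kap c z)) \<Longrightarrow> supp c K (\<lambda>x. g x * F x)"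
  by (auto simp: supp_def intro: continuous_on_mult)

lemma supp_cmult: "supp c K F \<Longrightarrow> supp c K (\<lambda>x. r * F x)"
  by (rule supp_mult, assumption, rule continuous_on_const)

lemma CI_add: "c \<in> A \<Longrightarrow> supp c K F \<Longrightarrow> supp c K G \<Longrightarrow> CI c (\<lambda>x. F x + G x) = CI c F + CI c G"
proof -
  assume *: "c \<in> A" "supp c K F" "supp c K G"
  have "ci c (\<lambda>x. F x + G x) = (\<lambda>z. ci c F z + ci c G z)"
    by (auto simp: ci_def algebra_simps)
  then show ?thesis using cint_add[OF supp_ci[OF *(1,2)] supp_ci[OF *(1,3)]] by (simp add: CI_def)
qed

lemma CI_cmult: "CI c (\<lambda>x. r * F x) = r * CI c F"
proof -
  have "ci c (\<lambda>x. r * F x) = (\<lambda>z. r * ci c F z)" by (auto simp: ci_def algebra_simps)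
  then show ?thesis by (simp add: CI_def cint_cmult)
qed

lemma CI_sum:
  assumes "c \<in> A" "finite I" "\<And>q. q \<in> I \<Longrightarrow> supp c (K q) (F q)"
  shows "CI c (\<lambda>x. \<Sum>q\<in>I. F q x) = (\<Sum>q\<in>I. CI c (F q))"
proof -
  have "ci c (\<lambda>x. \<Sum>q\<in>I. F q x) = (\<lambda>z. \<Sum>q\<in>I. ci c (F q) z)"
    by (auto simp: ci_def sum_distrib_left)
  then show ?thesis unfolding CI_def using cint_sum[OF assms(2) supp_ci[OF assms(1,3)]] by simp
qed

lemma CI_cong: "(\<And>x. x \<in> fst c \<Longrightarrow> F x = G x) \<Longrightarrow> CI c F = CI c G"
proof -
  assume *: "\<And>x. x \<in> fst c \<Longrightarrow> F x = G x"
  have "ci c F = ci c G" by (rule ext) (simp add: ci_def * kap_in)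
  then show ?thesis by (simp add: CI_def)
qed

lemma CI_mono:
  assumes "c \<in> A" "supp c K F" "supp c K' G" "\<And>x. x \<in> fst c \<Longrightarrow> F x \<le> G x"
  shows "CI c F \<le> CI c G"
  unfolding CI_def
proof (rule cint_mono[OF supp_ci[OF assms(1,2)] supp_ci[OF assms(1,3)]])
  fix z
  show "ci c F z \<le> ci c G z"
    using rho_pos[OF HH_posdef[OF assms(1), of z]] assms(4)[OF kap_in, of z]
    by (auto simp: ci_def intro!: mult_left_mono)
qed

lemma CI_nonneg:
  assumes "c \<in> A" "supp c K F" "\<And>x. x \<in> fst c \<Longrightarrow> 0 \<le> F x"
  shows "0 \<le> CI c F"
proof -
  have "supp c K (\<lambda>x. 0 * F x)" by (rule supp_cmult[OF assms(2)])
  from CI_mono[OF assms(1) this assms(2)] assms(3) CI_cmult[of c 0 F] show ?thesis by simp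
qed

text \<open>The common compact set K lies in both charts, so both integrals live on the overlap;
  there \<open>rho_transform\<close> supplies the Jacobian of the transition map.\<close>

lemma CI_change:
  assumes c: "c \<in> A" and c': "c' \<in> A" and F: "supp c K F" "supp c' K F"
  shows "CI c F = CI c' F"
  unfolding CI_def
proof (rule cint_change[OF open_overlap[OF c c'], of "transition c c'"])
  have K: "K \<subseteq> fst c" "K \<subseteq> fst c'" "\<And>x. x \<in> fst c \<Longrightarrow> x \<notin> K \<Longrightarrow> F x = 0" "\<And>x. x \<in> fst c' \<Longrightarrow> x \<notin> K \<Longrightarrow> F x = 0"
    using F by (auto simp: supp_def)
  let ?U = "snd c ` (fst c \<inter> fst c')"
  show "inj_on (transition c c') ?U"
  proof (rule inj_onI)
    fix y z assume y: "y \<in> ?U" and z: "z \<in> ?U" and eq: "transition c c' y = transition c c' z"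
    then obtain u v where uv: "u \<in> fst c" "u \<in> fst c'" "y = snd c u" "v \<in> fst c" "v \<in> fst c'" "z = snd c v" by blast
    have "snd c' u = snd c' v" using eq uv transition_maps[OF c c'] by simp
    then show "y = z" using uv inj_chart[OF c'] by (simp add: inj_on_eq_iff)
  qed
  show "transition c c' differentiable (at z)" if "z \<in> ?U" for z by (rule transition_derivative(2)[OF c c' that])
  show "cabs (ci c' F)" by (rule supp_ci[OF c' F(2)])
  show "ci c' F z = 0" if z: "z \<notin> transition c c' ` ?U" for z
  proof (cases "z \<in> img c'")
    case True
    have "kap c' z \<notin> fst c"
    proof
      assume "kap c' z \<in> fst c"
      then have "transition c c' (snd c (kap c' z)) = z"
        using transition_maps[OF c c' _ kap_in[OF True]] chart_kap[OF True] by simp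
      then have "z \<in> transition c c' ` ?U"
        using \<open>kap c' z \<in> fst c\<close> kap_in[OF True] by (intro image_eqI[of _ _ "snd c (kap c' z)"]) auto
      then show False using z by simp
    qed
    then have "F (kap c' z) = 0" using K(1) kap_in[OF True] by (intro K(4)) auto
    then show ?thesis by (simp add: ci_def)
  qed (simp add: ci_def)
  show "ci c F z = 0" if z: "z \<notin> ?U" for z
  proof (cases "z \<in> img c")
    case True
    have "kap c z \<notin> fst c'"
    proof
      assume "kap c z \<in> fst c'"
      then have "snd c (kap c z) \<in> ?U" using kap_in[OF True] by blast
      then show False using z chart_kap[OF True] by simp
    qed
    then have "F (kap c z) = 0" using K(2) kap_in[OF True] by (intro K(3)) auto
    then show ?thesis by (simp add: ci_def)
  qed (simp add: ci_def)
  show "ci c F z = jac (fd (transition c c') z) * ci c' F (transition c c' z)" if z: "z \<in> ?U" for z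
  proof -
    obtain x where x: "x \<in> fst c" "x \<in> fst c'" "z = snd c x" using z by blast
    have tz: "transition c c' z = snd c' x" unfolding x(3) by (rule transition_maps[OF c c' x(1,2)])
    have "linear (fd (transition c c') z)" by (rule linear_fd[OF transition_derivative(2)[OF c c' z]])
    from rho_transform[OF this HH_transform[OF c c' x(1,2), folded x(3)]]
    have "rho (HH c z) = jac (fd (transition c c') z) * rho (HH c' (snd c' x))" .
    then show ?thesis using x(1,2) c c' by (simp add: ci_def tz[unfolded x(3)] x(3))
  qed
qed

end

section \<open>Global integration by parts with a partition of unity\<close>

locale partition = log_setup X A D L N p \<iota> \<alpha> \<omega>
  for X :: "'a topology" and A :: "('a, 'n::finite) chart set" and D :: "'a set"
    and L :: "('a, 'i) line_bundle" and N p :: nat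
    and \<iota> :: "'a set \<times> ('a \<Rightarrow> complex) \<Rightarrow> 'i \<Rightarrow> 'a \<Rightarrow> complex"
    and \<alpha> :: "('a, 'n, 'i) form" and \<omega> :: "('a, 'n, unit) form" +
  fixes Q :: "'q set" and C :: "'q \<Rightarrow> ('a, 'n) chart" and Fr :: "'q \<Rightarrow> 'i" and pu :: "'q \<Rightarrow> 'a \<Rightarrow> real" and K :: "'q \<Rightarrow> 'a set"
  assumes Q: "finite Q"
    and C: "\<And>q. q \<in> Q \<Longrightarrow> C q \<in> A" and Fr: "\<And>q. q \<in> Q \<Longrightarrow> Fr q \<in> idx L" "\<And>q. q \<in> Q \<Longrightarrow> fst (C q) \<subseteq> cover L (Fr q)"
    and pu: "\<And>q. q \<in> Q \<Longrightarrow> C1_fun (pu q)" "\<And>q x. q \<in> Q \<Longrightarrow> 0 \<le> pu q x"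
      "\<And>q x. q \<in> Q \<Longrightarrow> x \<notin> K q \<Longrightarrow> pu q x = 0" "\<And>x. x \<in> topspace X \<Longrightarrow> (\<Sum>q\<in>Q. pu q x) = 1"
    and K: "\<And>q. q \<in> Q \<Longrightarrow> compactin X (K q)" "\<And>q. q \<in> Q \<Longrightarrow> K q \<subseteq> fst (C q)"
begin

text \<open>The chart with D removed; all integrals are taken there, of functions vanishing near
  D.\<close>

definition C0 :: "'q \<Rightarrow> ('a, 'n) chart" where
  "C0 q = (fst (C q) \<inter> (topspace X - D), snd (C q))"

lemma adm_C0: "q \<in> Q \<Longrightarrow> adm (C0 q) (Fr q)"
  using chart_restrict[OF C, of q "topspace X - D"] D_closed Fr by (auto simp: adm_def C0_def closedin_def)

lemma C0_A: "q \<in> Q \<Longrightarrow> C0 q \<in> A"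
  by (rule admD(1)[OF adm_C0])

lemma fst_C0: "q \<in> Q \<Longrightarrow> x \<in> fst (C0 q) \<longleftrightarrow> x \<in> fst (C q) \<and> x \<notin> D"
  using chart_subset[OF C] by (auto simp: C0_def)

text \<open>Continuity off D only. At points of D the invariant quantities are unspecified, since no
  admissible chart contains such a point.\<close>

definition mcont :: "('a \<Rightarrow> real) \<Rightarrow> bool" where
  "mcont F \<longleftrightarrow> (\<forall>c i. adm c i \<longrightarrow> continuous_on (img c) (\<lambda>z. F (kap c z)))"

lemma mcontD: "mcont F \<Longrightarrow> adm c i \<Longrightarrow> continuous_on (img c) (\<lambda>z. F (kap c z))"
  unfolding mcont_def by blast

lemma mcont_intro: "(\<And>c i. adm c i \<Longrightarrow> continuous_on (img c) (\<lambda>z. F (kap c z))) \<Longrightarrow> mcont F"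
  unfolding mcont_def by blast

lemma mcontI:
  "C1_fun f \<Longrightarrow> mcont f" "mcont del_norm_sq" "C1_fun f \<Longrightarrow> mcont (cross_term f)" "C1_fun f \<Longrightarrow> mcont (wedge_norm_sq f)"
  "mcont F \<Longrightarrow> mcont G \<Longrightarrow> mcont (\<lambda>x. F x * G x)" "mcont F \<Longrightarrow> mcont G \<Longrightarrow> mcont (\<lambda>x. F x + G x)"
  "mcont (\<lambda>x. r)"
  by (rule mcont_intro, rule C1_onD(4)[OF C1_funD], assumption, erule admD(1))
    (rule mcont_intro, erule invariant_continuous, assumption?
    | rule mcont_intro, rule continuous_on_mult, erule mcontD, assumption, erule mcontD, assumption
    | rule mcont_intro, rule continuous_on_add, erule mcontD, assumption, erule mcontD, assumption
    | rule mcont_intro, rule continuous_on_const)+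

text \<open>Removing an open neighbourhood V of D from a compact set leaves a compact set that
  misses D, and therefore one inside the punctured chart.\<close>

lemma supp_C0:
  assumes q: "q \<in> Q" and V: "openin X V" "D \<subseteq> V" and F: "mcont F"
    and S: "compactin X S" "S \<subseteq> fst (C q)" "\<And>x. x \<in> fst (C0 q) \<Longrightarrow> x \<notin> S \<Longrightarrow> F x = 0"
      "\<And>x. x \<in> fst (C0 q) \<Longrightarrow> x \<in> V \<Longrightarrow> F x = 0"
  shows "supp (C0 q) (S - V) F"
proof -
  have "compactin X (S \<inter> (topspace X - V))"
    by (rule compact_Int_closedin[OF S(1)]) (use V(1) in auto)
  moreover have "S \<inter> (topspace X - V) = S - V" using compactin_subset_topspace[OF S(1)] by auto
  moreover have "S - V \<subseteq> fst (C0 q)" using S(2) V(2) fst_C0[OF q] by auto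
  moreover have "F x = 0" if "x \<in> fst (C0 q) - (S - V)" for x
    using that S(3,4)[of x] by (cases "x \<in> V") simp_all
  ultimately show ?thesis using mcontD[OF F adm_C0[OF q]] unfolding supp_def by simp
qed

text \<open>f times the field \<open>YY\<close> vanishes near D and outside K q, so it extends by
  zero to a C^1 field with compact support, whose divergence has integral 0;
  \<open>divergence_chart\<close> identifies the integrand.\<close>

lemma CI_divergence:
  assumes q: "q \<in> Q" and V: "openin X V" "D \<subseteq> V" and f: "C1_fun f"
    and f0: "\<And>x. x \<notin> K q \<Longrightarrow> f x = 0" "\<And>x. x \<in> V \<Longrightarrow> f x = 0"
  shows "CI (C0 q) (\<lambda>x. f x / real (Suc p) * del_norm_sq x + cross_term f x) = 0"
proof -
  let ?c = "C0 q" and ?i = "Fr q"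
  note adm = adm_C0[OF q] and c = C0_A[OF q]
  note O = admD(5)[OF adm]
  have sup: "supp ?c (K q - V) f"
    by (rule supp_C0[OF q V mcontI(1)[OF f] K[OF q]]) (use f0 in auto)
  let ?K = "snd ?c ` (K q - V)"
  have K': "compact ?K" "?K \<subseteq> img ?c" using sup compact_chart_image[OF c] by (auto simp: supp_def)
  have K0: "f (kap ?c z) = 0" if "z \<in> img ?c" "z \<notin> ?K" for z
  proof -
    have "kap ?c z \<notin> K q - V" using that chart_kap[OF that(1)] by (metis imageI)
    then show ?thesis using f0 by auto
  qed
  define W where "W j z = (if z \<in> img ?c then fc ?c f z * YY ?c ?i j z else 0)" for j z
  have W1: "C1_on (W j) UNIV" for j
    unfolding W_def[abs_def]
  proof (rule extend_C1[OF O K'])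
    show "C1_on (\<lambda>z. fc ?c f z * YY ?c ?i j z) (img ?c)"
      by (rule Ck_on_mult[OF O fc_C1[OF f c] YY_C1[OF adm]])
    show "fc ?c f z * YY ?c ?i j z = 0" if "z \<in> img ?c" "z \<notin> ?K" for z
      using K0[OF that] by (simp add: fc_def)
  qed
  have W0: "W j z = 0" if "z \<notin> ?K" for j z
    using K0 that by (auto simp: W_def fc_def)
  note W = cint_del[OF W1 K'(1) W0]
  have "cint (\<lambda>z. \<Sum>j\<in>UNIV. Re (del (W j) z (cbasis j))) = (\<Sum>j\<in>UNIV. cint (\<lambda>z. Re (del (W j) z (cbasis j))))"
    by (rule cint_sum) (use W(1) in auto)
  also have "\<dots> = 0" by (simp add: W(2))
  also have "(\<lambda>z. \<Sum>j\<in>UNIV. Re (del (W j) z (cbasis j))) = ci ?c (\<lambda>x. f x / real (Suc p) * del_norm_sq x + cross_term f x)"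
  proof
    fix z
    show "(\<Sum>j\<in>UNIV. Re (del (W j) z (cbasis j))) = ci ?c (\<lambda>x. f x / real (Suc p) * del_norm_sq x + cross_term f x) z"
    proof (cases "z \<in> img ?c")
      case True
      have "del (W j) z = del (\<lambda>y. fc ?c f y * YY ?c ?i j y) z" for j
        by (rule del_cong_open(1)[OF O True]) (simp add: W_def)
      then have "(\<Sum>j\<in>UNIV. Re (del (W j) z (cbasis j))) = Re (\<Sum>j\<in>UNIV. del (\<lambda>y. fc ?c f y * YY ?c ?i j y) z (cbasis j))"
        by simp
      also have "\<dots> = ci ?c (\<lambda>x. f x / real (Suc p) * del_norm_sq x + cross_term f x) z"
        unfolding divergence_chart[OF adm f True]
        using True del_norm_sq_eq[OF adm kap_in[OF True]] cross_term_eq[OF f adm kap_in[OF True]] chart_kap[OF True]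
        by (simp add: ci_def)
      finally show ?thesis .
    next
      case False
      then have "z \<in> - ?K" using K'(2) by auto
      have o: "open (- ?K)" using compact_imp_closed[OF K'(1)] by auto
      have "del (W j) z = del (\<lambda>y. 0) z" for j
        by (rule del_cong_open(1)[OF o \<open>z \<in> - ?K\<close>]) (use W0 in auto)
      then show ?thesis using False by (simp add: ci_def)
    qed
  qed
  finally show ?thesis by (simp add: CI_def)
qed

lemma wedge_norm_sq_cross_term_vanish:
  assumes f: "C1_fun f" and V: "openin X V" "x \<in> V" "\<And>y. y \<in> V \<Longrightarrow> f y = r" and q: "q \<in> Q" and x: "x \<in> fst (C0 q)"
  shows "cross_term f x = 0" "wedge_norm_sq f x = 0"
  using cross_term_wedge_norm_sq_locally_const[OF f V adm_C0[OF q] x] by simp_all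

lemma Hausdorff: "Hausdorff_space X"
  by (rule conjunct1[OF cm[unfolded complex_manifold_def]])

lemma K_compl: "q \<in> Q \<Longrightarrow> openin X (topspace X - K q)"
  by (rule openin_diff[OF openin_topspace compactin_imp_closedin[OF Hausdorff K(1)]])

text \<open>\<open>CI_divergence\<close> is applied to pu q times \<psi>^2. The product rule gives
  F1, with the derivative on \<psi>^2, and F2, with the derivative on the partition; the integrals
  of F2 add up to 0. In F1 the cross term is estimated by \<open>cross_term_bound\<close>, which
  leaves half the energy bounded by twice the error, hence the constant 4.\<close>

lemma caccioppoli:
  assumes V: "openin X V" "D \<subseteq> V" and \<psi>: "C1_fun \<psi>" "\<And>x. x \<in> V \<Longrightarrow> \<psi> x = 0"
  shows "(\<Sum>q\<in>Q. CI (C0 q) (\<lambda>x. pu q x * ((\<psi> x)\<^sup>2 * del_norm_sq x))) \<le> 4 * (\<Sum>q\<in>Q. CI (C0 q) (\<lambda>x. pu q x * wedge_norm_sq \<psi> x))"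
proof -
  let ?N = "real (Suc p)"
  let ?psi2 = "\<lambda>x. \<psi> x * \<psi> x"
  have psi2: "C1_fun ?psi2" by (rule C1_fun_mult[OF \<psi>(1) \<psi>(1)])
  define F1 where "F1 q x = pu q x * (?psi2 x / ?N * del_norm_sq x + cross_term ?psi2 x)" for q x
  define F2 where "F2 q x = ?psi2 x * cross_term (pu q) x" for q x
  have Q\<psi>0: "cross_term ?psi2 x = 0" "wedge_norm_sq \<psi> x = 0" if "x \<in> V" "q \<in> Q" "x \<in> fst (C0 q)" for x q
    by (rule wedge_norm_sq_cross_term_vanish(1)[OF psi2 V(1) that(1) _ that(2,3), of 0], simp add: \<psi>(2))
      (rule wedge_norm_sq_cross_term_vanish(2)[OF \<psi>(1) V(1) that(1) \<psi>(2) that(2,3)])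
  have Qpu0: "cross_term (pu q) x = 0" if "q \<in> Q" "x \<notin> K q" "q' \<in> Q" "x \<in> fst (C0 q')" for q q' x
  proof (rule wedge_norm_sq_cross_term_vanish(1)[OF pu(1)[OF that(1)] K_compl[OF that(1)] _ _ that(3,4)])
    show "x \<in> topspace X - K q" using that chart_subset[OF C0_A[OF that(3)]] by auto
    show "pu q y = 0" if "y \<in> topspace X - K q" for y using that pu(3)[OF \<open>q \<in> Q\<close>] by auto
  qed
  have mc1: "mcont (F1 q)" if "q \<in> Q" for q
  proof -
    have "mcont (\<lambda>x. pu q x * (((1 / ?N) * ?psi2 x) * del_norm_sq x + cross_term ?psi2 x))"
      by (intro mcontI(1-7) pu(1)[OF that] psi2 \<psi>(1))
    then show ?thesis by (simp add: F1_def[abs_def])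
  qed
  have mc2: "mcont (F2 q)" if "q \<in> Q" for q
    unfolding F2_def[abs_def] by (intro mcontI(1-7) pu(1)[OF that] psi2 \<psi>(1))
  have s1: "supp (C0 q) (K q - V) (F1 q)" if q: "q \<in> Q" for q
    by (rule supp_C0[OF q V mc1[OF q] K[OF q]]) (use pu(3)[OF q] Q\<psi>0 q \<psi>(2) in \<open>auto simp: F1_def\<close>)
  have s2: "supp (C0 q) (K q - V) (F2 q)" if q: "q \<in> Q" for q
    by (rule supp_C0[OF q V mc2[OF q] K[OF q]]) (use Qpu0[OF q _ q] \<psi>(2) in \<open>auto simp: F2_def\<close>)
  have eq12: "CI (C0 q) (F1 q) + CI (C0 q) (F2 q) = 0" if q: "q \<in> Q" for q
  proof -
    have "CI (C0 q) (\<lambda>x. F1 q x + F2 q x) = CI (C0 q) (\<lambda>x. pu q x * ?psi2 x / ?N * del_norm_sq x + cross_term (\<lambda>x. pu q x * ?psi2 x) x)"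
      proof (rule CI_cong)
      fix x assume x: "x \<in> fst (C0 q)"
      have alg: "P * (S / n * B + Q1) + S * Q2 = P * S / n * B + (P * Q1 + S * Q2)" for P S n B Q1 Q2 :: real
        by (simp add: algebra_simps)
      show "F1 q x + F2 q x = pu q x * ?psi2 x / ?N * del_norm_sq x + cross_term (\<lambda>x. pu q x * ?psi2 x) x"
        unfolding F1_def F2_def cross_term_mult[OF pu(1)[OF q] psi2 adm_C0[OF q] x] by (rule alg)
    qed
    also have "\<dots> = 0"
      by (rule CI_divergence[OF q V C1_fun_mult[OF pu(1)[OF q] psi2]]) (use pu(3)[OF q] \<psi>(2) in auto)
    finally show ?thesis using CI_add[OF C0_A[OF q] s1[OF q] s2[OF q]] by simp
  qed
  \<comment> \<open>The product with pu q' is supported in both K q and K q', so its integral may be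
    computed in either chart.\<close>
  have swap: "CI (C0 q) (\<lambda>x. pu q' x * F2 q x) = CI (C0 q') (\<lambda>x. pu q' x * F2 q x)"
    and s3: "supp (C0 q) (K q \<inter> K q' - V) (\<lambda>x. pu q' x * F2 q x)" "supp (C0 q') (K q \<inter> K q' - V) (\<lambda>x. pu q' x * F2 q x)"
    if q: "q \<in> Q" and q': "q' \<in> Q" for q q'
  proof -
    have mc: "mcont (\<lambda>x. pu q' x * F2 q x)" by (intro mcontI(5) mcontI(1)[OF pu(1)[OF q']] mc2[OF q])
    have "closedin X (K q')" using K_compl[OF q'] compactin_subset_topspace[OF K(1)[OF q']] by (simp add: closedin_def)
    then have cK: "compactin X (K q \<inter> K q')" by (rule compact_Int_closedin[OF K(1)[OF q]])
    show 1: "supp (C0 q) (K q \<inter> K q' - V) (\<lambda>x. pu q' x * F2 q x)"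
      by (rule supp_C0[OF q V mc cK]) (use K(2)[OF q] Qpu0[OF q _ q] pu(3)[OF q'] \<psi>(2) in \<open>auto simp: F2_def\<close>)
    show 2: "supp (C0 q') (K q \<inter> K q' - V) (\<lambda>x. pu q' x * F2 q x)"
      by (rule supp_C0[OF q' V mc cK]) (use K(2)[OF q'] Qpu0[OF q _ q'] pu(3)[OF q'] \<psi>(2) in \<open>auto simp: F2_def\<close>)
    show "CI (C0 q) (\<lambda>x. pu q' x * F2 q x) = CI (C0 q') (\<lambda>x. pu q' x * F2 q x)"
      by (rule CI_change[OF C0_A[OF q] C0_A[OF q'] 1 2])
  qed
  \<comment> \<open>A second factor, the sum of all pu q' equal to 1, is inserted so that each piece
    can be moved to the chart of q'. In that one chart the sum over q is taken pointwise, where the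
    differentials of the partition cancel.\<close>
  have "(\<Sum>q\<in>Q. CI (C0 q) (F2 q)) = (\<Sum>q\<in>Q. \<Sum>q'\<in>Q. CI (C0 q) (\<lambda>x. pu q' x * F2 q x))"
  proof (rule sum.cong[OF refl])
    fix q assume q: "q \<in> Q"
    have "CI (C0 q) (F2 q) = CI (C0 q) (\<lambda>x. \<Sum>q'\<in>Q. pu q' x * F2 q x)"
      by (rule CI_cong) (use pu(4) chart_subset[OF C0_A[OF q]] in \<open>auto simp flip: sum_distrib_right\<close>)
    also have "\<dots> = (\<Sum>q'\<in>Q. CI (C0 q) (\<lambda>x. pu q' x * F2 q x))"
      by (rule CI_sum[OF C0_A[OF q] Q s3(1)[OF q]])
    finally show "CI (C0 q) (F2 q) = (\<Sum>q'\<in>Q. CI (C0 q) (\<lambda>x. pu q' x * F2 q x))" .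
  qed
  also have "\<dots> = (\<Sum>q\<in>Q. \<Sum>q'\<in>Q. CI (C0 q') (\<lambda>x. pu q' x * F2 q x))"
    by (intro sum.cong refl swap)
  also have "\<dots> = (\<Sum>q'\<in>Q. \<Sum>q\<in>Q. CI (C0 q') (\<lambda>x. pu q' x * F2 q x))" by (rule sum.swap)
  also have "\<dots> = 0"
  proof (rule sum.neutral, rule ballI)
    fix q' assume q': "q' \<in> Q"
    have "(\<Sum>q\<in>Q. CI (C0 q') (\<lambda>x. pu q' x * F2 q x)) = CI (C0 q') (\<lambda>x. \<Sum>q\<in>Q. pu q' x * F2 q x)"
      by (rule CI_sum[OF C0_A[OF q'] Q s3(2)[OF _ q'], symmetric])
    also have "\<dots> = CI (C0 q') (\<lambda>x. 0 * 0)"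
      by (rule CI_cong) (use cross_term_sum_const[OF pu(1) Q pu(4) adm_C0[OF q']] in \<open>simp add: F2_def flip: sum_distrib_left\<close>)
    also have "\<dots> = 0" using CI_cmult[of "C0 q'" 0 "\<lambda>x. 0"] by simp
    finally show "(\<Sum>q\<in>Q. CI (C0 q') (\<lambda>x. pu q' x * F2 q x)) = 0" .
  qed
  finally have "(\<Sum>q\<in>Q. CI (C0 q) (F2 q)) = 0" .
  moreover have "(\<Sum>q\<in>Q. CI (C0 q) (F1 q)) + (\<Sum>q\<in>Q. CI (C0 q) (F2 q)) = 0"
    unfolding sum.distrib[symmetric] by (rule sum.neutral) (use eq12 in blast)
  ultimately have z: "(\<Sum>q\<in>Q. CI (C0 q) (F1 q)) = 0" by simp
  define B where "B q x = pu q x * ((\<psi> x)\<^sup>2 * del_norm_sq x)" for q x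
  define E where "E q x = pu q x * wedge_norm_sq \<psi> x" for q x
  have sB: "supp (C0 q) (K q - V) (B q)" if q: "q \<in> Q" for q
    unfolding B_def[abs_def] power2_eq_square
  proof (rule supp_C0[OF q V _ K[OF q]])
    show "mcont (\<lambda>x. pu q x * (\<psi> x * \<psi> x * del_norm_sq x))"
      by (intro mcontI(5) mcontI(2) mcontI(1)[OF pu(1)[OF q]] mcontI(1)[OF \<psi>(1)])
  qed (simp_all add: pu(3)[OF q] \<psi>(2))
  have sE: "supp (C0 q) (K q - V) (E q)" if q: "q \<in> Q" for q
    unfolding E_def[abs_def]
  proof (rule supp_C0[OF q V _ K[OF q]])
    show "mcont (\<lambda>x. pu q x * wedge_norm_sq \<psi> x)"
      by (intro mcontI(5) mcontI(4)[OF \<psi>(1)] mcontI(1)[OF pu(1)[OF q]])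
  qed (simp_all add: pu(3)[OF q] Q\<psi>0(2)[OF _ q])
  \<comment> \<open>Multiplying by p + 1 clears the denominator in F1; the pointwise inequality is
    then \<open>cross_term_bound\<close> times pu q.\<close>
  have "(1 / 2) * CI (C0 q) (B q) + (- 2) * CI (C0 q) (E q) \<le> ?N * CI (C0 q) (F1 q)" if q: "q \<in> Q" for q
  proof -
    have "CI (C0 q) (\<lambda>x. (1 / 2) * B q x + (- 2) * E q x) \<le> CI (C0 q) (\<lambda>x. ?N * F1 q x)"
    proof (rule CI_mono[OF C0_A[OF q] supp_add[OF supp_cmult[OF sB[OF q]] supp_cmult[OF sE[OF q]]] supp_cmult[OF s1[OF q]]])
      fix x assume x: "x \<in> fst (C0 q)"
      have "(\<psi> x)\<^sup>2 * del_norm_sq x / 2 - 2 * wedge_norm_sq \<psi> x \<le> (\<psi> x)\<^sup>2 * del_norm_sq x + ?N * cross_term ?psi2 x"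
        using cross_term_bound[OF \<psi>(1) adm_C0[OF q] x] by simp
      from mult_left_mono[OF this pu(2)[OF q, of x]]
      show "(1 / 2) * B q x + (- 2) * E q x \<le> ?N * F1 q x"
        unfolding B_def E_def F1_def power2_eq_square by (simp add: algebra_simps del: of_nat_Suc)
    qed
    then show ?thesis
      unfolding CI_add[OF C0_A[OF q] supp_cmult[OF sB[OF q]] supp_cmult[OF sE[OF q]]] CI_cmult .
  qed
  then have "(\<Sum>q\<in>Q. (1 / 2) * CI (C0 q) (B q) + (- 2) * CI (C0 q) (E q)) \<le> (\<Sum>q\<in>Q. ?N * CI (C0 q) (F1 q))"
    by (intro sum_mono)
  then have "(1 / 2) * (\<Sum>q\<in>Q. CI (C0 q) (B q)) - 2 * (\<Sum>q\<in>Q. CI (C0 q) (E q)) \<le> 0"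
    using z by (simp add: sum.distrib sum_subtractf flip: sum_distrib_left sum_divide_distrib)
  then show ?thesis by (simp add: B_def[abs_def] E_def[abs_def])
qed

end


section \<open>Estimates near the divisor\<close>

text \<open>If the head v occurs again in the tail, that occurrence is moved next to it up to sign;
  swapping the two equal entries then gives s = - s.\<close>

lemma alt_repeated:
  "alt m s \<Longrightarrow> length vs = m \<Longrightarrow> \<not> distinct vs \<Longrightarrow> s vs = 0"
proof (induction vs arbitrary: m s)
  case (Cons v vs)
  then obtain m' where m: "m = Suc m'" "length vs = m'" by auto
  have a: "alt m' (\<lambda>us. s (v # us))" by (rule alt_Cons) (use Cons.prems m in simp)
  show ?case
  proof (cases "distinct vs")
    case False
    then show ?thesis by (rule Cons.IH[OF a m(2)])
  next
    case True
    then have "v \<in> set vs" using Cons.prems by simp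
    then obtain b where b: "b < length vs" "vs ! b = v" by (auto simp: in_set_conv_nth)
    have "s (v # rot b vs) = (- 1) ^ b * s (v # vs)"
      by (rule alt_rot[OF _ a]) (use b m in auto)
    moreover have "s (v # v # remove_nth b vs) = - s (v # v # remove_nth b vs)"
      by (rule alt_swap[of m']) (use Cons.prems m b in \<open>simp_all add: length_remove_nth\<close>)
    then have "s (v # rot b vs) = 0" using b by (simp add: rot_def)
    ultimately show ?thesis by simp
  qed
qed simp

lemma rot_map: "a < length J \<Longrightarrow> rot a (map f J) = map f (rot a J)"
  by (simp add: rot_def remove_nth_def take_map drop_map)

lemma prod_list_rot:
  fixes w :: "'b \<Rightarrow> 'c::comm_monoid_mult"
  assumes "a < length J"
  shows "prod_list (map w (rot a J)) = prod_list (map w J)"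
proof -
  have "J = take a J @ J ! a # drop (Suc a) J" by (rule id_take_nth_drop[OF assms])
  then have "prod_list (map w J) = prod_list (map w (take a J @ J ! a # drop (Suc a) J))" by simp
  also have "\<dots> = prod_list (map w (rot a J))"
    by (simp add: rot_def remove_nth_def mult.left_commute)
  finally show ?thesis ..
qed

text \<open>The weights w belong to the basis vectors, so their product is the same for every
  rotation; all p + 1 terms obey one bound.\<close>

lemma norm_skew_le:
  fixes d :: "complex ^ 'n::finite \<Rightarrow> complex"
  assumes d: "\<And>j. norm (d (cbasis j)) \<le> M * w j"
    and s: "\<And>J. length J = m \<Longrightarrow> norm (s (map cbasis J)) \<le> M' * prod_list (map w J)"
    and I: "length I = Suc m"
  shows "norm (skew (\<lambda>us. d (hd us) * s (tl us)) (map cbasis I)) \<le> real (Suc m) * (M * M' * prod_list (map w I))"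
proof -
  have "norm ((- 1) ^ a * (d (hd (rot a (map cbasis I))) * s (tl (rot a (map cbasis I))))) \<le> M * M' * prod_list (map w I)"
    if a: "a \<in> {..<Suc m}" for a
  proof -
    have "length (rot a I) = Suc m" using a I by (simp add: length_rot)
    then obtain j J where J: "rot a I = j # J" "length J = m" by (cases "rot a I") auto
    have "norm (d (cbasis j)) * norm (s (map cbasis J)) \<le> (M * w j) * (M' * prod_list (map w J))"
      by (rule mult_mono[OF d s[OF J(2)]]) (use order.trans[OF norm_ge_zero d] in auto)
    also have "\<dots> = M * M' * prod_list (map w (rot a I))" by (simp add: J)
    also have "prod_list (map w (rot a I)) = prod_list (map w I)"
      by (rule prod_list_rot) (use a I in simp)
    finally show ?thesis using a I by (simp add: rot_map J norm_mult norm_power)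
  qed
  then have "norm (\<Sum>a<Suc m. (- 1) ^ a * (d (hd (rot a (map cbasis I))) * s (tl (rot a (map cbasis I))))) \<le>
      real (card {..<Suc m}) * (M * M' * prod_list (map w I))"
    by (rule sum_norm_bound)
  then show ?thesis using I by (simp add: skew_def del: of_nat_Suc sum.lessThan_Suc)
qed

text \<open>In a list without repetition the index k occurs at most once, so at most one factor 1/y
  appears: this is why the wedge product keeps a simple pole. The factor 1 + r covers the lists
  avoiding k, since 1 \<le> r/y.\<close>

lemma prod_list_pole_le:
  assumes "distinct I" "0 < y" "y \<le> (r :: real)"
  shows "prod_list (map (\<lambda>j. if j = k then 1 / y else 1) I) \<le> (1 + r) / y"
proof -
  have "prod_list (map (\<lambda>j. if j = k then 1 / y else 1) I) = (\<Prod>j\<in>set I. if j = k then 1 / y else 1)"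
    by (rule prod.distinct_set_conv_list[OF assms(1), symmetric])
  also have "\<dots> = (if k \<in> set I then 1 / y else 1)" by (simp add: prod.delta)
  also have "\<dots> \<le> (1 + r) / y" using assms by (auto simp: field_simps)
  finally show ?thesis .
qed

lemma compact_family_bound:
  fixes f :: "'j \<Rightarrow> 'v::topological_space \<Rightarrow> 'w::real_normed_vector"
  assumes "finite J" "compact K" "\<And>j. j \<in> J \<Longrightarrow> continuous_on K (f j)"
  shows "\<exists>M>0. \<forall>j\<in>J. \<forall>z\<in>K. norm (f j z) \<le> M"
proof -
  have "continuous_on K (\<lambda>z. \<Sum>j\<in>J. norm (f j z))"
    by (intro continuous_on_sum continuous_on_norm assms(3))
  then have "bounded ((\<lambda>z. \<Sum>j\<in>J. norm (f j z)) ` K)"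
    by (intro compact_imp_bounded compact_continuous_image assms(2))
  then obtain M where M: "M > 0" "\<And>z. z \<in> K \<Longrightarrow> norm (\<Sum>j\<in>J. norm (f j z)) \<le> M"
    unfolding bounded_pos by auto
  have "norm (f j z) \<le> M" if "j \<in> J" "z \<in> K" for j z
  proof -
    have "norm (f j z) \<le> (\<Sum>j\<in>J. norm (f j z))"
      by (rule member_le_sum[OF that(1)]) (use assms(1) in auto)
    then show ?thesis using M(2)[OF that(2)] by simp
  qed
  with M(1) show ?thesis by blast
qed

lemma C1_on_norm_square:
  fixes l :: "'v::real_normed_vector \<Rightarrow> 'w::real_inner"
  assumes "bounded_linear l"
  shows "C1_on (\<lambda>z. (norm (l z - b))\<^sup>2) S"
proof (rule C1_onI)
  show "((\<lambda>z. (norm (l z - b))\<^sup>2) has_derivative (\<lambda>v. 2 * inner (l z - b) (l v))) (at z)" for z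
    unfolding power2_norm_eq_inner
    by (auto intro!: derivative_eq_intros bounded_linear.has_derivative[OF assms] simp: inner_commute)
  show "continuous_on S (\<lambda>z. 2 * inner (l z - b) (l v))" for v
    by (intro continuous_intros bounded_linear.continuous_on[OF assms])
qed

lemma del_norm_square_coordinate:
  "del (\<lambda>z :: complex ^ 'n::finite. of_real ((cmod (z $ k))\<^sup>2)) z v = cnj (z $ k) * v $ k"
proof -
  have h: "holo_on (\<lambda>z :: complex ^ 'n. z $ k) UNIV"
    unfolding holo_on_def
    by (intro ballI exI[of _ "\<lambda>v. v $ k"] conjI allI)
      (auto intro!: bounded_linear_imp_has_derivative bounded_linear_vec_nth)
  have d: "fd (\<lambda>z :: complex ^ 'n. z $ k) z = (\<lambda>v. v $ k)"
    by (rule fd_eq) (auto intro!: bounded_linear_imp_has_derivative bounded_linear_vec_nth)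
  note D = holo_onD(1)[OF h UNIV_I, of z]
  have "del (\<lambda>z :: complex ^ 'n. z $ k * cnj (z $ k)) z v = z $ k * cnj (delb (\<lambda>z. z $ k) z v) + del (\<lambda>z. z $ k) z v * cnj (z $ k)"
    by (simp add: del_mult[OF D differentiable_cnj[OF D]] del_cnj[OF D])
  then show ?thesis unfolding complex_norm_square by (simp add: del_holo[OF h UNIV_I] d mult.commute)
qed

lemma bmp_mono: "s \<le> t \<Longrightarrow> bmp s \<le> bmp t"
  unfolding bmp_def by (rule power_mono) auto

lemma stp_mono: "s \<le> t \<Longrightarrow> stp s \<le> stp t"
  unfolding stp_def using bmp_mono[of s t] bmp_mono[of "1 - bmp t" "1 - bmp s"] by simp

section \<open>Shrinking charts, and cutoff functions around the divisor\<close>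

context log_setup
begin

lemma fd_transition_restrict:
  assumes c: "c \<in> A" and W: "openin X W" and x: "x \<in> fst c \<inter> W"
  shows "fd (transition (fst c \<inter> W, snd c) c) (snd c x) = (\<lambda>v. v)"
proof -
  let ?c = "(fst c \<inter> W, snd c)"
  note c' = chart_restrict[OF c W]
  have o: "open (snd c ` (fst c \<inter> W))" using chart_facts(2)[OF c'] by simp
  have "transition ?c c z = z" if z: "z \<in> snd c ` (fst c \<inter> W)" for z
  proof -
    obtain y where y: "y \<in> fst c" "y \<in> W" "z = snd c y" using z by blast
    show ?thesis unfolding y(3) using transition_maps[OF c' c, of y] y by simp
  qed
  then have "fd (transition ?c c) (snd c x) = fd (\<lambda>z. z) (snd c x)"
    by (intro fd_cong_open[OF o]) (use x in auto)
  also have "\<dots> = (\<lambda>v. v)" by (rule fd_eq) (rule has_derivative_ident)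
  finally show ?thesis .
qed

text \<open>Forms are families indexed by charts, so agreement on a smaller chart is not automatic;
  it is the transformation law with the identity as transition map.\<close>

lemma form_restrict:
  assumes c: "c \<in> A" and W: "openin X W" and x: "x \<in> fst c \<inter> W"
  shows "HH (fst c \<inter> W, snd c) (snd c x) = HH c (snd c x)"
    "i \<in> idx L \<Longrightarrow> x \<in> cover L i \<Longrightarrow> x \<notin> D \<Longrightarrow> length vs = p \<Longrightarrow>
      \<alpha> (fst c \<inter> W, snd c) i x vs [] = \<alpha> c i x vs []"
proof -
  let ?c = "(fst c \<inter> W, snd c)"
  note c' = chart_restrict[OF c W]
  have "\<omega> ?c () x [v] [w] = \<omega> c () x [v] [w]" for v w
    using log_form_transform[OF omega_form c' c, of "()" "()" x "[v]" "[w]"] x chart_subset[OF c]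
    by (auto simp: trivial_bundle_def fd_transition_restrict[OF c W x])
  moreover have "kap ?c (snd c x) = x" using kap_chart[OF c', of x] x by simp
  moreover have "kap c (snd c x) = x" using kap_chart[OF c, of x] x by simp
  ultimately show "HH ?c (snd c x) = HH c (snd c x)" by (simp add: HH_def)
  assume "i \<in> idx L" "x \<in> cover L i" "x \<notin> D" "length vs = p"
  then show "\<alpha> ?c i x vs [] = \<alpha> c i x vs []"
    using log_form_transform[OF lf c' c, of i i x vs "[]"] x cover_facts(2)[of i x]
    by (simp add: fd_transition_restrict[OF c W x])
qed

end

text \<open>A finite cover by coordinate balls. By \<open>core\<close> the half balls already cover,
  which leaves the outer halves for the bump functions to decay. In charts meeting D the centre
  satisfies z^k = 0, so the ball is stable under setting z^k to 0 and |z^k| \<le> rad q on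
  it.\<close>

locale tube_cover = log_setup X A D L N p \<iota> \<alpha> \<omega>
  for X :: "'a topology" and A :: "('a, 'n::finite) chart set" and D :: "'a set"
    and L :: "('a, 'i) line_bundle" and N p :: nat
    and \<iota> :: "'a set \<times> ('a \<Rightarrow> complex) \<Rightarrow> 'i \<Rightarrow> 'a \<Rightarrow> complex"
    and \<alpha> :: "('a, 'n, 'i) form" and \<omega> :: "('a, 'n, unit) form" +
  fixes Q :: "'q set" and C :: "'q \<Rightarrow> ('a, 'n) chart" and Fr :: "'q \<Rightarrow> 'i"
    and ctr :: "'q \<Rightarrow> complex ^ 'n" and rad :: "'q \<Rightarrow> real" and kk :: "'q \<Rightarrow> 'n option"
  assumes Q: "finite Q"
    and C: "\<And>q. q \<in> Q \<Longrightarrow> C q \<in> A" and Fr: "\<And>q. q \<in> Q \<Longrightarrow> Fr q \<in> idx L" "\<And>q. q \<in> Q \<Longrightarrow> fst (C q) \<subseteq> cover L (Fr q)"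
    and rad: "\<And>q. q \<in> Q \<Longrightarrow> 0 < rad q" "\<And>q. q \<in> Q \<Longrightarrow> cball (ctr q) (rad q) \<subseteq> snd (C q) ` fst (C q)"
    and kk: "\<And>q. q \<in> Q \<Longrightarrow> adapted D (C q) (kk q)" "\<And>q k. q \<in> Q \<Longrightarrow> kk q = Some k \<Longrightarrow> ctr q $ k = 0"
    and core: "\<And>x. x \<in> topspace X \<Longrightarrow> \<exists>q\<in>Q. x \<in> fst (C q) \<and> norm (snd (C q) x - ctr q) < rad q / 2"
begin

definition KK :: "'q \<Rightarrow> 'a set" where "KK q = kap (C q) ` cball (ctr q) (rad q)"

text \<open>On the half ball the argument of \<open>bmp\<close> is at least 3/4, so the bump is at
  least 9/16 there, and a fortiori at least 1/2.\<close>

definition bp :: "'q \<Rightarrow> 'a \<Rightarrow> real" where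
  "bp q x = (if x \<in> fst (C q) then bmp (1 - (norm (snd (C q) x - ctr q))\<^sup>2 / (rad q)\<^sup>2) else 0)"

definition pu :: "'q \<Rightarrow> 'a \<Rightarrow> real" where
  "pu q x = bp q x * inverse (\<Sum>r\<in>Q. bp r x)"

text \<open>The factor 2 makes \<open>stp (2 * bp q x)\<close> equal to 1 on the half ball. The
  radial step is 0 for 2 |z^k|^2 \<le> e^2 and 1 for |z^k| \<ge> e. So the function is 0 close to D
  in the half ball, and 1 outside the tube and outside the ball.\<close>

definition chart_cutoff :: "'q \<Rightarrow> real \<Rightarrow> 'a \<Rightarrow> real" where
  "chart_cutoff q e x = 1 - (case kk q of None \<Rightarrow> 0 | Some k \<Rightarrow> if x \<in> fst (C q) then
     stp (2 * bp q x) * (1 - stp (2 * (cmod (snd (C q) x $ k))\<^sup>2 / e\<^sup>2 - 1)) else 0)"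

lemma KK_facts:
  assumes "q \<in> Q"
  shows "compactin X (KK q)" "closedin X (KK q)" "KK q \<subseteq> fst (C q)"
    "x \<in> KK q \<longleftrightarrow> x \<in> fst (C q) \<and> norm (snd (C q) x - ctr q) \<le> rad q"
proof -
  note c = C[OF assms] and s = rad(2)[OF assms]
  show "compactin X (KK q)" "closedin X (KK q)"
    unfolding KK_def using compactin_kap[OF c compact_cball s] by simp_all
  show 1: "KK q \<subseteq> fst (C q)"
    unfolding KK_def by (rule image_subsetI, rule kap_in) (use s in blast)
  have "snd (C q) x \<in> cball (ctr q) (rad q)" if x: "x \<in> KK q"
  proof -
    obtain z where "z \<in> cball (ctr q) (rad q)" "x = kap (C q) z" using x unfolding KK_def by blast
    then show ?thesis using chart_kap[of z "C q"] s by auto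
  qed
  moreover have "x \<in> KK q" if "x \<in> fst (C q)" "snd (C q) x \<in> cball (ctr q) (rad q)"
    unfolding KK_def using kap_chart[OF c that(1)] that(2) by (intro image_eqI[of _ _ "snd (C q) x"]) auto
  ultimately show "x \<in> KK q \<longleftrightarrow> x \<in> fst (C q) \<and> norm (snd (C q) x - ctr q) \<le> rad q"
    using 1 by (auto simp: dist_norm norm_minus_commute)
qed

lemma bp_facts:
  assumes q: "q \<in> Q"
  shows "C1_fun (bp q)" "0 \<le> bp q x" "x \<notin> KK q \<Longrightarrow> bp q x = 0"
    "x \<in> fst (C q) \<Longrightarrow> norm (snd (C q) x - ctr q) < rad q / 2 \<Longrightarrow> 1 / 2 \<le> bp q x"
proof -
  note c = C[OF q] and r = rad(1)[OF q]
  show "0 \<le> bp q x" by (simp add: bp_def bmp_nonneg)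
  show z: "bp q x = 0" if "x \<notin> KK q" for x
  proof (cases "x \<in> fst (C q)")
    case True
    then have "rad q < norm (snd (C q) x - ctr q)" using that KK_facts(4)[OF q] by auto
    then have "1 \<le> (norm (snd (C q) x - ctr q))\<^sup>2 / (rad q)\<^sup>2"
      using r by (simp add: power_mono)
    then show ?thesis by (simp add: bp_def bmp_def)
  qed (simp add: bp_def)
  show "1 / 2 \<le> bp q x" if "x \<in> fst (C q)" "norm (snd (C q) x - ctr q) < rad q / 2"
  proof -
    have "(norm (snd (C q) x - ctr q))\<^sup>2 \<le> (rad q / 2)\<^sup>2"
      by (rule power_mono) (use that in auto)
    then have "(norm (snd (C q) x - ctr q))\<^sup>2 / (rad q)\<^sup>2 \<le> 1 / 4"
      using r by (simp add: field_simps power2_eq_square)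
    then have "bmp (3 / 4) \<le> bmp (1 - (norm (snd (C q) x - ctr q))\<^sup>2 / (rad q)\<^sup>2)"
      by (intro bmp_mono) simp
    moreover have "bmp (3 / 4) = 9 / 16" by (simp add: bmp_def power2_eq_square)
    ultimately show ?thesis using that(1) by (simp add: bp_def)
  qed
  note O = chart_facts(2)[OF c]
  have u: "C1_on (\<lambda>z. 1 + (- 1 / (rad q)\<^sup>2) * (norm (z - ctr q))\<^sup>2) (img (C q))"
    by (intro Ck_on_add[OF O] Ck_on_const Ck_on_cmult[OF O] C1_on_norm_square bounded_linear_ident)
  have "C1_on (\<lambda>z. bmp (1 + (- 1 / (rad q)\<^sup>2) * (norm (z - ctr q))\<^sup>2)) (img (C q))"
    by (rule C1_on_real_compose[OF u bmp_deriv]) (intro continuous_intros)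
  then have "C1_on (\<lambda>z. bp q (kap (C q) z)) (img (C q))"
    by (rule Ck_on_cong_open[OF O, rotated]) (simp add: bp_def kap_in chart_kap)
  then show "C1_fun (bp q)"
    by (rule C1_fun_extend[OF c _ KK_facts(2,3)[OF q] z])
qed

lemma sum_bp_pos:
  assumes "x \<in> topspace X"
  shows "0 < (\<Sum>r\<in>Q. bp r x)"
proof -
  obtain q where q: "q \<in> Q" "x \<in> fst (C q)" "norm (snd (C q) x - ctr q) < rad q / 2"
    using core[OF assms] by blast
  show ?thesis
    by (rule sum_pos2[OF Q q(1)]) (use bp_facts(4)[OF q] bp_facts(2) in auto)
qed

lemma chart_cutoff_None: "kk q = None \<Longrightarrow> chart_cutoff q e = (\<lambda>x. 1)"
  by (simp add: chart_cutoff_def[abs_def])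

lemma chart_cutoff_range:
  assumes "q \<in> Q"
  shows "0 \<le> chart_cutoff q e x" "chart_cutoff q e x \<le> 1"
proof -
  have "0 \<le> a * (1 - b) \<and> a * (1 - b) \<le> 1" if "0 \<le> a" "a \<le> 1" "0 \<le> b" "b \<le> 1" for a b :: real
    using mult_mono[of a 1 "1 - b" 1] that by simp
  from this[OF stp_range stp_range] show "0 \<le> chart_cutoff q e x" "chart_cutoff q e x \<le> 1"
    by (auto simp: chart_cutoff_def split: option.split)
qed

lemma chart_cutoff_off: "q \<in> Q \<Longrightarrow> x \<notin> KK q \<Longrightarrow> chart_cutoff q e x = 1"
  using bp_facts(3)[of q x] by (auto simp: chart_cutoff_def stp_0 split: option.split)

lemma chart_cutoff_far: "kk q = Some k \<Longrightarrow> 0 < e \<Longrightarrow> x \<in> fst (C q) \<Longrightarrow> e \<le> cmod (snd (C q) x $ k) \<Longrightarrow> chart_cutoff q e x = 1"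
  using power_mono[of e "cmod (snd (C q) x $ k)" 2] by (simp add: chart_cutoff_def stp_1 field_simps)

lemma chart_cutoff_core:
  assumes "q \<in> Q" "kk q = Some k" "0 < e" "x \<in> fst (C q)" "norm (snd (C q) x - ctr q) < rad q / 2"
    "2 * (cmod (snd (C q) x $ k))\<^sup>2 < e\<^sup>2"
  shows "chart_cutoff q e x = 0"
proof -
  have "stp (2 * bp q x) = 1" using bp_facts(4)[OF assms(1,4,5)] by (intro stp_1) simp
  moreover have "stp (2 * (cmod (snd (C q) x $ k))\<^sup>2 / e\<^sup>2 - 1) = 0"
    using assms(3,6) by (intro stp_0) (simp add: field_simps)
  ultimately show ?thesis using assms by (simp add: chart_cutoff_def)
qed

lemma chart_cutoff_antimono:
  assumes "0 < e'" "e' \<le> e"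
  shows "chart_cutoff q e x \<le> chart_cutoff q e' x"
proof -
  have "stp (2 * y / e\<^sup>2 - 1) \<le> stp (2 * y / e'\<^sup>2 - 1)" if "0 \<le> y" for y
    using assms that power_mono[of e' e 2] by (intro stp_mono diff_right_mono divide_left_mono) auto
  then show ?thesis
    by (auto simp: chart_cutoff_def stp_range split: option.split intro!: mult_left_mono)
qed

lemma C1_fun_stp: "C1_fun f \<Longrightarrow> C1_fun (\<lambda>x. stp (f x))"
  by (rule C1_fun_compose[OF _ stp_deriv continuous_on_stp'])

lemma C1_on_coordinate:
  assumes "open S"
  shows "C1_on (\<lambda>z :: complex ^ 'n. 2 * (cmod (z $ k))\<^sup>2 / e\<^sup>2 - 1) S"
proof -
  have 1: "C1_on (\<lambda>z :: complex ^ 'n. (cmod (z $ k - 0))\<^sup>2) S"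
    by (rule C1_on_norm_square[OF bounded_linear_vec_nth])
  have "C1_on (\<lambda>z :: complex ^ 'n. (2 / e\<^sup>2) * (cmod (z $ k - 0))\<^sup>2 + (- 1)) S"
    by (intro Ck_on_add[OF assms] Ck_on_const Ck_on_cmult[OF assms] 1)
  then show ?thesis by simp
qed

lemma chart_cutoff_C1:
  assumes q: "q \<in> Q"
  shows "C1_fun (chart_cutoff q e)"
proof (cases "kk q")
  case None
  then show ?thesis by (simp add: chart_cutoff_None C1_fun_const)
next
  case (Some k)
  note c = C[OF q] and O = chart_facts(2)[OF C[OF q]]
  let ?f = "\<lambda>x. 1 - chart_cutoff q e x"
  have 1: "C1_on (\<lambda>z. stp (2 * bp q (kap (C q) z))) (img (C q))"
    by (rule C1_funD[OF C1_fun_stp[OF C1_fun_mult[OF C1_fun_const bp_facts(1)[OF q]]] c])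
  have 2: "C1_on (\<lambda>z :: complex ^ 'n. stp (2 * (cmod (z $ k))\<^sup>2 / e\<^sup>2 - 1)) (img (C q))"
    by (rule C1_on_real_compose[OF C1_on_coordinate[OF O] stp_deriv])
      (rule continuous_on_stp')
  have "C1_on (\<lambda>z :: complex ^ 'n. stp (2 * bp q (kap (C q) z)) * (1 + (- 1) * stp (2 * (cmod (z $ k))\<^sup>2 / e\<^sup>2 - 1))) (img (C q))"
    by (intro Ck_on_mult[OF O 1] Ck_on_add[OF O] Ck_on_const Ck_on_cmult[OF O] 2)
  then have "C1_on (\<lambda>z. ?f (kap (C q) z)) (img (C q))"
    by (rule Ck_on_cong_open[OF O, rotated]) (simp add: chart_cutoff_def Some kap_in chart_kap)
  then have "C1_fun ?f"
    by (rule C1_fun_extend[OF c _ KK_facts(2,3)[OF q]]) (simp add: chart_cutoff_off[OF q])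
  from C1_fun_diff[OF C1_fun_const[of 1] this] show ?thesis by simp
qed

sublocale partition X A D L N p \<iota> \<alpha> \<omega> Q C Fr pu KK
proof
  show "C1_fun (pu q)" if "q \<in> Q" for q
    unfolding pu_def[abs_def]
    by (intro C1_fun_mult bp_facts(1)[OF that] C1_fun_inverse[OF C1_fun_sum[OF bp_facts(1)] less_imp_neq[OF sum_bp_pos, THEN not_sym]])
  show "0 \<le> pu q x" if "q \<in> Q" for q x
    unfolding pu_def by (intro mult_nonneg_nonneg bp_facts(2)[OF that] inverse_nonnegative_iff_nonnegative[THEN iffD2] sum_nonneg bp_facts(2))
  show "pu q x = 0" if "q \<in> Q" "x \<notin> KK q" for q x
    using bp_facts(3)[OF that] by (simp add: pu_def)
  show "(\<Sum>q\<in>Q. pu q x) = 1" if "x \<in> topspace X" for x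
    using sum_bp_pos[OF that] by (simp add: pu_def flip: sum_distrib_right)
qed (use Q C Fr KK_facts in auto)

lemma restrict_C0:
  assumes q: "q \<in> Q" and z: "z \<in> img (C0 q)"
  shows "z \<in> img (C q)" "kap (C0 q) z = kap (C q) z" "kap (C q) z \<notin> D" "HH (C0 q) z = HH (C q) z"
    "length vs = p \<Longrightarrow> aa (C0 q) (Fr q) z vs = aa (C q) (Fr q) z vs"
    "kk q = Some k \<Longrightarrow> 0 < cmod (z $ k)"
proof -
  note c = C[OF q]
  have W: "openin X (topspace X - D)" using D_closed by (simp add: closedin_def)
  obtain x where x: "x \<in> fst (C q)" "x \<notin> D" "x \<in> topspace X" "z = snd (C q) x"
    using z by (auto simp: C0_def)
  have x': "x \<in> fst (C q) \<inter> (topspace X - D)" using x by blast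
  show "z \<in> img (C q)" using x by simp
  have k1: "kap (C q) z = x" using kap_chart[OF c x(1)] x(4) by simp
  have k2: "kap (C0 q) z = x"
    using kap_chart[OF C0_A[OF q], of x] x x' by (simp add: C0_def)
  show "kap (C0 q) z = kap (C q) z" "kap (C q) z \<notin> D" using k1 k2 x by simp_all
  show "HH (C0 q) z = HH (C q) z"
    using form_restrict(1)[OF c W x'] x(4) by (simp add: C0_def)
  show "aa (C0 q) (Fr q) z vs = aa (C q) (Fr q) z vs" if "length vs = p"
    unfolding aa_def k1 k2
    using form_restrict(2)[OF c W x' Fr(1)[OF q] _ x(2) that] Fr(2)[OF q] x(1) by (auto simp: C0_def)
  show "0 < cmod (z $ k)" if "kk q = Some k"
    using kk(1)[OF q] that x by (auto simp: adapted_def case_prod_beta)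
qed

text \<open>The function vanishes where z^k = 0 and its derivative in direction e_k is bounded on
  the ball, so the mean value inequality applies along the complex line from the projection of z to
  the hyperplane.\<close>

lemma zeta_bound:
  assumes q: "q \<in> Q" and k: "kk q = Some k"
  shows "\<exists>M>0. \<forall>z\<in>cball (ctr q) (rad q). cmod (\<zeta> (Fr q) (kap (C q) z)) \<le> M * cmod (z $ k)"
proof -
  note c = C[OF q] and O = chart_facts(2)[OF C[OF q]]
  let ?f = "\<lambda>z. \<zeta> (Fr q) (kap (C q) z)"
  let ?B = "cball (ctr q) (rad q)"
  have int: "fst (C q) \<inter> cover L (Fr q) = fst (C q)" using Fr(2)[OF q] by auto
  have h: "holo_on ?f (img (C q))" using zeta_holo[OF c Fr(1)[OF q]] by (simp add: int)
  have "continuous_on ?B (\<lambda>z. fd ?f z (cbasis k))"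
    by (rule continuous_on_subset[OF holo_continuous_fd[OF h O] rad(2)[OF q]])
  from compact_family_bound[of "{()}", OF _ compact_cball this]
  obtain M where M: "M > 0" "\<And>z. z \<in> ?B \<Longrightarrow> cmod (fd ?f z (cbasis k)) \<le> M" by auto
  have "cmod (?f z) \<le> M * cmod (z $ k)" if z: "z \<in> ?B" for z
  proof -
    \<comment> \<open>The projection of z to z^k = 0. As the centre lies on this hyperplane, the
      points between z0 and z stay in the ball, componentwise no farther from the centre than
      z.\<close>
    define z0 where "z0 = z + (- (z $ k)) *s cbasis k"
    have pt: "z0 + t *s cbasis k \<in> ?B" if "cmod t \<le> cmod (z $ k)" for t
    proof -
      have "norm (z0 + t *s cbasis k - ctr q) \<le> norm (z - ctr q)"
        by (rule norm_le_componentwise_cart)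
          (use that kk(2)[OF q k] in \<open>auto simp: z0_def axis_def\<close>)
      then show ?thesis using z by (simp add: dist_norm norm_minus_commute)
    qed
    have "cmod (?f (z0 + (z $ k) *s cbasis k) - ?f (z0 + 0 *s cbasis k)) \<le> M * cmod (z $ k - 0)"
    proof (rule field_differentiable_bound[of "cball 0 (cmod (z $ k))" "\<lambda>t. ?f (z0 + t *s cbasis k)" "\<lambda>t. fd ?f (z0 + t *s cbasis k) (cbasis k)"])
      fix t :: complex assume "t \<in> cball 0 (cmod (z $ k))"
      then have t: "z0 + t *s cbasis k \<in> ?B" by (intro pt) (simp add: dist_norm)
      show "((\<lambda>t. ?f (z0 + t *s cbasis k)) has_field_derivative fd ?f (z0 + t *s cbasis k) (cbasis k)) (at t within cball 0 (cmod (z $ k)))"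
        by (rule has_field_derivative_at_within, rule holo_on_line[OF h]) (use t rad(2)[OF q] in blast)
      show "cmod (fd ?f (z0 + t *s cbasis k) (cbasis k)) \<le> M" by (rule M(2)[OF t])
    qed auto
    moreover have "z0 + (z $ k) *s cbasis k = z" by (simp add: z0_def vec_eq_iff)
    moreover have "?f z0 = 0"
    proof -
      have "z0 + 0 *s cbasis k \<in> ?B" by (rule pt) simp
      then have z0: "z0 \<in> img (C q)" using rad(2)[OF q] by auto
      have "z0 $ k = 0" by (simp add: z0_def)
      then have "kap (C q) z0 \<in> {x \<in> fst (C q). snd (C q) x $ k = 0}"
        using kap_in[OF z0] chart_kap[OF z0] by simp
      moreover have "D \<inter> fst (C q) = {x \<in> fst (C q). snd (C q) x $ k = 0}"
        using kk(1)[OF q] by (simp add: adapted_def case_prod_beta k)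
      ultimately have "kap (C q) z0 \<in> D" by blast
      then show ?thesis by (rule zeta_zero_iff[OF Fr(1)[OF q] subsetD[OF Fr(2)[OF q] kap_in[OF z0]], THEN iffD2])
    qed
    ultimately show ?thesis by simp
  qed
  with M(1) show ?thesis by blast
qed

text \<open>The coefficients extend smoothly across D and are bounded on the closed ball. Only
  dz^k/z^k is unbounded, and it is nonzero on e_k alone, so each occurrence of k in J costs one
  factor 1/|z^k|.\<close>

lemma aa_bound:
  assumes q: "q \<in> Q" and k: "kk q = Some k"
  shows "\<exists>M>0. \<forall>z\<in>img (C0 q) \<inter> cball (ctr q) (rad q). \<forall>J. length J = p \<longrightarrow>
    norm (aa (C0 q) (Fr q) z (map cbasis J)) \<le> M * prod_list (map (\<lambda>j. if j = k then 1 / cmod (z $ k) else 1) J)"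
proof -
  let ?S = "{I :: 'n list. length I = p}"
  obtain f where f: "\<And>I. smooth_on (f I) (img (C q))"
    "\<And>z vs. z \<in> img (C q) \<Longrightarrow> kap (C q) z \<notin> D \<Longrightarrow> length vs = p \<Longrightarrow>
      aa (C q) (Fr q) z vs = (\<Sum>I | length I = p. f I z * wedge_covectors (map (log_coframe (Some k) z) I) vs)"
    using alpha_expand[OF C[OF q] kk(1)[OF q, unfolded k] Fr(1)[OF q] Fr(2)[OF q]] by blast
  have fin: "finite ?S" using finite_lists_length_eq[of "UNIV :: 'n set" p] by simp
  have "continuous_on (cball (ctr q) (rad q)) (f I)" for I
    using f(1)[of I] rad(2)[OF q] continuous_on_subset unfolding smooth_on_def by (metis Ck_on.simps(1))
  from compact_family_bound[of ?S "cball (ctr q) (rad q)" f, OF fin compact_cball this]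
  obtain M where M: "M > 0" "\<And>I z. length I = p \<Longrightarrow> z \<in> cball (ctr q) (rad q) \<Longrightarrow> norm (f I z) \<le> M" by blast
  let ?M = "real (card ?S) * (M * fact p) + 1"
  have "norm (aa (C0 q) (Fr q) z (map cbasis J)) \<le> ?M * prod_list (map (\<lambda>j. if j = k then 1 / cmod (z $ k) else 1) J)"
    if z: "z \<in> img (C0 q) \<inter> cball (ctr q) (rad q)" and J: "length J = p" for z J
  proof -
    let ?w = "\<lambda>j. if j = k then 1 / cmod (z $ k) else 1"
    have z1: "z \<in> img (C0 q)" "z \<in> cball (ctr q) (rad q)" using z by auto
    note R = restrict_C0[OF q z1(1)]
    have P: "0 \<le> prod_list (map ?w J)" by (rule prod_list_nonneg) auto
    have "norm (f I z * wedge_covectors (map (log_coframe (Some k) z) I) (map cbasis J)) \<le> M * (fact p * prod_list (map ?w J))"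
      if I: "I \<in> ?S" for I
    proof -
      have "norm (wedge_covectors (map (log_coframe (Some k) z) I) (map cbasis J)) \<le> fact (length J) * (\<Prod>a<length J. ?w (J ! a))"
        by (rule norm_wedge_covectors_le) (use I J R(6)[OF k] in \<open>auto simp: log_coframe_def axis_def norm_divide\<close>)
      also have "(\<Prod>a<length J. ?w (J ! a)) = prod_list (map ?w J)"
        by (simp add: prod.list_conv_set_nth atLeast0LessThan)
      finally show ?thesis
        unfolding norm_mult using M(2)[of I z] I z1(2) J P M(1) by (intro mult_mono) auto
    qed
    then have "norm (aa (C0 q) (Fr q) z (map cbasis J)) \<le> real (card ?S) * (M * (fact p * prod_list (map ?w J)))"
      using sum_norm_bound[of ?S "\<lambda>I. f I z * wedge_covectors (map (log_coframe (Some k) z) I) (map cbasis J)"] R(5)[of "map cbasis J"] f(2)[OF R(1,3)] J by simp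
    also have "\<dots> \<le> ?M * prod_list (map ?w J)" using P by (simp add: algebra_simps)
    finally show ?thesis .
  qed
  moreover have "?M > 0" using M(1) by (intro add_nonneg_pos) auto
  ultimately show ?thesis by blast
qed

text \<open>The radial factor contributes a multiple of conj(z^k) dz^k / e^2, hence a component
  along dz^k only, which is O(1/|z^k|) for |z^k| \<le> e; the bump contributes a bounded form. The
  constant is independent of e.\<close>

lemma del_chart_cutoff_bound:
  assumes q: "q \<in> Q" and k: "kk q = Some k"
  shows "\<exists>M>0. \<forall>e>0. \<forall>z\<in>img (C0 q) \<inter> cball (ctr q) (rad q). cmod (z $ k) \<le> e \<longrightarrow> (\<forall>j.
    norm (del (fc (C0 q) (chart_cutoff q e)) z (cbasis j)) \<le> M * (if j = k then 1 / cmod (z $ k) else 1))"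
proof -
  note c = C[OF q] and O = chart_facts(2)[OF C[OF q]]
  define F where "F y = complex_of_real (stp (2 * bp q (kap (C q) y)))" for y
  have F: "C1_on F (img (C q))"
    unfolding F_def
    by (rule Ck_on_linear[OF O bounded_linear_of_real C1_funD[OF C1_fun_stp[OF C1_fun_mult[OF C1_fun_const bp_facts(1)[OF q]]] c]])
  have "continuous_on (cball (ctr q) (rad q)) (\<lambda>z. del F z (cbasis j))" for j
    by (rule continuous_on_subset[OF Ck_on_continuous[OF Ck_on_del[OF O F]] rad(2)[OF q]])
  from compact_family_bound[of "UNIV :: 'n set" "cball (ctr q) (rad q)" "\<lambda>j z. del F z (cbasis j)", OF finite compact_cball this]
  obtain B where B: "B > 0" "\<And>j z. z \<in> cball (ctr q) (rad q) \<Longrightarrow> norm (del F z (cbasis j)) \<le> B" by auto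
  \<comment> \<open>8 is the slope bound 4 times the 2 from the radial argument; B bounds the
    derivative of the bump, and B * rad q absorbs it into B rad q/|z^k| in direction e_k.\<close>
  let ?M = "B + B * rad q + 8"
  have "norm (del (fc (C0 q) (chart_cutoff q e)) z (cbasis j)) \<le> ?M * (if j = k then 1 / cmod (z $ k) else 1)"
    if e: "e > 0" and z: "z \<in> img (C0 q) \<inter> cball (ctr q) (rad q)" and zk: "cmod (z $ k) \<le> e" for e z j
  proof -
    let ?u = "\<lambda>y :: complex ^ 'n. 2 * (cmod (y $ k))\<^sup>2 / e\<^sup>2 - 1"
    let ?G = "\<lambda>y. complex_of_real (stp (?u y))"
    have z1: "z \<in> img (C0 q)" "z \<in> cball (ctr q) (rad q)" using z by auto
    note R = restrict_C0[OF q z1(1)] and O0 = chart_facts(2)[OF C0_A[OF q]]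
    have y: "0 < cmod (z $ k)" by (rule R(6)[OF k])
    have yr: "cmod (z $ k) \<le> rad q"
      using Finite_Cartesian_Product.norm_nth_le[of "z - ctr q" k] kk(2)[OF q k] z1(2) by (simp add: dist_norm norm_minus_commute)
    have u: "?u differentiable (at z)"
      by (rule C1_onD(1)[OF C1_on_coordinate[OF open_UNIV] UNIV_I])
    have G: "?G differentiable (at z)"
      by (rule differentiable_of_real[OF del_real_compose(1)[OF u stp_deriv]])
    have F1: "F differentiable (at z)" by (rule C1_onD(1)[OF F R(1)])
    have "del (\<lambda>y. complex_of_real (?u y)) z v = 2 / e\<^sup>2 * (cnj (z $ k) * v $ k)" for v
    proof -
      have d: "(\<lambda>z :: complex ^ 'n. complex_of_real ((cmod (z $ k))\<^sup>2)) differentiable (at z)"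
        using C1_onD(1)[OF C1_on_norm_square[OF bounded_linear_vec_nth, of k 0 UNIV] UNIV_I, of z]
        by (intro differentiable_of_real) simp
      have "del (\<lambda>y. complex_of_real (?u y)) z v = del (\<lambda>y. of_real (2 / e\<^sup>2) * of_real ((cmod (y $ k))\<^sup>2) + (- 1)) z v"
        by (simp add: algebra_simps)
      also have "\<dots> = of_real (2 / e\<^sup>2) * del (\<lambda>y :: complex ^ 'n. of_real ((cmod (y $ k))\<^sup>2)) z v"
        using del_add[OF differentiable_mult[OF differentiable_const d] differentiable_const, of "of_real (2 / e\<^sup>2)" "- 1" v]
          del_cmult[OF d, of "of_real (2 / e\<^sup>2)" v] by simp
      finally show ?thesis by (simp only: del_norm_square_coordinate)
    qed
    then have dG: "del ?G z v = of_real (stp' (?u z)) * (2 / e\<^sup>2 * (cnj (z $ k) * v $ k))" for v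
      by (simp add: del_real_compose(2)[OF u stp_deriv])
    have nG: "norm (del ?G z (cbasis j)) \<le> (if j = k then 8 / cmod (z $ k) else 0)"
    proof (cases "j = k")
      case True
      \<comment> \<open>Inside the tube 1/e^2 \<le> 1/|z^k|^2, which replaces the dependence on e by
        the pole.\<close>
      have "cmod (z $ k) * cmod (z $ k) \<le> e\<^sup>2" unfolding power2_eq_square using zk e by (intro mult_mono) auto
      then have "2 / e\<^sup>2 * cmod (z $ k) \<le> 2 / cmod (z $ k)" using y e by (simp add: field_simps)
      then have "stp' (?u z) * (2 / e\<^sup>2 * cmod (z $ k)) \<le> 4 * (2 / cmod (z $ k))"
        using stp'_range[of "?u z"] by (intro mult_mono) auto
      then show ?thesis using True stp'_range(1)[of "?u z"]
        by (simp add: dG norm_mult norm_divide norm_power axis_def)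
    next
      case False
      then show ?thesis by (simp add: dG axis_def)
    qed
    have E1: "del (fc (C0 q) (chart_cutoff q e)) z = del (\<lambda>y. 1 + (- 1) * (F y * (1 + (- 1) * ?G y))) z"
    proof (rule del_cong_open(1)[OF O0 z1(1)])
      fix y assume y: "y \<in> img (C0 q)"
      note R' = restrict_C0[OF q y]
      show "fc (C0 q) (chart_cutoff q e) y = 1 + (- 1) * (F y * (1 + (- 1) * ?G y))"
        unfolding fc_def R'(2) using R'(1) by (simp add: chart_cutoff_def k kap_in chart_kap F_def algebra_simps)
    qed
    have E2: "del (\<lambda>y. 1 + (- 1) * (F y * (1 + (- 1) * ?G y))) z (cbasis j) = F z * del ?G z (cbasis j) - del F z (cbasis j) * (1 - ?G z)"
    proof -
      have 1: "(\<lambda>y. 1 + (- 1) * ?G y) differentiable (at z)"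
        by (intro differentiable_add differentiable_mult differentiable_const G)
      have 2: "(\<lambda>y. F y * (1 + (- 1) * ?G y)) differentiable (at z)"
        by (rule differentiable_mult[OF F1 1])
      show ?thesis
        unfolding del_add[OF differentiable_const differentiable_mult[OF differentiable_const 2]] del_cmult[OF 2]
          del_mult[OF F1 1] del_add[OF differentiable_const differentiable_mult[OF differentiable_const G]] del_cmult[OF G]
        by (simp add: algebra_simps)
    qed
    have "norm (del (fc (C0 q) (chart_cutoff q e)) z (cbasis j)) \<le> norm (F z * del ?G z (cbasis j)) + norm (del F z (cbasis j) * (1 - ?G z))"
      unfolding E1 E2 by (rule norm_triangle_ineq4)
    also have "\<dots> \<le> 1 * (if j = k then 8 / cmod (z $ k) else 0) + B * 1"
    proof (rule add_mono)
      show "norm (F z * del ?G z (cbasis j)) \<le> 1 * (if j = k then 8 / cmod (z $ k) else 0)"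
        unfolding norm_mult using nG stp_range[of "2 * bp q (kap (C q) z)"] by (intro mult_mono) (auto simp: F_def)
      have "1 - ?G z = of_real (1 - stp (?u z))" by simp
      then have "norm (1 - ?G z) \<le> 1" using stp_range[of "?u z"] by (simp only: norm_of_real)
      then show "norm (del F z (cbasis j) * (1 - ?G z)) \<le> B * 1"
        unfolding norm_mult using B(2)[OF z1(2), of j] B(1) by (intro mult_mono) auto
    qed
    also have "\<dots> \<le> ?M * (if j = k then 1 / cmod (z $ k) else 1)"
    proof (cases "j = k")
      case True
      have "B * cmod (z $ k) \<le> B * rad q" using yr B(1) by (intro mult_left_mono) auto
      then have "8 + B * cmod (z $ k) \<le> ?M" using B(1) by linarith
      then have "(8 + B * cmod (z $ k)) / cmod (z $ k) \<le> ?M / cmod (z $ k)" using y by (intro divide_right_mono) auto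
      then show ?thesis using True y by (simp add: add_divide_distrib)
    next
      case False
      then show ?thesis using B(1) rad(1)[OF q] by simp
    qed
    finally show ?thesis .
  qed
  moreover have "?M > 0" using B(1) rad(1)[OF q] by (intro add_pos_pos mult_pos_pos) auto
  ultimately show ?thesis by blast
qed

end


section \<open>The energy estimate and the vanishing of the derivative off the divisor\<close>

lemma cint_zero:
  fixes F :: "complex ^ 'n::finite \<Rightarrow> real"
  assumes F: "continuous_on UNIV F" "\<And>z. 0 \<le> F z" "cabs F" "cint F \<le> 0"
  shows "F z = 0"
proof -
  let ?f = "\<lambda>x. F (toC x)" and ?a = "ofC z - One" and ?b = "ofC z + One"
  have c: "continuous_on S ?f" for S
    by (rule continuous_on_compose2[OF F(1)]) (auto intro: continuous_intros)
  have i: "?f integrable_on cbox ?a ?b" by (rule integrable_continuous[OF c])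
  have "integral (cbox ?a ?b) ?f \<le> integral UNIV ?f"
    by (rule integral_subset_le[OF _ i cabs_integrable[OF F(3)]]) (use F(2) in auto)
  moreover have "0 \<le> integral (cbox ?a ?b) ?f" by (rule integral_nonneg[OF i]) (use F(2) in auto)
  ultimately have "integral (cbox ?a ?b) ?f = 0" using F(4) by (simp add: cint_def)
  then have "(?f has_integral 0) (cbox ?a ?b)" using integrable_integral[OF i] by simp
  moreover have "ofC z \<in> box ?a ?b" by (simp add: mem_box inner_add_left inner_diff_left)
  ultimately have "?f (ofC z) = 0"
    using has_integral_0_cbox_imp_0[OF c, of ?a ?b "ofC z"] F(2) box_subset_cbox[of ?a ?b] by blast
  then show ?thesis by simp
qed

context tube_cover
begin

lemma wedge_norm_sq_chart_cutoff_zero: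
  assumes q: "q \<in> Q" and q': "q' \<in> Q" "x \<in> fst (C0 q')"
  shows "x \<notin> KK q \<Longrightarrow> wedge_norm_sq (chart_cutoff q e) x = 0"
    "kk q = None \<Longrightarrow> wedge_norm_sq (chart_cutoff q e) x = 0"
    "kk q = Some k \<Longrightarrow> 0 < e \<Longrightarrow> x \<in> fst (C q) \<Longrightarrow> e < cmod (snd (C q) x $ k) \<Longrightarrow> wedge_norm_sq (chart_cutoff q e) x = 0"
proof -
  have t: "x \<in> topspace X" using chart_subset[OF C0_A[OF q'(1)]] q'(2) by auto
  note V = wedge_norm_sq_cross_term_vanish(2)[OF chart_cutoff_C1[OF q] _ _ _ q', where r = 1]
  show "wedge_norm_sq (chart_cutoff q e) x = 0" if "x \<notin> KK q"
    by (rule V[OF K_compl[OF q]]) (use t that chart_cutoff_off[OF q] in auto)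
  show "wedge_norm_sq (chart_cutoff q e) x = 0" if "kk q = None"
    by (rule V[OF openin_topspace t]) (simp add: chart_cutoff_None[OF that])
  show "wedge_norm_sq (chart_cutoff q e) x = 0" if k: "kk q = Some k" "0 < e" and x: "x \<in> fst (C q)" "e < cmod (snd (C q) x $ k)"
  proof (rule V)
    have "open {z :: complex ^ 'n. e < cmod (z $ k)}" by (intro open_Collect_less continuous_intros)
    from openin_chart_preimage[OF C[OF q] this]
    show "openin X {y \<in> fst (C q). snd (C q) y \<in> {z. e < cmod (z $ k)}}" .
    show "x \<in> {y \<in> fst (C q). snd (C q) y \<in> {z. e < cmod (z $ k)}}" using x by simp
    show "chart_cutoff q e y = 1" if "y \<in> {y \<in> fst (C q). snd (C q) y \<in> {z. e < cmod (z $ k)}}" for y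
      by (rule chart_cutoff_far[OF k]) (use that in auto)
  qed
qed

text \<open>The weight gives |z^k|^(2/N) and the squared simple pole of the wedge product
  |z^k|^(-2); the inverse metric and the volume density are bounded on the closed ball. All
  constants come from bounds uniform in e.\<close>

lemma tube_estimate:
  assumes q: "q \<in> Q" and k: "kk q = Some k"
  shows "\<exists>M>0. \<forall>e>0. \<forall>z\<in>img (C0 q) \<inter> cball (ctr q) (rad q). cmod (z $ k) \<le> e \<longrightarrow>
    rho (HH (C0 q) z) * wedge_norm_sq (chart_cutoff q e) (kap (C0 q) z) \<le> M * cmod (z $ k) powr (2 / real N - 2)"
proof -
  let ?B = "cball (ctr q) (rad q)" and ?r = "rad q" and ?c = "C0 q" and ?i = "Fr q"
  note c = C[OF q] and O = chart_facts(2)[OF C[OF q]] and adm = adm_C0[OF q]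
  obtain Mz where Mz: "Mz > 0" "\<And>z. z \<in> ?B \<Longrightarrow> cmod (\<zeta> ?i (kap (C q) z)) \<le> Mz * cmod (z $ k)"
    using zeta_bound[OF q k] by blast
  obtain Ma where Ma: "Ma > 0" "\<And>z J. z \<in> img ?c \<inter> ?B \<Longrightarrow> length J = p \<Longrightarrow>
      norm (aa ?c ?i z (map cbasis J)) \<le> Ma * prod_list (map (\<lambda>j. if j = k then 1 / cmod (z $ k) else 1) J)"
    using aa_bound[OF q k] by blast
  obtain Md where Md: "Md > 0" "\<And>e z j. e > 0 \<Longrightarrow> z \<in> img ?c \<inter> ?B \<Longrightarrow> cmod (z $ k) \<le> e \<Longrightarrow>
      norm (del (fc ?c (chart_cutoff q e)) z (cbasis j)) \<le> Md * (if j = k then 1 / cmod (z $ k) else 1)"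
    using del_chart_cutoff_bound[OF q k] by blast
  have "continuous_on ?B (\<lambda>z. inv_entry (HH (C q) z) (fst s) (snd s))" for s
    by (rule continuous_on_subset[OF C1_onD(4)[OF C1_on_inv_entry[OF O HH_Ck[OF c] HH_posdef[OF c]]] rad(2)[OF q]])
  from compact_family_bound[of "UNIV :: ('n \<times> 'n) set" ?B "\<lambda>s z. inv_entry (HH (C q) z) (fst s) (snd s)", OF finite compact_cball this]
  obtain MG where MG: "MG > 0" "\<And>z a b. z \<in> ?B \<Longrightarrow> norm (inv_entry (HH (C q) z) a b) \<le> MG" by auto
  have "continuous_on ?B (\<lambda>z. rho (HH (C q) z))"
    by (rule continuous_on_subset[OF rho_continuous[OF c] rad(2)[OF q]])
  from compact_family_bound[of "{()}" ?B "\<lambda>_ z. rho (HH (C q) z)", OF _ compact_cball this]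
  obtain MR where MR: "MR > 0" "\<And>z. z \<in> ?B \<Longrightarrow> norm (rho (HH (C q) z)) \<le> MR" by auto
  \<comment> \<open>The numerator of the simple pole: p + 1 terms of \<open>skew\<close>, the bounds
    for \<partial>\<psi> and \<alpha>, and the factor 1 + rad q from
    \<open>prod_list_pole_le\<close>.\<close>
  define b where "b = real (Suc p) * (Md * Ma * (1 + ?r))"
  define W where "W = (Mz\<^sup>2) powr (1 / real N)"
  define Kc where "Kc = (real CARD('n) ^ 2 * MG) ^ Suc p"
  have b: "b > 0" unfolding b_def using Md(1) Ma(1) rad(1)[OF q] by (intro mult_pos_pos) auto
  have W: "W > 0" unfolding W_def using Mz(1) by simp
  have Kc: "Kc > 0" unfolding Kc_def using MG(1) by simp
  have "rho (HH ?c z) * wedge_norm_sq (chart_cutoff q e) (kap ?c z) \<le> MR * W * Kc * b\<^sup>2 * cmod (z $ k) powr (2 / real N - 2)"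
    if e: "e > 0" and z: "z \<in> img ?c \<inter> ?B" and zk: "cmod (z $ k) \<le> e" for e z
  proof -
    let ?y = "cmod (z $ k)"
    let ?w = "\<lambda>j. if j = k then 1 / ?y else 1"
    have z1: "z \<in> img ?c" "z \<in> ?B" using z by auto
    note R = restrict_C0[OF q z1(1)]
    have y: "0 < ?y" by (rule R(6)[OF k])
    have yr: "?y \<le> ?r"
      using Finite_Cartesian_Product.norm_nth_le[of "z - ctr q" k] kk(2)[OF q k] z1(2) by (simp add: dist_norm norm_minus_commute)
    let ?g = "gam ?c ?i (chart_cutoff q e) z"
    have g: "norm (?g (map cbasis I)) \<le> b / ?y" if I: "length I = Suc p" for I
    proof (cases "distinct I")
      case True
      have "norm (?g (map cbasis I)) \<le> real (Suc p) * (Md * Ma * prod_list (map ?w I))"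
        unfolding gam_def da_def by (rule norm_skew_le[OF Md(2)[OF e z zk] Ma(2)[OF z] I])
      also have "\<dots> \<le> real (Suc p) * (Md * Ma * ((1 + ?r) / ?y))"
        using Md(1) Ma(1) by (intro mult_left_mono prod_list_pole_le[OF True y yr]) auto
      finally show ?thesis by (simp add: b_def)
    next
      case False
      then have "\<not> distinct (map cbasis I :: (complex ^ 'n) list)" by (auto simp: distinct_map)
      then have "?g (map cbasis I) = 0"
        unfolding gam_def by (intro alt_repeated[OF alt_skew[OF da_mlin(2)[OF adm chart_cutoff_C1[OF q] z1(1)]]]) (simp_all add: I)
      then show ?thesis using b y by simp
    qed
    have "norm (ip (inv_entry (HH ?c z)) (Suc p) ?g ?g) \<le> Kc * (b / ?y * (b / ?y))"
      unfolding Kc_def by (rule ip_norm_le) (use MG(1) MG(2)[OF z1(2)] b y g R(4) in auto)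
    then have ip: "Re (ip (inv_entry (HH ?c z)) (Suc p) ?g ?g) \<le> Kc * (b / ?y * (b / ?y))"
      using complex_Re_le_cmod order.trans by blast
    have "(cmod (\<zeta> ?i (kap ?c z)))\<^sup>2 \<le> (Mz * ?y)\<^sup>2"
      unfolding R(2) by (rule power_mono[OF Mz(2)[OF z1(2)]]) simp
    then have "wt ?i (kap ?c z) \<le> (Mz\<^sup>2 * ?y\<^sup>2) powr (1 / real N)"
      unfolding wt_def by (intro powr_mono2) (auto simp: power_mult_distrib)
    also have "\<dots> = W * ?y powr (2 / real N)"
    proof -
      have "(?y\<^sup>2) powr (1 / real N) = ?y powr (2 / real N)"
        using powr_powr[of ?y 2 "1 / real N"] y by (simp add: powr_numeral)
      then show ?thesis using Mz(1) y by (simp add: W_def powr_mult)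
    qed
    finally have wt: "wt ?i (kap ?c z) \<le> W * ?y powr (2 / real N)" .
    have wt0: "0 < wt ?i (kap ?c z)" by (rule wt_facts(2)[OF adm z1(1)])
    have sz: "snd ?c (kap ?c z) = z" by (rule chart_kap[OF z1(1)])
    have "wedge_norm_sq (chart_cutoff q e) (kap ?c z) = wt ?i (kap ?c z) * Re (ip (inv_entry (HH ?c z)) (Suc p) ?g ?g)"
      using wedge_norm_sq_eq[OF chart_cutoff_C1[OF q, of e] adm kap_in[OF z1(1)]] unfolding sz pairing_def .
    also have "\<dots> \<le> wt ?i (kap ?c z) * (Kc * (b / ?y * (b / ?y)))"
      using ip wt0 by (intro mult_left_mono) auto
    also have "\<dots> \<le> (W * ?y powr (2 / real N)) * (Kc * (b / ?y * (b / ?y)))"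
      using wt Kc b y by (intro mult_right_mono) auto
    finally have N: "wedge_norm_sq (chart_cutoff q e) (kap ?c z) \<le> (W * ?y powr (2 / real N)) * (Kc * (b / ?y * (b / ?y)))" .
    have y2: "?y powr 2 = ?y * ?y" using y by (simp add: powr_numeral power2_eq_square)
    have "rho (HH ?c z) \<le> MR" using MR(2)[OF z1(2)] R(4) by simp
    then have "rho (HH ?c z) * wedge_norm_sq (chart_cutoff q e) (kap ?c z) \<le> MR * ((W * ?y powr (2 / real N)) * (Kc * (b / ?y * (b / ?y))))"
      using N MR(1) wedge_norm_sq_nonneg[OF chart_cutoff_C1[OF q] adm kap_in[OF z1(1)]] by (intro mult_mono) auto
    also have "?y powr (2 / real N) = ?y powr (2 / real N - 2) * (?y * ?y)"
      unfolding powr_diff y2 using y by simp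
    also have "MR * ((W * (?y powr (2 / real N - 2) * (?y * ?y))) * (Kc * (b / ?y * (b / ?y)))) = MR * W * Kc * b\<^sup>2 * ?y powr (2 / real N - 2)"
      using y by (simp add: power2_eq_square field_simps)
    finally show ?thesis .
  qed
  moreover have "MR * W * Kc * b\<^sup>2 > 0" using MR(1) W Kc b by simp
  ultimately show ?thesis by blast
qed

text \<open>An open set on which the chart cutoff is 0; since the half balls cover X, these sets
  together form a neighbourhood of D.\<close>

definition VV :: "real \<Rightarrow> 'q \<Rightarrow> 'a set" where
  "VV e q = (case kk q of None \<Rightarrow> {} | Some k \<Rightarrow>
     {x \<in> fst (C q). snd (C q) x \<in> {z. norm (z - ctr q) < rad q / 2 \<and> 2 * (cmod (z $ k))\<^sup>2 < e\<^sup>2}})"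

definition VD :: "real \<Rightarrow> 'a set" where "VD e = (\<Union>q\<in>Q. VV e q)"

text \<open>A product, so that it vanishes as soon as one factor does; each factor is 1 away from
  its own ball, which makes the product globally defined.\<close>

definition cutoff :: "real \<Rightarrow> 'a \<Rightarrow> real" where "cutoff e x = (\<Prod>q\<in>Q. chart_cutoff q e x)"

lemma VV_open: "q \<in> Q \<Longrightarrow> openin X (VV e q)"
proof (cases "kk q")
  case (Some k)
  assume q: "q \<in> Q"
  have "open {z :: complex ^ 'n. norm (z - ctr q) < rad q / 2 \<and> 2 * (cmod (z $ k))\<^sup>2 < e\<^sup>2}"
    by (intro open_Collect_conj open_Collect_less continuous_intros)
  from openin_chart_preimage[OF C[OF q] this] show ?thesis by (simp add: VV_def Some)
qed (simp add: VV_def)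

lemma chart_cutoff_VV: "q \<in> Q \<Longrightarrow> 0 < e \<Longrightarrow> x \<in> VV e q \<Longrightarrow> chart_cutoff q e x = 0"
  by (cases "kk q") (auto simp: VV_def intro: chart_cutoff_core)

lemma VD_facts:
  assumes "0 < e"
  shows "openin X (VD e)" "D \<subseteq> VD e" "x \<in> VD e \<Longrightarrow> cutoff e x = 0" "C1_fun (cutoff e)"
proof -
  show "openin X (VD e)" unfolding VD_def using VV_open by blast
  show "C1_fun (cutoff e)" unfolding cutoff_def[abs_def] by (intro C1_fun_prod chart_cutoff_C1)
  show "cutoff e x = 0" if "x \<in> VD e"
    using that chart_cutoff_VV[OF _ assms] Q unfolding VD_def cutoff_def by (auto intro: prod_zero)
  show "D \<subseteq> VD e"
  proof
    fix x assume x: "x \<in> D"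
    then have "x \<in> topspace X" using closedin_subset[OF D_closed] by auto
    then obtain q where q: "q \<in> Q" "x \<in> fst (C q)" "norm (snd (C q) x - ctr q) < rad q / 2"
      using core by blast
    have "x \<in> VV e q"
    proof (cases "kk q")
      case None
      then show ?thesis using kk(1)[OF q(1)] x q(2) by (auto simp: adapted_def case_prod_beta)
    next
      case (Some k)
      have "D \<inter> fst (C q) = {x \<in> fst (C q). snd (C q) x $ k = 0}"
        using kk(1)[OF q(1)] by (simp add: adapted_def case_prod_beta Some)
      then have "snd (C q) x $ k = 0" using x q(2) by blast
      then show ?thesis using q assms by (simp add: VV_def Some)
    qed
    then show "x \<in> VD e" using q(1) by (auto simp: VD_def)
  qed
qed

lemma cutoff_range: "0 \<le> cutoff e x" "cutoff e x \<le> 1"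
  unfolding cutoff_def using chart_cutoff_range by (auto intro!: prod_nonneg prod_le_1)

lemma mcont_power2: "mcont F \<Longrightarrow> mcont (\<lambda>x. (F x)\<^sup>2)"
  unfolding power2_eq_square by (rule mcontI(5))

text \<open>Since F is supported in KK q, every summand can be moved to the chart of q by
  \<open>CI_change\<close>, where the partition sums to 1.\<close>

lemma CI_partition:
  assumes q: "q \<in> Q" and V: "openin X V" "D \<subseteq> V" and F: "mcont F"
    and F0: "\<And>q' x. q' \<in> Q \<Longrightarrow> x \<in> fst (C0 q') \<Longrightarrow> x \<notin> KK q \<Longrightarrow> F x = 0"
      "\<And>q' x. q' \<in> Q \<Longrightarrow> x \<in> fst (C0 q') \<Longrightarrow> x \<in> V \<Longrightarrow> F x = 0"
  shows "(\<Sum>q'\<in>Q. CI (C0 q') (\<lambda>x. pu q' x * F x)) = CI (C0 q) F"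
    "q' \<in> Q \<Longrightarrow> supp (C0 q') (KK q \<inter> KK q' - V) (\<lambda>x. pu q' x * F x)"
proof -
  have mc: "mcont (\<lambda>x. pu q' x * F x)" if "q' \<in> Q" for q'
    by (rule mcontI(5)[OF mcontI(1)[OF pu(1)[OF that]] F])
  have cK: "compactin X (KK q \<inter> KK q')" if "q' \<in> Q" for q'
    by (rule compact_Int_closedin[OF K(1)[OF q] KK_facts(2)[OF that]])
  show 1: "supp (C0 q') (KK q \<inter> KK q' - V) (\<lambda>x. pu q' x * F x)" if q': "q' \<in> Q" for q'
    by (rule supp_C0[OF q' V mc[OF q'] cK[OF q']])
      (use K(2)[OF q'] F0[OF q'] pu(3)[OF q'] in auto)
  have 2: "supp (C0 q) (KK q \<inter> KK q' - V) (\<lambda>x. pu q' x * F x)" if q': "q' \<in> Q" for q'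
    by (rule supp_C0[OF q V mc[OF q'] cK[OF q']])
      (use K(2)[OF q] F0[OF q] pu(3)[OF q'] in auto)
  have "(\<Sum>q'\<in>Q. CI (C0 q') (\<lambda>x. pu q' x * F x)) = (\<Sum>q'\<in>Q. CI (C0 q) (\<lambda>x. pu q' x * F x))"
    by (rule sum.cong[OF refl], rule CI_change[OF C0_A C0_A[OF q] 1 2])
  also have "\<dots> = CI (C0 q) (\<lambda>x. \<Sum>q'\<in>Q. pu q' x * F x)"
    by (rule CI_sum[OF C0_A[OF q] Q 2, symmetric])
  also have "\<dots> = CI (C0 q) F"
    by (rule CI_cong) (use pu(4) chart_subset[OF C0_A[OF q]] in \<open>auto simp flip: sum_distrib_right\<close>)
  finally show "(\<Sum>q'\<in>Q. CI (C0 q') (\<lambda>x. pu q' x * F x)) = CI (C0 q) F" .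
qed

text \<open>One summand of the product rule bound for |\<partial>\<psi> \<and> \<alpha>|^2. The
  squares of the other factors are kept because they make the term vanish on all of
  \<open>VD e\<close>, which gives compact support off D; as a size estimate they are bounded by
  1.\<close>

definition cutoff_term :: "'q \<Rightarrow> real \<Rightarrow> 'a \<Rightarrow> real" where
  "cutoff_term q e x = (\<Prod>r\<in>Q - {q}. chart_cutoff r e x)\<^sup>2 * wedge_norm_sq (chart_cutoff q e) x"

lemma cutoff_term_facts:
  assumes q: "q \<in> Q" and e: "0 < e"
  shows "mcont (cutoff_term q e)" "q' \<in> Q \<Longrightarrow> x \<in> fst (C0 q') \<Longrightarrow> x \<notin> KK q \<Longrightarrow> cutoff_term q e x = 0"
    "q' \<in> Q \<Longrightarrow> x \<in> fst (C0 q') \<Longrightarrow> x \<in> VD e \<Longrightarrow> cutoff_term q e x = 0"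
    "q' \<in> Q \<Longrightarrow> x \<in> fst (C0 q') \<Longrightarrow> 0 \<le> cutoff_term q e x \<and> cutoff_term q e x \<le> wedge_norm_sq (chart_cutoff q e) x"
proof -
  show "mcont (cutoff_term q e)"
    unfolding cutoff_term_def[abs_def]
    by (intro mcontI(5) mcont_power2 mcontI(1)[OF C1_fun_prod[OF chart_cutoff_C1]] mcontI(4)[OF chart_cutoff_C1[OF q]]) auto
  show "cutoff_term q e x = 0" if "q' \<in> Q" "x \<in> fst (C0 q')" "x \<notin> KK q"
    using wedge_norm_sq_chart_cutoff_zero(1)[OF q that] by (simp add: cutoff_term_def)
  show "cutoff_term q e x = 0" if q': "q' \<in> Q" "x \<in> fst (C0 q')" "x \<in> VD e"
  proof -
    obtain r where r: "r \<in> Q" "x \<in> VV e r" using q'(3) by (auto simp: VD_def)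
    show ?thesis
    proof (cases "r = q")
      case True
      have "wedge_norm_sq (chart_cutoff q e) x = 0"
        by (rule wedge_norm_sq_cross_term_vanish(2)[OF chart_cutoff_C1[OF q] VV_open[OF q] _ chart_cutoff_VV[OF q e] q'(1,2)]) (use r True in simp_all)
      then show ?thesis by (simp add: cutoff_term_def)
    next
      case False
      have "(\<Prod>r\<in>Q - {q}. chart_cutoff r e x) = 0"
        by (rule prod_zero) (use Q r False chart_cutoff_VV[OF r(1) e r(2)] in auto)
      then show ?thesis by (simp add: cutoff_term_def)
    qed
  qed
  show "0 \<le> cutoff_term q e x \<and> cutoff_term q e x \<le> wedge_norm_sq (chart_cutoff q e) x" if q': "q' \<in> Q" "x \<in> fst (C0 q')"
  proof -
    have n: "0 \<le> wedge_norm_sq (chart_cutoff q e) x" by (rule wedge_norm_sq_nonneg[OF chart_cutoff_C1[OF q] adm_C0[OF q'(1)] q'(2)])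
    have "0 \<le> (\<Prod>r\<in>Q - {q}. chart_cutoff r e x)" "(\<Prod>r\<in>Q - {q}. chart_cutoff r e x) \<le> 1"
      using chart_cutoff_range by (auto intro!: prod_nonneg prod_le_1)
    then have "(\<Prod>r\<in>Q - {q}. chart_cutoff r e x)\<^sup>2 \<le> 1" by (rule power_le_one)
    then show ?thesis using n mult_right_mono[of "(\<Prod>r\<in>Q - {q}. chart_cutoff r e x)\<^sup>2" 1 "wedge_norm_sq (chart_cutoff q e) x"] by (simp add: cutoff_term_def)
  qed
qed

lemma supp_cutoff_term: "q \<in> Q \<Longrightarrow> 0 < e \<Longrightarrow> supp (C0 q) (KK q - VD e) (cutoff_term q e)"
  by (rule supp_C0[OF _ VD_facts(1,2) cutoff_term_facts(1) K cutoff_term_facts(2) cutoff_term_facts(3)])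

text \<open>The exponent s = 2/N - 2 lies in (-2, 0] for every N \<ge> 1, so
  \<open>cint_tube_bound\<close> applies to the tube estimate and returns the power 2 + s = 2/N.
  Charts away from D contribute nothing.\<close>

lemma CI_cutoff_term_bound:
  assumes q: "q \<in> Q"
  shows "\<exists>M\<ge>0. \<forall>e>0. CI (C0 q) (cutoff_term q e) \<le> M * e powr (2 / real N)"
proof (cases "kk q")
  case None
  have "CI (C0 q) (cutoff_term q e) = CI (C0 q) (\<lambda>x. 0 * 0)" for e
    by (rule CI_cong) (use wedge_norm_sq_chart_cutoff_zero(2)[OF q q _ None] in \<open>simp add: cutoff_term_def\<close>)
  then have "CI (C0 q) (cutoff_term q e) = 0" for e using CI_cmult[of "C0 q" 0 "\<lambda>x. 0"] by simp
  then show ?thesis by (intro exI[of _ 0]) simp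
next
  case (Some k)
  let ?s = "2 / real N - 2" and ?R = "norm (ctr q) + rad q"
  have s: "- 2 < ?s" "?s \<le> 0" using N by (auto simp: field_simps)
  obtain M where M: "M > 0" "\<And>e z. e > 0 \<Longrightarrow> z \<in> img (C0 q) \<inter> cball (ctr q) (rad q) \<Longrightarrow> cmod (z $ k) \<le> e \<Longrightarrow>
    rho (HH (C0 q) z) * wedge_norm_sq (chart_cutoff q e) (kap (C0 q) z) \<le> M * cmod (z $ k) powr ?s"
    using tube_estimate[OF q Some] by blast
  obtain B where B: "B \<ge> 0" "\<forall>\<epsilon>>0. \<forall>F :: complex ^ 'n \<Rightarrow> real. cabs F \<longrightarrow> (\<forall>z. 0 \<le> F z) \<longrightarrow>
    (\<forall>z. F z \<noteq> 0 \<longrightarrow> (\<forall>j. norm (z $ j) \<le> ?R) \<and> 0 < norm (z $ k) \<and> norm (z $ k) \<le> \<epsilon> \<and> F z \<le> norm (z $ k) powr ?s) \<longrightarrow>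
    cint F \<le> B * \<epsilon> powr (2 + ?s)"
    using cint_tube_bound[OF s, of ?R k] rad(1)[OF q] by auto
  have "CI (C0 q) (cutoff_term q e) \<le> (M * B) * e powr (2 / real N)" if e: "e > 0" for e
  proof -
    \<comment> \<open>Dividing by M normalizes the pointwise bound to |z^k|^s, the form required by
      \<open>cint_tube_bound\<close>.\<close>
    let ?F = "\<lambda>z. (1 / M) * ci (C0 q) (cutoff_term q e) z"
    have F0: "0 \<le> ?F z" for z
      using M(1) cutoff_term_facts(4)[OF q e q kap_in] rho_pos[OF HH_posdef[OF C0_A[OF q]], of z] by (auto simp: ci_def)
    have F1: "(\<forall>j. norm (z $ j) \<le> ?R) \<and> 0 < norm (z $ k) \<and> norm (z $ k) \<le> e \<and> ?F z \<le> norm (z $ k) powr ?s" if nz: "?F z \<noteq> 0" for z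
    proof -
      have z: "z \<in> img (C0 q)" and T: "cutoff_term q e (kap (C0 q) z) \<noteq> 0"
        using nz by (auto simp: ci_def split: if_splits)
      note R = restrict_C0[OF q z] and x = kap_in[OF z]
      have "kap (C0 q) z \<in> KK q" using T cutoff_term_facts(2)[OF q e q x] by blast
      then have zB: "norm (z - ctr q) \<le> rad q"
        unfolding R(2) KK_facts(4)[OF q] using chart_kap[OF R(1)] by simp
      have "norm (z $ j) \<le> ?R" for j
        using Finite_Cartesian_Product.norm_nth_le[of z j] norm_triangle_sub[of z "ctr q"] zB by simp
      moreover have ze: "norm (z $ k) \<le> e"
      proof (rule ccontr)
        assume "\<not> norm (z $ k) \<le> e"
        then have "e < cmod (snd (C q) (kap (C0 q) z) $ k)" unfolding R(2) chart_kap[OF R(1)] by simp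
        moreover have "kap (C0 q) z \<in> fst (C q)" unfolding R(2) by (rule kap_in[OF R(1)])
        ultimately have "wedge_norm_sq (chart_cutoff q e) (kap (C0 q) z) = 0" using wedge_norm_sq_chart_cutoff_zero(3)[OF q q x Some e] by simp
        then show False using T by (simp add: cutoff_term_def)
      qed
      moreover have "?F z \<le> norm (z $ k) powr ?s"
      proof -
        have "rho (HH (C0 q) z) * cutoff_term q e (kap (C0 q) z) \<le> rho (HH (C0 q) z) * wedge_norm_sq (chart_cutoff q e) (kap (C0 q) z)"
          using cutoff_term_facts(4)[OF q e q x] rho_pos[OF HH_posdef[OF C0_A[OF q] z]] by (intro mult_left_mono) auto
        also have "\<dots> \<le> M * cmod (z $ k) powr ?s"
          by (rule M(2)[OF e _ ze]) (use z zB in \<open>simp add: dist_norm norm_minus_commute\<close>)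
        finally show ?thesis using z M(1) by (simp add: ci_def field_simps)
      qed
      ultimately show ?thesis using R(6)[OF Some] by blast
    qed
    have "cint ?F \<le> B * e powr (2 + ?s)"
      using B(2) e cabs_cmult[OF supp_ci[OF C0_A[OF q] supp_cutoff_term[OF q e]], of "1 / M"] F0 F1 by blast
    then have "(1 / M) * CI (C0 q) (cutoff_term q e) \<le> B * e powr (2 + ?s)" unfolding cint_cmult CI_def .
    then show ?thesis using M(1) by (simp add: field_simps)
  qed
  then show ?thesis using M(1) B(1) by (intro exI[of _ "M * B"]) simp
qed

definition energy :: "real \<Rightarrow> real" where
  "energy e = (\<Sum>q\<in>Q. CI (C0 q) (\<lambda>x. pu q x * ((cutoff e x)\<^sup>2 * del_norm_sq x)))"

lemma supp_cutoff:
  assumes q: "q \<in> Q" and e: "0 < e"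
  shows "supp (C0 q) (KK q - VD e) (\<lambda>x. pu q x * ((cutoff e x)\<^sup>2 * del_norm_sq x))"
    "supp (C0 q) (KK q - VD e) (\<lambda>x. pu q x * wedge_norm_sq (cutoff e) x)"
proof -
  note V = VD_facts[OF e]
  have m: "mcont (\<lambda>x. pu q x * ((cutoff e x)\<^sup>2 * del_norm_sq x))"
    by (intro mcontI(5) mcont_power2 mcontI(2) mcontI(1)[OF pu(1)[OF q]] mcontI(1)[OF V(4)])
  show "supp (C0 q) (KK q - VD e) (\<lambda>x. pu q x * ((cutoff e x)\<^sup>2 * del_norm_sq x))"
    by (rule supp_C0[OF q V(1,2) m K[OF q]]) (simp_all add: pu(3)[OF q] V(3))
  have m': "mcont (\<lambda>x. pu q x * wedge_norm_sq (cutoff e) x)"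
    by (intro mcontI(5) mcontI(4)[OF V(4)] mcontI(1)[OF pu(1)[OF q]])
  show "supp (C0 q) (KK q - VD e) (\<lambda>x. pu q x * wedge_norm_sq (cutoff e) x)"
  proof (rule supp_C0[OF q V(1,2) m' K[OF q]])
    show "pu q x * wedge_norm_sq (cutoff e) x = 0" if "x \<in> fst (C0 q)" "x \<in> VD e" for x
      using wedge_norm_sq_cross_term_vanish(2)[OF V(4,1) that(2) V(3) q that(1)] by simp
  qed (simp_all add: pu(3)[OF q])
qed

lemma energy_bound: "\<exists>M\<ge>0. \<forall>e>0. energy e \<le> M * e powr (2 / real N)"
proof -
  have "\<forall>q\<in>Q. \<exists>M\<ge>0. \<forall>e>0. CI (C0 q) (cutoff_term q e) \<le> M * e powr (2 / real N)"
    using CI_cutoff_term_bound by blast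
  then obtain M where M: "\<And>q. q \<in> Q \<Longrightarrow> 0 \<le> M q" "\<And>q e. q \<in> Q \<Longrightarrow> e > 0 \<Longrightarrow> CI (C0 q) (cutoff_term q e) \<le> M q * e powr (2 / real N)"
    by (auto dest!: bchoice)
  let ?n = "real (card Q)"
  have "energy e \<le> (4 * (?n * sum M Q)) * e powr (2 / real N)" if e: "e > 0" for e
  proof -
    note V = VD_facts[OF e]
    have P1: "(\<Sum>q'\<in>Q. CI (C0 q') (\<lambda>x. pu q' x * cutoff_term q e x)) = CI (C0 q) (cutoff_term q e)" if q: "q \<in> Q" for q
      by (rule CI_partition(1)[OF q V(1,2) cutoff_term_facts(1)[OF q e]], fact cutoff_term_facts(2)[OF q e], fact cutoff_term_facts(3)[OF q e])
    have P2: "supp (C0 q') (KK q \<inter> KK q' - VD e) (\<lambda>x. pu q' x * cutoff_term q e x)" if q: "q \<in> Q" and q': "q' \<in> Q" for q q'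
      by (rule CI_partition(2)[OF q V(1,2) cutoff_term_facts(1)[OF q e] _ _ q'], fact cutoff_term_facts(2)[OF q e], fact cutoff_term_facts(3)[OF q e])
    have 1: "energy e \<le> 4 * (\<Sum>q\<in>Q. CI (C0 q) (\<lambda>x. pu q x * wedge_norm_sq (cutoff e) x))"
      unfolding energy_def by (rule caccioppoli[OF V(1,2,4,3)])
    have "(\<Sum>q'\<in>Q. CI (C0 q') (\<lambda>x. pu q' x * wedge_norm_sq (cutoff e) x)) \<le> (\<Sum>q'\<in>Q. ?n * (\<Sum>q\<in>Q. CI (C0 q') (\<lambda>x. pu q' x * cutoff_term q e x)))"
    proof (rule sum_mono)
      fix q' assume q': "q' \<in> Q"
      let ?G = "\<lambda>x. ?n * (\<Sum>q\<in>Q. pu q' x * cutoff_term q e x)"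
      have sG: "supp (C0 q') (KK q' - VD e) ?G"
      proof (rule supp_C0[OF q' V(1,2) _ K[OF q']])
        have "mcont (\<lambda>x. \<Sum>q\<in>I. pu q' x * cutoff_term q e x)" if "finite I" "I \<subseteq> Q" for I
          using that by (induction I) (auto intro!: mcontI(7) mcontI(6) mcontI(5) mcontI(1)[OF pu(1)[OF q']] cutoff_term_facts(1)[OF _ e])
        from mcontI(5)[OF mcontI(7) this[OF Q order.refl]] show "mcont ?G" .
      qed (simp_all add: pu(3)[OF q'] cutoff_term_facts(3)[OF _ e q'])
      have "CI (C0 q') (\<lambda>x. pu q' x * wedge_norm_sq (cutoff e) x) \<le> CI (C0 q') ?G"
      proof (rule CI_mono[OF C0_A[OF q'] supp_cutoff(2)[OF q' e] sG])
        fix x assume x: "x \<in> fst (C0 q')"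
        have "wedge_norm_sq (cutoff e) x \<le> ?n * (\<Sum>q\<in>Q. cutoff_term q e x)"
          unfolding cutoff_term_def cutoff_def[abs_def] by (rule wedge_norm_sq_prod[OF chart_cutoff_C1 Q adm_C0[OF q'] x])
        from mult_left_mono[OF this pu(2)[OF q', of x]]
        show "pu q' x * wedge_norm_sq (cutoff e) x \<le> ?G x" by (simp add: sum_distrib_left mult.left_commute)
      qed
      also have "\<dots> = ?n * (\<Sum>q\<in>Q. CI (C0 q') (\<lambda>x. pu q' x * cutoff_term q e x))"
        unfolding CI_cmult by (subst CI_sum[OF C0_A[OF q'] Q P2[OF _ q']]) simp_all
      finally show "CI (C0 q') (\<lambda>x. pu q' x * wedge_norm_sq (cutoff e) x) \<le> ?n * (\<Sum>q\<in>Q. CI (C0 q') (\<lambda>x. pu q' x * cutoff_term q e x))" .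
    qed
    also have "(\<Sum>q'\<in>Q. ?n * (\<Sum>q\<in>Q. CI (C0 q') (\<lambda>x. pu q' x * cutoff_term q e x))) = ?n * (\<Sum>q\<in>Q. \<Sum>q'\<in>Q. CI (C0 q') (\<lambda>x. pu q' x * cutoff_term q e x))"
      unfolding sum_distrib_left[symmetric] by (subst sum.swap) simp
    finally have 2: "(\<Sum>q\<in>Q. CI (C0 q) (\<lambda>x. pu q x * wedge_norm_sq (cutoff e) x)) \<le> ?n * (\<Sum>q\<in>Q. \<Sum>q'\<in>Q. CI (C0 q') (\<lambda>x. pu q' x * cutoff_term q e x))" .
    have "(\<Sum>q\<in>Q. \<Sum>q'\<in>Q. CI (C0 q') (\<lambda>x. pu q' x * cutoff_term q e x)) = (\<Sum>q\<in>Q. CI (C0 q) (cutoff_term q e))"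
      by (rule sum.cong[OF refl], rule P1) simp_all
    also have "\<dots> \<le> (\<Sum>q\<in>Q. M q * e powr (2 / real N))" by (rule sum_mono, rule M(2)[OF _ e])
    also have "\<dots> = sum M Q * e powr (2 / real N)" by (rule sum_distrib_right[symmetric])
    finally have 3: "(\<Sum>q\<in>Q. \<Sum>q'\<in>Q. CI (C0 q') (\<lambda>x. pu q' x * cutoff_term q e x)) \<le> sum M Q * e powr (2 / real N)" .
    have alg: "j \<le> (4 * (n * m)) * t" if "j \<le> 4 * a" "a \<le> n * b" "b \<le> m * t" "0 \<le> n" for j a b n m t :: real
      using that mult_left_mono[OF that(3,4)] by (simp add: mult.assoc)
    show ?thesis by (rule alg[OF 1 2 3]) simp
  qed
  moreover have "0 \<le> 4 * (?n * sum M Q)" using M(1) by (simp add: sum_nonneg)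
  ultimately show ?thesis by blast
qed

lemma cutoff_antimono: "0 < e' \<Longrightarrow> e' \<le> e \<Longrightarrow> cutoff e x \<le> cutoff e' x"
  unfolding cutoff_def by (rule prod_mono) (use chart_cutoff_range chart_cutoff_antimono in blast)

lemma energy_antimono:
  assumes e: "0 < e'" "e' \<le> e"
  shows "energy e \<le> energy e'"
  unfolding energy_def
proof (rule sum_mono, rule CI_mono)
  fix q x assume q: "q \<in> Q" and x: "x \<in> fst (C0 q)"
  have "(cutoff e x)\<^sup>2 \<le> (cutoff e' x)\<^sup>2" by (rule power_mono[OF cutoff_antimono[OF e] cutoff_range(1)])
  then show "pu q x * ((cutoff e x)\<^sup>2 * del_norm_sq x) \<le> pu q x * ((cutoff e' x)\<^sup>2 * del_norm_sq x)"
    using del_norm_sq_nonneg[OF adm_C0[OF q] x] by (intro mult_left_mono mult_right_mono pu(2)[OF q])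
qed (use e in \<open>auto intro: C0_A supp_cutoff(1)\<close>)

text \<open>For t < e the energy at e is at most the energy at t, which is O(t^(2/N)); letting t
  tend to 0 gives the bound for the fixed e.\<close>

lemma energy_zero:
  assumes e: "0 < e"
  shows "energy e \<le> 0"
proof -
  obtain M where M: "\<And>e. 0 < e \<Longrightarrow> energy e \<le> M * e powr (2 / real N)" using energy_bound by blast
  have "((\<lambda>t. M * t powr (2 / real N)) \<longlongrightarrow> M * 0) (at_right 0)"
    using N by (intro tendsto_mult tendsto_const tendsto_zero_powrI[where b = "2 / real N"] tendsto_ident_at)
      (auto simp: eventually_at_right_less[THEN eventually_mono])
  moreover have "eventually (\<lambda>t. energy e \<le> M * t powr (2 / real N)) (at_right 0)"
  proof (rule eventually_at_rightI[OF _ e])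
    fix t assume "t \<in> {0<..<e}"
    then show "energy e \<le> M * t powr (2 / real N)" using energy_antimono[of t e] M[of t] by auto
  qed
  ultimately have "energy e \<le> M * 0" by (rule tendsto_lowerbound[OF _ _ trivial_limit_at_right_real])
  then show ?thesis by simp
qed

text \<open>For e small every chart cutoff equals 1 at x, since x is off D. Some pu q is nonzero at
  x, and a continuous nonnegative integrand with nonpositive integral is zero there.\<close>

lemma del_norm_sq_zero_everywhere:
  assumes x: "x \<in> topspace X" "x \<notin> D"
  shows "del_norm_sq x = 0"
proof -
  have "eventually (\<lambda>e. chart_cutoff q e x = 1) (at_right 0)" if q: "q \<in> Q" for q
  proof (cases "x \<in> KK q \<and> kk q \<noteq> None")
    case True
    then obtain k where k: "kk q = Some k" and xC: "x \<in> fst (C q)" using KK_facts(3)[OF q] by auto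
    have "D \<inter> fst (C q) = {x \<in> fst (C q). snd (C q) x $ k = 0}"
      using kk(1)[OF q] by (simp add: adapted_def case_prod_beta k)
    then have "0 < cmod (snd (C q) x $ k)" using xC x(2) by auto
    then show ?thesis
      by (rule eventually_at_rightI[rotated]) (use chart_cutoff_far[OF k _ xC] in auto)
  next
    case False
    then have "chart_cutoff q e x = 1" for e using chart_cutoff_off[OF q] chart_cutoff_None by (cases "kk q") auto
    then show ?thesis by simp
  qed
  then have "eventually (\<lambda>e. \<forall>q\<in>Q. chart_cutoff q e x = 1) (at_right 0)"
    by (intro eventually_ball_finite[OF Q]) blast
  then have "eventually (\<lambda>e. 0 < e \<and> cutoff e x = 1) (at_right 0)"
    by (rule eventually_elim2[OF _ eventually_at_right_less]) (simp add: cutoff_def)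
  from eventually_happens[OF this] obtain e where e: "0 < e" "cutoff e x = 1" by auto
  have "(\<Sum>q\<in>Q. pu q x) \<noteq> 0" using pu(4)[OF x(1)] by simp
  then obtain q where q: "q \<in> Q" "pu q x \<noteq> 0" by (meson sum.neutral)
  let ?F = "\<lambda>q x. pu q x * ((cutoff e x)\<^sup>2 * del_norm_sq x)"
  have nn: "0 \<le> ?F q x" if "q \<in> Q" "x \<in> fst (C0 q)" for q x
    using pu(2)[OF that(1)] del_norm_sq_nonneg[OF adm_C0[OF that(1)] that(2)] by simp
  have "CI (C0 q) (?F q) \<le> energy e"
    unfolding energy_def by (rule member_le_sum[OF q(1) _ Q]) (rule CI_nonneg[OF C0_A supp_cutoff(1)[OF _ e(1)] nn], auto)
  then have le: "cint (ci (C0 q) (?F q)) \<le> 0" using energy_zero[OF e(1)] by (simp add: CI_def)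
  note S = supp_cutoff(1)[OF q(1) e(1)] and A0 = C0_A[OF q(1)]
  have nn': "0 \<le> ci (C0 q) (?F q) z" for z
  proof (cases "z \<in> img (C0 q)")
    case True
    have "0 \<le> rho (HH (C0 q) z) * ?F q (kap (C0 q) z)"
      by (rule mult_nonneg_nonneg[OF less_imp_le[OF rho_pos[OF HH_posdef[OF A0 True]]] nn[OF q(1) kap_in[OF True]]])
    then show ?thesis by (simp only: ci_def True if_True)
  qed (simp add: ci_def)
  have "x \<in> KK q" using q pu(3)[OF q(1)] by blast
  then have xc: "x \<in> fst (C0 q)" using KK_facts(3)[OF q(1)] fst_C0[OF q(1)] x(2) by blast
  have "ci (C0 q) (?F q) (snd (C0 q) x) = 0"
    by (rule cint_zero[OF ci_facts(3)[OF A0 S] nn' supp_ci[OF A0 S] le])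
  moreover have "ci (C0 q) (?F q) (snd (C0 q) x) = rho (HH (C0 q) (snd (C0 q) x)) * ?F q x"
    using xc A0 by (simp add: ci_def)
  ultimately have "rho (HH (C0 q) (snd (C0 q) x)) * ?F q x = 0" by simp
  then show ?thesis
    using rho_pos[OF HH_posdef[OF A0 imageI[OF xc]]] q(2) e(2) by simp
qed

end

section \<open>Choice of a finite cover and passage to arbitrary charts\<close>

context log_setup
begin

text \<open>At points of D a coordinate chart for D, restricted to a frame domain, is centred on D;
  at the other points D is removed from the chart, so that the adapted coordinate is
  \<open>None\<close>.\<close>

lemma local_data:
  assumes x: "x \<in> topspace X"
  shows "\<exists>c i k r. c \<in> A \<and> i \<in> idx L \<and> fst c \<subseteq> cover L i \<and> x \<in> fst c \<and> 0 < r \<and>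
    cball (snd c x) r \<subseteq> img c \<and> adapted D c k \<and> (\<forall>j. k = Some j \<longrightarrow> snd c x $ j = 0)"
proof -
  obtain i where i: "i \<in> idx L" "x \<in> cover L i" using cover_all[OF x] by blast
  have "\<exists>c k. c \<in> A \<and> fst c \<subseteq> cover L i \<and> x \<in> fst c \<and> adapted D c k \<and> (\<forall>j. k = Some j \<longrightarrow> snd c x $ j = 0)"
  proof (cases "x \<in> D")
    case True
    then obtain c k where c: "c \<in> A" "x \<in> fst c" "D \<inter> fst c = {y \<in> fst c. snd c y $ k = 0}"
      using D_local by blast
    then have "adapted D (fst c \<inter> cover L i, snd c) (Some k)" "snd c x $ k = 0"
      using True by (auto simp: adapted_def)
    then show ?thesis
      using chart_restrict[OF c(1) cover_facts(1)[OF i(1)]] c(2) i(2)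
      by (intro exI[of _ "(fst c \<inter> cover L i, snd c)"] exI[of _ "Some k"]) auto
  next
    case False
    obtain c where c: "c \<in> A" "x \<in> fst c" using x cm unfolding complex_manifold_def by blast
    have W: "openin X (cover L i \<inter> (topspace X - D))"
      by (intro openin_Int cover_facts(1)[OF i(1)] openin_diff openin_topspace D_closed)
    show ?thesis
      using chart_restrict[OF c(1) W] c(2) i(2) False x
      by (intro exI[of _ "(fst c \<inter> (cover L i \<inter> (topspace X - D)), snd c)"] exI[of _ None]) (auto simp: adapted_def)
  qed
  then obtain c k where c: "c \<in> A" "fst c \<subseteq> cover L i" "x \<in> fst c" "adapted D c k" "\<forall>j. k = Some j \<longrightarrow> snd c x $ j = 0"
    by blast
  obtain r where "r > 0" "cball (snd c x) r \<subseteq> img c"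
    using chart_facts(2)[OF c(1)] c(3) unfolding open_contains_cball by blast
  with c i(1) show ?thesis by blast
qed

text \<open>Compactness selects finitely many of the half balls, with the points of X themselves as
  index set.\<close>

lemma del_norm_sq_vanishes:
  assumes "x \<in> topspace X" "x \<notin> D"
  shows "del_norm_sq x = 0"
proof -
  define G where "G x g \<longleftrightarrow> fst g \<in> A \<and> fst (snd g) \<in> idx L \<and> fst (fst g) \<subseteq> cover L (fst (snd g)) \<and>
    x \<in> fst (fst g) \<and> 0 < snd (snd (snd g)) \<and> cball (snd (fst g) x) (snd (snd (snd g))) \<subseteq> img (fst g) \<and>
    adapted D (fst g) (fst (snd (snd g))) \<and> (\<forall>j. fst (snd (snd g)) = Some j \<longrightarrow> snd (fst g) x $ j = 0)"
    for x and g :: "('a, 'n) chart \<times> 'i \<times> 'n option \<times> real"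
  have "\<forall>x\<in>topspace X. \<exists>g. G x g"
  proof
    fix x assume "x \<in> topspace X"
    from local_data[OF this] obtain c i k r where "c \<in> A \<and> i \<in> idx L \<and> fst c \<subseteq> cover L i \<and> x \<in> fst c \<and> 0 < r \<and>
      cball (snd c x) r \<subseteq> img c \<and> adapted D c k \<and> (\<forall>j. k = Some j \<longrightarrow> snd c x $ j = 0)"
      by (elim exE)
    then have "G x (c, i, k, r)" unfolding G_def fst_conv snd_conv .
    then show "\<exists>g. G x g" ..
  qed
  from bchoice[OF this] obtain g where g: "\<forall>x\<in>topspace X. G x (g x)" ..
  define C where "C x = fst (g x)" for x
  define Fr where "Fr x = fst (snd (g x))" for x
  define kk where "kk x = fst (snd (snd (g x)))" for x
  define rad where "rad x = snd (snd (snd (g x)))" for x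
  define ctr where "ctr x = snd (C x) x" for x
  have G: "C x \<in> A" "Fr x \<in> idx L" "fst (C x) \<subseteq> cover L (Fr x)" "x \<in> fst (C x)" "0 < rad x"
    "cball (ctr x) (rad x) \<subseteq> img (C x)" "adapted D (C x) (kk x)" "kk x = Some j \<Longrightarrow> ctr x $ j = 0"
    if "x \<in> topspace X" for x j
    using bspec[OF g that] unfolding G_def C_def Fr_def kk_def rad_def ctr_def by simp_all
  define U where "U x = {y \<in> fst (C x). snd (C x) y \<in> ball (ctr x) (rad x / 2)}" for x
  have "\<exists>F. finite F \<and> F \<subseteq> U ` topspace X \<and> topspace X \<subseteq> \<Union>F"
  proof -
    have "openin X (U x)" if "x \<in> topspace X" for x
      unfolding U_def by (rule openin_chart_preimage[OF G(1)[OF that] open_ball])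
    then have 1: "\<forall>V\<in>U ` topspace X. openin X V" by simp
    have "x \<in> U x" if "x \<in> topspace X" for x
      using G(4,5)[OF that] by (simp add: U_def ctr_def)
    then have 2: "topspace X \<subseteq> \<Union>(U ` topspace X)" by blast
    show ?thesis by (rule compact[unfolded compact_space_alt, THEN spec, THEN mp, OF conjI[OF 1 2]])
  qed
  then obtain F where F: "finite F" "F \<subseteq> U ` topspace X" "topspace X \<subseteq> \<Union>F" by blast
  obtain Q where Q: "Q \<subseteq> topspace X" "finite Q" "F = U ` Q" using finite_subset_image[OF F(1,2)] by blast
  interpret tube_cover X A D L N p \<iota> \<alpha> \<omega> Q C Fr ctr rad kk
  proof
    show "\<exists>q\<in>Q. x \<in> fst (C q) \<and> norm (snd (C q) x - ctr q) < rad q / 2" if "x \<in> topspace X" for x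
      using that F(3) Q(3) by (auto simp: U_def dist_norm norm_minus_commute)
  qed (rule Q(2) | rule G[OF subsetD[OF Q(1)]]; assumption)+
  show ?thesis by (rule del_norm_sq_zero_everywhere[OF assms])
qed

text \<open>A chart of the atlas may meet D or leave the domain of the frame, so x is first placed
  in an admissible restriction, where the vanishing norm forces the form to vanish by
  definiteness.\<close>

theorem del_conn_zero: "form_zero A D (dual_bundle L) (p + 1) 0 (del_conn X A D N \<iota> \<alpha>)"
  unfolding form_zero_def
proof (intro ballI allI impI)
  fix c i x and vs ws :: "(complex ^ 'n) list"
  assume c: "c \<in> A" and "i \<in> idx (dual_bundle L)" and x: "x \<in> fst c \<inter> cover (dual_bundle L) i - D"
    and len: "length vs = p + 1 \<and> length ws = 0"
  then have i: "i \<in> idx L" and x: "x \<in> fst c" "x \<in> cover L i" "x \<notin> D" and ws: "ws = []" and vs: "length vs = Suc p"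
    by simp_all
  define W where "W = cover L i \<inter> (topspace X - D)"
  have W: "openin X W"
    unfolding W_def by (intro openin_Int cover_facts(1)[OF i] openin_diff openin_topspace D_closed)
  let ?c = "(fst c \<inter> W, snd c)"
  note c' = chart_restrict[OF c W]
  have adm: "adm ?c i" using c' i by (auto simp: adm_def W_def)
  have xt: "x \<in> topspace X" using chart_subset[OF c] x(1) by blast
  then have xW: "x \<in> fst c \<inter> W" using x by (simp add: W_def)
  have "bb ?c i (snd ?c x) vs = 0"
    by (rule del_norm_sq_zero[OF adm _ del_norm_sq_vanishes[OF xt x(3)] vs]) (use xW in simp)
  moreover have "kap ?c (snd c x) = x" using kap_chart[OF c', of x] xW by simp
  ultimately have "del_conn X A D N \<iota> \<alpha> ?c i x vs [] = 0" by (simp add: bb_def)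
  \<comment> \<open>The connection differentiates the components, so agreement of \<alpha> at x
    alone would not do; the components in the two charts agree on the whole neighbourhood.\<close>
  moreover have "del_conn X A D N \<iota> \<alpha> c i x vs [] = del_conn X A D N \<iota> \<alpha> ?c i x vs []"
  proof -
    note O = admD(5)[OF adm]
    have img: "snd c x \<in> img ?c" using xW by auto
    have k: "kap c z = kap ?c z" "kap ?c z \<in> fst c \<inter> W" if "z \<in> img ?c" for z
      using kap_restrict[OF c, of z W] kap_in[OF that] that by simp_all
    have form: "\<alpha> c i y us [] = \<alpha> ?c i y us []" if "y \<in> fst c \<inter> W" "length us = p" for y us
      using form_restrict(2)[OF c W that(1) i _ _ that(2)] that(1) by (simp add: W_def)
    have 1: "dir_del c (\<lambda>y. \<alpha> c i y us []) x v = dir_del ?c (\<lambda>y. \<alpha> ?c i y us []) x v" if "length us = p" for us v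
    proof -
      have "del (\<lambda>z. \<alpha> c i (kap c z) us []) (snd c x) = del (\<lambda>z. \<alpha> ?c i (kap ?c z) us []) (snd c x)"
        by (rule del_cong_open(1)[OF O img]) (use k form[OF _ that] in simp)
      then show ?thesis by (simp only: dir_del_eq snd_conv)
    qed
    have 2: "connection_form X A D N \<iota> c i x v = connection_form X A D N \<iota> ?c i x v" for v
    proof -
      have "del (\<lambda>z. \<zeta> i (kap c z)) (snd c x) = del (\<lambda>z. \<zeta> i (kap ?c z)) (snd c x)"
        by (rule del_cong_open(1)[OF O img]) (use k in simp)
      then show ?thesis by (simp only: connection_form_def dir_del_eq snd_conv)
    qed
    have r: "length (remove_nth a vs) = p" if "a < length vs" for a
      using that vs by (simp add: length_remove_nth)
    show ?thesis
      unfolding del_conn_def del_form_def wedge_10_def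
      by (intro arg_cong2[where f = "(+)"] arg_cong2[where f = "(*)"] refl sum.cong)
        (use 1 2 r form[OF xW] in auto)
  qed
  ultimately show "del_conn X A D N \<iota> \<alpha> c i x vs ws = 0" using ws by simp
qed

end

text \<open>Finitely many closed components: near a point of one of them the others are removed from
  the chart, and the equation of that component cuts out the whole divisor.\<close>

lemma (in cmanifold) disjoint_hypersurfaces:
  assumes I: "finite I" and hs: "\<And>i. i \<in> I \<Longrightarrow> smooth_hypersurface X A (D i)"
    and disj: "\<And>i j. i \<in> I \<Longrightarrow> j \<in> I \<Longrightarrow> i \<noteq> j \<Longrightarrow> D i \<inter> D j = {}"
  shows "closedin X (\<Union>i\<in>I. D i)"
    "x \<in> (\<Union>i\<in>I. D i) \<Longrightarrow> \<exists>c\<in>A. \<exists>k. x \<in> fst c \<and> (\<Union>i\<in>I. D i) \<inter> fst c = {y \<in> fst c. snd c y $ k = 0}"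
proof -
  have cl: "closedin X (D i)" if "i \<in> I" for i using hs[OF that] by (simp add: smooth_hypersurface_def)
  show "closedin X (\<Union>i\<in>I. D i)" using I cl by (auto intro: closedin_Union)
  assume "x \<in> (\<Union>i\<in>I. D i)"
  then obtain i where i: "i \<in> I" "x \<in> D i" by blast
  then obtain c k where c: "c \<in> A" "x \<in> fst c" "D i \<inter> fst c = {y \<in> fst c. snd c y $ k = 0}"
    using hs[OF i(1)] unfolding smooth_hypersurface_def by fastforce
  define W where "W = topspace X - (\<Union>j\<in>I - {i}. D j)"
  have W: "openin X W"
    unfolding W_def using I cl by (intro openin_diff openin_topspace closedin_Union) auto
  have xW: "x \<in> W"
    using disj[OF i(1)] i(2) chart_subset[OF c(1)] c(2) by (auto simp: W_def)
  have "(\<Union>i\<in>I. D i) \<inter> (fst c \<inter> W) = D i \<inter> fst c \<inter> W" using i(1) by (auto simp: W_def)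
  also have "\<dots> = {y \<in> fst c \<inter> W. snd c y $ k = 0}" unfolding c(3) by blast
  finally show "\<exists>c\<in>A. \<exists>k. x \<in> fst c \<and> (\<Union>i\<in>I. D i) \<inter> fst c = {y \<in> fst c. snd c y $ k = 0}"
    using chart_restrict[OF c(1) W] c(2) xW
    by (intro bexI[of _ "(fst c \<inter> W, snd c)"] exI[of _ k]) auto
qed


theorem corollary0p2:
  fixes X :: "'a topology"
    and A :: "('a, 'n::finite) chart set"
    and D :: "nat \<Rightarrow> 'a set"
    and r N p :: nat
    and L :: "('a, 'i) line_bundle"
    and \<iota> :: "'a set \<times> ('a \<Rightarrow> complex) \<Rightarrow> 'i \<Rightarrow> 'a \<Rightarrow> complex"
    and \<alpha> :: "('a, 'n, 'i) form"
    and Dtot :: "'a set"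
  assumes "compact_kaehler_manifold X A"
    and "\<And>i. i \<in> {1..r} \<Longrightarrow> smooth_hypersurface X A (D i)"
    and "\<And>i j. i \<in> {1..r} \<Longrightarrow> j \<in> {1..r} \<Longrightarrow> i \<noteq> j \<Longrightarrow> D i \<inter> D j = {}"
    and "Dtot = (\<Union>i\<in>{1..r}. D i)"
    and "holomorphic_line_bundle X A L"
    and "N \<ge> 1"
    and "line_bundle_iso A (tensor_power L N) (divisor_bundle X A Dtot) \<iota>"
    and "log_form A Dtot (dual_bundle L) p 0 \<alpha>"
    and "form_zero A Dtot (dual_bundle L) (p + 1) 1
           (delbar_conn (del_conn X A Dtot N \<iota> \<alpha>))"
  shows "form_zero A Dtot (dual_bundle L) (p + 1) 0 (del_conn X A Dtot N \<iota> \<alpha>)"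
proof -
  obtain \<omega> where X: "complex_manifold X A" "compact_space X" and \<omega>: "kaehler_form X A \<omega>"
    using assms(1) by (auto simp: compact_kaehler_manifold_def)
  interpret cmanifold X A by (rule cmanifold.intro[OF X(1)])
  interpret log_setup X A Dtot L N p \<iota> \<alpha> \<omega>
  proof
    show "closedin X Dtot" unfolding assms(4) by (rule disjoint_hypersurfaces(1)[OF finite_atLeastAtMost assms(2,3)])
    show "\<exists>c\<in>A. \<exists>k. x \<in> fst c \<and> Dtot \<inter> fst c = {y \<in> fst c. snd c y $ k = 0}" if "x \<in> Dtot" for x
      unfolding assms(4)
      by (rule disjoint_hypersurfaces(2)[OF finite_atLeastAtMost assms(2,3) that[unfolded assms(4)]])
  qed (fact X(2) \<omega> assms(5-9))+
  show ?thesis by (rule del_conn_zero)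
qed

end
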